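(* Let $Q$ be an admissible external field in the plane and let $S_Q$ be the support of the equilibrium measure in the plane in the presence of $Q$. Let $z_0$ be an interior point of $S_Q$ and assume that in a neighborhood $U$ of $z_0$, $Q(z)=C|\varphi(z)|^{2p}$, where $\varphi$ is a complex analytic function on $U$ such that $\varphi(z_0)$ and $\varphi'(z_0)$ are nonzero, $p$ is a natural number, and $C>0$. For $q>0$ set $r=\sqrt{\frac{q}{2C(1+q)}}$, let $D_r(\varphi^p(z_0))$ be the disc of radius $r$ centered at $\varphi^p(z_0)$, let $\psi$ be the local inverse of $\varphi^p$ near $\varphi^p(z_0)$ (with $\psi(\varphi^p(z_0))=z_0$), and let $\Omega:=\psi(D_r(\varphi^p(z_0)))$. Then for all $q>0$ sufficiently small, meaning small enough that $\psi$ exists on $D_r(\varphi^p(z_0))$ and $\Omega$ is compactly contained in $S_Q$, the support $S_V$ of the equilibrium measure in the plane in the presence of the external field $V(z)=(1+q)Q(z)+q\ln|z-z_0|^{-1}$ is $S_V=S_Q\setminus\Omega$.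
   Context: An external field $Q:\mathbb{C}\to\mathbb{R}\cup\{\infty\}$ is admissible if $\exp(-Q)$ is upper-semicontinuous, is positive on a set of positive logarithmic capacity, and satisfies $|z|\exp(-Q(z))\to0$ as $|z|\to\infty$. For an admissible $Q$, the equilibrium measure $\mu_Q$ is the unique probability measure $\mu$ on $\mathbb{C}$ minimizing the weighted logarithmic energy $\iint\ln\frac{1}{|w-z|}\,d\mu(w)\,d\mu(z)+2\int Q\,d\mu$. The notation $\varphi^p$ means the $p$th power of $\varphi$ (not iteration), and natural numbers are $1,2,3,\dots$. The local inverse $\psi$ takes values in $U$, where $\varphi$ is defined and $Q=C|\varphi|^{2p}$, and satisfies $\varphi^p\circ\psi=\mathrm{id}$. "Compactly contained in $S_Q$" means that the closure of $\Omega$ is a compact subset of the interior of $S_Q$. *)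

theory Defs
  imports "HOL-Probability.Probability" "HOL-Complex_Analysis.Complex_Analysis"
begin

text \<open>
  Extended-real integral, positive part minus negative part. In \<^typ>\<open>ereal\<close> we have
  \<^prop>\<open>(\<infinity>::ereal) - \<infinity> = \<infinity>\<close>, so an integral that is undefined gets the value \<open>\<infinity>\<close>. Likewise
  \<^prop>\<open>-\<infinity> + \<infinity> = (\<infinity>::ereal)\<close>, so measures whose weighted energy below is an undefined expression have
  energy \<open>\<infinity>\<close> and never compete in the minimization.
\<close>

definition ereal_integral :: "'a measure \<Rightarrow> ('a \<Rightarrow> ereal) \<Rightarrow> ereal" where
  "ereal_integral M f =
     enn2ereal (\<integral>\<^sup>+ x. e2ennreal (f x) \<partial>M) - enn2ereal (\<integral>\<^sup>+ x. e2ennreal (- f x) \<partial>M)"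

definition exp_ereal :: "ereal \<Rightarrow> ennreal" where
  "exp_ereal x =
     (if x = \<infinity> then \<infinity> else if x = -\<infinity> then 0 else ennreal (exp (real_of_ereal x)))"

text \<open>\<open>ln (1 / t)\<close> with value \<open>\<infinity>\<close> at \<open>0\<close>; the real-valued \<^term>\<open>ln (1 / 0 :: real)\<close> is \<open>0\<close>.\<close>

definition ln_recip :: "real \<Rightarrow> ereal" where
  "ln_recip t = (if t = 0 then \<infinity> else ereal (ln (1 / t)))"

definition borel_probs :: "complex measure set" where
  "borel_probs = {\<mu>. prob_space \<mu> \<and> sets \<mu> = sets borel}"

definition measure_support :: "complex measure \<Rightarrow> complex set" where
  "measure_support \<mu> = {z. \<forall>N. open N \<and> z \<in> N \<longrightarrow> emeasure \<mu> N > 0}"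

definition log_energy :: "complex measure \<Rightarrow> ereal" where
  "log_energy \<mu> = ereal_integral (\<mu> \<Otimes>\<^sub>M \<mu>) (\<lambda>(z, w). ln_recip (norm (w - z)))"

definition log_capacity :: "complex set \<Rightarrow> ennreal" where
  "log_capacity E =
     exp_ereal (- (INF \<mu> \<in> {\<mu> \<in> borel_probs. compact (measure_support \<mu>) \<and> measure_support \<mu> \<subseteq> E}.
                     log_energy \<mu>))"

text \<open>The third conjunct is upper semicontinuity of \<open>exp (- Q)\<close>.\<close>

definition admissible_field :: "(complex \<Rightarrow> ereal) \<Rightarrow> bool" where
  "admissible_field Q \<longleftrightarrow>
     (\<forall>z. Q z \<noteq> -\<infinity>) \<and>
     log_capacity {z. exp_ereal (- Q z) > 0} > 0 \<and>
     (\<forall>a. open {z. exp_ereal (- Q z) < a}) \<and>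
     ((\<lambda>z. ennreal (norm z) * exp_ereal (- Q z)) \<longlongrightarrow> 0) at_infinity"

definition weighted_energy :: "(complex \<Rightarrow> ereal) \<Rightarrow> complex measure \<Rightarrow> ereal" where
  "weighted_energy Q \<mu> = log_energy \<mu> + 2 * ereal_integral \<mu> Q"

definition equilibrium_measure :: "(complex \<Rightarrow> ereal) \<Rightarrow> complex measure" where
  "equilibrium_measure Q =
     (THE \<mu>. \<mu> \<in> borel_probs \<and> (\<forall>\<nu> \<in> borel_probs. weighted_energy Q \<mu> \<le> weighted_energy Q \<nu>))"

definition equilibrium_support :: "(complex \<Rightarrow> ereal) \<Rightarrow> complex set" where
  "equilibrium_support Q = measure_support (equilibrium_measure Q)"

definition local_inverse_on_disc ::
    "(complex \<Rightarrow> complex) \<Rightarrow> complex set \<Rightarrow> complex \<Rightarrow> real \<Rightarrow> (complex \<Rightarrow> complex) \<Rightarrow> bool" where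
  "local_inverse_on_disc f U z0 r \<psi> \<longleftrightarrow>
     \<psi> holomorphic_on ball (f z0) r \<and>
     \<psi> ` ball (f z0) r \<subseteq> U \<and>
     \<psi> (f z0) = z0 \<and>
     (\<forall>w \<in> ball (f z0) r. f (\<psi> w) = w)"

definition compactly_contained :: "complex set \<Rightarrow> complex set \<Rightarrow> bool" where
  "compactly_contained A S \<longleftrightarrow> compact (closure A) \<and> closure A \<subseteq> interior S"

end

theory Submission imports Defs begin

text \<open>
  Put \<open>f = \<phi>\<^sup>p\<close>, so that \<open>Q = C |f|\<^sup>2\<close> near \<open>z\<^sub>0\<close>. The equilibrium potential of \<open>\<mu>\<^sub>Q\<close> is constant on the
  support, so in the coordinate \<open>f\<close> the measure \<open>\<mu>\<^sub>Q\<close> has constant density \<open>2 C / \<pi>\<close> with respect to area on \<open>\<Omega>\<close>.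
  Since \<open>\<psi>\<close> is holomorphic, the mean value property makes the potential of \<open>\<mu>\<^sub>Q\<close> restricted to \<open>\<Omega>\<close> agree off \<open>\<Omega>\<close> with that of a
  charge \<open>2 C r\<^sup>2 = q / (1 + q)\<close> at \<open>z\<^sub>0\<close>, and fall below it on \<open>\<Omega>\<close>. Hence \<open>(1 + q)\<close> times the restriction of
  \<open>\<mu>\<^sub>Q\<close> to the complement of \<open>\<Omega>\<close> is a probability measure that satisfies Frostman's conditions for \<open>V\<close>. As the
  logarithmic energy is positive definite, it is the equilibrium measure of \<open>V\<close>.

  The boundary of \<open>\<Omega>\<close> stays in the support: otherwise \<open>\<Omega>\<close> would be dense in a ball \<open>N\<close> that it does not
  fill and that carries no mass outside \<open>\<Omega>\<close>. There \<open>Re (cnj c * (f - c)) + r\<^sup>2 ln (|f - c| / r)\<close>, with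
  \<open>c = f z\<^sub>0\<close>, would be the real part of a function \<open>K\<close> holomorphic on all of \<open>N\<close>, and following the level lines of
  \<open>Im K\<close> would give an open subset of \<open>N\<close> disjoint from \<open>\<Omega>\<close>.
\<close>

section \<open>Smoothing and circular means\<close>

text \<open>Two obstacles shape the argument. The integrals in the energy may be undefined, and
  \<open>THE\<close> in the equilibrium measure demands existence and uniqueness for both fields. So
  everything is moved into \<open>ennreal\<close>: on a disc of radius \<open>R\<close> the kernel
  \<open>ln (2 * R / |z - w|)\<close> is nonnegative, and the growth of the field confines the
  minimization to such a disc. For \<open>Q\<close> a minimizer comes from compactness; for
  \<open>V\<close> Frostman's conditions alone suffice, by positive definiteness. The density
  \<open>2 C / pi\<close> is found without differentiating potentials. Averaged over a disc of
  radius \<open>s\<close> in the coordinate \<open>f\<close>, the field \<open>C |\<zeta>|^2\<close>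
  exceeds its central value by \<open>C s^2 / 2\<close>, while the logarithmic kernel falls below
  its own by a compactly supported defect of total mass \<open>pi s^2 / 4\<close>. Hence
  \<open>\<mu>\<close> and the constant density have equal smoothings by the defect, and smoothings
  at scales tending to 0 determine a measure. No boundary regularity of \<open>\<Omega>\<close> is
  available, as \<open>\<psi>\<close> lives on the open disc only. The boundary argument uses just
  that \<open>f\<close> leaves every smaller closed disc as its argument leaves
  \<open>\<Omega>\<close>.\<close>

lemma nn_integral_lborel_affine:
  fixes f :: "complex \<Rightarrow> ennreal"
  assumes [measurable]: "f \<in> borel_measurable borel" and "c \<noteq> 0"
  shows "(\<integral>\<^sup>+x. f x \<partial>lborel) = ennreal (c\<^sup>2) * (\<integral>\<^sup>+x. f (t + c *\<^sub>R x) \<partial>lborel)"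
  by (subst lborel_affine[OF assms(2), of t])
     (simp add: nn_integral_density nn_integral_distr nn_integral_cmult)

text \<open>Since \<open>h\<close> is continuous with values between 0 and 1 and
  \<open>\<rho>\<close> is integrable, dominated convergence applies under both integral signs, with
  \<open>\<rho>\<close> and then its total mass as bounds. Up to that mass, the scaled copies of
  \<open>\<rho>\<close> form an approximate identity.\<close>

lemma tendsto_smoothing:
  fixes \<mu> :: "complex measure" and \<rho> :: "complex \<Rightarrow> ennreal" and h :: "complex \<Rightarrow> real"
  assumes "finite_measure \<mu>" and sets[measurable_cong]: "sets \<mu> = sets borel"
    and [measurable]: "\<rho> \<in> borel_measurable borel" and fin: "(\<integral>\<^sup>+x. \<rho> x \<partial>lborel) < \<infinity>"
    and s: "s \<longlonglongrightarrow> (0::real)"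
    and h: "continuous_on UNIV h" "\<And>x. 0 \<le> h x" "\<And>x. h x \<le> 1"
  shows "(\<lambda>n. \<integral>\<^sup>+z. (\<integral>\<^sup>+b. ennreal (h (z - s n *\<^sub>R b)) * \<rho> b \<partial>lborel) \<partial>\<mu>)
    \<longlonglongrightarrow> (\<integral>\<^sup>+z. ennreal (h z) \<partial>\<mu>) * (\<integral>\<^sup>+x. \<rho> x \<partial>lborel)"
proof -
  interpret finite_measure \<mu> by fact
  have [measurable]: "h \<in> borel_measurable borel"
    using h(1) by (rule borel_measurable_continuous_onI)
  have pt: "(\<lambda>n. ennreal (h (z - s n *\<^sub>R b))) \<longlonglongrightarrow> ennreal (h z)" for z b
  proof -
    have "(\<lambda>n. z - s n *\<^sub>R b) \<longlonglongrightarrow> z - 0 *\<^sub>R b"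
      by (intro tendsto_intros s)
    then have "(\<lambda>n. h (z - s n *\<^sub>R b)) \<longlonglongrightarrow> h z"
      using h(1) by (auto simp: continuous_on_def dest!: tendsto_compose)
    then show ?thesis by (rule tendsto_ennrealI)
  qed
  have le: "ennreal (h x) * \<rho> b \<le> \<rho> b" for x b
    using mult_right_mono[of "ennreal (h x)" 1 "\<rho> b"] h(3)[of x] by simp
  have inner: "(\<lambda>n. \<integral>\<^sup>+b. ennreal (h (z - s n *\<^sub>R b)) * \<rho> b \<partial>lborel)
      \<longlonglongrightarrow> (\<integral>\<^sup>+b. ennreal (h z) * \<rho> b \<partial>lborel)" for z
  proof (rule nn_integral_dominated_convergence[where w=\<rho>])
    have "AE b in lborel. \<rho> b \<noteq> \<infinity>"
      using fin by (intro nn_integral_PInf_AE) auto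
    then show "AE b in lborel. (\<lambda>n. ennreal (h (z - s n *\<^sub>R b)) * \<rho> b) \<longlonglongrightarrow> ennreal (h z) * \<rho> b"
      by eventually_elim (auto intro!: tendsto_mult_ennreal pt tendsto_const)
  qed (use fin le in auto)
  have "(\<lambda>n. \<integral>\<^sup>+z. (\<integral>\<^sup>+b. ennreal (h (z - s n *\<^sub>R b)) * \<rho> b \<partial>lborel) \<partial>\<mu>)
      \<longlonglongrightarrow> (\<integral>\<^sup>+z. (\<integral>\<^sup>+b. ennreal (h z) * \<rho> b \<partial>lborel) \<partial>\<mu>)"
  proof (rule nn_integral_dominated_convergence[where w="\<lambda>_. \<integral>\<^sup>+x. \<rho> x \<partial>lborel"])
    show "(\<integral>\<^sup>+x. (\<integral>\<^sup>+x. \<rho> x \<partial>lborel) \<partial>\<mu>) < \<infinity>"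
      using fin emeasure_finite[of "space \<mu>"] by (simp add: ennreal_mult_eq_top_iff less_top[symmetric])
    show "AE x in \<mu>. (\<integral>\<^sup>+b. ennreal (h (x - s j *\<^sub>R b)) * \<rho> b \<partial>lborel) \<le> (\<integral>\<^sup>+x. \<rho> x \<partial>lborel)" for j
      by (intro AE_I2 nn_integral_mono le)
  qed (use inner in auto)
  also have "(\<integral>\<^sup>+z. (\<integral>\<^sup>+b. ennreal (h z) * \<rho> b \<partial>lborel) \<partial>\<mu>)
      = (\<integral>\<^sup>+z. ennreal (h z) \<partial>\<mu>) * (\<integral>\<^sup>+x. \<rho> x \<partial>lborel)"
    by (simp add: nn_integral_cmult nn_integral_multc)
  finally show ?thesis .
qed

text \<open>Tonelli and the substitution \<open>a = z - s b\<close> move the averaging from the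
  measure to the test function, where the limit \<open>s -> 0\<close> can be taken.\<close>

lemma nn_integral_smoothing:
  fixes \<mu> :: "complex measure" and \<rho> :: "complex \<Rightarrow> ennreal" and h :: "complex \<Rightarrow> real"
  assumes "finite_measure \<mu>" and sets[measurable_cong]: "sets \<mu> = sets borel"
    and [measurable]: "\<rho> \<in> borel_measurable borel" "h \<in> borel_measurable borel" and "s > (0::real)"
  shows "(\<integral>\<^sup>+a. ennreal (h a) * (\<integral>\<^sup>+z. \<rho> ((z - a) /\<^sub>R s) \<partial>\<mu>) \<partial>lborel)
    = ennreal (s\<^sup>2) * (\<integral>\<^sup>+z. (\<integral>\<^sup>+b. ennreal (h (z - s *\<^sub>R b)) * \<rho> b \<partial>lborel) \<partial>\<mu>)"
proof -
  interpret finite_measure \<mu> by fact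
  interpret pair_sigma_finite lborel \<mu> ..
  have "(\<integral>\<^sup>+a. ennreal (h a) * (\<integral>\<^sup>+z. \<rho> ((z - a) /\<^sub>R s) \<partial>\<mu>) \<partial>lborel)
      = (\<integral>\<^sup>+a. (\<integral>\<^sup>+z. ennreal (h a) * \<rho> ((z - a) /\<^sub>R s) \<partial>\<mu>) \<partial>lborel)"
    by (simp add: nn_integral_cmult)
  also have "\<dots> = (\<integral>\<^sup>+z. (\<integral>\<^sup>+a. ennreal (h a) * \<rho> ((z - a) /\<^sub>R s) \<partial>lborel) \<partial>\<mu>)"
    by (intro Fubini'[symmetric]) measurable
  also have "\<dots> = (\<integral>\<^sup>+z. ennreal (s\<^sup>2) * (\<integral>\<^sup>+b. ennreal (h (z - s *\<^sub>R b)) * \<rho> b \<partial>lborel) \<partial>\<mu>)"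
  proof (intro nn_integral_cong)
    fix z
    show "(\<integral>\<^sup>+a. ennreal (h a) * \<rho> ((z - a) /\<^sub>R s) \<partial>lborel)
        = ennreal (s\<^sup>2) * (\<integral>\<^sup>+b. ennreal (h (z - s *\<^sub>R b)) * \<rho> b \<partial>lborel)"
      using \<open>s > 0\<close> by (subst nn_integral_lborel_affine[of _ "-s" z]) (simp_all add: power2_eq_square)
  qed
  also have "\<dots> = ennreal (s\<^sup>2) * (\<integral>\<^sup>+z. (\<integral>\<^sup>+b. ennreal (h (z - s *\<^sub>R b)) * \<rho> b \<partial>lborel) \<partial>\<mu>)"
    by (intro nn_integral_cmult) measurable
  finally show ?thesis .
qed

text \<open>Equal smoothings at scales tending to 0 give equal integrals of continuous functions
  with compact support in \<open>G\<close>; such functions decrease to indicators of compact sets,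
  and inner regularity does the rest. The hypothesis is local and holds only for large
  \<open>n\<close>, because a profile centred in \<open>A\<close> may reach outside \<open>G\<close>
  at a coarse scale. The profiles used later are a disc, a Gaussian and the defect of a mean
  value.\<close>

lemma emeasure_eq_if_smoothings_eq:
  fixes \<mu> \<nu> :: "complex measure" and \<rho> :: "complex \<Rightarrow> ennreal"
  assumes "finite_measure \<mu>" "sets \<mu> = sets borel" "finite_measure \<nu>" "sets \<nu> = sets borel"
    and \<rho>[measurable]: "\<rho> \<in> borel_measurable borel"
    and "(\<integral>\<^sup>+x. \<rho> x \<partial>lborel) < \<infinity>" "(\<integral>\<^sup>+x. \<rho> x \<partial>lborel) \<noteq> 0"
    and s: "s \<longlonglongrightarrow> (0::real)" "\<And>n. s n > 0"
    and "open G"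
    and eq: "\<And>A. compact A \<Longrightarrow> A \<subseteq> G \<Longrightarrow> \<forall>\<^sub>F n in sequentially. AE a in lborel. a \<in> A \<longrightarrow>
          (\<integral>\<^sup>+z. \<rho> ((z - a) /\<^sub>R s n) \<partial>\<mu>) = (\<integral>\<^sup>+z. \<rho> ((z - a) /\<^sub>R s n) \<partial>\<nu>)"
    and B: "B \<in> sets borel" "B \<subseteq> G"
  shows "emeasure \<mu> B = emeasure \<nu> B"
proof -
  have h_eq: "(\<integral>\<^sup>+z. ennreal (h z) \<partial>\<mu>) = (\<integral>\<^sup>+z. ennreal (h z) \<partial>\<nu>)"
    if h: "continuous_on UNIV h" "\<And>x. 0 \<le> h x" "\<And>x. h x \<le> 1"
      and A: "compact A" "A \<subseteq> G" "\<And>x. x \<notin> A \<Longrightarrow> h x = 0" for h A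
  proof -
    have [measurable]: "h \<in> borel_measurable borel"
      using h(1) by (rule borel_measurable_continuous_onI)
    have ev: "\<forall>\<^sub>F n in sequentially.
        (\<integral>\<^sup>+z. (\<integral>\<^sup>+b. ennreal (h (z - s n *\<^sub>R b)) * \<rho> b \<partial>lborel) \<partial>\<mu>) =
        (\<integral>\<^sup>+z. (\<integral>\<^sup>+b. ennreal (h (z - s n *\<^sub>R b)) * \<rho> b \<partial>lborel) \<partial>\<nu>)"
      using eq[OF A(1,2)]
    proof eventually_elim
      case (elim n)
      have "(\<integral>\<^sup>+a. ennreal (h a) * (\<integral>\<^sup>+z. \<rho> ((z - a) /\<^sub>R s n) \<partial>\<mu>) \<partial>lborel) =
          (\<integral>\<^sup>+a. ennreal (h a) * (\<integral>\<^sup>+z. \<rho> ((z - a) /\<^sub>R s n) \<partial>\<nu>) \<partial>lborel)"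
        using elim by (intro nn_integral_cong_AE) (auto elim!: eventually_mono simp: A(3))
      then show ?case
        using s(2)[of n]
        by (simp add: nn_integral_smoothing assms(1-4) ennreal_mult_cancel_left)
    qed
    have "(\<integral>\<^sup>+z. ennreal (h z) \<partial>\<mu>) * (\<integral>\<^sup>+x. \<rho> x \<partial>lborel) =
        (\<integral>\<^sup>+z. ennreal (h z) \<partial>\<nu>) * (\<integral>\<^sup>+x. \<rho> x \<partial>lborel)"
      using tendsto_smoothing[OF assms(1,2) \<rho> assms(6) s(1) h]
        tendsto_cong[OF ev] tendsto_smoothing[OF assms(3,4) \<rho> assms(6) s(1) h]
      by (auto intro: LIMSEQ_unique)
    then show ?thesis
      using assms(6,7) by (auto simp: mult.commute[of _ "integral\<^sup>N lborel \<rho>"] ennreal_mult_cancel_left)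
  qed
  have comp: "emeasure \<mu> A = emeasure \<nu> A" if A: "compact A" "A \<subseteq> G" for A
  proof (cases "A = {}")
    case False
    obtain e where e0: "e > 0" "(\<Union>x\<in>A. cball x e) \<subseteq> G"
      using compact_subset_open_imp_cball_epsilon_subset[OF A(1) \<open>open G\<close> A(2)] by blast
    have "x \<in> (\<Union>x\<in>A. cball x e)" if "infdist x A \<le> e" for x
    proof -
      obtain y where "y \<in> A" "infdist x A = dist x y"
        using infdist_attains_inf[OF compact_imp_closed[OF A(1)] False] by blast
      with that show ?thesis by (auto simp: dist_commute)
    qed
    with e0 have e: "e > 0" "{x. infdist x A \<le> e} \<subseteq> G"
      by blast+
    have cpt: "compact {x. infdist x A \<le> e}"
      using compact_infdist_le[OF False A(1) e(1)] .
    \<comment> \<open>Cut-offs that equal 1 on \<open>A\<close>, vanish at distance \<open>e\<close>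
      from it, and decrease to the indicator of \<open>A\<close> as the slope grows.\<close>
    define h where "h n x = max 0 (1 - real (Suc n) / e * infdist x A)" for n x
    have hn: "h n x = 0" if "\<not> infdist x A \<le> e" for n x
    proof -
      have "1 \<le> infdist x A / e" using that e(1) by (simp add: field_simps)
      also have "\<dots> \<le> real (Suc n) * (infdist x A / e)"
        using mult_right_mono[of 1 "real (Suc n)" "infdist x A / e"] infdist_nonneg[of x A] e(1) by simp
      finally show ?thesis by (simp add: h_def)
    qed
    have cont: "continuous_on UNIV (h n)" for n
      unfolding h_def by (intro continuous_intros continuous_on_infdist)
    have h01: "0 \<le> h n x" "h n x \<le> 1" for n x
      using e(1) infdist_nonneg[of x A] by (auto simp: h_def)
    have eqn: "(\<integral>\<^sup>+z. ennreal (h n z) \<partial>\<mu>) = (\<integral>\<^sup>+z. ennreal (h n z) \<partial>\<nu>)" for n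
      by (rule h_eq[OF cont h01 cpt e(2)]) (auto intro: hn)
    have lim: "(\<lambda>n. \<integral>\<^sup>+z. ennreal (h n z) \<partial>M) \<longlonglongrightarrow> emeasure M A"
      if M: "finite_measure M" "sets M = sets borel" for M
    proof -
      interpret finite_measure M by fact
      have [measurable]: "h n \<in> borel_measurable M" for n
        using borel_measurable_continuous_onI[OF cont] measurable_cong_sets[OF M(2) refl] by blast
      have [measurable]: "A \<in> sets M"
        using A(1) M(2) by (simp add: borel_compact)
      have "(\<lambda>n. ennreal (h n z)) \<longlonglongrightarrow> indicator A z" for z
      proof (cases "z \<in> A")
        case True
        then show ?thesis by (simp add: h_def)
      next
        case False
        then have pos: "infdist z A > 0"
          using \<open>A \<noteq> {}\<close> A(1) compact_imp_closed in_closed_iff_infdist_zero infdist_nonneg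
          by (metis less_eq_real_def)
        then have "\<forall>\<^sub>F n in sequentially. real (Suc n) > e / infdist z A"
          by real_asymp
        then have "\<forall>\<^sub>F n in sequentially. ennreal (h n z) = indicator A z"
          by eventually_elim (use pos e(1) False in \<open>auto simp: h_def field_simps\<close>)
        then show ?thesis by (rule tendsto_eventually)
      qed
      then have "(\<lambda>n. \<integral>\<^sup>+z. ennreal (h n z) \<partial>M) \<longlonglongrightarrow> (\<integral>\<^sup>+z. indicator A z \<partial>M)"
        using h01 by (intro nn_integral_dominated_convergence[where w="\<lambda>_. 1"])
          (auto simp: less_top[symmetric])
      then show ?thesis by simp
    qed
    show ?thesis
      using lim[OF assms(1,2)] lim[OF assms(3,4)] by (simp add: eqn LIMSEQ_unique)
  qed simp
  have fin: "emeasure \<mu> (space \<mu>) \<noteq> \<infinity>" "emeasure \<nu> (space \<nu>) \<noteq> \<infinity>"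
    using finite_measure.emeasure_finite assms(1,3) by auto
  show ?thesis
    unfolding inner_regular[OF assms(2) fin(1) B(1)] inner_regular[OF assms(4) fin(2) B(1)]
    using B(2) comp by (intro SUP_cong) auto
qed

section \<open>Area in the plane: rotation invariance and radial integrals\<close>

lemma emeasure_lborel_ball_complex:
  "s \<ge> 0 \<Longrightarrow> emeasure lborel (ball (a::complex) s) = ennreal (pi * s\<^sup>2)"
  by (simp add: emeasure_ball unit_ball_vol_2)

lemma emeasure_lborel_cball_complex:
  "s \<ge> 0 \<Longrightarrow> emeasure lborel (cball (a::complex) s) = ennreal (pi * s\<^sup>2)"
  by (simp add: emeasure_cball unit_ball_vol_2)

text \<open>A rotation pulls discs back to discs of the same radius, so both measures have the same
  smoothings by the indicator of the unit disc. Restriction to the discs \<open>?b k\<close>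
  supplies the finiteness that the comparison of smoothings needs.\<close>

lemma lborel_rotation:
  assumes u: "norm u = 1"
  shows "distr lborel borel (\<lambda>z. u * z) = (lborel :: complex measure)" (is "?D = _")
proof (rule measure_eqI)
  fix B assume "B \<in> sets ?D"
  then have B[measurable]: "B \<in> sets borel" by simp
  have u0: "u \<noteq> 0" using u by auto
  let ?b = "\<lambda>k::nat. ball (0::complex) (real k)"
  have local: "emeasure ?D (B \<inter> ?b k) = emeasure lborel (B \<inter> ?b k)" for k
  proof -
    let ?M = "density ?D (indicator (?b k))" and ?N = "density lborel (indicator (?b k)) :: complex measure"
    have pre: "(\<lambda>z. u * z) -` ball a t = ball (a / u) t" for a t
    proof -
      have "dist (a / u) z = dist a (u * z)" for z
      proof -
        have "a - u * z = u * (a / u - z)" using u0 by (simp add: field_simps)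
        then show ?thesis using u by (simp add: dist_norm norm_mult)
      qed
      then show ?thesis by auto
    qed
    have indM: "(indicator (?b k) :: complex \<Rightarrow> ennreal) \<in> borel_measurable ?D"
        "(indicator (?b k) :: complex \<Rightarrow> ennreal) \<in> borel_measurable lborel"
      by (auto intro!: borel_measurable_indicator)
    have resM: "emeasure ?M X = emeasure ?D (?b k \<inter> X)" if "X \<in> sets borel" for X
      using emeasure_density[OF indM(1), of X] that by (simp flip: indicator_inter_arith)
    have resN: "emeasure ?N X = emeasure lborel (?b k \<inter> X)" if "X \<in> sets borel" for X
      using emeasure_density[OF indM(2), of X] that by (simp flip: indicator_inter_arith)
    have finM: "finite_measure ?M"
      using resM[of UNIV]
      by (intro finite_measureI) (simp add: emeasure_distr pre emeasure_lborel_ball_complex)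
    have finN: "finite_measure ?N"
      using resN[of UNIV]
      by (intro finite_measureI) (simp add: emeasure_lborel_ball_complex)
    have "emeasure ?M (B \<inter> ?b k) = emeasure ?N (B \<inter> ?b k)"
    proof (rule emeasure_eq_if_smoothings_eq[OF finM _ finN, where \<rho>="indicator (ball 0 1)" and s="\<lambda>n. 1 / real (Suc n)" and G="?b k"])
      show "(\<lambda>n. 1 / real (Suc n)) \<longlonglongrightarrow> 0" by real_asymp
    next
      fix A assume A: "compact A" "A \<subseteq> ?b k"
      obtain e where e: "e > 0" "(\<Union>x\<in>A. cball x e) \<subseteq> ?b k"
        using compact_subset_open_imp_cball_epsilon_subset[OF A(1) _ A(2)] by auto
      have "\<forall>\<^sub>F n in sequentially. 1 / real (Suc n) < e"
        using e(1) by real_asymp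
      then show "\<forall>\<^sub>F n in sequentially. AE a in lborel. a \<in> A \<longrightarrow>
          (\<integral>\<^sup>+z. indicator (ball 0 1) ((z - a) /\<^sub>R (1 / real (Suc n))) \<partial>?M) =
          (\<integral>\<^sup>+z. indicator (ball 0 1) ((z - a) /\<^sub>R (1 / real (Suc n))) \<partial>?N)"
      proof eventually_elim
        case (elim n)
        let ?s = "1 / real (Suc n)"
        have "indicator (ball 0 1) ((z - a) /\<^sub>R s) = (indicator (ball a s) z :: ennreal)"
          if "s > 0" for z a :: complex and s
        proof -
          have "norm ((z - a) /\<^sub>R s) = norm (a - z) / s"
            using that by (simp add: norm_minus_commute divide_inverse mult.commute)
          then show ?thesis
            using that by (simp add: indicator_def dist_norm)
        qed
        from this[of ?s] have ind: "indicator (ball 0 1) ((z - a) /\<^sub>R ?s) = (indicator (ball a ?s) z :: ennreal)"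
          for z a :: complex
          by (metis of_nat_0_less_iff zero_less_Suc zero_less_divide_1_iff)
        show ?case
        proof (intro AE_I2 impI)
          fix a :: complex assume "a \<in> A"
          then have sub: "ball a ?s \<subseteq> ?b k"
            using e(2) elim by (fastforce simp: subset_iff)
          have "emeasure ?M (ball a ?s) = emeasure ?D (ball a ?s)"
            and "emeasure ?N (ball a ?s) = emeasure lborel (ball a ?s)"
            using sub by (simp_all only: resM resN borel_open open_ball Int_absorb1)
          then show "(\<integral>\<^sup>+z. indicator (ball 0 1) ((z - a) /\<^sub>R ?s) \<partial>?M) =
              (\<integral>\<^sup>+z. indicator (ball 0 1) ((z - a) /\<^sub>R ?s) \<partial>?N)"
            unfolding ind by (simp add: emeasure_distr pre emeasure_lborel_ball_complex)
        qed
      qed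
    qed (auto simp: emeasure_lborel_ball_complex intro!: borel_measurable_indicator)
    then show ?thesis
      using resM[of "B \<inter> ?b k"] resN[of "B \<inter> ?b k"] by (simp add: Int_ac)
  qed
  have inc: "incseq (\<lambda>k. B \<inter> ?b k)" by (auto simp: incseq_def)
  have un: "(\<Union>k. B \<inter> ?b k) = B"
    using reals_Archimedean2 by (auto simp: dist_norm)
  have "emeasure ?D B = (SUP k. emeasure ?D (B \<inter> ?b k))"
    using SUP_emeasure_incseq[of "\<lambda>k. B \<inter> ?b k" ?D] inc un by (simp add: image_subset_iff)
  also have "\<dots> = (SUP k. emeasure lborel (B \<inter> ?b k))"
    by (simp add: local)
  also have "\<dots> = emeasure lborel B"
    using SUP_emeasure_incseq[of "\<lambda>k. B \<inter> ?b k" lborel] inc un by (simp add: image_subset_iff)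
  finally show "emeasure ?D B = emeasure lborel B" .
qed simp

text \<open>A disc of squared radius \<open>a\<close> has area \<open>pi a\<close>. With the squared
  modulus as variable the Jacobian is constant, so radial integrals become one-dimensional ones
  without a weight.\<close>

lemma distr_norm_square:
  "distr lborel borel (\<lambda>z::complex. (norm z)\<^sup>2) = density lborel (\<lambda>u. ennreal pi * indicator {0..} u)"
  (is "?D = ?E")
proof (rule measure_eqI_generator_eq[where \<Omega>=UNIV and E="range (\<lambda>a::real. {..a})" and A="\<lambda>n. {..real n}"])
  show "Int_stable (range (\<lambda>a::real. {..a}))"
    by (auto intro!: Int_stableI_image simp: )
  show "sets ?D = sigma_sets UNIV (range atMost)" "sets ?E = sigma_sets UNIV (range atMost)"
    by (simp_all add: borel_eq_atMost)
  have D: "emeasure ?D {..a} = ennreal pi * emeasure lborel {0..a}" for a :: real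
  proof (cases "a \<ge> 0")
    case True
    have "(\<lambda>z::complex. (norm z)\<^sup>2) -` {..a} = cball 0 (sqrt a)"
      by (auto simp: real_le_rsqrt sqrt_ge_absD real_sqrt_le_iff power2_eq_square intro: real_le_rsqrt)
         (metis True norm_ge_zero power2_eq_square power_mono real_sqrt_pow2)
    with True show ?thesis
      by (simp add: emeasure_distr emeasure_lborel_cball_complex ennreal_mult)
  next
    case False
    then have "(\<lambda>z::complex. (norm z)\<^sup>2) -` {..a} = {}"
      by (auto simp: not_le) (meson linorder_not_less order.strict_trans2 zero_le_power2)
    with False show ?thesis by (simp add: emeasure_distr)
  qed
  have E: "emeasure ?E {..a} = ennreal pi * emeasure lborel {0..a}" for a :: real
    by (simp add: emeasure_density nn_integral_cmult mult.assoc flip: indicator_inter_arith)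
       (simp add: atLeastAtMost_def)
  show "emeasure ?D X = emeasure ?E X" if "X \<in> range atMost" for X
    using that D E by auto
  show "emeasure ?D {..real n} \<noteq> \<infinity>" for n
    unfolding D by (simp add: ennreal_mult_eq_top_iff)
  show "(\<Union>n. {..real n}) = UNIV"
    using real_arch_simple by auto
qed auto

lemma nn_integral_radial:
  fixes g :: "real \<Rightarrow> ennreal"
  assumes [measurable]: "g \<in> borel_measurable borel"
  shows "(\<integral>\<^sup>+z. g ((norm (z::complex))\<^sup>2) \<partial>lborel) = ennreal pi * (\<integral>\<^sup>+u. g u * indicator {0..} u \<partial>lborel)"
proof -
  have "(\<integral>\<^sup>+z. g ((norm (z::complex))\<^sup>2) \<partial>lborel) = (\<integral>\<^sup>+u. g u \<partial>distr lborel borel (\<lambda>z::complex. (norm z)\<^sup>2))"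
    by (simp add: nn_integral_distr)
  also have "\<dots> = (\<integral>\<^sup>+u. ennreal pi * (g u * indicator {0..} u) \<partial>lborel)"
    unfolding distr_norm_square by (simp add: nn_integral_density mult_ac)
  finally show ?thesis by (simp add: nn_integral_cmult)
qed

text \<open>Rotating by an \<open>n\<close>-th root of \<open>-1\<close> kills the \<open>n\<close>-th term of the power series of \<open>F\<close>.\<close>

lemma
  fixes F :: "complex \<Rightarrow> complex"
  assumes F: "F holomorphic_on ball 0 S" and A[measurable]: "A \<in> sets borel" and finA: "emeasure lborel A < \<infinity>"
    and rot: "\<And>u z. norm u = 1 \<Longrightarrow> z \<in> A \<Longrightarrow> u * z \<in> A"
    and e[measurable]: "e \<in> borel_measurable borel"
    and e_rot: "\<And>u z. norm u = 1 \<Longrightarrow> z \<in> A \<Longrightarrow> e (u * z) = \<sigma> u * e z" and \<sigma>: "\<sigma> = (\<lambda>u. u) \<or> \<sigma> = cnj"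
    and q: "\<And>z. z \<in> A \<Longrightarrow> norm (e z) \<le> q" "0 \<le> q" "q < S"
  shows integrable_rotation_mean: "integrable lborel (\<lambda>z. indicator A z *\<^sub>R F (e z))"
    and integral_rotation_mean: "(\<integral>z. indicator A z *\<^sub>R F (e z) \<partial>lborel) = measure lborel A *\<^sub>R F 0"
proof -
  define a where "a n = (deriv ^^ n) F 0 / fact n" for n
  have sums: "(\<lambda>n. a n * w ^ n) sums F w" if "norm w < S" for w
    using holomorphic_power_series[OF F, of w] that by (simp add: a_def)
  \<comment> \<open>A radius strictly between \<open>q\<close> and \<open>S\<close>: convergence of
    the series there makes it absolutely convergent at \<open>q\<close>, which gives a dominating
    series on all of \<open>A\<close>.\<close>
  define q' where "q' = (q + S) / 2"
  have "norm (of_real q' :: complex) < S"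
    unfolding norm_of_real using q by (simp add: q'_def)
  then have "summable (\<lambda>n. a n * of_real q' ^ n)"
    using sums[of "of_real q'"] by (simp add: sums_iff)
  then have "summable (\<lambda>n. norm (a n * of_real q ^ n))"
    by (rule powser_insidea) (unfold norm_of_real, use q in \<open>simp add: q'_def\<close>)
  then have sm: "summable (\<lambda>n. norm (a n) * q ^ n)"
    using q by (simp add: norm_mult norm_power)
  define f where "f n z = indicator A z *\<^sub>R (a n * e z ^ n)" for n z
  have fm[measurable]: "f n \<in> borel_measurable borel" for n
    unfolding f_def by measurable
  have le: "norm (f n z) \<le> norm (a n) * q ^ n * indicator A z" for n z
    using q(1)[of z] q(2)
    by (auto simp: f_def norm_mult norm_power indicator_def intro!: mult_left_mono power_mono)
  have indint: "integrable lborel (\<lambda>z. c * indicator A z :: real)" for c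
    using finA by (intro integrable_mult_right) (simp add: integrable_real_indicator)
  have int: "integrable lborel (f n)" for n
    by (rule Bochner_Integration.integrable_bound[OF indint[of "norm (a n) * q ^ n"] _ AE_I2])
      (simp, unfold real_norm_def, rule order_trans[OF le abs_ge_self])
  have AEs: "AE z in lborel. summable (\<lambda>n. norm (f n z))"
    by (intro AE_I2 summable_comparison_test'[OF summable_mult2[OF sm]]) (use le in auto)
  have "(\<integral>z. norm (f n z) \<partial>lborel) \<le> (\<integral>z. norm (a n) * q ^ n * indicator A z \<partial>lborel)" for n
    by (intro integral_mono integrable_norm int indint le)
  then have "norm (\<integral>z. norm (f n z) \<partial>lborel) \<le> norm (a n) * q ^ n * measure lborel A" for n
    by simp
  then have sI: "summable (\<lambda>n. \<integral>z. norm (f n z) \<partial>lborel)"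
    by (intro summable_comparison_test'[OF summable_mult2[OF sm]]) auto
  have F_eq: "(\<Sum>n. f n z) = indicator A z *\<^sub>R F (e z)" for z
    using sums[of "e z"] q(1)[of z] q(3) by (auto simp: f_def indicator_def sums_iff)
  show "integrable lborel (\<lambda>z. indicator A z *\<^sub>R F (e z))"
    using integrable_suminf[OF int AEs sI] by (simp add: F_eq)
  have zero: "integral\<^sup>L lborel (f n) = 0" if "n > 0" for n
  proof -
    define u where "u = cis (pi / n)"
    have un: "u ^ n = -1"
      unfolding u_def Complex.DeMoivre using that by simp
    \<comment> \<open>Both choices of \<open>\<sigma>\<close> thus satisfy
      \<open>\<sigma> u ^ n = -1\<close>. The conjugate one serves functions such as
      \<open>z -> x / z\<close>.\<close>
    have "cnj u ^ n = -1"
      unfolding complex_cnj_power[symmetric] un by simp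
    with un \<sigma> have u: "norm u = 1" "u ^ n = -1" "\<sigma> u ^ n = -1"
      by (auto simp: u_def)
    have indA: "u * z \<in> A \<longleftrightarrow> z \<in> A" for z
    proof -
      have eq: "inverse u * (u * z) = z" using u(1) by (auto simp: field_simps)
      have "z \<in> A" if "u * z \<in> A"
        using rot[OF _ that, of "inverse u"] u(1) unfolding eq by (simp add: norm_inverse)
      then show ?thesis using rot[of u z] u(1) by auto
    qed
    have "integral\<^sup>L lborel (f n) = integral\<^sup>L (distr lborel borel (\<lambda>z. u * z)) (f n)"
      by (simp add: lborel_rotation u)
    also have "\<dots> = (\<integral>z. f n (u * z) \<partial>lborel)"
      by (intro integral_distr) auto
    also have "\<dots> = (\<integral>z. - f n z \<partial>lborel)"
      by (intro Bochner_Integration.integral_cong)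
        (auto simp: f_def indicator_def indA e_rot u power_mult_distrib)
    finally show ?thesis by simp
  qed
  have "(\<lambda>n. integral\<^sup>L lborel (f n)) sums (\<integral>z. (\<Sum>n. f n z) \<partial>lborel)"
    by (rule sums_integral[OF int AEs sI])
  moreover have "(\<lambda>n. integral\<^sup>L lborel (f n)) sums integral\<^sup>L lborel (f 0)"
    using sums_finite[of "{0}" "\<lambda>n. integral\<^sup>L lborel (f n)"] zero by auto
  moreover have "F 0 = a 0"
    by (simp add: a_def)
  moreover have f0: "integral\<^sup>L lborel (f 0) = measure lborel A *\<^sub>R a 0"
  proof -
    have "integrable lborel (\<lambda>z. indicator A z :: real)"
      using indint[of 1] by simp
    moreover have "f 0 = (\<lambda>z. indicator A z *\<^sub>R a 0)"
      by (auto simp: f_def)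
    ultimately show ?thesis by simp
  qed
  ultimately show "(\<integral>z. indicator A z *\<^sub>R F (e z) \<partial>lborel) = measure lborel A *\<^sub>R F 0"
    using f0 by (simp add: F_eq sums_iff)
qed

section \<open>Area means of logarithms over discs and annuli\<close>

lemma nn_integral_incseq:
  assumes [measurable]: "f \<in> borel_measurable M" and "range A \<subseteq> sets M" "incseq A"
  shows "(\<lambda>n. \<integral>\<^sup>+x. f x * indicator (A n) x \<partial>M) \<longlonglongrightarrow> (\<integral>\<^sup>+x. f x * indicator (\<Union>n. A n) x \<partial>M)"
proof -
  have [measurable]: "A n \<in> sets M" for n using assms(2) by auto
  show ?thesis
    using Lim_emeasure_incseq[of A "density M f"] assms(2,3)
    by (simp add: emeasure_density)
qed

lemma borel_measurable_on_indicator: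
  fixes G :: "complex \<Rightarrow> complex" and h :: "complex \<Rightarrow> ennreal"
  assumes "continuous_on A G" and A[measurable]: "A \<in> sets borel" and [measurable]: "h \<in> borel_measurable borel"
  shows "(\<lambda>z. h (G z) * indicator A z) \<in> borel_measurable borel"
proof -
  have [measurable]: "(\<lambda>z. indicator A z *\<^sub>R G z) \<in> borel_measurable borel"
    using assms by (intro borel_measurable_continuous_on_indicator)
  have "(\<lambda>z. h (G z) * indicator A z) = (\<lambda>z. h (indicator A z *\<^sub>R G z) * indicator A z)"
    by (auto simp: indicator_def)
  then show ?thesis by simp
qed

text \<open>A nonvanishing \<open>G\<close> on a disc has a holomorphic logarithm, so
  \<open>ln |G|\<close> is harmonic and equals its area mean at the centre. It may be unbounded
  below near the boundary; the upper bound \<open>c\<close> makes the integrand nonnegative, so that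
  the mean value on smaller concentric discs passes to the limit by monotone convergence.\<close>

lemma nn_integral_ln_norm_mean:
  fixes G :: "complex \<Rightarrow> complex"
  assumes G: "G holomorphic_on ball a s" and s: "s > 0"
    and nz: "\<And>z. z \<in> ball a s \<Longrightarrow> G z \<noteq> 0" and bd: "\<And>z. z \<in> ball a s \<Longrightarrow> ln (norm (G z)) \<le> c"
  shows "(\<integral>\<^sup>+z. ennreal (c - ln (norm (G z))) * indicator (ball a s) z \<partial>lborel)
    = ennreal (pi * s\<^sup>2 * (c - ln (norm (G a))))"
proof -
  define H where "H x = G (a + x)" for x
  have H: "H holomorphic_on ball 0 s"
    unfolding H_def
    by (rule holomorphic_on_compose_gen[OF _ G, unfolded o_def]) (auto intro!: holomorphic_intros simp: dist_norm)
  have in_ball: "a + x \<in> ball a s \<longleftrightarrow> x \<in> ball 0 s" for x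
    by (simp add: dist_norm)
  obtain g where g: "g holomorphic_on ball 0 s" "\<And>x. x \<in> ball 0 s \<Longrightarrow> exp (g x) = H x"
    using holomorphic_logarithm_exists[of "ball 0 s" H 0] H nz s
    by (metis H_def centre_in_ball convex_ball in_ball open_ball)
  have ln_g: "ln (norm (G (a + x))) = Re (g x)" if "x \<in> ball 0 s" for x
    using g(2)[OF that] by (metis H_def ln_exp norm_exp_eq_Re)
  have le: "Re (g x) \<le> c" if "x \<in> ball 0 s" for x
    using bd[of "a + x"] ln_g[OF that] in_ball that by simp
  have meas: "(\<lambda>z. ennreal (c - ln (norm (G z))) * indicator (ball a s) z) \<in> borel_measurable borel"
    by (rule borel_measurable_on_indicator[OF holomorphic_on_imp_continuous_on[OF G], where h="\<lambda>w. ennreal (c - ln (norm w))"]) auto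
  have measg[measurable]: "(\<lambda>x. ennreal (c - Re (g x)) * indicator (ball 0 s) x) \<in> borel_measurable borel"
    by (rule borel_measurable_on_indicator[OF holomorphic_on_imp_continuous_on[OF g(1)], where h="\<lambda>w. ennreal (c - Re w)"]) auto
  have small: "(\<integral>\<^sup>+x. ennreal (c - Re (g x)) * indicator (ball 0 t) x \<partial>lborel) = ennreal (pi * t\<^sup>2 * (c - Re (g 0)))"
    if t: "0 \<le> t" "t < s" for t
  proof -
    have fin: "emeasure lborel (ball (0::complex) t) < \<infinity>"
      using t by (simp add: emeasure_lborel_ball_complex)
    have int: "integrable lborel (\<lambda>z. indicator (ball 0 t) z *\<^sub>R g z)"
      and eq: "(\<integral>z. indicator (ball 0 t) z *\<^sub>R g z \<partial>lborel) = measure lborel (ball (0::complex) t) *\<^sub>R g 0"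
      using integrable_rotation_mean[OF g(1) _ fin, of "\<lambda>z. z" "\<lambda>u. u" t]
        integral_rotation_mean[OF g(1) _ fin, of "\<lambda>z. z" "\<lambda>u. u" t] t
      by (auto simp: norm_mult dist_norm)
    have mt: "measure lborel (ball (0::complex) t) = pi * t\<^sup>2"
      using t by (simp add: measure_def emeasure_lborel_ball_complex)
    have indi: "integrable lborel (\<lambda>z::complex. c * indicator (ball 0 t) z)"
      using fin by (intro integrable_mult_right) (simp add: integrable_real_indicator)
    have intRe: "integrable lborel (\<lambda>z. Re (indicator (ball 0 t) z *\<^sub>R g z))"
      using int by (rule integrable_Re)
    have eqRe: "(\<integral>z. Re (indicator (ball 0 t) z *\<^sub>R g z) \<partial>lborel) = pi * t\<^sup>2 * Re (g 0)"
      unfolding integral_Re[OF int] eq mt by simp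
    have "integrable lborel (\<lambda>z. c * indicator (ball 0 t) z - Re (indicator (ball 0 t) z *\<^sub>R g z))"
      using indi intRe by (rule Bochner_Integration.integrable_diff)
    moreover have "(\<integral>z. c * indicator (ball 0 t) z - Re (indicator (ball 0 t) z *\<^sub>R g z) \<partial>lborel)
        = pi * t\<^sup>2 * (c - Re (g 0))"
      unfolding Bochner_Integration.integral_diff[OF indi intRe] eqRe using mt
      by (simp add: algebra_simps)
    moreover have "0 \<le> c * indicator (ball 0 t) z - Re (indicator (ball 0 t) z *\<^sub>R g z)" for z
      using le[of z] t by (auto simp: indicator_def)
    ultimately have "(\<integral>\<^sup>+z. ennreal (c * indicator (ball 0 t) z - Re (indicator (ball 0 t) z *\<^sub>R g z)) \<partial>lborel)
        = ennreal (pi * t\<^sup>2 * (c - Re (g 0)))"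
      by (subst nn_integral_eq_integral) auto
    then show ?thesis
      by (auto simp: indicator_def intro!: nn_integral_cong elim!: trans[rotated])
  qed
  \<comment> \<open>Radii below \<open>s\<close> that increase to \<open>s\<close>.\<close>
  define t where "t n = s * (real n / real (Suc n))" for n
  have t: "0 \<le> t n" "t n < s" for n
    using s by (auto simp: t_def field_simps)
  have "t \<longlonglongrightarrow> s" unfolding t_def by real_asymp
  have un: "(\<Union>n. ball 0 (t n)) = ball (0::complex) s"
  proof (intro equalityI subsetI)
    fix x :: complex assume "x \<in> ball 0 s"
    then have "\<forall>\<^sub>F n in sequentially. norm x < t n"
      using \<open>t \<longlonglongrightarrow> s\<close> by (intro order_tendstoD(1)) auto
    then show "x \<in> (\<Union>n. ball 0 (t n))"
      by (auto simp: eventually_sequentially)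
  qed (use t in \<open>auto intro: less_trans\<close>)
  have inc: "incseq (\<lambda>n. ball (0::complex) (t n))"
  proof (intro incseq_SucI subset_ball)
    show "t n \<le> t (Suc n)" for n
      using s unfolding t_def by (intro mult_left_mono) (auto simp: field_simps)
  qed
  have "(\<lambda>n. \<integral>\<^sup>+x. (ennreal (c - Re (g x)) * indicator (ball 0 s) x) * indicator (ball 0 (t n)) x \<partial>lborel)
      \<longlonglongrightarrow> (\<integral>\<^sup>+x. (ennreal (c - Re (g x)) * indicator (ball 0 s) x) * indicator (\<Union>n. ball 0 (t n)) x \<partial>lborel)"
    by (intro nn_integral_incseq inc) auto
  moreover have "(\<integral>\<^sup>+x. (ennreal (c - Re (g x)) * indicator (ball 0 s) x) * indicator (ball 0 (t n)) x \<partial>lborel)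
      = ennreal (pi * (t n)\<^sup>2 * (c - Re (g 0)))" for n
    unfolding small[OF t, symmetric] using t(2)[of n]
    by (intro nn_integral_cong) (auto simp: indicator_def)
  moreover have "(\<lambda>n. ennreal (pi * (t n)\<^sup>2 * (c - Re (g 0)))) \<longlonglongrightarrow> ennreal (pi * s\<^sup>2 * (c - Re (g 0)))"
    by (intro tendsto_intros \<open>t \<longlonglongrightarrow> s\<close>)
  ultimately have "(\<integral>\<^sup>+x. (ennreal (c - Re (g x)) * indicator (ball 0 s) x) * indicator (\<Union>n. ball 0 (t n)) x \<partial>lborel)
      = ennreal (pi * s\<^sup>2 * (c - Re (g 0)))"
    by (auto intro: LIMSEQ_unique)
  moreover have "(\<integral>\<^sup>+z. ennreal (c - ln (norm (G z))) * indicator (ball a s) z \<partial>lborel)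
      = (\<integral>\<^sup>+x. (ennreal (c - Re (g x)) * indicator (ball 0 s) x) * indicator (\<Union>n. ball 0 (t n)) x \<partial>lborel)"
    unfolding un
    by (subst nn_integral_lborel_affine[OF meas, of 1 a])
       (auto intro!: nn_integral_cong simp: indicator_def ln_g dist_norm)
  ultimately show ?thesis
    using ln_g[of 0] s by simp
qed

lemma ln_xx_tendsto_0: "((\<lambda>x::real. x\<^sup>2 * ln x) \<longlongrightarrow> 0) (at_right 0)"
  by real_asymp

lemma integral_ln_norm_annulus:
  assumes "0 < \<tau>" "\<tau> < s" and c: "ln s \<le> c"
  shows "(\<integral>\<^sup>+z. ennreal (c - ln (norm (z::complex))) * indicator {z. \<tau> \<le> norm z \<and> norm z < s} z \<partial>lborel)
    = ennreal (pi * ((s\<^sup>2 - \<tau>\<^sup>2) * c - (s\<^sup>2 * ln s - \<tau>\<^sup>2 * ln \<tau>) + (s\<^sup>2 - \<tau>\<^sup>2) / 2))"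
proof -
  have s: "0 < s" using assms by simp
  define g where "g u = ennreal (c - ln u / 2) * indicator {\<tau>\<^sup>2..<s\<^sup>2} u" for u
  have [measurable]: "g \<in> borel_measurable borel" unfolding g_def by measurable
  have "ennreal (c - ln (norm z)) * indicator {z. \<tau> \<le> norm z \<and> norm z < s} z = g ((norm z)\<^sup>2)" for z :: complex
  proof -
    have "\<tau> \<le> norm z \<longleftrightarrow> \<tau>\<^sup>2 \<le> (norm z)\<^sup>2" "norm z < s \<longleftrightarrow> (norm z)\<^sup>2 < s\<^sup>2"
      using assms by (simp_all add: power_mono_iff flip: not_le)
    then show ?thesis using assms
      by (auto simp: g_def indicator_def ln_realpow)
  qed
  then have "(\<integral>\<^sup>+z. ennreal (c - ln (norm (z::complex))) * indicator {z. \<tau> \<le> norm z \<and> norm z < s} z \<partial>lborel)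
      = ennreal pi * (\<integral>\<^sup>+u. g u * indicator {0..} u \<partial>lborel)"
    by (simp add: nn_integral_radial)
  also have "(\<integral>\<^sup>+u. g u * indicator {0..} u \<partial>lborel)
      = (\<integral>\<^sup>+u. ennreal (c - ln u / 2) * indicator {\<tau>\<^sup>2..s\<^sup>2} u \<partial>lborel)"
  proof (rule nn_integral_cong_AE)
    have "AE u in lborel. u \<noteq> s\<^sup>2" by (rule AE_lborel_singleton)
    then show "AE u in lborel. g u * indicator {0..} u = ennreal (c - ln u / 2) * indicator {\<tau>\<^sup>2..s\<^sup>2} u"
      by eventually_elim (auto simp: g_def indicator_def order_trans[OF zero_le_power2])
  qed
  also have "\<dots> = ennreal ((c * s\<^sup>2 - (s\<^sup>2 * ln (s\<^sup>2) - s\<^sup>2) / 2) - (c * \<tau>\<^sup>2 - (\<tau>\<^sup>2 * ln (\<tau>\<^sup>2) - \<tau>\<^sup>2) / 2))"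
  proof (rule nn_integral_FTC_Icc[where F="\<lambda>u. c * u - (u * ln u - u) / 2"])
    show "\<tau>\<^sup>2 \<le> s\<^sup>2" using assms by (intro power_mono) auto
    fix u assume u: "u \<in> {\<tau>\<^sup>2..s\<^sup>2}"
    then have "0 < u" using assms(1) by (auto intro: less_le_trans[of 0 "\<tau>\<^sup>2"])
    then show "((\<lambda>u. c * u - (u * ln u - u) / 2) has_real_derivative c - ln u / 2) (at u)"
      by (auto intro!: derivative_eq_intros simp: field_simps)
    have "ln u \<le> ln (s\<^sup>2)" using u \<open>0 < u\<close> s by (subst ln_le_cancel_iff) auto
    then show "0 \<le> c - ln u / 2"
      using c s by (simp add: ln_realpow)
  qed auto
  also have "ennreal pi * \<dots> = ennreal (pi * ((s\<^sup>2 - \<tau>\<^sup>2) * c - (s\<^sup>2 * ln s - \<tau>\<^sup>2 * ln \<tau>) + (s\<^sup>2 - \<tau>\<^sup>2) / 2))"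
  proof -
    have "pi * ((c * s\<^sup>2 - (s\<^sup>2 * ln (s\<^sup>2) - s\<^sup>2) / 2) - (c * \<tau>\<^sup>2 - (\<tau>\<^sup>2 * ln (\<tau>\<^sup>2) - \<tau>\<^sup>2) / 2))
        = pi * ((s\<^sup>2 - \<tau>\<^sup>2) * c - (s\<^sup>2 * ln s - \<tau>\<^sup>2 * ln \<tau>) + (s\<^sup>2 - \<tau>\<^sup>2) / 2)"
      using assms(1) s by (simp add: ln_realpow field_simps)
    then show ?thesis by (subst ennreal_mult'[symmetric]) auto
  qed
  finally show ?thesis .
qed


lemma null_sets_sphere: "sphere (a::complex) t \<in> null_sets lborel"
  using negligible_sphere[of a t]
  by (auto simp: null_sets_completion_iff negligible_iff_null_sets negligible_convex_frontier)

text \<open>The disc is cut along the circle through \<open>x\<close>. Inside,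
  \<open>ln |x - z|\<close> is harmonic in \<open>z\<close> and has mean \<open>ln |x|\<close>.
  Outside, it is \<open>ln |z| + Re (Ln (1 - x / z))\<close>, and the second term integrates to 0
  over every annulus by rotation. Annuli are kept away from the circle, where that logarithm is
  singular, and then enlarged up to it.\<close>

lemma nn_integral_ln_dist_ball:
  fixes x :: complex
  assumes x: "norm x < s" and c: "0 \<le> c" "ln (2 * s) \<le> c"
  shows "(\<integral>\<^sup>+z. ennreal (c - ln (norm (x - z))) * indicator (ball 0 s) z \<partial>lborel)
    = ennreal (pi * s\<^sup>2 * (c - ln s + (1 - (norm x / s)\<^sup>2) / 2))"
proof -
  define t where "t = norm x"
  have t: "0 \<le> t" "t < s" and s: "0 < s"
    using x by (auto simp: t_def intro: le_less_trans[OF norm_ge_zero])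
  have ln_le: "ln u \<le> c" if "u < 2 * s" "0 \<le> u" for u
  proof (cases "u = 0")
    case False
    then have "ln u \<le> ln (2 * s)" using that by simp
    then show ?thesis using c by simp
  qed (use c in simp)
  define f where "f z = ennreal (c - ln (norm (x - z)))" for z
  have [measurable]: "f \<in> borel_measurable borel" unfolding f_def by measurable
  have inner: "(\<integral>\<^sup>+z. f z * indicator (ball 0 t) z \<partial>lborel) = ennreal (pi * t\<^sup>2 * (c - ln t))"
  proof (cases "t = 0")
    case False
    have le: "ln (norm (x - z)) \<le> c" if "z \<in> ball 0 t" for z
      using that t norm_triangle_ineq4[of x z] by (intro ln_le) (auto simp: t_def)
    have hol: "(\<lambda>z. x - z) holomorphic_on ball 0 t"
      by (intro holomorphic_intros)
    have nz: "x - z \<noteq> 0" if "z \<in> ball 0 t" for z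
      using that by (auto simp: t_def)
    show ?thesis
      unfolding f_def using nn_integral_ln_norm_mean[OF hol _ nz le] False t
      by (simp add: t_def)
  qed simp
  define E where "E \<tau> = pi * ((s\<^sup>2 - \<tau>\<^sup>2) * c - (s\<^sup>2 * ln s - \<tau>\<^sup>2 * ln \<tau>) + (s\<^sup>2 - \<tau>\<^sup>2) / 2)" for \<tau>
  have annulus: "(\<integral>\<^sup>+z. f z * indicator {z. \<tau> \<le> norm z \<and> norm z < s} z \<partial>lborel) = ennreal (E \<tau>)" and E_nonneg: "0 \<le> E \<tau>"
    if \<tau>: "t < \<tau>" "\<tau> < s" for \<tau>
  proof -
    define A where "A = {z :: complex. \<tau> \<le> norm z \<and> norm z < s}"
    have A[measurable]: "A \<in> sets borel" unfolding A_def by measurable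
    have \<tau>0: "0 < \<tau>" using \<tau> t by simp
    have finA: "emeasure lborel A < \<infinity>"
    proof -
      have "A \<subseteq> ball 0 s" by (auto simp: A_def)
      then have "emeasure lborel A \<le> emeasure lborel (ball (0::complex) s)"
        by (intro emeasure_mono) auto
      then show ?thesis using s by (simp add: emeasure_lborel_ball_complex le_less_trans)
    qed
    have holo: "(\<lambda>w. Ln (1 - w)) holomorphic_on ball 0 1"
    proof (intro holomorphic_intros)
      fix w :: complex assume "w \<in> ball 0 1"
      then have "0 < Re (1 - w)" using complex_Re_le_cmod[of w] by simp
      then show "1 - w \<notin> \<real>\<^sub>\<le>\<^sub>0" by (auto simp: complex_nonpos_Reals_iff)
    qed
    have q: "t / \<tau> < 1" "0 \<le> t / \<tau>" using \<tau> \<tau>0 t by auto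
    have nq: "norm (x / z) \<le> t / \<tau>" if "z \<in> A" for z
      using that \<tau>0 by (auto simp: A_def norm_divide t_def intro!: frac_le)
    have rot: "u * z \<in> A" if "norm u = 1" "z \<in> A" for u z
      using that by (auto simp: A_def norm_mult)
    \<comment> \<open>The rotation mean is needed for a function that turns the opposite way; this
      is the conjugate choice of \<open>\<sigma>\<close>.\<close>
    have e_rot: "x / (u * z) = cnj u * (x / z)" if "norm u = 1" for u z
    proof -
      have "u * cnj u = 1" using complex_norm_square[of u] that by simp
      then have "cnj u = 1 / u" by (metis mult_zero_left nonzero_mult_div_cancel_left zero_neq_one)
      then show ?thesis by simp
    qed
    have em: "(\<lambda>z. x / z) \<in> borel_measurable borel" by measurable
    have int: "integrable lborel (\<lambda>z. indicator A z *\<^sub>R Ln (1 - x / z))"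
      and mean: "(\<integral>z. indicator A z *\<^sub>R Ln (1 - x / z) \<partial>lborel) = 0"
      using integrable_rotation_mean[OF holo A finA rot em e_rot _ nq q(2,1)]
        integral_rotation_mean[OF holo A finA rot em e_rot _ nq q(2,1)] by auto
    have intRe: "integrable lborel (\<lambda>z. Re (indicator A z *\<^sub>R Ln (1 - x / z)))"
      using int by (rule integrable_Re)
    have meanRe: "(\<integral>z. Re (indicator A z *\<^sub>R Ln (1 - x / z)) \<partial>lborel) = 0"
      unfolding integral_Re[OF int] mean by simp
    define h where "h z = indicator A z * (c - ln (norm z))" for z :: complex
    have hm[measurable]: "h \<in> borel_measurable borel" unfolding h_def by measurable
    have h0: "0 \<le> h z" for z
      using ln_le[of "norm z"] s by (auto simp: h_def A_def indicator_def)
    have lns: "ln s \<le> c" using ln_le[of s] s by simp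
    have nnh: "(\<integral>\<^sup>+z. ennreal (h z) \<partial>lborel) = ennreal (E \<tau>)"
      using integral_ln_norm_annulus[OF \<tau>0 \<tau>(2) lns] unfolding E_def A_def[symmetric]
      by (auto simp: h_def indicator_def elim!: trans[rotated] intro!: nn_integral_cong)
    have lnn: "0 \<le> E \<tau>"
    proof -
      have "\<tau>\<^sup>2 \<le> s\<^sup>2" using \<tau>0 \<tau> by (intro power_mono) auto
      moreover have "s\<^sup>2 * ln s - \<tau>\<^sup>2 * ln \<tau> \<le> (s\<^sup>2 - \<tau>\<^sup>2) * c + (s\<^sup>2 - \<tau>\<^sup>2) / 2"
      proof -
        have "ln (s\<^sup>2 / \<tau>\<^sup>2) \<le> s\<^sup>2 / \<tau>\<^sup>2 - 1"
          using \<tau>0 s by (intro ln_le_minus_one) auto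
        then have "2 * (ln s - ln \<tau>) \<le> s\<^sup>2 / \<tau>\<^sup>2 - 1"
          using \<tau>0 s by (simp add: ln_div ln_realpow)
        then have "\<tau>\<^sup>2 * (ln s - ln \<tau>) \<le> (s\<^sup>2 - \<tau>\<^sup>2) / 2"
          using \<tau>0 by (simp add: field_simps)
        moreover have "(s\<^sup>2 - \<tau>\<^sup>2) * ln s \<le> (s\<^sup>2 - \<tau>\<^sup>2) * c"
          using lns \<open>\<tau>\<^sup>2 \<le> s\<^sup>2\<close> by (intro mult_left_mono) auto
        ultimately show ?thesis by (simp add: field_simps)
      qed
      ultimately show ?thesis unfolding E_def by (intro mult_nonneg_nonneg) auto
    qed
    have inth: "integrable lborel h"
      using nnh h0 by (intro integrableI_nonneg) auto
    have Lh: "integral\<^sup>L lborel h = E \<tau>"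
      using h0 lnn nnh by (subst integral_eq_nn_integral) auto
    have ln_eq: "ln (norm (x - z)) = ln (norm z) + Re (Ln (1 - x / z))" if "z \<in> A" for z
    proof -
      have z: "z \<noteq> 0" using that \<tau>0 by (auto simp: A_def)
      have "norm (x / z) < 1" using nq[OF that] q(1) by simp
      then have nz: "1 - x / z \<noteq> 0" by auto
      have "norm (x - z) = norm z * norm (1 - x / z)"
        using z by (simp add: norm_mult[symmetric] algebra_simps norm_minus_commute)
      then show ?thesis using z nz by (simp add: ln_mult Re_Ln)
    qed
    have "integrable lborel (\<lambda>z. h z - Re (indicator A z *\<^sub>R Ln (1 - x / z)))"
      using inth intRe by (rule Bochner_Integration.integrable_diff)
    moreover have "(\<integral>z. h z - Re (indicator A z *\<^sub>R Ln (1 - x / z)) \<partial>lborel) = E \<tau>"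
      unfolding Bochner_Integration.integral_diff[OF inth intRe] meanRe Lh by simp
    moreover have "0 \<le> h z - Re (indicator A z *\<^sub>R Ln (1 - x / z))" for z
    proof (cases "z \<in> A")
      case True
      have "ln (norm (x - z)) \<le> c"
        using True x norm_triangle_ineq4[of x z] by (intro ln_le) (auto simp: A_def)
      then show ?thesis using True ln_eq[OF True] by (simp add: h_def)
    qed (simp add: h_def)
    ultimately have "(\<integral>\<^sup>+z. ennreal (h z - Re (indicator A z *\<^sub>R Ln (1 - x / z))) \<partial>lborel) = ennreal (E \<tau>)"
      by (subst nn_integral_eq_integral) auto
    moreover have "ennreal (h z - Re (indicator A z *\<^sub>R Ln (1 - x / z))) = f z * indicator A z" for z
      using ln_eq[of z] by (cases "z \<in> A") (auto simp: h_def f_def diff_diff_eq)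
    ultimately show "(\<integral>\<^sup>+z. f z * indicator {z. \<tau> \<le> norm z \<and> norm z < s} z \<partial>lborel) = ennreal (E \<tau>)"
      by (simp add: A_def)
    show "0 \<le> E \<tau>" by fact
  qed
  \<comment> \<open>Radii decreasing to \<open>|x|\<close>. The offset 2 keeps even the first of
    them strictly below \<open>s\<close>.\<close>
  define \<tau> where "\<tau> n = t + (s - t) / real (n + 2)" for n
  have \<tau>: "t < \<tau> n" "\<tau> n < s" for n
  proof -
    have "(s - t) / real (n + 2) < (s - t) / 1"
      using t by (intro divide_strict_left_mono) auto
    then show "\<tau> n < s" by (simp add: \<tau>_def)
  qed (use t in \<open>simp add: \<tau>_def\<close>)
  have \<tau>_lim: "\<tau> \<longlonglongrightarrow> t" unfolding \<tau>_def by real_asymp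
  have \<tau>_ln_lim: "(\<lambda>n. (\<tau> n)\<^sup>2 * ln (\<tau> n)) \<longlonglongrightarrow> t\<^sup>2 * ln t"
  proof (cases "t = 0")
    case True
    have "filterlim \<tau> (at_right 0) sequentially"
      using \<tau>_lim \<tau>(1) True by (intro tendsto_imp_filterlim_at_right) auto
    moreover have eq: "t\<^sup>2 * ln t = 0" using True by simp
    ultimately show ?thesis unfolding eq by (intro filterlim_compose[OF ln_xx_tendsto_0])
  qed (auto intro!: tendsto_intros \<tau>_lim)
  have E_lim: "(\<lambda>n. E (\<tau> n)) \<longlonglongrightarrow> E t"
    unfolding E_def
    by (intro tendsto_add tendsto_diff tendsto_mult[OF tendsto_const] tendsto_mult[OF _ tendsto_const]
        tendsto_divide[OF _ tendsto_const] tendsto_power tendsto_const \<tau>_lim \<tau>_ln_lim) auto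
  have Et: "0 \<le> E t"
    by (rule LIMSEQ_le_const[OF E_lim]) (use E_nonneg \<tau> in auto)
  have "(\<lambda>n. \<integral>\<^sup>+z. f z * indicator {z. \<tau> n \<le> norm z \<and> norm z < s} z \<partial>lborel)
      \<longlonglongrightarrow> (\<integral>\<^sup>+z. f z * indicator (\<Union>n. {z. \<tau> n \<le> norm z \<and> norm z < s}) z \<partial>lborel)"
  proof (intro nn_integral_incseq incseq_SucI)
    show "{z. \<tau> n \<le> norm z \<and> norm z < s} \<subseteq> {z::complex. \<tau> (Suc n) \<le> norm z \<and> norm z < s}" for n
    proof -
      have "\<tau> (Suc n) \<le> \<tau> n"
        using t by (auto simp: \<tau>_def intro!: divide_left_mono)
      then show ?thesis by auto
    qed
  qed auto
  also have "(\<Union>n. {z. \<tau> n \<le> norm z \<and> norm z < s}) = {z::complex. t < norm z \<and> norm z < s}"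
  proof (intro equalityI subsetI)
    fix z :: complex assume "z \<in> {z. t < norm z \<and> norm z < s}"
    then have "\<forall>\<^sub>F n in sequentially. \<tau> n < norm z"
      using \<tau>_lim by (intro order_tendstoD(2)) auto
    with \<open>z \<in> _\<close> show "z \<in> (\<Union>n. {z. \<tau> n \<le> norm z \<and> norm z < s})"
      by (auto simp: eventually_sequentially intro: less_imp_le)
  qed (use \<tau>(1) in \<open>auto intro: less_le_trans\<close>)
  finally have outer: "(\<integral>\<^sup>+z. f z * indicator {z. t < norm z \<and> norm z < s} z \<partial>lborel) = ennreal (E t)"
    using tendsto_ennrealI[OF E_lim] by (auto simp: annulus[OF \<tau>] intro: LIMSEQ_unique)
  have "(\<integral>\<^sup>+z. f z * indicator (ball 0 s) z \<partial>lborel) =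
      (\<integral>\<^sup>+z. f z * indicator (ball 0 t) z + f z * indicator {z. t < norm z \<and> norm z < s} z \<partial>lborel)"
  proof (rule nn_integral_cong_AE)
    have "AE z in lborel. z \<notin> sphere (0::complex) t"
      by (rule AE_not_in[OF null_sets_sphere])
    then show "AE z in lborel. f z * indicator (ball 0 s) z = f z * indicator (ball 0 t) z + f z * indicator {z. t < norm z \<and> norm z < s} z"
      by eventually_elim (use t in \<open>auto simp: indicator_def\<close>)
  qed
  also have "\<dots> = ennreal (pi * t\<^sup>2 * (c - ln t)) + ennreal (E t)"
  proof -
    have "{z::complex. t < norm z \<and> norm z < s} \<in> sets borel" by measurable
    then show ?thesis
      unfolding inner[symmetric] outer[symmetric]
      by (intro nn_integral_add) (auto intro!: borel_measurable_times_ennreal borel_measurable_indicator)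
  qed
  also have "\<dots> = ennreal (pi * t\<^sup>2 * (c - ln t) + E t)"
    using ln_le[of t] t Et by (intro ennreal_plus[symmetric]) auto
  also have "pi * t\<^sup>2 * (c - ln t) + E t = pi * s\<^sup>2 * (c - ln s + (1 - (norm x / s)\<^sup>2) / 2)"
    using s unfolding E_def t_def[symmetric] by (simp add: field_simps)
  finally show ?thesis unfolding f_def .
qed

section \<open>The truncated logarithmic kernel on conformal discs\<close>

lemma sets_borel_ball[measurable]: "ball (a::complex) s \<in> sets borel" "cball (a::complex) s \<in> sets borel"
  by auto

text \<open>The kernel \<open>ln (2 R / |z - w|)\<close>. For two points of the disc of radius
  \<open>R\<close> it is nonnegative, so the truncation by \<open>ennreal\<close> changes nothing
  there and energies of measures on that disc are never indeterminate.\<close>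

definition log_kernel :: "real \<Rightarrow> complex \<Rightarrow> complex \<Rightarrow> ennreal" where
  "log_kernel R z w = (if z = w then \<infinity> else ennreal (ln (2 * R) - ln (norm (z - w))))"

text \<open>For \<open>0 < |x| < 1\<close> this is the value of
  \<open>ln (1 / |x - \<zeta>|)\<close> at the centre \<open>\<zeta> = 0\<close> minus its mean over
  the unit disc, that mean being \<open>(1 - |x|^2) / 2\<close>. For \<open>|x| \<ge> 1\<close> the
  function is harmonic in the disc and the defect vanishes.\<close>

definition disc_defect :: "complex \<Rightarrow> ennreal" where
  "disc_defect x = (if x = 0 then \<infinity> else if norm x < 1 then ennreal (- ln (norm x) - (1 - (norm x)\<^sup>2) / 2) else 0)"

lemma borel_measurable_log_kernel[measurable]:
  "(\<lambda>(z, w). log_kernel R z w) \<in> borel_measurable (borel \<Otimes>\<^sub>M borel)"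
  unfolding log_kernel_def split_beta by measurable

lemma borel_measurable_log_kernel'[measurable (raw)]:
  assumes [measurable]: "f \<in> borel_measurable M" "g \<in> borel_measurable M"
  shows "(\<lambda>x. log_kernel R (f x) (g x)) \<in> borel_measurable M"
  unfolding log_kernel_def by measurable

lemma log_kernel_commute: "log_kernel R z w = log_kernel R w z"
  by (simp add: log_kernel_def norm_minus_commute)

lemma borel_measurable_disc_defect[measurable]: "disc_defect \<in> borel_measurable borel"
  unfolding disc_defect_def by measurable

lemma disc_defect_nonneg_aux:
  assumes "0 < t" "t \<le> (1::real)"
  shows "0 \<le> - ln t - (1 - t\<^sup>2) / 2"
proof -
  have "ln (t\<^sup>2) \<le> t\<^sup>2 - 1" using assms by (intro ln_le_minus_one) auto
  then show ?thesis using assms by (simp add: ln_realpow)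
qed

text \<open>Adding \<open>j\<close>, which on the unit disc is the mean of
  \<open>ln (2 / |x - \<zeta>|)\<close>, turns the defect into \<open>ln 2 - ln |x|\<close>, whose
  integral is the potential of the disc at 0. The two known integrals are
  \<open>pi (ln 2 + 1/2)\<close> and \<open>pi (ln 2 + 1/4)\<close>.\<close>

lemma nn_integral_disc_defect: "(\<integral>\<^sup>+x. disc_defect x \<partial>lborel) = ennreal (pi / 4)"
proof -
  define j where "j x = ennreal (ln 2 + (1 - (norm x)\<^sup>2) / 2) * indicator (ball 0 1) x" for x :: complex
  have [measurable]: "j \<in> borel_measurable borel" unfolding j_def
    by (intro borel_measurable_times_ennreal borel_measurable_indicator) auto
  have j: "(\<integral>\<^sup>+x. j x \<partial>lborel) = ennreal (pi * (ln 2 + 1 / 4))"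
  proof -
    have "j x = ennreal (ln 2 + (1 - (norm x)\<^sup>2) / 2) * indicator {..<1} ((norm x)\<^sup>2)" for x
      by (auto simp: j_def indicator_def power_less_one_iff)
    then have "(\<integral>\<^sup>+x. j x \<partial>lborel) = ennreal pi * (\<integral>\<^sup>+u. ennreal (ln 2 + (1 - u) / 2) * indicator {..<1} u * indicator {0..} u \<partial>lborel)"
      using nn_integral_radial[of "\<lambda>u. ennreal (ln 2 + (1 - u) / 2) * indicator {..<1} u"] by simp
    also have "(\<integral>\<^sup>+u. ennreal (ln 2 + (1 - u) / 2) * indicator {..<1} u * indicator {0..} u \<partial>lborel)
        = (\<integral>\<^sup>+u. ennreal (ln 2 + (1 - u) / 2) * indicator {0..1} (u::real) \<partial>lborel)"
    proof (rule nn_integral_cong_AE)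
      have "AE u in lborel. u \<noteq> (1::real)" by (rule AE_lborel_singleton)
      then show "AE u in lborel. ennreal (ln 2 + (1 - u) / 2) * indicator {..<1} u * indicator {0..} u
          = ennreal (ln 2 + (1 - u) / 2) * indicator {0..1} (u::real)"
        by eventually_elim (auto simp: indicator_def)
    qed
    also have "\<dots> = ennreal ((ln 2 * 1 + (1 - 1\<^sup>2 / 2) / 2) - (ln 2 * 0 + (0 - 0\<^sup>2 / 2) / 2))"
    proof (rule nn_integral_FTC_Icc[where F="\<lambda>u. ln 2 * u + (u - u\<^sup>2 / 2) / 2"])
      fix u :: real assume "u \<in> {0..1}"
      then show "0 \<le> ln 2 + (1 - u) / 2" by (intro add_nonneg_nonneg) auto
      show "((\<lambda>u. ln 2 * u + (u - u\<^sup>2 / 2) / 2) has_real_derivative ln 2 + (1 - u) / 2) (at u)"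
        by (auto intro!: derivative_eq_intros simp: field_simps)
    qed auto
    also have "ennreal pi * \<dots> = ennreal (pi * (ln 2 + 1 / 4))"
    proof -
      have "pi * ((ln 2 * 1 + (1 - 1\<^sup>2 / 2) / 2) - (ln 2 * 0 + (0 - 0\<^sup>2 / 2) / 2)) = pi * (ln 2 + 1 / (4::real))"
        by simp
      then show ?thesis by (subst ennreal_mult'[symmetric]) auto
    qed
    finally show ?thesis .
  qed
  have "(\<integral>\<^sup>+x. disc_defect x \<partial>lborel) + (\<integral>\<^sup>+x. j x \<partial>lborel) = (\<integral>\<^sup>+x. disc_defect x + j x \<partial>lborel)"
    by (simp add: nn_integral_add)
  also have "\<dots> = (\<integral>\<^sup>+x. ennreal (ln 2 - ln (norm (0 - x :: complex))) * indicator (ball 0 1) x \<partial>lborel)"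
  proof (rule nn_integral_cong_AE)
    have "AE x in lborel. x \<noteq> (0::complex)" by (rule AE_lborel_singleton)
    then show "AE x in lborel. disc_defect x + j x = ennreal (ln 2 - ln (norm (0 - x))) * indicator (ball 0 1) x"
    proof eventually_elim
      case (elim x)
      have "0 \<le> ln 2 + (1 - (norm x)\<^sup>2) / 2" if "norm x < 1"
        using that power_le_one[of "norm x" 2] by (intro add_nonneg_nonneg) auto
      then show ?case
        using elim disc_defect_nonneg_aux[of "norm x"]
        by (auto simp: disc_defect_def j_def indicator_def simp flip: ennreal_plus)
    qed
  qed
  also have "\<dots> = ennreal (pi * (ln 2 + 1 / 2))"
    using nn_integral_ln_dist_ball[of 0 1 "ln 2"] by simp
  also have "\<dots> = ennreal (pi / 4) + ennreal (pi * (ln 2 + 1 / 4))"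
    by (subst ennreal_plus[symmetric]) (auto simp: field_simps)
  finally have "(\<integral>\<^sup>+x. j x \<partial>lborel) + (\<integral>\<^sup>+x. disc_defect x \<partial>lborel) = ennreal (pi * (ln 2 + 1 / 4)) + ennreal (pi / 4)"
    by (simp add: add_ac)
  then show ?thesis
    unfolding j by (simp add: ennreal_add_left_cancel)
qed

text \<open>For \<open>z\<close> outside the image, \<open>z - \<psi>\<close> has no zero, so the
  mean value property of \<open>ln |z - \<psi>|\<close> is exact.\<close>

lemma nn_integral_log_kernel_outside:
  fixes \<psi> :: "complex \<Rightarrow> complex"
  assumes \<psi>: "\<psi> holomorphic_on ball a s" and s: "s > 0"
    and sub: "\<psi> ` ball a s \<subseteq> cball 0 R" and z: "z \<in> cball 0 R" "z \<notin> \<psi> ` ball a s"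
  shows "(\<integral>\<^sup>+\<zeta>. log_kernel R z (\<psi> \<zeta>) * indicator (ball a s) \<zeta> \<partial>lborel) = ennreal (pi * s\<^sup>2) * log_kernel R z (\<psi> a)"
proof -
  have hol: "(\<lambda>\<zeta>. z - \<psi> \<zeta>) holomorphic_on ball a s"
    by (intro holomorphic_intros \<psi>)
  have nz: "z - \<psi> \<zeta> \<noteq> 0" if "\<zeta> \<in> ball a s" for \<zeta>
    using that z by auto
  have le: "ln (norm (z - \<psi> \<zeta>)) \<le> ln (2 * R)" if "\<zeta> \<in> ball a s" for \<zeta>
  proof -
    have "norm (\<psi> \<zeta>) \<le> R" "norm z \<le> R" using subsetD[OF sub imageI[OF that]] z by auto
    then have "norm (z - \<psi> \<zeta>) \<le> 2 * R"
      using norm_triangle_ineq4[of z "\<psi> \<zeta>"] by linarith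
    then show ?thesis using nz[OF that] by (intro ln_mono) auto
  qed
  have a: "a \<in> ball a s" using s by simp
  have "(\<integral>\<^sup>+\<zeta>. log_kernel R z (\<psi> \<zeta>) * indicator (ball a s) \<zeta> \<partial>lborel)
      = (\<integral>\<^sup>+\<zeta>. ennreal (ln (2 * R) - ln (norm (z - \<psi> \<zeta>))) * indicator (ball a s) \<zeta> \<partial>lborel)"
    using z(2) by (intro nn_integral_cong) (auto simp: log_kernel_def indicator_def)
  also have "\<dots> = ennreal (pi * s\<^sup>2 * (ln (2 * R) - ln (norm (z - \<psi> a))))"
    by (rule nn_integral_ln_norm_mean[OF hol s nz le])
  also have "\<dots> = ennreal (pi * s\<^sup>2) * log_kernel R z (\<psi> a)"
    using nz[OF a] le[OF a] by (simp add: log_kernel_def ennreal_mult)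
  finally show ?thesis .
qed

text \<open>Inside, \<open>\<psi> \<omega> - \<psi> \<zeta> = (\<omega> - \<zeta>) * q \<zeta>\<close> with \<open>q\<close> holomorphic and nonvanishing, so only the
  explicit potential of a flat disc differs from the mean value.\<close>

lemma
  fixes \<psi> :: "complex \<Rightarrow> complex"
  assumes \<psi>: "\<psi> holomorphic_on ball a s" and s: "s > 0" and inj: "inj_on \<psi> (ball a s)"
    and sub: "\<psi> ` ball a s \<subseteq> cball 0 R" and \<omega>: "\<omega> \<in> ball a s"
  shows nn_integral_log_kernel_inside: "(\<integral>\<^sup>+\<zeta>. log_kernel R (\<psi> \<omega>) (\<psi> \<zeta>) * indicator (ball a s) \<zeta> \<partial>lborel)
      + ennreal (pi * s\<^sup>2) * disc_defect ((\<omega> - a) /\<^sub>R s) = ennreal (pi * s\<^sup>2) * log_kernel R (\<psi> \<omega>) (\<psi> a)" (is ?eq)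
    and nn_integral_log_kernel_inside_finite:
      "(\<integral>\<^sup>+\<zeta>. log_kernel R (\<psi> \<omega>) (\<psi> \<zeta>) * indicator (ball a s) \<zeta> \<partial>lborel) < \<infinity>" (is ?fin)
proof -
  define q where "q \<zeta> = (if \<zeta> = \<omega> then deriv \<psi> \<omega> else (\<psi> \<zeta> - \<psi> \<omega>) / (\<zeta> - \<omega>))" for \<zeta>
  have q: "q holomorphic_on ball a s"
    unfolding q_def by (rule pole_lemma_open[OF \<psi> open_ball])
  have nz: "q \<zeta> \<noteq> 0" if "\<zeta> \<in> ball a s" for \<zeta>
    using that \<omega> inj holomorphic_injective_imp_regular[OF \<psi> open_ball inj \<omega>]
    by (auto simp: q_def inj_on_def)
  have fac: "norm (\<psi> \<omega> - \<psi> \<zeta>) = norm (\<omega> - \<zeta>) * norm (q \<zeta>)" for \<zeta>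
    by (simp add: q_def norm_divide norm_minus_commute)
  have dist_le: "norm (\<psi> \<omega> - \<psi> \<zeta>) \<le> 2 * R" if "\<zeta> \<in> ball a s" for \<zeta>
  proof -
    have "norm (\<psi> \<zeta>) \<le> R" "norm (\<psi> \<omega>) \<le> R"
      using subsetD[OF sub imageI[OF that]] subsetD[OF sub imageI[OF \<omega>]] by auto
    then show ?thesis using norm_triangle_ineq4[of "\<psi> \<omega>" "\<psi> \<zeta>"] by linarith
  qed
  \<comment> \<open>\<open>ln |q|\<close> needs an upper bound on the whole disc although
    \<open>\<psi>\<close> need not extend to its closure. Near \<open>\<omega>\<close> compactness
    gives one; farther away the numerator of \<open>q\<close> is at most \<open>2 R\<close> and the
    denominator at least \<open>\<delta>\<close>.\<close>
  obtain \<delta> where \<delta>: "\<delta> > 0" "cball \<omega> \<delta> \<subseteq> ball a s"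
    using \<omega> open_contains_cball[of "ball a s"] by (meson open_ball)
  have "compact (q ` cball \<omega> \<delta>)"
    using holomorphic_on_imp_continuous_on[OF q] \<delta>(2)
    by (intro compact_continuous_image) (auto intro: continuous_on_subset)
  then obtain B where B: "\<And>\<zeta>. \<zeta> \<in> cball \<omega> \<delta> \<Longrightarrow> norm (q \<zeta>) \<le> B"
    using compact_imp_bounded bounded_iff by (metis image_eqI)
  have q_le: "norm (q \<zeta>) \<le> max B (2 * R / \<delta>)" if "\<zeta> \<in> ball a s" for \<zeta>
  proof (cases "\<zeta> \<in> cball \<omega> \<delta>")
    case False
    then have far: "\<delta> < norm (\<omega> - \<zeta>)" by (simp add: dist_norm)
    have "\<delta> * norm (q \<zeta>) \<le> norm (\<omega> - \<zeta>) * norm (q \<zeta>)"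
      using far by (intro mult_right_mono) auto
    also have "\<dots> \<le> 2 * R" using dist_le[OF that] by (simp add: fac)
    finally show ?thesis using \<delta>(1) by (simp add: field_simps le_max_iff_disj)
  qed (use B in \<open>auto simp: le_max_iff_disj\<close>)
  \<comment> \<open>Upper bounds for the logarithms of
    \<open>\<psi> \<omega> - \<psi> \<zeta>\<close>, of \<open>\<omega> - \<zeta>\<close> and of
    \<open>q\<close> keep all three integrands nonnegative. They do not add up exactly; the surplus
    \<open>c1 + c2 - c\<close> is put on both sides and cancelled at the end.\<close>
  define c where "c = ln (2 * R)"
  define c1 where "c1 = \<bar>ln (2 * s)\<bar> + \<bar>c\<bar>"
  define c2 where "c2 = max 0 (ln (max B (2 * R / \<delta>)))"
  have q_ln: "ln (norm (q \<zeta>)) \<le> c2" if "\<zeta> \<in> ball a s" for \<zeta>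
    using nz[OF that] q_le[OF that] unfolding c2_def by (intro max.coboundedI2[OF ln_mono]) auto
  have c12: "0 \<le> c1" "ln (2 * s) \<le> c1" "c \<le> c1 + c2"
    by (auto simp: c1_def c2_def)
  have "ln s \<le> ln (2 * s)" using s by (subst ln_le_cancel_iff) auto
  then have lns: "ln s \<le> c1" using c12(2) by (rule order_trans)
  let ?\<omega> = "\<omega> - a"
  define t where "t = norm ?\<omega> / s"
  have t: "0 \<le> t" "t < 1" using \<omega> s by (auto simp: t_def dist_norm norm_minus_commute)
  have c1_le: "ln (norm (\<omega> - \<zeta>)) \<le> c1" if "\<zeta> \<in> ball a s" for \<zeta>
  proof (cases "\<omega> = \<zeta>")
    case False
    have "norm (\<omega> - \<zeta>) \<le> 2 * s"
      using that \<omega> dist_triangle2[of \<omega> \<zeta> a] by (simp add: dist_norm norm_minus_commute)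
    then have "ln (norm (\<omega> - \<zeta>)) \<le> ln (2 * s)" using False by (intro ln_mono) auto
    then show ?thesis using c12 by simp
  qed (use c12 in simp)
  have [measurable]: "(\<lambda>\<zeta>. log_kernel R (\<psi> \<omega>) (\<psi> \<zeta>) * indicator (ball a s) \<zeta>) \<in> borel_measurable borel"
    by (rule borel_measurable_on_indicator[OF holomorphic_on_imp_continuous_on[OF \<psi>]]) auto
  have [measurable]: "(\<lambda>\<zeta>. ennreal (c2 - ln (norm (q \<zeta>))) * indicator (ball a s) \<zeta>) \<in> borel_measurable borel"
    by (rule borel_measurable_on_indicator[OF holomorphic_on_imp_continuous_on[OF q], where h="\<lambda>w. ennreal (c2 - ln (norm w))"]) auto
  let ?I = "\<integral>\<^sup>+\<zeta>. log_kernel R (\<psi> \<omega>) (\<psi> \<zeta>) * indicator (ball a s) \<zeta> \<partial>lborel"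
  have "?I + ennreal (pi * s\<^sup>2 * (c1 + c2 - c))
      = (\<integral>\<^sup>+\<zeta>. log_kernel R (\<psi> \<omega>) (\<psi> \<zeta>) * indicator (ball a s) \<zeta> + ennreal (c1 + c2 - c) * indicator (ball a s) \<zeta> \<partial>lborel)"
  proof -
    have cst: "(\<integral>\<^sup>+\<zeta>. ennreal (c1 + c2 - c) * indicator (ball a s) \<zeta> \<partial>lborel) = ennreal (pi * s\<^sup>2 * (c1 + c2 - c))"
      using s c12 by (subst nn_integral_cmult_indicator)
        (auto simp: emeasure_lborel_ball_complex mult.commute simp flip: ennreal_mult)
    have "(\<lambda>\<zeta>. ennreal (c1 + c2 - c) * indicator (ball a s) \<zeta>) \<in> borel_measurable lborel"
      by (intro borel_measurable_times_ennreal borel_measurable_indicator) auto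
    then show ?thesis
      unfolding cst[symmetric] by (intro nn_integral_add[symmetric]) auto
  qed
  also have "\<dots> = (\<integral>\<^sup>+\<zeta>. ennreal (c1 - ln (norm (\<omega> - \<zeta>))) * indicator (ball a s) \<zeta>
        + ennreal (c2 - ln (norm (q \<zeta>))) * indicator (ball a s) \<zeta> \<partial>lborel)"
  proof (rule nn_integral_cong_AE)
    have "AE \<zeta> in lborel. \<zeta> \<noteq> \<omega>" by (rule AE_lborel_singleton)
    then show "AE \<zeta> in lborel. log_kernel R (\<psi> \<omega>) (\<psi> \<zeta>) * indicator (ball a s) \<zeta> + ennreal (c1 + c2 - c) * indicator (ball a s) \<zeta>
        = ennreal (c1 - ln (norm (\<omega> - \<zeta>))) * indicator (ball a s) \<zeta> + ennreal (c2 - ln (norm (q \<zeta>))) * indicator (ball a s) \<zeta>"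
    proof eventually_elim
      case (elim \<zeta>)
      show ?case
      proof (cases "\<zeta> \<in> ball a s")
        case True
        have "\<psi> \<omega> \<noteq> \<psi> \<zeta>" using inj True \<omega> elim by (auto simp: inj_on_def)
        moreover from this have "ln (norm (\<psi> \<omega> - \<psi> \<zeta>)) \<le> c"
          unfolding c_def using dist_le[OF True] by (intro ln_mono) auto
        moreover have "ln (norm (\<psi> \<omega> - \<psi> \<zeta>)) = ln (norm (\<omega> - \<zeta>)) + ln (norm (q \<zeta>))"
          unfolding fac using elim nz[OF True] by (subst ln_mult) auto
        ultimately show ?thesis
          using True c1_le[OF True] q_ln[OF True] c12
          by (simp add: log_kernel_def c_def[symmetric] flip: ennreal_plus)
      qed simp
    qed
  qed
  also have "\<dots> = (\<integral>\<^sup>+\<zeta>. ennreal (c1 - ln (norm (\<omega> - \<zeta>))) * indicator (ball a s) \<zeta> \<partial>lborel)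
      + (\<integral>\<^sup>+\<zeta>. ennreal (c2 - ln (norm (q \<zeta>))) * indicator (ball a s) \<zeta> \<partial>lborel)"
    by (rule nn_integral_add) auto
  also have "(\<integral>\<^sup>+\<zeta>. ennreal (c2 - ln (norm (q \<zeta>))) * indicator (ball a s) \<zeta> \<partial>lborel)
      = ennreal (pi * s\<^sup>2 * (c2 - ln (norm (q a))))"
    by (rule nn_integral_ln_norm_mean[OF q s nz q_ln])
  also have "(\<integral>\<^sup>+\<zeta>. ennreal (c1 - ln (norm (\<omega> - \<zeta>))) * indicator (ball a s) \<zeta> \<partial>lborel)
      = (\<integral>\<^sup>+\<zeta>. ennreal (c1 - ln (norm (?\<omega> - \<zeta>))) * indicator (ball 0 s) \<zeta> \<partial>lborel)"
    by (subst nn_integral_lborel_affine[of _ 1 a])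
       (auto intro!: nn_integral_cong simp: indicator_def dist_norm algebra_simps)
  also have "\<dots> = ennreal (pi * s\<^sup>2 * (c1 - ln s + (1 - t\<^sup>2) / 2))"
    unfolding t_def using t s c12 by (intro nn_integral_ln_dist_ball) (auto simp: t_def)
  also have "\<dots> + ennreal (pi * s\<^sup>2 * (c2 - ln (norm (q a))))
      = ennreal (pi * s\<^sup>2 * (c1 - ln s + (1 - t\<^sup>2) / 2 + (c2 - ln (norm (q a)))))"
  proof -
    have "ln s \<le> c1" by (fact lns)
    moreover have "t\<^sup>2 \<le> 1" using t by (simp add: power_le_one)
    ultimately have "0 \<le> pi * s\<^sup>2 * (c1 - ln s + (1 - t\<^sup>2) / 2)"
      by (intro mult_nonneg_nonneg) auto
    then show ?thesis
      using q_ln[of a] s by (subst ennreal_plus[symmetric]) (auto simp: algebra_simps)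
  qed
  finally have sum: "?I + ennreal (pi * s\<^sup>2 * (c1 + c2 - c))
      = ennreal (pi * s\<^sup>2 * (c1 - ln s + (1 - t\<^sup>2) / 2 + (c2 - ln (norm (q a)))))" .
  then have "?I + ennreal (pi * s\<^sup>2 * (c1 + c2 - c)) < \<infinity>" by simp
  then show ?fin by (simp add: ennreal_add_eq_top less_top)
  show ?eq
  proof (cases "\<omega> = a")
    case True
    then show ?thesis using s by (simp add: log_kernel_def disc_defect_def ennreal_mult_top)
  next
    case False
    have "ennreal (pi * s\<^sup>2) * disc_defect (?\<omega> /\<^sub>R s) = ennreal (pi * s\<^sup>2 * (- ln t - (1 - t\<^sup>2) / 2))"
    proof -
      have "norm (?\<omega> /\<^sub>R s) = t" using s by (simp add: t_def divide_inverse mult.commute)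
      moreover have "t \<noteq> 0" using False s by (simp add: t_def)
      ultimately show ?thesis
        using t disc_defect_nonneg_aux[of t] False s by (simp add: disc_defect_def ennreal_mult)
    qed
    moreover have t0: "0 < t" using False s by (simp add: t_def)
    have "\<psi> \<omega> \<noteq> \<psi> a" using inj \<omega> s False by (auto simp: inj_on_def)
    have "ln (norm (\<psi> \<omega> - \<psi> a)) \<le> c"
      unfolding c_def using dist_le[of a] s \<open>\<psi> \<omega> \<noteq> \<psi> a\<close> by (intro ln_mono) auto
    then have "ennreal (pi * s\<^sup>2) * log_kernel R (\<psi> \<omega>) (\<psi> a) = ennreal (pi * s\<^sup>2 * (c - ln (norm (\<psi> \<omega> - \<psi> a))))"
      using \<open>\<psi> \<omega> \<noteq> \<psi> a\<close> by (simp add: log_kernel_def c_def ennreal_mult)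
    moreover have ln_eq: "ln (norm (\<psi> \<omega> - \<psi> a)) = ln t + ln s + ln (norm (q a))"
    proof -
      have "norm (\<psi> \<omega> - \<psi> a) = t * s * norm (q a)" using s by (simp add: fac t_def)
      then show ?thesis using t0 s nz[of a] by (simp add: ln_mult)
    qed
    ultimately have "(?I + ennreal (pi * s\<^sup>2) * disc_defect (?\<omega> /\<^sub>R s)) + ennreal (pi * s\<^sup>2 * (c1 + c2 - c))
        = ennreal (pi * s\<^sup>2) * log_kernel R (\<psi> \<omega>) (\<psi> a) + ennreal (pi * s\<^sup>2 * (c1 + c2 - c))"
    proof -
      assume D: "ennreal (pi * s\<^sup>2) * disc_defect (?\<omega> /\<^sub>R s) = ennreal (pi * s\<^sup>2 * (- ln t - (1 - t\<^sup>2) / 2))"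
        and L: "ennreal (pi * s\<^sup>2) * log_kernel R (\<psi> \<omega>) (\<psi> a) = ennreal (pi * s\<^sup>2 * (c - ln (norm (\<psi> \<omega> - \<psi> a))))"
      have "(?I + ennreal (pi * s\<^sup>2) * disc_defect (?\<omega> /\<^sub>R s)) + ennreal (pi * s\<^sup>2 * (c1 + c2 - c))
          = (?I + ennreal (pi * s\<^sup>2 * (c1 + c2 - c))) + ennreal (pi * s\<^sup>2) * disc_defect (?\<omega> /\<^sub>R s)"
        by (simp add: add_ac)
      also have "\<dots> = ennreal (pi * s\<^sup>2 * (c1 - ln s + (1 - t\<^sup>2) / 2 + (c2 - ln (norm (q a)))) + pi * s\<^sup>2 * (- ln t - (1 - t\<^sup>2) / 2))"
      proof -
        have "ln s \<le> c1" by (fact lns)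
        moreover have "t\<^sup>2 \<le> 1" using t by (simp add: power_le_one)
        ultimately have "0 \<le> pi * s\<^sup>2 * (c1 - ln s + (1 - t\<^sup>2) / 2 + (c2 - ln (norm (q a))))"
          using q_ln[of a] s by (intro mult_nonneg_nonneg) auto
        then show ?thesis
          unfolding sum D using disc_defect_nonneg_aux[of t] t t0 by (subst ennreal_plus) auto
      qed
      also have "pi * s\<^sup>2 * (c1 - ln s + (1 - t\<^sup>2) / 2 + (c2 - ln (norm (q a)))) + pi * s\<^sup>2 * (- ln t - (1 - t\<^sup>2) / 2)
          = pi * s\<^sup>2 * (c - ln (norm (\<psi> \<omega> - \<psi> a))) + pi * s\<^sup>2 * (c1 + c2 - c)"
        unfolding ln_eq by (simp add: algebra_simps)
      also have "ennreal \<dots> = ennreal (pi * s\<^sup>2 * (c - ln (norm (\<psi> \<omega> - \<psi> a)))) + ennreal (pi * s\<^sup>2 * (c1 + c2 - c))"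
        using c12 \<open>ln (norm (\<psi> \<omega> - \<psi> a)) \<le> c\<close> by (intro ennreal_plus) auto
      finally show ?thesis unfolding L .
    qed
    then show ?thesis
      by (simp add: add.commute[of _ "ennreal (pi * s\<^sup>2 * (c1 + c2 - c))"] ennreal_add_left_cancel)
  qed
qed

section \<open>Positive definiteness of the logarithmic energy\<close>

lemma ennreal_eq_top_if_nat_le: "(\<And>N. of_nat N \<le> x) \<Longrightarrow> x = (\<infinity>::ennreal)"
  by (metis ennreal_Ex_less_of_nat infinity_ennreal_def less_top not_less)

lemma nn_integral_exp_halfline:
  assumes "0 < (u::real)"
  shows "(\<integral>\<^sup>+t. ennreal (exp (- t * u)) * indicator {0..} t \<partial>lborel) = ennreal (1 / u)"
proof -
  have "(\<integral>\<^sup>+t. ennreal (exp (- t * u)) * indicator {0..} t \<partial>lborel) = ennreal (0 - (- exp (- 0 * u) / u))"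
  proof (rule nn_integral_FTC_atLeast[where F="\<lambda>t. - exp (- t * u) / u"])
    show "((\<lambda>t. - exp (- t * u) / u) has_real_derivative exp (- t * u)) (at t)" for t
      using assms by (auto intro!: derivative_eq_intros)
    show "((\<lambda>t. - exp (- t * u) / u) \<longlongrightarrow> 0) at_top"
      using assms by real_asymp
  qed auto
  then show ?thesis by simp
qed

lemma nn_integral_inverse_Icc:
  assumes "0 < x" "x \<le> (1::real)"
  shows "(\<integral>\<^sup>+u. ennreal (1 / (2 * u)) * indicator {x..1} u \<partial>lborel) = ennreal (- ln x / 2)"
proof -
  have "(\<integral>\<^sup>+u. ennreal (1 / (2 * u)) * indicator {x..1} u \<partial>lborel) = ennreal (ln 1 / 2 - ln x / 2)"
  proof (rule nn_integral_FTC_Icc[where F="\<lambda>u. ln u / 2"])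
    fix u assume "u \<in> {x..1}"
    then have "u > 0" using assms by auto
    then show "((\<lambda>u. ln u / 2) has_real_derivative 1 / (2 * u)) (at u)" "0 \<le> 1 / (2 * u)"
      by (auto intro!: derivative_eq_intros simp: field_simps)
  qed (use assms in auto)
  then show ?thesis by simp
qed

text \<open>The integrand is the integral of \<open>exp (- t u) / 2\<close> over \<open>u\<close>
  between \<open>x\<close> and 1; after exchanging the integrations the inner one is
  \<open>1 / (2 u)\<close>. For \<open>x = 0\<close> this diverges, matching the logarithmic
  singularity on the diagonal.\<close>

lemma Frullani_exp:
  assumes x: "0 \<le> x" "x \<le> (1::real)"
  shows "(\<integral>\<^sup>+t. ennreal ((exp (- t * x) - exp (- t)) / (2 * t)) * indicator {0<..} t \<partial>lborel)
    = (if x = 0 then \<infinity> else ennreal (- ln x / 2))"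
proof -
  have "ennreal ((exp (- t * x) - exp (- t)) / (2 * t)) =
      (\<integral>\<^sup>+u. ennreal (exp (- t * u) / 2) * indicator {x..1} u \<partial>lborel)" if "t > 0" for t
  proof -
    have "(\<integral>\<^sup>+u. ennreal (exp (- t * u) / 2) * indicator {x..1} u \<partial>lborel)
        = ennreal (- exp (- t * 1) / (2 * t) - - exp (- t * x) / (2 * t))"
      using that x by (intro nn_integral_FTC_Icc[where F="\<lambda>u. - exp (- t * u) / (2 * t)"])
        (auto intro!: derivative_eq_intros)
    then show ?thesis by (simp add: diff_divide_distrib)
  qed
  then have "(\<integral>\<^sup>+t. ennreal ((exp (- t * x) - exp (- t)) / (2 * t)) * indicator {0<..} t \<partial>lborel)
      = (\<integral>\<^sup>+t. (\<integral>\<^sup>+u. ennreal (exp (- t * u) / 2) * indicator {x..1} u * indicator {0<..} t \<partial>lborel) \<partial>lborel)"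
    by (intro nn_integral_cong) (auto simp: indicator_def)
  also have "\<dots> = (\<integral>\<^sup>+u. (\<integral>\<^sup>+t. ennreal (exp (- t * u) / 2) * indicator {x..1} u * indicator {0<..} t \<partial>lborel) \<partial>lborel)"
    by (intro lborel_pair.Fubini') measurable
  also have "\<dots> = (\<integral>\<^sup>+u. ennreal (1 / (2 * u)) * indicator {x..1} u \<partial>lborel)"
  proof (rule nn_integral_cong_AE)
    have "AE u in lborel. u \<noteq> (0::real)" by (rule AE_lborel_singleton)
    then show "AE u in lborel. (\<integral>\<^sup>+t. ennreal (exp (- t * u) / 2) * indicator {x..1} u * indicator {0<..} t \<partial>lborel)
        = ennreal (1 / (2 * u)) * indicator {x..1} u"
    proof eventually_elim
      case (elim u)
      show ?case
      proof (cases "u \<in> {x..1}")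
        case True
        then have u: "u > 0" using x elim by auto
        have "AE t in lborel. t \<noteq> (0::real)" by (rule AE_lborel_singleton)
        then have "(\<integral>\<^sup>+t. ennreal (exp (- t * u) / 2) * indicator {x..1} u * indicator {0<..} t \<partial>lborel)
            = (\<integral>\<^sup>+t. ennreal (1 / 2) * (ennreal (exp (- t * u)) * indicator {0..} t) \<partial>lborel)"
        proof (intro nn_integral_cong_AE, eventually_elim)
          case (elim t)
          have "ennreal (exp (- t * u) / 2) = ennreal (1 / 2) * ennreal (exp (- t * u))"
            by (subst ennreal_mult[symmetric]) auto
          then show ?case using elim True by (auto simp: indicator_def)
        qed
        also have "\<dots> = ennreal (1 / 2) * ennreal (1 / u)"
          using nn_integral_exp_halfline[OF u] by (subst nn_integral_cmult) auto
        also have "\<dots> = ennreal (1 / (2 * u))"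
          using u by (subst ennreal_mult[symmetric]) auto
        finally show ?thesis using True by simp
      qed simp
    qed
  qed
  also have "\<dots> = (if x = 0 then \<infinity> else ennreal (- ln x / 2))"
  proof (cases "x = 0")
    case True
    have "(\<integral>\<^sup>+u. ennreal (1 / (2 * u)) * indicator {0..1} u \<partial>lborel) = \<infinity>"
    proof (rule ennreal_eq_top_if_nat_le)
      fix N :: nat
      \<comment> \<open>The lower limit \<open>exp (- 2 N)\<close> is chosen so that the integral
        over the remaining interval is exactly \<open>N\<close>.\<close>
      have "(of_nat N :: ennreal) = ennreal (- ln (exp (- 2 * real N)) / 2)"
        by (simp add: ennreal_of_nat_eq_real_of_nat)
      also have "\<dots> = (\<integral>\<^sup>+u. ennreal (1 / (2 * u)) * indicator {exp (- 2 * real N)..1} u \<partial>lborel)"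
        by (rule nn_integral_inverse_Icc[symmetric]) auto
      also have "\<dots> \<le> (\<integral>\<^sup>+u. ennreal (1 / (2 * u)) * indicator {0..1} u \<partial>lborel)"
        by (intro nn_integral_mono mult_left_mono)
          (auto simp: indicator_def intro: order_trans[OF less_imp_le[OF exp_gt_zero]])
      finally show "of_nat N \<le> (\<integral>\<^sup>+u. ennreal (1 / (2 * u)) * indicator {0..1} u \<partial>lborel)" .
    qed
    then show ?thesis using True by simp
  next
    case False
    then show ?thesis using x nn_integral_inverse_Icc[of x] by simp
  qed
  finally show ?thesis .
qed

section \<open>Gaussian convolution squares and the energy gap\<close>

definition gauss_mass :: "real \<Rightarrow> real" where
  "gauss_mass \<tau> = pi / (4 * \<tau>)"

lemma nn_integral_gauss:
  assumes "0 < \<tau>"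
  shows "(\<integral>\<^sup>+a. ennreal (exp (- 4 * \<tau> * (norm (a::complex))\<^sup>2)) \<partial>lborel) = ennreal (gauss_mass \<tau>)"
proof -
  have "(\<integral>\<^sup>+a. ennreal (exp (- 4 * \<tau> * (norm (a::complex))\<^sup>2)) \<partial>lborel)
      = ennreal pi * (\<integral>\<^sup>+u. ennreal (exp (- u * (4 * \<tau>))) * indicator {0..} u \<partial>lborel)"
    using nn_integral_radial[of "\<lambda>u. ennreal (exp (- u * (4 * \<tau>)))"] by (simp add: mult_ac)
  also have "\<dots> = ennreal (gauss_mass \<tau>)"
    using assms by (subst nn_integral_exp_halfline) (auto simp: gauss_mass_def simp flip: ennreal_mult)
  finally show ?thesis .
qed

text \<open>Measured from the midpoint of \<open>z\<close> and \<open>w\<close>, the parallelogram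
  law separates \<open>|z - w|^2\<close> from the integration variable.\<close>

lemma nn_integral_gauss_convolution:
  assumes \<tau>: "0 < \<tau>"
  shows "(\<integral>\<^sup>+a. ennreal (exp (- 2 * \<tau> * (norm (z - a))\<^sup>2)) * ennreal (exp (- 2 * \<tau> * (norm (w - a))\<^sup>2)) \<partial>lborel)
    = ennreal (gauss_mass \<tau>) * ennreal (exp (- \<tau> * (norm (z - w :: complex))\<^sup>2))"
proof -
  define m where "m = (z + w) / 2"
  have par: "(norm (z - (m + b)))\<^sup>2 + (norm (w - (m + b)))\<^sup>2 = (norm (z - w))\<^sup>2 / 2 + 2 * (norm b)\<^sup>2" for b
    unfolding cmod_power2 m_def by (simp add: power2_eq_square field_simps)
  have "(\<integral>\<^sup>+a. ennreal (exp (- 2 * \<tau> * (norm (z - a))\<^sup>2)) * ennreal (exp (- 2 * \<tau> * (norm (w - a))\<^sup>2)) \<partial>lborel)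
      = (\<integral>\<^sup>+b. ennreal (exp (- 2 * \<tau> * (norm (z - (m + b)))\<^sup>2)) * ennreal (exp (- 2 * \<tau> * (norm (w - (m + b)))\<^sup>2)) \<partial>lborel)"
    by (subst nn_integral_lborel_affine[of _ 1 m]) simp_all
  also have "\<dots> = (\<integral>\<^sup>+b. ennreal (exp (- \<tau> * (norm (z - w))\<^sup>2)) * ennreal (exp (- 4 * \<tau> * (norm (b::complex))\<^sup>2)) \<partial>lborel)"
  proof (intro nn_integral_cong)
    fix b
    have "- 2 * \<tau> * (norm (z - (m + b)))\<^sup>2 + - 2 * \<tau> * (norm (w - (m + b)))\<^sup>2
        = - 2 * \<tau> * ((norm (z - (m + b)))\<^sup>2 + (norm (w - (m + b)))\<^sup>2)"
      by (simp add: algebra_simps)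
    also have "\<dots> = - \<tau> * (norm (z - w))\<^sup>2 + - 4 * \<tau> * (norm b)\<^sup>2"
      unfolding par by (simp add: algebra_simps)
    finally show "ennreal (exp (- 2 * \<tau> * (norm (z - (m + b)))\<^sup>2)) * ennreal (exp (- 2 * \<tau> * (norm (w - (m + b)))\<^sup>2))
        = ennreal (exp (- \<tau> * (norm (z - w))\<^sup>2)) * ennreal (exp (- 4 * \<tau> * (norm b)\<^sup>2))"
      by (simp flip: ennreal_mult exp_add)
  qed
  also have "\<dots> = ennreal (gauss_mass \<tau>) * ennreal (exp (- \<tau> * (norm (z - w))\<^sup>2))"
    unfolding nn_integral_gauss[OF \<tau>, symmetric]
    by (subst nn_integral_cmult) (auto simp: mult.commute)
  finally show ?thesis .
qed

definition mutual_energy :: "real \<Rightarrow> complex measure \<Rightarrow> complex measure \<Rightarrow> ennreal" where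
  "mutual_energy R \<mu> \<nu> = (\<integral>\<^sup>+z. (\<integral>\<^sup>+w. log_kernel R z w \<partial>\<nu>) \<partial>\<mu>)"

text \<open>The argument \<open>x = (|z - w| / (2 R))^2\<close> stays in the unit interval for
  points of the disc, and the square compensates the factor \<open>1/2\<close> in the Frullani
  integral.\<close>

lemma log_kernel_eq_Frullani:
  assumes R: "R > 0" and z: "z \<in> cball 0 R" "w \<in> cball 0 R"
  shows "log_kernel R z w = (\<integral>\<^sup>+t. ennreal ((exp (- t * ((norm (z - w))\<^sup>2 / (4 * R\<^sup>2))) - exp (- t)) / (2 * t)) * indicator {0<..} t \<partial>lborel)"
proof -
  let ?x = "(norm (z - w))\<^sup>2 / (4 * R\<^sup>2)"
  have "norm (z - w) \<le> 2 * R" using z norm_triangle_ineq4[of z w] by simp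
  then have "(norm (z - w))\<^sup>2 \<le> (2 * R)\<^sup>2" by (intro power_mono) auto
  then have x: "0 \<le> ?x" "?x \<le> 1" using R by (auto simp: power_mult_distrib)
  have "- ln ?x / 2 = ln (2 * R) - ln (norm (z - w))" if "z \<noteq> w"
  proof -
    have "?x = (norm (z - w) / (2 * R))\<^sup>2" by (simp add: power_divide power_mult_distrib)
    then have "ln ?x = 2 * ln (norm (z - w) / (2 * R))" using R that by (simp add: ln_realpow)
    then show ?thesis using R that by (simp add: ln_div)
  qed
  then show ?thesis
    unfolding Frullani_exp[OF x] using R by (auto simp: log_kernel_def)
qed

text \<open>Positive definiteness of the logarithmic energy: by the Frullani integral the kernel is a mixture
  of Gaussians, and a Gaussian is the convolution square of a narrower one.\<close>

lemma mutual_energy_gap: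
  assumes R: "R > 0"
    and \<mu>: "prob_space \<mu>" "sets \<mu> = sets borel" "AE z in \<mu>. z \<in> cball 0 R"
    and \<nu>: "prob_space \<nu>" "sets \<nu> = sets borel" "AE z in \<nu>. z \<in> cball 0 R"
  obtains E where "mutual_energy R \<mu> \<mu> + mutual_energy R \<nu> \<nu> = 2 * mutual_energy R \<mu> \<nu> + E"
    and "E = 0 \<Longrightarrow> \<mu> = \<nu>"
proof -
  \<comment> \<open>Facts are proved for all pairs from \<open>P\<close>, so that the two
    self-energies and the mutual energy are treated at once.\<close>
  define P where "P = {\<mu>, \<nu>}"
  have P: "prob_space m" "sets m = sets borel" "AE z in m. z \<in> cball 0 R" if "m \<in> P" for m
    using that \<mu> \<nu> by (auto simp: P_def)
  define c where "c t = t / (4 * R\<^sup>2)" for t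
  have c: "c t > 0" if "t > 0" for t using that R by (simp add: c_def)
  define \<gamma> where "\<gamma> m t a = (\<integral>\<^sup>+z. ennreal (exp (- 2 * c t * (norm (z - a))\<^sup>2)) \<partial>m)" for m t and a :: complex
  define g where "g m t a = enn2real (\<gamma> m t a)" for m t a
  have \<gamma>_le: "\<gamma> m t a \<le> 1" if "m \<in> P" "t > 0" for m t a
  proof -
    interpret prob_space m using P that by simp
    have "\<gamma> m t a \<le> (\<integral>\<^sup>+z. 1 \<partial>m)"
      unfolding \<gamma>_def using c[OF that(2)] by (intro nn_integral_mono) (auto simp: ennreal_le_1)
    then show ?thesis by (simp add: emeasure_space_1)
  qed
  have g: "ennreal (g m t a) = \<gamma> m t a" if "m \<in> P" "t > 0" for m t a
    unfolding g_def using \<gamma>_le[OF that, of a] by (intro ennreal_enn2real) (auto simp: less_top[symmetric] top_unique dest: le_less_trans)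
  have g0: "0 \<le> g m t a" for m t a by (simp add: g_def)
  have \<gamma>_meas: "(\<lambda>(t, a). \<gamma> m t a) \<in> borel_measurable (borel \<Otimes>\<^sub>M borel)" if "m \<in> P" for m
  proof -
    interpret prob_space m using P that by simp
    note [measurable_cong] = P(2)[OF that]
    show ?thesis unfolding \<gamma>_def c_def split_beta by measurable
  qed
  have g_meas: "(\<lambda>(t, a). g m t a) \<in> borel_measurable (borel \<Otimes>\<^sub>M borel)" if "m \<in> P" for m
    using \<gamma>_meas[OF that] unfolding g_def split_beta by measurable
  have [measurable]: "g m t \<in> borel_measurable borel" if "m \<in> P" for m t
    using measurable_compose[OF measurable_Pair1' g_meas[OF that], of t] by simp
  have \<gamma>_meas1: "\<gamma> m t \<in> borel_measurable borel" if "m \<in> P" for m t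
    using measurable_compose[OF measurable_Pair1' \<gamma>_meas[OF that], of t] by simp
  \<comment> \<open>The squared distance in \<open>L^2\<close> of the two Gaussian smoothings at
    parameter \<open>t\<close>: this is what the quadratic form of a Gaussian convolution square
    produces.\<close>
  define D where "D t = (\<integral>\<^sup>+a. ennreal ((g \<mu> t a - g \<nu> t a)\<^sup>2) \<partial>lborel)" for t
  have in_P: "\<mu> \<in> P" "\<nu> \<in> P" by (auto simp: P_def)
  have D_meas[measurable]: "D \<in> borel_measurable borel"
  proof -
    note [measurable] = g_meas[OF in_P(1)] g_meas[OF in_P(2)]
    have [measurable]: "(\<lambda>p. g m (fst p) (snd p)) \<in> borel_measurable (borel \<Otimes>\<^sub>M lborel)" if "m \<in> P" for m
      using g_meas[OF that] by (simp add: split_beta cong: measurable_cong_sets)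
    show ?thesis
      unfolding D_def using in_P by measurable
  qed
  define \<Phi> where "\<Phi> t m n = (\<integral>\<^sup>+z. (\<integral>\<^sup>+w. ennreal (exp (- c t * (norm (z - w))\<^sup>2)) \<partial>n) \<partial>m)"
    for t and m n :: "complex measure"
  have \<Phi>: "ennreal (gauss_mass (c t)) * \<Phi> t m n = (\<integral>\<^sup>+a. ennreal (g m t a * g n t a) \<partial>lborel)"
    if mn: "m \<in> P" "n \<in> P" and t: "t > 0" for t m n
  proof -
    interpret m: prob_space m using P mn by simp
    interpret n: prob_space n using P mn by simp
    note [measurable_cong] = P(2)[OF mn(1)] P(2)[OF mn(2)]
    interpret ml: pair_sigma_finite lborel m ..
    interpret nl: pair_sigma_finite lborel n ..
    note [measurable] = \<gamma>_meas1[OF mn(2), of t]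
    let ?e = "\<lambda>z a. ennreal (exp (- 2 * c t * (norm (z - a))\<^sup>2))"
    have "ennreal (gauss_mass (c t)) * \<Phi> t m n = (\<integral>\<^sup>+z. (\<integral>\<^sup>+w. (\<integral>\<^sup>+a. ?e z a * ?e w a \<partial>lborel) \<partial>n) \<partial>m)"
      unfolding \<Phi>_def nn_integral_gauss_convolution[OF c[OF t]]
      by (simp add: nn_integral_cmult)
    also have "\<dots> = (\<integral>\<^sup>+z. (\<integral>\<^sup>+a. (\<integral>\<^sup>+w. ?e z a * ?e w a \<partial>n) \<partial>lborel) \<partial>m)"
      by (intro nn_integral_cong nl.Fubini') measurable
    also have "\<dots> = (\<integral>\<^sup>+z. (\<integral>\<^sup>+a. ?e z a * \<gamma> n t a \<partial>lborel) \<partial>m)"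
      unfolding \<gamma>_def by (intro nn_integral_cong nn_integral_cmult) measurable
    also have "\<dots> = (\<integral>\<^sup>+a. (\<integral>\<^sup>+z. ?e z a * \<gamma> n t a \<partial>m) \<partial>lborel)"
      by (intro ml.Fubini') measurable
    also have "\<dots> = (\<integral>\<^sup>+a. \<gamma> m t a * \<gamma> n t a \<partial>lborel)"
      unfolding \<gamma>_def by (intro nn_integral_cong nn_integral_multc) measurable
    also have "\<dots> = (\<integral>\<^sup>+a. ennreal (g m t a * g n t a) \<partial>lborel)"
      by (intro nn_integral_cong) (simp add: g[OF mn(1) t, symmetric] g[OF mn(2) t, symmetric] ennreal_mult g0)
    finally show ?thesis .
  qed
  have \<Phi>_sum: "ennreal (gauss_mass (c t)) * (\<Phi> t \<mu> \<mu> + \<Phi> t \<nu> \<nu>) = ennreal (gauss_mass (c t)) * (2 * \<Phi> t \<mu> \<nu>) + D t"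
    if t: "t > 0" for t
  proof -
    have "ennreal (gauss_mass (c t)) * (\<Phi> t \<mu> \<mu> + \<Phi> t \<nu> \<nu>)
        = (\<integral>\<^sup>+a. ennreal (g \<mu> t a * g \<mu> t a) \<partial>lborel) + (\<integral>\<^sup>+a. ennreal (g \<nu> t a * g \<nu> t a) \<partial>lborel)"
      by (simp add: distrib_left \<Phi>[OF in_P(1,1) t] \<Phi>[OF in_P(2,2) t])
    also have "\<dots> = (\<integral>\<^sup>+a. ennreal (g \<mu> t a * g \<mu> t a) + ennreal (g \<nu> t a * g \<nu> t a) \<partial>lborel)"
      using in_P by (intro nn_integral_add[symmetric]) measurable
    also have "\<dots> = (\<integral>\<^sup>+a. 2 * ennreal (g \<mu> t a * g \<nu> t a) + ennreal ((g \<mu> t a - g \<nu> t a)\<^sup>2) \<partial>lborel)"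
    proof (intro nn_integral_cong)
      fix a
      have "(2::ennreal) * ennreal (g \<mu> t a * g \<nu> t a) = ennreal (2 * (g \<mu> t a * g \<nu> t a))"
        using g0 by (simp add: ennreal_mult)
      moreover have "g \<mu> t a * g \<mu> t a + g \<nu> t a * g \<nu> t a = 2 * (g \<mu> t a * g \<nu> t a) + (g \<mu> t a - g \<nu> t a)\<^sup>2"
        by (simp add: power2_eq_square algebra_simps)
      ultimately show "ennreal (g \<mu> t a * g \<mu> t a) + ennreal (g \<nu> t a * g \<nu> t a)
          = 2 * ennreal (g \<mu> t a * g \<nu> t a) + ennreal ((g \<mu> t a - g \<nu> t a)\<^sup>2)"
        using g0 by (simp flip: ennreal_plus)
    qed
    also have "\<dots> = (\<integral>\<^sup>+a. 2 * ennreal (g \<mu> t a * g \<nu> t a) \<partial>lborel) + D t"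
      unfolding D_def using in_P by (intro nn_integral_add) measurable
    also have "(\<integral>\<^sup>+a. 2 * ennreal (g \<mu> t a * g \<nu> t a) \<partial>lborel) = 2 * (\<integral>\<^sup>+a. ennreal (g \<mu> t a * g \<nu> t a) \<partial>lborel)"
      using in_P by (intro nn_integral_cmult) measurable
    finally show ?thesis by (simp add: \<Phi>[OF in_P t, symmetric] mult_ac)
  qed
  define k where "k t z w = ennreal ((exp (- t * ((norm (z - w))\<^sup>2 / (4 * R\<^sup>2))) - exp (- t)) / (2 * t)) * indicator {0<..} t"
    for t :: real and z w :: complex
  define \<Psi> where "\<Psi> m n t = (\<integral>\<^sup>+z. (\<integral>\<^sup>+w. k t z w \<partial>n) \<partial>m)" for m n t
  have J: "mutual_energy R m n = (\<integral>\<^sup>+t. \<Psi> m n t \<partial>lborel)" and \<Psi>_meas: "\<Psi> m n \<in> borel_measurable borel"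
    if mn: "m \<in> P" "n \<in> P" for m n
  proof -
    interpret m: prob_space m using P mn by simp
    interpret n: prob_space n using P mn by simp
    note [measurable_cong] = P(2)[OF mn(1)] P(2)[OF mn(2)]
    interpret ml: pair_sigma_finite lborel m ..
    interpret nl: pair_sigma_finite lborel n ..
    show "\<Psi> m n \<in> borel_measurable borel"
      unfolding \<Psi>_def k_def by measurable
    have "mutual_energy R m n = (\<integral>\<^sup>+z. (\<integral>\<^sup>+w. (\<integral>\<^sup>+t. k t z w \<partial>lborel) \<partial>n) \<partial>m)"
      unfolding mutual_energy_def
    proof (rule nn_integral_cong_AE)
      show "AE z in m. (\<integral>\<^sup>+w. log_kernel R z w \<partial>n) = (\<integral>\<^sup>+w. (\<integral>\<^sup>+t. k t z w \<partial>lborel) \<partial>n)"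
        using P(3)[OF mn(1)]
      proof eventually_elim
        case (elim z)
        show ?case
        proof (rule nn_integral_cong_AE)
          show "AE w in n. log_kernel R z w = (\<integral>\<^sup>+t. k t z w \<partial>lborel)"
            using P(3)[OF mn(2)] by eventually_elim (simp add: k_def log_kernel_eq_Frullani[OF R elim])
        qed
      qed
    qed
    also have "\<dots> = (\<integral>\<^sup>+z. (\<integral>\<^sup>+t. (\<integral>\<^sup>+w. k t z w \<partial>n) \<partial>lborel) \<partial>m)"
      unfolding k_def by (intro nn_integral_cong nl.Fubini') measurable
    also have "\<dots> = (\<integral>\<^sup>+t. \<Psi> m n t \<partial>lborel)"
      unfolding k_def \<Psi>_def by (intro ml.Fubini') measurable
    finally show "mutual_energy R m n = (\<integral>\<^sup>+t. \<Psi> m n t \<partial>lborel)" .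
  qed
  \<comment> \<open>The Frullani integrand is a Gaussian minus a constant. Since subtraction is
    inconvenient in \<open>ennreal\<close>, the finite constant is added back here and cancelled
    when the sums are compared.\<close>
  have \<Psi>: "\<Psi> m n t + ennreal (exp (- t) / (2 * t)) = ennreal (1 / (2 * t)) * \<Phi> t m n"
    if mn: "m \<in> P" "n \<in> P" and t: "t > 0" for m n t
  proof -
    interpret m: prob_space m using P mn by simp
    interpret n: prob_space n using P mn by simp
    note [measurable_cong] = P(2)[OF mn(1)] P(2)[OF mn(2)]
    have "\<Psi> m n t + ennreal (exp (- t) / (2 * t)) = (\<integral>\<^sup>+z. (\<integral>\<^sup>+w. k t z w \<partial>n) + ennreal (exp (- t) / (2 * t)) \<partial>m)"
      unfolding \<Psi>_def k_def by (subst nn_integral_add) (simp_all add: m.emeasure_space_1)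
    also have "\<dots> = (\<integral>\<^sup>+z. (\<integral>\<^sup>+w. k t z w + ennreal (exp (- t) / (2 * t)) \<partial>n) \<partial>m)"
      unfolding k_def by (subst nn_integral_add) (simp_all add: n.emeasure_space_1)
    also have "\<dots> = (\<integral>\<^sup>+z. (\<integral>\<^sup>+w. ennreal (1 / (2 * t)) * ennreal (exp (- c t * (norm (z - w))\<^sup>2)) \<partial>n) \<partial>m)"
    proof (rule nn_integral_cong_AE)
      show "AE z in m. (\<integral>\<^sup>+w. k t z w + ennreal (exp (- t) / (2 * t)) \<partial>n)
          = (\<integral>\<^sup>+w. ennreal (1 / (2 * t)) * ennreal (exp (- c t * (norm (z - w))\<^sup>2)) \<partial>n)"
        using P(3)[OF mn(1)]
      proof eventually_elim
        case (elim z)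
        show ?case
        proof (rule nn_integral_cong_AE)
          show "AE w in n. k t z w + ennreal (exp (- t) / (2 * t)) = ennreal (1 / (2 * t)) * ennreal (exp (- c t * (norm (z - w))\<^sup>2))"
            using P(3)[OF mn(2)]
          proof eventually_elim
            case (elim w)
            have "norm (z - w) \<le> 2 * R" using elim \<open>z \<in> cball 0 R\<close> norm_triangle_ineq4[of z w] by simp
            then have "(norm (z - w))\<^sup>2 \<le> (2 * R)\<^sup>2" by (intro power_mono) auto
            then have "(norm (z - w))\<^sup>2 / (4 * R\<^sup>2) \<le> 1" using R by (auto simp: power_mult_distrib)
            then have "t * ((norm (z - w))\<^sup>2 / (4 * R\<^sup>2)) \<le> t * 1" using t by (intro mult_left_mono) auto
            then have "exp (- t) \<le> exp (- t * ((norm (z - w))\<^sup>2 / (4 * R\<^sup>2)))" by simp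
            then show ?case using t
              by (simp add: k_def c_def diff_divide_distrib[symmetric] flip: ennreal_plus ennreal_mult)
                 (simp add: diff_divide_distrib)
          qed
        qed
      qed
    qed
    also have "\<dots> = ennreal (1 / (2 * t)) * \<Phi> t m n"
      unfolding \<Phi>_def by (simp add: nn_integral_cmult)
    finally show ?thesis .
  qed
  \<comment> \<open>The gap at parameter \<open>t\<close>: \<open>D t\<close>, divided by the mass
    of the Gaussian and weighted as in the Frullani integral.\<close>
  define E where "E t = ennreal (1 / (2 * t)) * ennreal (1 / gauss_mass (c t)) * D t * indicator {0<..} t" for t
  have [measurable]: "E \<in> borel_measurable borel" unfolding E_def gauss_mass_def c_def by measurable
  have \<Psi>_sum: "\<Psi> \<mu> \<mu> t + \<Psi> \<nu> \<nu> t = 2 * \<Psi> \<mu> \<nu> t + E t" for t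
  proof (cases "t > 0")
    case False
    then show ?thesis by (simp add: \<Psi>_def k_def E_def)
  next
    case True
    let ?u = "ennreal (exp (- t) / (2 * t))" and ?G = "gauss_mass (c t)"
    have G: "?G > 0" using c[OF True] by (simp add: gauss_mass_def)
    have "\<Phi> t \<mu> \<mu> + \<Phi> t \<nu> \<nu> = ennreal (1 / ?G) * (ennreal ?G * (\<Phi> t \<mu> \<mu> + \<Phi> t \<nu> \<nu>))"
      using G by (simp flip: mult.assoc ennreal_mult)
    also have "\<dots> = 2 * \<Phi> t \<mu> \<nu> + ennreal (1 / ?G) * D t"
      unfolding \<Phi>_sum[OF True] using G by (simp add: distrib_left flip: mult.assoc ennreal_mult)
    finally have "\<Phi> t \<mu> \<mu> + \<Phi> t \<nu> \<nu> = 2 * \<Phi> t \<mu> \<nu> + ennreal (1 / ?G) * D t" .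
    then have eq: "ennreal (1 / (2 * t)) * (\<Phi> t \<mu> \<mu> + \<Phi> t \<nu> \<nu>) = ennreal (1 / (2 * t)) * (2 * \<Phi> t \<mu> \<nu> + ennreal (1 / ?G) * D t)"
      by simp
    have "(\<Psi> \<mu> \<mu> t + ?u) + (\<Psi> \<nu> \<nu> t + ?u) = ennreal (1 / (2 * t)) * (\<Phi> t \<mu> \<mu> + \<Phi> t \<nu> \<nu>)"
      unfolding \<Psi>[OF in_P(1,1) True] \<Psi>[OF in_P(2,2) True] by (simp only: distrib_left)
    also note eq
    also have "ennreal (1 / (2 * t)) * (2 * \<Phi> t \<mu> \<nu> + ennreal (1 / ?G) * D t) = 2 * (ennreal (1 / (2 * t)) * \<Phi> t \<mu> \<nu>) + E t"
      using True by (simp add: E_def distrib_left mult_ac)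
    finally have "(\<Psi> \<mu> \<mu> t + ?u) + (\<Psi> \<nu> \<nu> t + ?u) = 2 * (\<Psi> \<mu> \<nu> t + ?u) + E t"
      unfolding \<Psi>[OF in_P True] .
    then have "(?u + ?u) + (\<Psi> \<mu> \<mu> t + \<Psi> \<nu> \<nu> t) = (?u + ?u) + (2 * \<Psi> \<mu> \<nu> t + E t)"
      by (simp only: distrib_left mult_2 add_ac)
    then show ?thesis
      by (subst (asm) ennreal_add_left_cancel) auto
  qed
  show ?thesis
  proof (rule that[of "\<integral>\<^sup>+t. E t \<partial>lborel"])
    note [measurable] = \<Psi>_meas[OF in_P(1,1)] \<Psi>_meas[OF in_P(2,2)] \<Psi>_meas[OF in_P]
    have "mutual_energy R \<mu> \<mu> + mutual_energy R \<nu> \<nu> = (\<integral>\<^sup>+t. \<Psi> \<mu> \<mu> t + \<Psi> \<nu> \<nu> t \<partial>lborel)"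
      by (simp add: J in_P nn_integral_add)
    also have "\<dots> = 2 * mutual_energy R \<mu> \<nu> + (\<integral>\<^sup>+t. E t \<partial>lborel)"
      by (simp add: \<Psi>_sum J in_P nn_integral_add nn_integral_cmult)
    finally show "mutual_energy R \<mu> \<mu> + mutual_energy R \<nu> \<nu> = 2 * mutual_energy R \<mu> \<nu> + (\<integral>\<^sup>+t. E t \<partial>lborel)" .
  next
    assume "(\<integral>\<^sup>+t. E t \<partial>lborel) = 0"
    then have AE0: "AE t in lborel. E t = 0" by (simp add: nn_integral_0_iff_AE)
    \<comment> \<open>A vanishing gap gives \<open>E t = 0\<close> only for almost every
      \<open>t\<close>. Choosing such parameters beyond every \<open>n\<close> makes the widths of
      the Gaussians tend to 0, and the smoothings then determine the measures.\<close>
    have "\<exists>t. real n < t \<and> E t = 0" for n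
    proof (rule ccontr)
      assume "\<not> ?thesis"
      then have "AE t in lborel. t \<notin> {real n<..<real n + 1}" using AE0 by (auto elim!: eventually_mono)
      then have "{real n<..<real n + 1} \<in> null_sets lborel"
        by (subst (asm) AE_iff_null_sets[symmetric]) auto
      then show False by (simp add: null_sets_def)
    qed
    then obtain t where t: "\<And>n. real n < t n" "\<And>n. E (t n) = 0" by metis
    have t0: "t n > 0" for n using t(1)[of n] by (rule le_less_trans[rotated]) simp
    have D0: "D (t n) = 0" for n
    proof -
      have "1 / (2 * t n) > 0" "1 / gauss_mass (c (t n)) > 0"
        using t0[of n] c[OF t0[of n]] by (auto simp: gauss_mass_def)
      then show ?thesis using t(2)[of n] t0[of n] by (simp add: E_def)
    qed
    have eq: "AE a in lborel. \<gamma> \<mu> (t n) a = \<gamma> \<nu> (t n) a" for n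
    proof -
      have "AE a in lborel. ennreal ((g \<mu> (t n) a - g \<nu> (t n) a)\<^sup>2) = 0"
        using D0[of n] in_P unfolding D_def by (subst (asm) nn_integral_0_iff_AE) auto
      then show ?thesis
        by eventually_elim (simp flip: g[OF in_P(1) t0] g[OF in_P(2) t0])
    qed
    define s where "s n = 1 / sqrt (2 * c (t n))" for n
    have s: "s n > 0" for n using c[OF t0[of n]] by (simp add: s_def)
    have "filterlim t at_top sequentially"
      by (rule filterlim_at_top_mono[OF filterlim_real_sequentially]) (auto intro!: always_eventually less_imp_le t(1))
    moreover have "((\<lambda>t. 1 / sqrt (2 * c t)) \<longlongrightarrow> 0) at_top"
      unfolding c_def using R by real_asymp
    ultimately have s_lim: "s \<longlonglongrightarrow> 0"
      unfolding s_def by (rule filterlim_compose[rotated])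
    define \<rho> where "\<rho> x = ennreal (exp (- (norm x)\<^sup>2))" for x :: complex
    have [measurable]: "\<rho> \<in> borel_measurable borel" unfolding \<rho>_def by measurable
    have \<rho>: "(\<integral>\<^sup>+x. \<rho> x \<partial>lborel) = ennreal pi"
      using nn_integral_gauss[of "1/4"] by (simp add: \<rho>_def gauss_mass_def)
    have sm: "(\<integral>\<^sup>+z. \<rho> ((z - a) /\<^sub>R s n) \<partial>m) = \<gamma> m (t n) a" for m n a
    proof -
      have "(norm ((z - a) /\<^sub>R s n))\<^sup>2 = 2 * c (t n) * (norm (z - a))\<^sup>2" for z
        using c[OF t0[of n]] by (simp add: s_def power_mult_distrib)
      then show ?thesis by (simp add: \<rho>_def \<gamma>_def)
    qed
    have fin: "finite_measure \<mu>" "finite_measure \<nu>"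
      using \<mu>(1) \<nu>(1) by (auto intro: prob_space.finite_measure)
    have "emeasure \<mu> B = emeasure \<nu> B" if "B \<in> sets borel" for B
      by (rule emeasure_eq_if_smoothings_eq[OF fin(1) \<mu>(2) fin(2) \<nu>(2) _ _ _ s_lim s open_UNIV, of \<rho>])
         (auto simp: \<rho> sm intro!: always_eventually eventually_mono[OF eq] that)
    then show "\<mu> = \<nu>"
      using \<mu>(2) \<nu>(2) by (intro measure_eqI) auto
  qed
qed

lemma mutual_energy_commute:
  assumes "sigma_finite_measure \<mu>" "sigma_finite_measure \<nu>"
    and [measurable_cong]: "sets \<mu> = sets borel" "sets \<nu> = sets borel"
  shows "mutual_energy R \<mu> \<nu> = mutual_energy R \<nu> \<mu>"
proof -
  interpret pair_sigma_finite \<mu> \<nu> using assms by (intro pair_sigma_finite.intro)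
  show ?thesis
    unfolding mutual_energy_def by (subst Fubini') (simp_all add: log_kernel_commute)
qed

section \<open>Compactness of probability measures on a disc\<close>

text \<open>A continuous function of period 1 that is 0 on \<open>[0, 1/12]\<close>, where the sine
  is at most \<open>1/2\<close>, and 1 on \<open>[1/4, 1/3]\<close>, where it is at least
  \<open>5/6\<close>. It reads a base 4 digit that is known to be 0 or 1.\<close>

definition digit_bump :: "real \<Rightarrow> real" where
  "digit_bump x = max 0 (min 1 (3 * sin (2 * pi * x) - 3 / 2))"

lemma digit_bump_add_nat: "digit_bump (real N + y) = digit_bump y"
proof -
  have "2 * pi * (real N + y) = 2 * real N * pi + 2 * pi * y" by (simp add: algebra_simps)
  then have "sin (2 * pi * (real N + y)) = sin (2 * pi * y)"
    using sin_2npi[of N] cos_2npi[of N] by (simp add: sin_add)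
  then show ?thesis by (simp add: digit_bump_def)
qed

lemma digit_bump_0:
  assumes "0 \<le> y" "y \<le> 1 / 12"
  shows "digit_bump y = 0"
proof -
  have "2 * pi * y \<le> 2 * pi * (1 / 12)" using assms by (intro mult_left_mono) auto
  moreover have "0 \<le> 2 * pi * y" using assms by simp
  then have "- (pi / 2) \<le> 2 * pi * y" using pi_gt_zero by linarith
  ultimately have "sin (2 * pi * y) \<le> sin (pi / 6)"
    using pi_gt_zero by (intro sin_monotone_2pi_le) auto
  then show ?thesis by (simp add: digit_bump_def sin_30)
qed

lemma digit_bump_1:
  assumes "0 \<le> y" "y \<le> 1 / 12"
  shows "digit_bump (1 / 4 + y) = 1"
proof -
  have "2 * pi * (1 / 4 + y) = pi / 2 + 2 * pi * y" by (simp add: algebra_simps)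
  then have "sin (2 * pi * (1 / 4 + y)) = cos (2 * pi * y)" by (simp add: sin_add)
  moreover have "2 * pi * y \<le> 2 * pi * (1 / 12)" using assms by (intro mult_left_mono) auto
  then have "cos (pi / 6) \<le> cos (2 * pi * y)"
    using assms pi_gt_zero by (intro cos_monotone_0_pi_le) auto
  moreover have "5 / 6 \<le> cos (pi / 6)"
    unfolding cos_30 using real_le_rsqrt[of "5 / 3" 3] by (simp add: power2_eq_square)
  ultimately have "5 / 6 \<le> sin (2 * pi * (1 / 4 + y))" by simp
  then show ?thesis by (simp add: digit_bump_def)
qed

text \<open>Multiplication by \<open>4 ^ j\<close> leaves an integer, the digit \<open>e j\<close>
  divided by 4, and a tail of at most \<open>1/16 + 1/64 + ... = 1/12\<close>. Allowing only the
  digits 0 and 1 in base 4 creates the gaps that make a continuous reading possible.\<close>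

lemma digit_bump_digit:
  fixes e :: "nat \<Rightarrow> nat"
  assumes e: "\<And>j. e j \<le> 1"
  shows "digit_bump (4 ^ j * (\<Sum>i. real (e i) / 4 ^ Suc i)) = real (e j)"
proof -
  have sum4: "(\<lambda>i. (1/4::real) ^ i) sums (1 / (1 - 1 / 4))" by (rule geometric_sums) simp
  have sm: "summable (\<lambda>i. real (e i) / 4 ^ Suc i)"
  proof (rule summable_comparison_test')
    show "summable (\<lambda>i. (1/4::real) ^ i)" using sum4 by (rule sums_summable)
    show "norm (real (e i) / 4 ^ Suc i) \<le> (1/4) ^ i" for i
      using e[of i] by (simp add: power_divide field_simps)
  qed
  have nat_part: "\<exists>N::nat. 4 ^ j * (\<Sum>i<j. real (e i) / 4 ^ Suc i) = real N" for j
  proof (induction j)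
    case (Suc j)
    then obtain N :: nat where N: "4 ^ j * (\<Sum>i<j. real (e i) / 4 ^ Suc i) = real N" by blast
    have "4 ^ Suc j * (\<Sum>i<Suc j. real (e i) / 4 ^ Suc i) = 4 * (4 ^ j * (\<Sum>i<j. real (e i) / 4 ^ Suc i)) + real (e j)"
      by (simp add: algebra_simps)
    also have "\<dots> = real (4 * N + e j)" unfolding N by simp
    finally show ?case by blast
  qed (auto intro: exI[of _ 0])
  define r where "r = 4 ^ j * (\<Sum>i. real (e (i + Suc j)) / 4 ^ Suc (i + Suc j))"
  have sm': "summable (\<lambda>i. real (e (i + Suc j)) / 4 ^ Suc (i + Suc j))"
    using sm by (subst summable_iff_shift)
  have r0: "0 \<le> r" unfolding r_def using sm' by (intro mult_nonneg_nonneg suminf_nonneg) auto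
  have r1: "r \<le> 1 / 12"
  proof -
    have "(\<Sum>i. real (e (i + Suc j)) / 4 ^ Suc (i + Suc j)) \<le> (\<Sum>i. (1 / 4) ^ (j + 2) * (1/4::real) ^ i)"
    proof (rule suminf_le[OF _ sm'])
      show "summable (\<lambda>i. (1 / 4) ^ (j + 2) * (1/4::real) ^ i)"
        using sum4 by (intro summable_mult) (rule sums_summable)
      show "real (e (i + Suc j)) / 4 ^ Suc (i + Suc j) \<le> (1 / 4) ^ (j + 2) * (1/4) ^ i" for i
        using e[of "i + Suc j"] by (simp add: power_divide power_add field_simps)
    qed
    also have "\<dots> = (1 / 4) ^ (j + 2) * (1 / (1 - 1 / 4))"
      using sum4 by (subst suminf_mult) (auto simp: sums_iff)
    finally have "r \<le> 4 ^ j * ((1 / 4) ^ (j + 2) * (4 / 3))"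
      unfolding r_def by (intro mult_left_mono) auto
    also have "\<dots> = 1 / 12" by (simp add: power_divide power_add)
    finally show ?thesis .
  qed
  obtain N :: nat where N: "4 ^ j * (\<Sum>i<j. real (e i) / 4 ^ Suc i) = real N" using nat_part by blast
  have "(\<Sum>i. real (e i) / 4 ^ Suc i)
      = (\<Sum>i. real (e (i + Suc j)) / 4 ^ Suc (i + Suc j)) + (\<Sum>i<Suc j. real (e i) / 4 ^ Suc i)"
    by (rule suminf_split_initial_segment[OF sm])
  then have "4 ^ j * (\<Sum>i. real (e i) / 4 ^ Suc i)
      = r + (4 ^ j * (\<Sum>i<j. real (e i) / 4 ^ Suc i) + 4 ^ j * (real (e j) / 4 ^ Suc j))"
    unfolding r_def sum.lessThan_Suc by (simp only: distrib_left)
  then have "4 ^ j * (\<Sum>i. real (e i) / 4 ^ Suc i) = r + (real N + real (e j) / 4)"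
    unfolding N by simp
  then have "4 ^ j * (\<Sum>i. real (e i) / 4 ^ Suc i) = real N + (real (e j) / 4 + r)" by simp
  then have "digit_bump (4 ^ j * (\<Sum>i. real (e i) / 4 ^ Suc i)) = digit_bump (real (e j) / 4 + r)"
    by (simp only: digit_bump_add_nat)
  also have "\<dots> = real (e j)"
    using e[of j] digit_bump_0[OF r0 r1] digit_bump_1[OF r0 r1] by (cases "e j") auto
  finally show ?thesis .
qed

text \<open>Written with floors the digit is Borel measurable in \<open>a\<close> and equals 0 or 1
  for every real \<open>a\<close>; for \<open>a\<close> in \<open>[0, 1)\<close> it is the binary
  digit of weight \<open>2 ^ (- k - 1)\<close>.\<close>

definition bin_digit :: "nat \<Rightarrow> real \<Rightarrow> nat" where
  "bin_digit k a = nat (\<lfloor>2 ^ Suc k * a\<rfloor> - 2 * \<lfloor>2 ^ k * a\<rfloor>)"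

lemma bin_digit_eq: "int (bin_digit k a) = \<lfloor>2 ^ Suc k * a\<rfloor> - 2 * \<lfloor>2 ^ k * a\<rfloor>" and bin_digit_le: "bin_digit k a \<le> 1"
proof -
  have "2 * \<lfloor>x\<rfloor> \<le> \<lfloor>2 * x\<rfloor> \<and> \<lfloor>2 * x\<rfloor> \<le> 2 * \<lfloor>x\<rfloor> + 1" for x :: real
  proof -
    have a: "x < real_of_int \<lfloor>x\<rfloor> + 1" by simp
    have "2 * x < real_of_int (2 * \<lfloor>x\<rfloor> + 1) + 1"
      using mult_strict_left_mono[OF a, of 2] by simp
    then show ?thesis by (simp add: le_floor_iff floor_le_iff)
  qed
  from this[of "2 ^ k * a"] show "int (bin_digit k a) = \<lfloor>2 ^ Suc k * a\<rfloor> - 2 * \<lfloor>2 ^ k * a\<rfloor>" "bin_digit k a \<le> 1"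
    by (auto simp: bin_digit_def mult.assoc)
qed

text \<open>The partial sums telescope to the floor of \<open>2 ^ n * a\<close> divided by
  \<open>2 ^ n\<close>, which is within \<open>2 ^ (- n)\<close> of \<open>a\<close>.\<close>

lemma bin_digit_sums:
  assumes "0 \<le> a" "a < 1"
  shows "(\<lambda>k. real (bin_digit k a) / 2 ^ Suc k) sums a"
proof -
  have part: "(\<Sum>k<n. real (bin_digit k a) / 2 ^ Suc k) = real_of_int \<lfloor>2 ^ n * a\<rfloor> / 2 ^ n" for n
  proof (induction n)
    case 0
    have "\<lfloor>a\<rfloor> = 0" using assms by (simp add: floor_eq_iff)
    then show ?case by simp
  next
    case (Suc n)
    have "real (bin_digit n a) = real_of_int (int (bin_digit n a))" by simp
    also have "\<dots> = real_of_int \<lfloor>2 ^ Suc n * a\<rfloor> - 2 * real_of_int \<lfloor>2 ^ n * a\<rfloor>"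
      unfolding bin_digit_eq by (simp only: of_int_diff of_int_mult of_int_numeral)
    finally have d: "real (bin_digit n a) = real_of_int \<lfloor>2 ^ Suc n * a\<rfloor> - 2 * real_of_int \<lfloor>2 ^ n * a\<rfloor>" .
    have "x / 2 ^ n + (m - 2 * x) / 2 ^ Suc n = m / 2 ^ Suc n" for x m :: real
      by (simp add: field_simps)
    then show ?case unfolding sum.lessThan_Suc Suc d .
  qed
  have fl: "x - 1 \<le> real_of_int \<lfloor>x\<rfloor>" "real_of_int \<lfloor>x\<rfloor> \<le> x" for x :: real
    using real_of_int_floor_gt_diff_one[of x] by (auto intro: less_imp_le)
  have lower: "a - (1/2) ^ n \<le> real_of_int \<lfloor>2 ^ n * a\<rfloor> / 2 ^ n" for n
  proof -
    have "(2 ^ n * a - 1) / 2 ^ n \<le> real_of_int \<lfloor>2 ^ n * a\<rfloor> / 2 ^ n"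
      by (rule divide_right_mono[OF fl(1)]) (rule zero_le_power, rule zero_le_numeral)
    moreover have "(2 ^ n * a - 1) / 2 ^ n = a - (1/2) ^ n"
      by (simp add: diff_divide_distrib power_divide)
    ultimately show ?thesis by (simp only:)
  qed
  have upper: "real_of_int \<lfloor>2 ^ n * a\<rfloor> / 2 ^ n \<le> a" for n
  proof -
    have "real_of_int \<lfloor>2 ^ n * a\<rfloor> / 2 ^ n \<le> 2 ^ n * a / 2 ^ n"
      by (rule divide_right_mono[OF fl(2)]) (rule zero_le_power, rule zero_le_numeral)
    moreover have "2 ^ n * a / 2 ^ n = a" by simp
    ultimately show ?thesis by (simp only:)
  qed
  have "(\<lambda>n. a - (1/2) ^ n) \<longlonglongrightarrow> a - 0"
    by (intro tendsto_diff tendsto_const LIMSEQ_power_zero) auto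
  then have "(\<lambda>n. real_of_int \<lfloor>2 ^ n * a\<rfloor> / 2 ^ n) \<longlonglongrightarrow> a"
    using tendsto_sandwich[OF always_eventually[OF allI[OF lower]] always_eventually[OF allI[OF upper]] _ tendsto_const]
    by (simp only: diff_zero)
  then show ?thesis unfolding sums_def part .
qed

lemma continuous_digit_series: "continuous_on UNIV (\<lambda>t. \<Sum>k. digit_bump (4 ^ (2 * k + c) * t) / 2 ^ Suc k)"
proof (rule uniform_limit_theorem[OF always_eventually])
  show "\<forall>n. continuous_on UNIV (\<lambda>t. \<Sum>k<n. digit_bump (4 ^ (2 * k + c) * t) / 2 ^ Suc k)"
    unfolding digit_bump_def by (intro allI continuous_intros) auto
  show "uniform_limit UNIV (\<lambda>n t. \<Sum>k<n. digit_bump (4 ^ (2 * k + c) * t) / 2 ^ Suc k)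
      (\<lambda>t. \<Sum>k. digit_bump (4 ^ (2 * k + c) * t) / 2 ^ Suc k) sequentially"
  proof (rule Weierstrass_m_test)
    show "norm (digit_bump (4 ^ (2 * k + c) * t) / 2 ^ Suc k) \<le> (1/2) ^ k" for k t
    proof -
      have "\<bar>digit_bump (4 ^ (2 * k + c) * t)\<bar> \<le> 1" by (auto simp: digit_bump_def)
      then show ?thesis by (simp add: power_divide field_simps)
    qed
    show "summable (\<lambda>k. (1/2::real) ^ k)" by (rule summable_geometric) simp
  qed
qed auto

text \<open>A Schoenberg-type curve: interleaving binary digits encodes the square in the line by a Borel map
  with a continuous left inverse.\<close>

lemma exists_continuous_decoding:
  assumes R: "R > 0"
  shows "\<exists>(T :: complex \<Rightarrow> real) (\<gamma> :: real \<Rightarrow> complex). T \<in> borel_measurable borel \<and> (\<forall>z. 0 \<le> T z \<and> T z \<le> 1) \<and>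
    continuous_on UNIV \<gamma> \<and> (\<forall>z \<in> cball 0 R. \<gamma> (T z) = z)"
proof -
  \<comment> \<open>Even positions carry the real part and odd ones the imaginary part. Division by
    \<open>4 R\<close> sends the coordinates into \<open>[0, 1/2]\<close>, safely below 1, where the
    binary expansion is valid.\<close>
  define e where "e z j = (if even j then bin_digit (j div 2) ((Re z + R) / (4 * R)) else bin_digit (j div 2) ((Im z + R) / (4 * R)))"
    for z :: complex and j
  have e1: "e z j \<le> 1" for z j unfolding e_def by (cases "even j") (simp_all only: if_True if_False bin_digit_le)
  define T where "T z = (\<Sum>i. real (e z i) / 4 ^ Suc i)" for z
  have real_digit: "real (bin_digit k a) = real_of_int \<lfloor>2 ^ Suc k * a\<rfloor> - 2 * real_of_int \<lfloor>2 ^ k * a\<rfloor>" for k a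
  proof -
    have "real (bin_digit k a) = real_of_int (\<lfloor>2 ^ Suc k * a\<rfloor> - 2 * \<lfloor>2 ^ k * a\<rfloor>)"
      unfolding bin_digit_eq[symmetric] by simp
    then show ?thesis by simp
  qed
  have em: "(\<lambda>z. real (e z j)) \<in> borel_measurable borel" for j
    unfolding e_def by (cases "even j") (simp_all add: real_digit)
  have T_meas: "T \<in> borel_measurable borel"
    unfolding T_def using em by (intro borel_measurable_suminf borel_measurable_divide) auto
  have sum4: "(\<lambda>i. (1/4::real) ^ Suc i) sums (1 / 3)"
  proof -
    have "(\<lambda>i. (1/4::real) ^ i) sums (1 / (1 - 1 / 4))" by (rule geometric_sums) simp
    from sums_mult[OF this, of "1/4"] show ?thesis by simp
  qed
  have le4: "real (e z i) / 4 ^ Suc i \<le> (1/4) ^ Suc i" for z i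
    using e1[of z i] by (simp add: power_divide field_simps)
  have sm: "summable (\<lambda>i. real (e z i) / 4 ^ Suc i)" for z
    by (rule summable_comparison_test'[OF sums_summable[OF sum4]]) (use le4 in auto)
  have T0: "0 \<le> T z" for z unfolding T_def by (intro suminf_nonneg sm) auto
  have T1: "T z \<le> 1" for z
  proof -
    have "T z \<le> (\<Sum>i. (1/4) ^ Suc i)" unfolding T_def by (intro suminf_le le4 sm sums_summable[OF sum4])
    also have "\<dots> = 1 / 3" using sum4 by (simp add: sums_iff)
    finally show ?thesis by simp
  qed
  \<comment> \<open>\<open>S 0\<close> and \<open>S 1\<close> read the even and the odd digits
    continuously and reassemble them in base 2.\<close>
  define S where "S c t = (\<Sum>k. digit_bump (4 ^ (2 * k + c) * t) / 2 ^ Suc k)" for c t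
  define \<gamma> where "\<gamma> t = Complex (4 * R * S 0 t - R) (4 * R * S 1 t - R)" for t
  have "continuous_on UNIV (S c)" for c
    unfolding S_def by (rule continuous_digit_series)
  then have cont: "continuous_on UNIV \<gamma>"
    unfolding \<gamma>_def by (intro continuous_intros) auto
  have ST: "S c (T z) = (\<Sum>k. real (e z (2 * k + c)) / 2 ^ Suc k)" for c z
    unfolding S_def T_def using digit_bump_digit[of "e z", OF e1] by simp
  have dec: "\<gamma> (T z) = z" if "z \<in> cball 0 R" for z
  proof -
    have rng: "0 \<le> (x + R) / (4 * R)" "(x + R) / (4 * R) < 1" if "\<bar>x\<bar> \<le> R" for x
      using that R by (auto simp: field_simps)
    have "\<bar>Re z\<bar> \<le> R" "\<bar>Im z\<bar> \<le> R"
      using that abs_Re_le_cmod[of z] abs_Im_le_cmod[of z] by auto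
    then have "S 0 (T z) = (Re z + R) / (4 * R)" "S 1 (T z) = (Im z + R) / (4 * R)"
      unfolding ST e_def using bin_digit_sums[OF rng] by (auto simp: sums_iff)
    then show ?thesis using R by (simp add: \<gamma>_def complex_eq_iff)
  qed
  show ?thesis using T_meas T0 T1 cont dec by blast
qed

section \<open>Almost surely convergent representations of sequences of measures\<close>

definition probs_on :: "real \<Rightarrow> complex measure set" where
  "probs_on R = {\<mu>. prob_space \<mu> \<and> sets \<mu> = sets borel \<and> (AE z in \<mu>. z \<in> cball 0 R)}"

lemma probs_onD:
  assumes "\<mu> \<in> probs_on R"
  shows "prob_space \<mu>" "sets \<mu> = sets borel" "AE z in \<mu>. z \<in> cball 0 R" "space \<mu> = UNIV" "sigma_finite_measure \<mu>" "finite_measure \<mu>"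
proof -
  show *: "prob_space \<mu>" "sets \<mu> = sets borel" "AE z in \<mu>. z \<in> cball 0 R"
    using assms by (auto simp: probs_on_def)
  show "space \<mu> = UNIV" using sets_eq_imp_space_eq[OF *(2)] by simp
  interpret prob_space \<mu> by fact
  show "sigma_finite_measure \<mu>" "finite_measure \<mu>" by unfold_locales
qed

text \<open>Encoding the disc in the unit interval turns compactness into Helly's selection theorem
  for laws on the line, where tightness is immediate. Skorohod's theorem upgrades weak convergence
  to pointwise convergence, and the continuous decoding carries it back to the plane. Pointwise
  convergence is the form in which Fatou's lemma can be applied.\<close>

lemma probs_on_subsequence:
  assumes R: "R > 0" and \<mu>: "\<And>n. \<mu> n \<in> probs_on R"
  shows "\<exists>(N :: real measure) (s :: nat \<Rightarrow> nat) (X :: nat \<Rightarrow> real \<Rightarrow> complex) Y.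
    prob_space N \<and> strict_mono s \<and> (\<forall>n. X n \<in> borel_measurable N) \<and> Y \<in> borel_measurable N \<and>
    (\<forall>n. distr N borel (X n) = \<mu> (s n)) \<and> (\<forall>x \<in> space N. (\<lambda>n. X n x) \<longlonglongrightarrow> Y x)"
proof -
  obtain T :: "complex \<Rightarrow> real" and \<gamma> :: "real \<Rightarrow> complex" where
    T\<gamma>: "T \<in> borel_measurable borel \<and> (\<forall>z. 0 \<le> T z \<and> T z \<le> 1) \<and> continuous_on UNIV \<gamma> \<and> (\<forall>z \<in> cball 0 R. \<gamma> (T z) = z)"
    using exists_continuous_decoding[OF R] by (elim exE)
  then have T[measurable]: "T \<in> borel_measurable borel" and T01: "\<And>z. 0 \<le> T z" "\<And>z. T z \<le> 1"
    and \<gamma>: "continuous_on UNIV \<gamma>" and dec: "\<And>z. z \<in> cball 0 R \<Longrightarrow> \<gamma> (T z) = z"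
    by blast+
  have \<gamma>m[measurable]: "\<gamma> \<in> borel_measurable borel" using \<gamma> by (rule borel_measurable_continuous_onI)
  note sets_\<mu>[measurable_cong] = probs_onD(2)[OF \<mu>]
  define M where "M n = distr (\<mu> n) borel T" for n
  have M: "real_distribution (M n)" for n
  proof -
    interpret prob_space "\<mu> n" by (rule probs_onD(1)[OF \<mu>])
    interpret p: prob_space "M n" unfolding M_def by (rule prob_space_distr) measurable
    show ?thesis by unfold_locales (simp_all add: M_def)
  qed
  have "tight M"
    unfolding tight_def
  proof (intro conjI allI impI M)
    fix \<epsilon> :: real assume "\<epsilon> > 0"
    \<comment> \<open>The definition of tightness uses intervals open on the left, hence -1 as left
      end point, so that the possible value 0 is included.\<close>
    have "measure (M n) {-1<..1} = 1" for n
    proof -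
      interpret prob_space "\<mu> n" by (rule probs_onD(1)[OF \<mu>])
      have "-1 < T z" for z using T01(1)[of z] by linarith
      then have "T -` {-1<..1} \<inter> space (\<mu> n) = space (\<mu> n)"
        using T01(2) by auto
      then show ?thesis unfolding M_def by (subst measure_distr) (auto simp: prob_space)
    qed
    then show "\<exists>a b. a < b \<and> (\<forall>n. 1 - \<epsilon> < measure (M n) {a<..b})"
      using \<open>\<epsilon> > 0\<close> by (intro exI[of _ "-1"] exI[of _ 1]) auto
  qed
  then obtain s L where s: "strict_mono s" and L: "real_distribution L" "weak_conv_m (M \<circ> id \<circ> s) L"
    using tight_imp_convergent_subsubsequence[of M id] strict_mono_id by (auto simp: id_def)
  have Ms: "real_distribution ((M \<circ> id \<circ> s) n)" for n using M by simp
  obtain N :: "real measure" and Ys :: "nat \<Rightarrow> real \<Rightarrow> real" and Yl :: "real \<Rightarrow> real" where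
    sk: "prob_space N \<and> (\<forall>n. Ys n \<in> measurable N borel) \<and> (\<forall>n. distr N borel (Ys n) = (M \<circ> id \<circ> s) n) \<and>
      Yl \<in> measurable N lborel \<and> distr N borel Yl = L \<and> (\<forall>x\<in>space N. (\<lambda>n. Ys n x) \<longlonglongrightarrow> Yl x)"
    using Skorohod[OF Ms L] by (elim exE)
  then have N: "prob_space N"
    and Ys: "\<And>n. Ys n \<in> measurable N borel" "\<And>n. distr N borel (Ys n) = (M \<circ> id \<circ> s) n"
    and Yl: "Yl \<in> measurable N lborel" and conv: "\<And>x. x \<in> space N \<Longrightarrow> (\<lambda>n. Ys n x) \<longlonglongrightarrow> Yl x"
    by blast+
  show ?thesis
  proof (intro exI[of _ N] exI[of _ s] exI[of _ "\<lambda>n x. \<gamma> (Ys n x)"] exI[of _ "\<lambda>x. \<gamma> (Yl x)"] conjI allI ballI N s)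
    show "(\<lambda>x. \<gamma> (Ys n x)) \<in> borel_measurable N" for n using Ys(1) by measurable
    show "(\<lambda>x. \<gamma> (Yl x)) \<in> borel_measurable N" using Yl by (simp cong: measurable_cong_sets)
    show "(\<lambda>n. \<gamma> (Ys n x)) \<longlonglongrightarrow> \<gamma> (Yl x)" if "x \<in> space N" for x
      using conv[OF that] \<gamma> by (auto simp: continuous_on_def dest!: tendsto_compose)
    show "distr N borel (\<lambda>x. \<gamma> (Ys n x)) = \<mu> (s n)" for n
    proof -
      have "distr N borel (\<lambda>x. \<gamma> (Ys n x)) = distr (distr N borel (Ys n)) borel \<gamma>"
        using Ys(1) by (subst distr_distr) (auto simp: o_def)
      also have "\<dots> = distr (\<mu> (s n)) borel (\<gamma> \<circ> T)"
        unfolding Ys(2) by (simp add: M_def distr_distr)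
      also have "\<dots> = distr (\<mu> (s n)) (\<mu> (s n)) (\<lambda>x. x)"
      proof (rule distr_cong_AE)
        show "AE x in \<mu> (s n). (\<gamma> \<circ> T) x = x"
          using probs_onD(3)[OF \<mu>[of "s n"]] by eventually_elim (simp add: dec)
      qed (auto simp: sets_\<mu>)
      also have "\<dots> = \<mu> (s n)" by (rule distr_id2) simp
      finally show ?thesis .
    qed
  qed
qed

section \<open>Energy minimizers on a disc\<close>

lemma ennreal_two_mult: "0 \<le> x \<Longrightarrow> 2 * ennreal x = ennreal (2 * x)"
  by (simp add: ennreal_mult)

lemma liminf_add_le_ennreal:
  fixes f g :: "nat \<Rightarrow> ennreal"
  shows "liminf f + liminf g \<le> liminf (\<lambda>n. f n + g n)"
proof -
  have inc: "incseq (\<lambda>n. INF m\<in>{n..}. h m)" for h :: "nat \<Rightarrow> ennreal"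
    by (auto simp: incseq_def intro!: INF_superset_mono)
  have "liminf f + liminf g = (SUP n. (INF m\<in>{n..}. f m) + (INF m\<in>{n..}. g m))"
    unfolding liminf_SUP_INF by (intro ennreal_SUP_add[symmetric] inc)
  also have "\<dots> \<le> liminf (\<lambda>n. f n + g n)"
    unfolding liminf_SUP_INF by (intro SUP_mono' INF_greatest add_mono INF_lower)
  finally show ?thesis .
qed

text \<open>As a map into \<open>[0, \<infinity>]\<close> the kernel is continuous also on the
  diagonal. This gives lower semicontinuity of potentials and energies through Fatou's
  lemma.\<close>

lemma tendsto_log_kernel:
  assumes f: "(f \<longlongrightarrow> z) F" and g: "(g \<longlongrightarrow> w) F" and R: "R > 0"
  shows "((\<lambda>x. log_kernel R (f x) (g x)) \<longlongrightarrow> log_kernel R z w) F"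
proof (cases "z = w")
  case False
  have d: "((\<lambda>x. norm (f x - g x)) \<longlongrightarrow> norm (z - w)) F"
    by (intro tendsto_intros f g)
  have "\<forall>\<^sub>F x in F. 0 < norm (f x - g x)"
    using d False by (intro order_tendstoD(1)) auto
  then have ev: "\<forall>\<^sub>F x in F. ennreal (ln (2 * R) - ln (norm (f x - g x))) = log_kernel R (f x) (g x)"
    by eventually_elim (auto simp: log_kernel_def)
  have "((\<lambda>x. ennreal (ln (2 * R) - ln (norm (f x - g x)))) \<longlongrightarrow> ennreal (ln (2 * R) - ln (norm (z - w)))) F"
    using False by (intro tendsto_intros d) auto
  then show ?thesis
    using Lim_transform_eventually[OF _ ev] False by (simp add: log_kernel_def)
next
  case True
  have d: "((\<lambda>x. norm (f x - g x)) \<longlongrightarrow> 0) F"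
    using tendsto_norm[OF tendsto_diff[OF f g]] True by simp
  have "((\<lambda>x. log_kernel R (f x) (g x)) \<longlongrightarrow> top) F"
    unfolding tendsto_top_iff_ennreal
  proof (intro allI impI)
    fix l :: real assume "l \<ge> 0"
    have "\<forall>\<^sub>F x in F. norm (f x - g x) < 2 * R * exp (- l)"
      using d R by (intro order_tendstoD(2)) auto
    then show "\<forall>\<^sub>F x in F. ennreal l < log_kernel R (f x) (g x)"
    proof eventually_elim
      case (elim x)
      show ?case
      proof (cases "f x = g x")
        case False
        then have "ln (norm (f x - g x)) < ln (2 * R * exp (- l))"
          using elim R by (subst ln_less_cancel_iff) auto
        also have "\<dots> = ln (2 * R) - l" using R by (simp add: ln_mult)
        finally show ?thesis using False \<open>l \<ge> 0\<close> by (simp add: log_kernel_def ennreal_lessI)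
      qed (simp add: log_kernel_def)
    qed
  qed
  then show ?thesis using True by (simp add: log_kernel_def)
qed

definition field_energy :: "real \<Rightarrow> (complex \<Rightarrow> ennreal) \<Rightarrow> complex measure \<Rightarrow> ennreal" where
  "field_energy R p \<mu> = mutual_energy R \<mu> \<mu> + 2 * (\<integral>\<^sup>+z. p z \<partial>\<mu>)"

definition lsc_seq :: "(complex \<Rightarrow> ennreal) \<Rightarrow> bool" where
  "lsc_seq p \<longleftrightarrow> (\<forall>f z. f \<longlonglongrightarrow> z \<longrightarrow> p z \<le> liminf (\<lambda>n. p (f n)))"

lemma return_in_probs_on: "R > 0 \<Longrightarrow> return borel 0 \<in> probs_on R"
  by (auto simp: probs_on_def prob_space_return AE_return)

text \<open>Fatou's lemma along an almost surely convergent representation of a minimizing sequence.\<close>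

lemma field_energy_minimizer_exists:
  assumes R: "R > 0" and [measurable]: "p \<in> borel_measurable borel" and lsc: "lsc_seq p"
  shows "\<exists>\<mu>\<in>probs_on R. \<forall>\<nu>\<in>probs_on R. field_energy R p \<mu> \<le> field_energy R p \<nu>"
proof -
  define m where "m = Inf (field_energy R p ` probs_on R)"
  have "field_energy R p ` probs_on R \<noteq> {}" using return_in_probs_on[OF R] by blast
  from Inf_as_limit[OF this] obtain u where u: "\<And>n. u n \<in> field_energy R p ` probs_on R" "u \<longlonglongrightarrow> m"
    unfolding m_def by blast
  then have "\<forall>n. \<exists>\<mu>. \<mu> \<in> probs_on R \<and> u n = field_energy R p \<mu>" by blast
  then obtain \<mu> where \<mu>: "\<And>n. \<mu> n \<in> probs_on R" "\<And>n. u n = field_energy R p (\<mu> n)" by metis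
  obtain N :: "real measure" and s X Y where
    rep: "prob_space N \<and> strict_mono s \<and> (\<forall>n. X n \<in> borel_measurable N) \<and> Y \<in> borel_measurable N \<and>
      (\<forall>n. distr N borel (X n) = \<mu> (s n)) \<and> (\<forall>x \<in> space N. (\<lambda>n. X n x) \<longlonglongrightarrow> Y x)"
    using probs_on_subsequence[OF R, of \<mu>, OF \<mu>(1)] by (elim exE)
  then have N: "prob_space N" and s: "strict_mono s"
    and X[measurable]: "\<And>n. X n \<in> borel_measurable N" and Y[measurable]: "Y \<in> borel_measurable N"
    and dX: "\<And>n. distr N borel (X n) = \<mu> (s n)"
    and conv: "\<And>x. x \<in> space N \<Longrightarrow> (\<lambda>n. X n x) \<longlonglongrightarrow> Y x"
    by blast+
  interpret N: prob_space N by fact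
  define M where "M = distr N borel Y"
  have energy_distr: "field_energy R p (distr N borel Z)
      = (\<integral>\<^sup>+x. (\<integral>\<^sup>+y. log_kernel R (Z x) (Z y) \<partial>N) \<partial>N) + 2 * (\<integral>\<^sup>+x. p (Z x) \<partial>N)"
    if [measurable]: "Z \<in> borel_measurable N" for Z
    unfolding field_energy_def mutual_energy_def by (simp add: nn_integral_distr)
  have "(\<integral>\<^sup>+x. (\<integral>\<^sup>+y. log_kernel R (Y x) (Y y) \<partial>N) \<partial>N)
      \<le> (\<integral>\<^sup>+x. liminf (\<lambda>n. \<integral>\<^sup>+y. log_kernel R (X n x) (X n y) \<partial>N) \<partial>N)"
  proof (rule nn_integral_mono)
    fix x assume x: "x \<in> space N"
    have "(\<integral>\<^sup>+y. log_kernel R (Y x) (Y y) \<partial>N) = (\<integral>\<^sup>+y. liminf (\<lambda>n. log_kernel R (X n x) (X n y)) \<partial>N)"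
      by (intro nn_integral_cong lim_imp_Liminf[symmetric] tendsto_log_kernel conv R x) auto
    also have "\<dots> \<le> liminf (\<lambda>n. \<integral>\<^sup>+y. log_kernel R (X n x) (X n y) \<partial>N)"
      by (rule nn_integral_liminf) simp
    finally show "(\<integral>\<^sup>+y. log_kernel R (Y x) (Y y) \<partial>N) \<le> liminf (\<lambda>n. \<integral>\<^sup>+y. log_kernel R (X n x) (X n y) \<partial>N)" .
  qed
  also have "\<dots> \<le> liminf (\<lambda>n. \<integral>\<^sup>+x. (\<integral>\<^sup>+y. log_kernel R (X n x) (X n y) \<partial>N) \<partial>N)"
    by (rule nn_integral_liminf) measurable
  finally have J: "(\<integral>\<^sup>+x. (\<integral>\<^sup>+y. log_kernel R (Y x) (Y y) \<partial>N) \<partial>N)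
      \<le> liminf (\<lambda>n. \<integral>\<^sup>+x. (\<integral>\<^sup>+y. log_kernel R (X n x) (X n y) \<partial>N) \<partial>N)" .
  have "(\<integral>\<^sup>+x. p (Y x) \<partial>N) \<le> (\<integral>\<^sup>+x. liminf (\<lambda>n. p (X n x)) \<partial>N)"
    using lsc conv by (intro nn_integral_mono) (auto simp: lsc_seq_def)
  also have "\<dots> \<le> liminf (\<lambda>n. \<integral>\<^sup>+x. p (X n x) \<partial>N)"
    by (rule nn_integral_liminf) simp
  finally have P: "(\<integral>\<^sup>+x. p (Y x) \<partial>N) \<le> liminf (\<lambda>n. \<integral>\<^sup>+x. p (X n x) \<partial>N)" .
  have "field_energy R p M \<le> liminf (\<lambda>n. field_energy R p (\<mu> (s n)))"
    unfolding M_def dX[symmetric] energy_distr[OF Y] energy_distr[OF X] mult_2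
    by (intro order_trans[OF _ liminf_add_le_ennreal] add_mono J P)
  also have "(\<lambda>n. field_energy R p (\<mu> (s n))) = u \<circ> s" by (auto simp: \<mu>(2))
  also have "liminf (u \<circ> s) = m"
    using LIMSEQ_subseq_LIMSEQ[OF u(2) s] by (rule lim_imp_Liminf[rotated]) simp
  finally have le: "field_energy R p M \<le> m" .
  have "AE x in N. \<forall>n. X n x \<in> cball 0 R"
  proof (subst AE_all_countable, intro allI)
    fix n
    have "AE z in distr N borel (X n). z \<in> cball 0 R"
      unfolding dX using probs_onD(3)[OF \<mu>(1)] .
    then show "AE x in N. X n x \<in> cball 0 R" by (subst (asm) AE_distr_iff) auto
  qed
  then have "AE x in N. Y x \<in> cball 0 R"
  proof (rule AE_mp, intro AE_I2 impI)
    fix x assume x: "x \<in> space N" "\<forall>n. X n x \<in> cball 0 R"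
    then show "Y x \<in> cball 0 R"
      using closed_sequentially[OF closed_cball[of 0 R], of "\<lambda>n. X n x" "Y x"] conv[OF x(1)] by blast
  qed
  then have "M \<in> probs_on R"
    by (auto simp: probs_on_def M_def AE_distr_iff intro!: N.prob_space_distr)
  moreover have "field_energy R p M \<le> field_energy R p \<nu>" if "\<nu> \<in> probs_on R" for \<nu>
    using le that unfolding m_def by (meson INF_lower order_trans)
  ultimately show ?thesis by blast
qed

section \<open>Variation of the energy along segments of measures\<close>

lemma mixture_exists:
  assumes \<mu>: "\<mu> \<in> probs_on R" and \<nu>: "\<nu> \<in> probs_on R" and e: "0 \<le> e" "e \<le> 1"
  obtains m where "m \<in> probs_on R"
    "\<And>f. f \<in> borel_measurable borel \<Longrightarrow> (\<integral>\<^sup>+z. f z \<partial>m) = ennreal (1 - e) * (\<integral>\<^sup>+z. f z \<partial>\<mu>) + ennreal e * (\<integral>\<^sup>+z. f z \<partial>\<nu>)"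
proof -
  define N where "N b = (if b then \<nu> else \<mu>)" for b
  define m where "m = measure_pmf (bernoulli_pmf e) \<bind> N"
  have Nb: "N b \<in> probs_on R" for b using \<mu> \<nu> by (simp add: N_def)
  have N_meas: "N \<in> measurable (measure_pmf (bernoulli_pmf e)) (subprob_algebra borel)"
  proof -
    have "N b \<in> space (subprob_algebra borel)" for b
      using probs_onD[OF Nb, of b] by (auto simp: space_subprob_algebra intro!: prob_space_imp_subprob_space)
    then show ?thesis by (auto simp: measurable_def)
  qed
  have sets: "sets m = sets borel" unfolding m_def
    by (subst sets_bind[of _ _ borel]) (auto simp: probs_onD[OF Nb])
  have int: "(\<integral>\<^sup>+z. f z \<partial>m) = ennreal (1 - e) * (\<integral>\<^sup>+z. f z \<partial>\<mu>) + ennreal e * (\<integral>\<^sup>+z. f z \<partial>\<nu>)"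
    if "f \<in> borel_measurable borel" for f
    unfolding m_def using that e by (subst nn_integral_bind[OF that N_meas]) (simp add: N_def mult.commute add.commute)
  have "prob_space m"
    unfolding m_def
    by (rule prob_space.prob_space_bind[OF measure_pmf.prob_space_axioms _ N_meas]) (simp add: probs_onD[OF Nb])
  moreover have "AE z in m. z \<in> cball 0 R"
  proof -
    have "(\<integral>\<^sup>+z. indicator (- cball 0 R) z \<partial>M) = 0" if M: "M \<in> probs_on R" for M
    proof -
      note [measurable_cong] = probs_onD(2)[OF M]
      show ?thesis
        using probs_onD(3)[OF M] by (subst nn_integral_0_iff_AE) (auto simp: indicator_def elim!: eventually_mono)
    qed
    then have "(\<integral>\<^sup>+z. indicator (- cball 0 R) z \<partial>m) = 0"
      using \<mu> \<nu> by (subst int) auto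
    then show ?thesis
      using sets by (subst (asm) nn_integral_0_iff_AE) (auto simp: indicator_def measurable_cong_sets[OF sets refl] split: if_splits)
  qed
  ultimately show ?thesis using that[of m] sets int by (auto simp: probs_on_def)
qed

lemma log_kernel_measurable_integral:
  assumes "\<mu> \<in> probs_on R"
  shows "(\<lambda>z. \<integral>\<^sup>+w. log_kernel R' z w \<partial>\<mu>) \<in> borel_measurable borel"
proof -
  interpret sigma_finite_measure \<mu> by (rule probs_onD(5)[OF assms])
  note [measurable_cong] = probs_onD(2)[OF assms]
  show ?thesis by measurable
qed

text \<open>The gap is nonnegative. In particular two finite self-energies force a finite mutual
  energy.\<close>

lemma mutual_energy_le_average:
  assumes "R > 0" "\<mu> \<in> probs_on R" "\<nu> \<in> probs_on R"
  shows "2 * mutual_energy R \<mu> \<nu> \<le> mutual_energy R \<mu> \<mu> + mutual_energy R \<nu> \<nu>"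
  using mutual_energy_gap[OF assms(1) probs_onD(1-3)[OF assms(2)] probs_onD(1-3)[OF assms(3)]]
  by (metis le_iff_add)

text \<open>The energy of \<open>(1 - e) \<mu> + e \<nu>\<close> is a quadratic polynomial in
  \<open>e\<close> that is smallest at 0, so its linear coefficient is nonnegative. Finite energy of
  \<open>\<nu>\<close> makes all coefficients real numbers, the mixed one by the bound through the
  average.\<close>

lemma first_variation:
  assumes R: "R > 0" and p[measurable]: "p \<in> borel_measurable borel" and \<mu>: "\<mu> \<in> probs_on R" and \<nu>: "\<nu> \<in> probs_on R"
    and min: "\<And>m. m \<in> probs_on R \<Longrightarrow> field_energy R p \<mu> \<le> field_energy R p m"
    and fin: "field_energy R p \<nu> < \<infinity>"
  shows "mutual_energy R \<mu> \<mu> + (\<integral>\<^sup>+z. p z \<partial>\<mu>) \<le> mutual_energy R \<mu> \<nu> + (\<integral>\<^sup>+z. p z \<partial>\<nu>)"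
proof -
  have fin\<mu>: "field_energy R p \<mu> < \<infinity>" using min[OF \<nu>] fin by simp
  obtain A a where A: "mutual_energy R \<mu> \<mu> = ennreal A" "0 \<le> A" and a: "(\<integral>\<^sup>+z. p z \<partial>\<mu>) = ennreal a" "0 \<le> a"
    using fin\<mu> by (cases "mutual_energy R \<mu> \<mu>"; cases "\<integral>\<^sup>+z. p z \<partial>\<mu>") (auto simp: field_energy_def ennreal_mult_top)
  obtain C c where C: "mutual_energy R \<nu> \<nu> = ennreal C" "0 \<le> C" and c: "(\<integral>\<^sup>+z. p z \<partial>\<nu>) = ennreal c" "0 \<le> c"
    using fin by (cases "mutual_energy R \<nu> \<nu>"; cases "\<integral>\<^sup>+z. p z \<partial>\<nu>") (auto simp: field_energy_def ennreal_mult_top)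
  have "2 * mutual_energy R \<mu> \<nu> < \<infinity>"
    using mutual_energy_le_average[OF R \<mu> \<nu>] by (auto simp: A C intro: le_less_trans)
  then obtain B where B: "mutual_energy R \<mu> \<nu> = ennreal B" "0 \<le> B"
    by (cases "mutual_energy R \<mu> \<nu>") (auto simp: ennreal_mult_top)
  have comm: "mutual_energy R \<nu> \<mu> = ennreal B"
    using mutual_energy_commute probs_onD[OF \<mu>] probs_onD[OF \<nu>] B(1) by metis
  have quad: "A + 2 * a \<le> (1 - e)\<^sup>2 * A + 2 * (e * (1 - e)) * B + e\<^sup>2 * C + 2 * ((1 - e) * a + e * c)"
    if e: "0 < e" "e < 1" for e
  proof -
    obtain m where m: "m \<in> probs_on R"
      "\<And>f. f \<in> borel_measurable borel \<Longrightarrow> (\<integral>\<^sup>+z. f z \<partial>m) = ennreal (1 - e) * (\<integral>\<^sup>+z. f z \<partial>\<mu>) + ennreal e * (\<integral>\<^sup>+z. f z \<partial>\<nu>)"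
      by (rule mixture_exists[OF \<mu> \<nu>, of e]) (use e in auto)
    have "mutual_energy R m m = (\<integral>\<^sup>+z. (ennreal (1 - e) * (\<integral>\<^sup>+w. log_kernel R z w \<partial>\<mu>) + ennreal e * (\<integral>\<^sup>+w. log_kernel R z w \<partial>\<nu>)) \<partial>m)"
      unfolding mutual_energy_def by (intro nn_integral_cong m(2)) measurable
    also have "\<dots> = ennreal (1 - e) * (\<integral>\<^sup>+z. (ennreal (1 - e) * (\<integral>\<^sup>+w. log_kernel R z w \<partial>\<mu>) + ennreal e * (\<integral>\<^sup>+w. log_kernel R z w \<partial>\<nu>)) \<partial>\<mu>)
        + ennreal e * (\<integral>\<^sup>+z. (ennreal (1 - e) * (\<integral>\<^sup>+w. log_kernel R z w \<partial>\<mu>) + ennreal e * (\<integral>\<^sup>+w. log_kernel R z w \<partial>\<nu>)) \<partial>\<nu>)"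
    proof (rule m(2))
      note [measurable] = log_kernel_measurable_integral[OF \<mu>, of R] log_kernel_measurable_integral[OF \<nu>, of R]
      show "(\<lambda>z. ennreal (1 - e) * (\<integral>\<^sup>+w. log_kernel R z w \<partial>\<mu>) + ennreal e * (\<integral>\<^sup>+w. log_kernel R z w \<partial>\<nu>)) \<in> borel_measurable borel"
        by measurable
    qed
    also have "\<dots> = ennreal (1 - e) * (ennreal (1 - e) * ennreal A + ennreal e * ennreal B)
        + ennreal e * (ennreal (1 - e) * ennreal B + ennreal e * ennreal C)"
    proof -
      have "(\<integral>\<^sup>+z. (ennreal (1 - e) * (\<integral>\<^sup>+w. log_kernel R z w \<partial>\<mu>) + ennreal e * (\<integral>\<^sup>+w. log_kernel R z w \<partial>\<nu>)) \<partial>M)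
          = ennreal (1 - e) * mutual_energy R M \<mu> + ennreal e * mutual_energy R M \<nu>" if M: "M \<in> probs_on R" for M
      proof -
        note [measurable_cong] = probs_onD(2)[OF M]
        note [measurable] = log_kernel_measurable_integral[OF \<mu>] log_kernel_measurable_integral[OF \<nu>]
        show ?thesis
          unfolding mutual_energy_def by (subst nn_integral_add) (simp_all add: nn_integral_cmult)
      qed
      then show ?thesis using \<mu> \<nu> by (simp add: A B C comm)
    qed
    also have "\<dots> = ennreal ((1 - e)\<^sup>2 * A + 2 * (e * (1 - e)) * B + e\<^sup>2 * C)"
    proof -
      have "ennreal (1 - e) * (ennreal (1 - e) * ennreal A + ennreal e * ennreal B)
          + ennreal e * (ennreal (1 - e) * ennreal B + ennreal e * ennreal C)
          = ennreal ((1 - e) * ((1 - e) * A + e * B) + e * ((1 - e) * B + e * C))"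
        using e A(2) B(2) C(2) by (simp flip: ennreal_mult ennreal_plus)
      also have "(1 - e) * ((1 - e) * A + e * B) + e * ((1 - e) * B + e * C)
          = (1 - e)\<^sup>2 * A + 2 * (e * (1 - e)) * B + e\<^sup>2 * C"
        by (simp add: power2_eq_square algebra_simps)
      finally show ?thesis .
    qed
    finally have J: "mutual_energy R m m = ennreal ((1 - e)\<^sup>2 * A + 2 * (e * (1 - e)) * B + e\<^sup>2 * C)" .
    have "field_energy R p m = ennreal ((1 - e)\<^sup>2 * A + 2 * (e * (1 - e)) * B + e\<^sup>2 * C) + 2 * (ennreal (1 - e) * ennreal a + ennreal e * ennreal c)"
      unfolding field_energy_def J by (simp add: m(2) a c)
    also have "\<dots> = ennreal ((1 - e)\<^sup>2 * A + 2 * (e * (1 - e)) * B + e\<^sup>2 * C + 2 * ((1 - e) * a + e * c))"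
      using e A B C a c by (simp flip: ennreal_mult ennreal_plus ennreal_numeral)
    finally have "field_energy R p m = \<dots>" .
    moreover have "field_energy R p \<mu> = ennreal (A + 2 * a)"
      using A a by (simp add: field_energy_def ennreal_two_mult)
    ultimately have "ennreal (A + 2 * a) \<le> ennreal ((1 - e)\<^sup>2 * A + 2 * (e * (1 - e)) * B + e\<^sup>2 * C + 2 * ((1 - e) * a + e * c))"
      using min[OF m(1)] by (simp only:)
    moreover have "0 \<le> (1 - e)\<^sup>2 * A + 2 * (e * (1 - e)) * B + e\<^sup>2 * C + 2 * ((1 - e) * a + e * c)"
      using e A(2) B(2) C(2) a(2) c(2) by (intro add_nonneg_nonneg mult_nonneg_nonneg) auto
    ultimately show ?thesis by (subst (asm) ennreal_le_iff)
  qed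
  \<comment> \<open>The quadratic inequality with the value at \<open>e = 0\<close> subtracted and
    one factor \<open>e\<close> divided out; the limit \<open>e -> 0\<close> then isolates the
    linear coefficient.\<close>
  have lin: "0 \<le> 2 * (B + c - A - a) + e * (A - 2 * B + C)" if e: "0 < e" "e < 1" for e
  proof -
    have "0 \<le> e * (2 * (B + c - A - a) + e * (A - 2 * B + C))"
      using quad[OF e] by (simp add: power2_eq_square algebra_simps)
    then show ?thesis using e by (simp add: zero_le_mult_iff)
  qed
  have "((\<lambda>e. 2 * (B + c - A - a) + e * (A - 2 * B + C)) \<longlongrightarrow> 2 * (B + c - A - a) + 0 * (A - 2 * B + C)) (at_right 0)"
    by (intro tendsto_intros)
  moreover have "\<forall>\<^sub>F e in at_right 0. 0 \<le> 2 * (B + c - A - a) + e * (A - 2 * B + C)"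
    unfolding eventually_at_right_field using lin by (intro exI[of _ 1]) auto
  ultimately have "0 \<le> 2 * (B + c - A - a) + 0 * (A - 2 * B + C)"
    by (rule tendsto_lowerbound) simp
  then have "A + a \<le> B + c" by simp
  then show ?thesis
    using A B C a c by (simp flip: ennreal_plus)
qed

text \<open>Converse of the first variation, and the place where convexity enters: the energy of
  \<open>\<nu>\<close> exceeds that of \<open>\<mu>\<close> by at least the gap, which vanishes only
  for equal measures.\<close>

lemma strict_minimizer:
  assumes R: "R > 0" and \<mu>: "\<mu> \<in> probs_on R" and fin: "field_energy R p \<mu> < \<infinity>"
    and var: "\<And>\<nu>. \<nu> \<in> probs_on R \<Longrightarrow> field_energy R p \<nu> < \<infinity> \<Longrightarrow>
      mutual_energy R \<mu> \<mu> + (\<integral>\<^sup>+z. p z \<partial>\<mu>) \<le> mutual_energy R \<mu> \<nu> + (\<integral>\<^sup>+z. p z \<partial>\<nu>)"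
    and \<nu>: "\<nu> \<in> probs_on R" "\<nu> \<noteq> \<mu>"
  shows "field_energy R p \<mu> < field_energy R p \<nu>"
proof (cases "field_energy R p \<nu> < \<infinity>")
  case True
  obtain E where E: "mutual_energy R \<mu> \<mu> + mutual_energy R \<nu> \<nu> = 2 * mutual_energy R \<mu> \<nu> + E" "E = 0 \<Longrightarrow> \<mu> = \<nu>"
    using mutual_energy_gap[OF R probs_onD(1-3)[OF \<mu>] probs_onD(1-3)[OF \<nu>(1)]] by metis
  obtain A a where A: "mutual_energy R \<mu> \<mu> = ennreal A" "0 \<le> A" and a: "(\<integral>\<^sup>+z. p z \<partial>\<mu>) = ennreal a" "0 \<le> a"
    using fin by (cases "mutual_energy R \<mu> \<mu>"; cases "\<integral>\<^sup>+z. p z \<partial>\<mu>") (auto simp: field_energy_def ennreal_mult_top)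
  obtain C c where C: "mutual_energy R \<nu> \<nu> = ennreal C" "0 \<le> C" and c: "(\<integral>\<^sup>+z. p z \<partial>\<nu>) = ennreal c" "0 \<le> c"
    using True by (cases "mutual_energy R \<nu> \<nu>"; cases "\<integral>\<^sup>+z. p z \<partial>\<nu>") (auto simp: field_energy_def ennreal_mult_top)
  have lt: "2 * mutual_energy R \<mu> \<nu> + E < \<infinity>" using A C by (simp flip: E(1))
  then obtain B e where B: "mutual_energy R \<mu> \<nu> = ennreal B" "0 \<le> B" and e: "E = ennreal e" "0 \<le> e"
    by (cases "mutual_energy R \<mu> \<nu>"; cases E) (auto simp: ennreal_mult_top)
  have "e \<noteq> 0" using E(2) \<nu>(2) e by auto
  have "ennreal (A + C) = ennreal (2 * B + e)"
    using E(1) A(2) B(2) C(2) e(2) unfolding A(1) B(1) C(1) e(1) ennreal_two_mult[OF B(2)]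
    by (simp flip: ennreal_plus)
  then have "A + C = 2 * B + e" using A B C e by (subst (asm) ennreal_inj) auto
  moreover have "ennreal (A + a) \<le> ennreal (B + c)"
    using var[OF \<nu>(1) True] A B C a c by (simp flip: ennreal_plus)
  then have "A + a \<le> B + c" using A B C a c by (subst (asm) ennreal_le_iff) auto
  ultimately have "A + 2 * a < C + 2 * c" using \<open>e \<noteq> 0\<close> e by linarith
  then have "ennreal (A + 2 * a) < ennreal (C + 2 * c)" using A a by (intro ennreal_lessI) auto
  then show ?thesis
    using A C a c by (simp add: field_energy_def ennreal_two_mult)
qed (use fin in \<open>auto simp: less_top[symmetric]\<close>)

section \<open>Weighted energy and admissible fields\<close>

text \<open>The bound \<open>|w - z| \<le> (1 + |z|) (1 + |w|)\<close> separates the variables, so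
  that growth of the field at each point can compensate the kernel.\<close>

lemma ln_recip_lower: "- ereal (ln (1 + norm z)) - ereal (ln (1 + norm w)) \<le> ln_recip (norm (w - z :: complex))"
proof (cases "z = w")
  case False
  have pos: "0 < 1 + norm z" "0 < 1 + norm w" by (auto intro: add_pos_nonneg)
  have "norm (w - z) \<le> norm w + norm z" by (rule norm_triangle_ineq4)
  also have "\<dots> \<le> (1 + norm z) * (1 + norm w)" by (simp add: algebra_simps)
  finally have "ln (norm (w - z)) \<le> ln ((1 + norm z) * (1 + norm w))"
    using False mult_pos_pos[OF pos] by (subst ln_le_cancel_iff) auto
  also have "\<dots> = ln (1 + norm z) + ln (1 + norm w)"
    using pos by (intro ln_mult_pos)
  finally show ?thesis using False by (simp add: ln_recip_def ln_div)
qed (simp add: ln_recip_def)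

lemma ln_recip_not_MInf [simp]: "ln_recip t \<noteq> -\<infinity>"
  by (simp add: ln_recip_def)

lemma borel_measurable_ln_recip[measurable]: "ln_recip \<in> borel_measurable borel"
  unfolding ln_recip_def by measurable

text \<open>The lower bound is logarithmic because \<open>ln (1 + |z|)\<close> is exactly what each
  variable can contribute to the negative part of the kernel.\<close>

definition field_above :: "(complex \<Rightarrow> ereal) \<Rightarrow> real \<Rightarrow> bool" where
  "field_above P M \<longleftrightarrow> P \<in> borel_measurable borel \<and> (\<forall>z. ereal (ln (1 + norm z) - M) \<le> P z)"

text \<open>The integrand of the weighted energy, with the field distributed over both variables and
  the shift \<open>2 M\<close> that makes it nonnegative. It unites two terms whose separate
  integrals may be infinite of opposite signs.\<close>

definition energy_kernel :: "(complex \<Rightarrow> ereal) \<Rightarrow> real \<Rightarrow> complex \<Rightarrow> complex \<Rightarrow> ereal" where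
  "energy_kernel P M z w = ln_recip (norm (w - z)) + P z + P w + ereal (2 * M)"

lemma field_above_not_MInf: "field_above P M \<Longrightarrow> P z \<noteq> -\<infinity>"
  by (auto simp: field_above_def) (metis MInfty_neq_ereal(1) ereal_infty_less_eq(2))

lemma field_above_ge:
  assumes "field_above P M"
  shows "ereal (- M) \<le> P z"
proof -
  have "- M \<le> ln (1 + norm z) - M" by simp
  then have "ereal (- M) \<le> ereal (ln (1 + norm z) - M)" by (simp only: ereal_less_eq)
  also have "\<dots> \<le> P z" using assms by (simp add: field_above_def)
  finally show ?thesis .
qed

lemma energy_kernel_lower:
  assumes "field_above P M"
  shows "(P z - ereal (ln (1 + norm z)) + ereal M) + (P w - ereal (ln (1 + norm w)) + ereal M) \<le> energy_kernel P M z w"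
  using ln_recip_lower[of z w] field_above_not_MInf[OF assms, of z] field_above_not_MInf[OF assms, of w]
  unfolding energy_kernel_def
  by (cases "P z"; cases "P w"; cases "ln_recip (norm (w - z))") auto

lemma energy_kernel_nonneg:
  assumes "field_above P M"
  shows "0 \<le> energy_kernel P M z w"
proof -
  have "0 \<le> P z - ereal (ln (1 + norm z)) + ereal M" for z
  proof -
    have "ereal (ln (1 + norm z) - M) \<le> P z" using assms by (simp add: field_above_def)
    then show ?thesis by (cases "P z") auto
  qed
  from add_nonneg_nonneg[OF this this]
  have "0 \<le> (P z - ereal (ln (1 + norm z)) + ereal M) + (P w - ereal (ln (1 + norm w)) + ereal M)" .
  then show ?thesis using energy_kernel_lower[OF assms, of z w] by (rule order_trans)
qed

text \<open>The definition of the kernel with every negative part carried to the other side: free of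
  subtraction, it can be integrated term by term in \<open>ennreal\<close>.\<close>

lemma energy_kernel_pos_neg:
  assumes P: "field_above P M" and M: "0 \<le> M"
  shows "e2ennreal (energy_kernel P M z w) + e2ennreal (- ln_recip (norm (w - z))) + e2ennreal (- P z) + e2ennreal (- P w)
    = e2ennreal (ln_recip (norm (w - z))) + e2ennreal (P z) + e2ennreal (P w) + ennreal (2 * M)"
proof -
  have nn: "0 \<le> energy_kernel P M z w" by (rule energy_kernel_nonneg[OF P])
  note nz = field_above_not_MInf[OF P, of z] field_above_not_MInf[OF P, of w]
  show ?thesis
  proof (cases "P z = \<infinity> \<or> P w = \<infinity> \<or> ln_recip (norm (w - z)) = \<infinity>")
    case True
    then show ?thesis using nz ln_recip_not_MInf[of "norm (w - z)"]
      by (cases "P z"; cases "P w"; cases "ln_recip (norm (w - z))") (auto simp: energy_kernel_def)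
  next
    case False
    then obtain a b c where abc: "P z = ereal a" "P w = ereal b" "ln_recip (norm (w - z)) = ereal c"
      using nz ln_recip_not_MInf[of "norm (w - z)"] by (cases "P z"; cases "P w"; cases "ln_recip (norm (w - z))") auto
    have "0 \<le> c + a + b + 2 * M" using nn abc by (simp add: energy_kernel_def)
    then have mx: "max 0 (c + a + b + 2 * M) + max 0 (- c) + max 0 (- a) + max 0 (- b) = max 0 c + max 0 a + max 0 b + 2 * M"
      by (simp add: max_def)
    have gen: "ennreal w + ennreal x + ennreal y + ennreal z = ennreal (w + x + y + z)"
      if "0 \<le> w" "0 \<le> x" "0 \<le> y" "0 \<le> z" for w x y z
      using that by simp
    have e2: "e2ennreal (ereal x) = ennreal (max 0 x)" for x
      by (cases "0 \<le> x") (auto simp: ennreal_neg max_def)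
    have "e2ennreal (ereal (c + a + b + 2 * M)) + e2ennreal (ereal (- c)) + e2ennreal (ereal (- a)) + e2ennreal (ereal (- b))
        = e2ennreal (ereal c) + e2ennreal (ereal a) + e2ennreal (ereal b) + ennreal (2 * M)"
      unfolding e2 using M by (subst (1 2) gen) (auto simp: mx simp del: ennreal_plus)
    then show ?thesis unfolding energy_kernel_def abc by simp
  qed
qed

section \<open>Comparison of the weighted energy with an energy of nonnegative kernel\<close>

definition kernel_energy :: "(complex \<Rightarrow> ereal) \<Rightarrow> real \<Rightarrow> complex measure \<Rightarrow> ennreal" where
  "kernel_energy P M \<nu> = (\<integral>\<^sup>+z. (\<integral>\<^sup>+w. e2ennreal (energy_kernel P M z w) \<partial>\<nu>) \<partial>\<nu>)"

lemma borel_probsD: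
  assumes "\<nu> \<in> borel_probs"
  shows "prob_space \<nu>" "sets \<nu> = sets borel"
  using assms by (auto simp: borel_probs_def)

lemma probs_on_borel_probs: "\<nu> \<in> probs_on R \<Longrightarrow> \<nu> \<in> borel_probs"
  by (simp add: probs_on_def borel_probs_def)

text \<open>If \<open>ln (1 + |z|)\<close> is integrable, all negative parts have finite integrals
  and the terms may be rearranged. Otherwise the field has integral \<open>\<infinity>\<close>,
  because it dominates \<open>ln (1 + |z|)\<close> up to a constant, and the weighted energy is
  \<open>\<infinity>\<close>; then only the inequality is claimed.\<close>

lemma
  assumes P: "field_above P M" and M: "0 \<le> M" and \<nu>: "\<nu> \<in> borel_probs"
  shows weighted_energy_eq_kernel_energy:
      "(\<integral>\<^sup>+z. ennreal (ln (1 + norm z)) \<partial>\<nu>) < \<infinity> \<Longrightarrow> weighted_energy P \<nu> = enn2ereal (kernel_energy P M \<nu>) - ereal (2 * M)"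
    and weighted_energy_ge_kernel_energy: "enn2ereal (kernel_energy P M \<nu>) - ereal (2 * M) \<le> weighted_energy P \<nu>"
proof -
  interpret prob_space \<nu> by (rule borel_probsD(1)[OF \<nu>])
  interpret pp: pair_prob_space \<nu> \<nu> ..
  note [measurable_cong] = borel_probsD(2)[OF \<nu>]
  have [measurable]: "P \<in> borel_measurable borel" using P by (simp add: field_above_def)
  have [measurable]: "(\<lambda>(z, w). energy_kernel P M z w) \<in> borel_measurable (borel \<Otimes>\<^sub>M borel)"
    unfolding energy_kernel_def split_beta by measurable
  define Pp where "Pp = (\<integral>\<^sup>+z. e2ennreal (P z) \<partial>\<nu>)"
  define Pn where "Pn = (\<integral>\<^sup>+z. e2ennreal (- P z) \<partial>\<nu>)"
  have Pn: "Pn < \<infinity>"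
  proof -
    have "Pn \<le> (\<integral>\<^sup>+z. ennreal M \<partial>\<nu>)"
      unfolding Pn_def
    proof (rule nn_integral_mono)
      fix z :: complex
      have "- P z \<le> ereal M" using field_above_ge[OF P, of z] by (cases "P z") auto
      then show "e2ennreal (- P z) \<le> ennreal M" using e2ennreal_mono by fastforce
    qed
    then show ?thesis by (simp add: emeasure_space_1 le_less_trans)
  qed
  show eq: "weighted_energy P \<nu> = enn2ereal (kernel_energy P M \<nu>) - ereal (2 * M)"
    if ln_fin: "(\<integral>\<^sup>+z. ennreal (ln (1 + norm z)) \<partial>\<nu>) < \<infinity>"
  proof -
    define Lp where "Lp = (\<integral>\<^sup>+z. (\<integral>\<^sup>+w. e2ennreal (ln_recip (norm (w - z))) \<partial>\<nu>) \<partial>\<nu>)"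
    define Ln where "Ln = (\<integral>\<^sup>+z. (\<integral>\<^sup>+w. e2ennreal (- ln_recip (norm (w - z))) \<partial>\<nu>) \<partial>\<nu>)"
    have "Ln \<le> (\<integral>\<^sup>+z. (\<integral>\<^sup>+w. ennreal (ln (1 + norm z)) + ennreal (ln (1 + norm w)) \<partial>\<nu>) \<partial>\<nu>)"
      unfolding Ln_def
    proof (intro nn_integral_mono)
      fix z w :: complex
      have "- ln_recip (norm (w - z)) \<le> ereal (ln (1 + norm z) + ln (1 + norm w))"
        using ln_recip_lower[of z w] by (cases "ln_recip (norm (w - z))") auto
      then have "e2ennreal (- ln_recip (norm (w - z))) \<le> ennreal (ln (1 + norm z) + ln (1 + norm w))"
        using e2ennreal_mono by fastforce
      then show "e2ennreal (- ln_recip (norm (w - z))) \<le> ennreal (ln (1 + norm z)) + ennreal (ln (1 + norm w))"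
        by (simp add: ennreal_plus)
    qed
    also have "\<dots> = (\<integral>\<^sup>+z. ennreal (ln (1 + norm z)) \<partial>\<nu>) + (\<integral>\<^sup>+z. ennreal (ln (1 + norm z)) \<partial>\<nu>)"
      by (simp add: nn_integral_add emeasure_space_1)
    also have "\<dots> < \<infinity>" using ln_fin by (simp add: ennreal_add_eq_top less_top[symmetric])
    finally have Ln: "Ln < \<infinity>" .
    have "(\<integral>\<^sup>+z. (\<integral>\<^sup>+w. e2ennreal (energy_kernel P M z w) + e2ennreal (- ln_recip (norm (w - z))) + e2ennreal (- P z) + e2ennreal (- P w) \<partial>\<nu>) \<partial>\<nu>)
        = kernel_energy P M \<nu> + Ln + Pn + Pn"
      unfolding kernel_energy_def Ln_def Pn_def
      by (simp add: nn_integral_add emeasure_space_1 add_ac)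
    moreover have "(\<integral>\<^sup>+z. (\<integral>\<^sup>+w. e2ennreal (ln_recip (norm (w - z))) + e2ennreal (P z) + e2ennreal (P w) + ennreal (2 * M) \<partial>\<nu>) \<partial>\<nu>)
        = Lp + Pp + Pp + ennreal (2 * M)"
      unfolding Lp_def Pp_def
      by (simp add: nn_integral_add emeasure_space_1 add_ac)
    ultimately have sum: "kernel_energy P M \<nu> + Ln + Pn + Pn = Lp + Pp + Pp + ennreal (2 * M)"
      using energy_kernel_pos_neg[OF P M] by simp
    have "log_energy \<nu> = enn2ereal Lp - enn2ereal Ln"
      unfolding log_energy_def ereal_integral_def Lp_def Ln_def
      by (simp add: split_beta nn_integral_fst[symmetric])
    moreover have "ereal_integral \<nu> P = enn2ereal Pp - enn2ereal Pn"
      by (simp add: ereal_integral_def Pp_def Pn_def)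
    ultimately have W: "weighted_energy P \<nu> = (enn2ereal Lp - enn2ereal Ln) + 2 * (enn2ereal Pp - enn2ereal Pn)"
      by (simp add: weighted_energy_def)
    obtain n where n: "Ln = ennreal n" "0 \<le> n" using Ln by (cases Ln) auto
    obtain b where b: "Pn = ennreal b" "0 \<le> b" using Pn by (cases Pn) auto
    have sum': "enn2ereal (kernel_energy P M \<nu>) + ereal n + ereal b + ereal b = enn2ereal Lp + enn2ereal Pp + enn2ereal Pp + ereal (2 * M)"
      using arg_cong[OF sum, of enn2ereal] n b M by (simp add: plus_ennreal.rep_eq enn2ereal_ennreal)
    have W': "weighted_energy P \<nu> = (enn2ereal Lp - ereal n) + 2 * (enn2ereal Pp - ereal b)"
      using W n b by (simp add: enn2ereal_ennreal)
    have nnl: "0 \<le> enn2ereal Lp" "0 \<le> enn2ereal Pp" "0 \<le> enn2ereal (kernel_energy P M \<nu>)" by auto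
    show ?thesis
      unfolding W' using sum' nnl
      by (cases "enn2ereal Lp"; cases "enn2ereal Pp"; cases "enn2ereal (kernel_energy P M \<nu>)") (auto simp: times_ereal.simps numeral_eq_ereal)
  qed
  show "enn2ereal (kernel_energy P M \<nu>) - ereal (2 * M) \<le> weighted_energy P \<nu>"
  proof (cases "(\<integral>\<^sup>+z. ennreal (ln (1 + norm z)) \<partial>\<nu>) < \<infinity>")
    case False
    have "(\<integral>\<^sup>+z. ennreal (ln (1 + norm z)) \<partial>\<nu>) \<le> (\<integral>\<^sup>+z. e2ennreal (P z) + ennreal M \<partial>\<nu>)"
    proof (rule nn_integral_mono)
      fix z :: complex
      have "ereal (ln (1 + norm z) - M) \<le> P z" using P by (simp add: field_above_def)
      then show "ennreal (ln (1 + norm z)) \<le> e2ennreal (P z) + ennreal M"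
      proof (cases "P z")
        case (real r)
        then have "ln (1 + norm z) \<le> max 0 r + M" using \<open>ereal (ln (1 + norm z) - M) \<le> P z\<close> by simp
        then have "ennreal (ln (1 + norm z)) \<le> ennreal (max 0 r + M)" by (rule ennreal_leI)
        also have "\<dots> = e2ennreal (P z) + ennreal M"
          using M by (cases "0 \<le> r") (auto simp: real ennreal_plus ennreal_neg max_def)
        finally show ?thesis .
      qed auto
    qed
    also have "\<dots> = Pp + ennreal M" by (simp add: nn_integral_add emeasure_space_1 Pp_def)
    finally have "Pp = \<infinity>" using False by (auto simp: less_top[symmetric] top_unique ennreal_add_eq_top)
    moreover obtain b where b: "Pn = ennreal b" "0 \<le> b" using Pn by (cases Pn) auto
    ultimately have "ereal_integral \<nu> P = \<infinity>"
      by (simp add: ereal_integral_def Pp_def[symmetric] Pn_def[symmetric] enn2ereal_ennreal)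
    \<comment> \<open>This holds even if \<open>log_energy \<nu>\<close> is
      \<open>-\<infinity>\<close>, by the convention
      \<open>-\<infinity> + \<infinity> = \<infinity>\<close> in \<open>ereal\<close>.\<close>
    then have "weighted_energy P \<nu> = \<infinity>" by (cases "log_energy \<nu>") (auto simp: weighted_energy_def numeral_eq_ereal)
    then show ?thesis by simp
  qed (simp add: eq)
qed

text \<open>On the disc, \<open>ln (2 R)\<close> added to the energy kernel splits it into three
  nonnegative terms: the truncated kernel and the two shifted fields. The hypothesis
  \<open>1 \<le> 2 * R\<close> makes the added constant nonnegative.\<close>

lemma kernel_energy_eq_field_energy:
  assumes P: "field_above P M" and M: "0 \<le> M" and R: "1 \<le> 2 * R" and \<nu>: "\<nu> \<in> probs_on R"
  shows "field_energy R (\<lambda>z. e2ennreal (P z + ereal M)) \<nu> = kernel_energy P M \<nu> + ennreal (ln (2 * R))"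
proof -
  interpret prob_space \<nu> by (rule probs_onD(1)[OF \<nu>])
  note [measurable_cong] = probs_onD(2)[OF \<nu>]
  have [measurable]: "P \<in> borel_measurable borel" using P by (simp add: field_above_def)
  have [measurable]: "(\<lambda>(z, w). energy_kernel P M z w) \<in> borel_measurable (borel \<Otimes>\<^sub>M borel)"
    unfolding energy_kernel_def split_beta by measurable
  let ?p = "\<lambda>z. e2ennreal (P z + ereal M)"
  have "field_energy R ?p \<nu> = (\<integral>\<^sup>+z. (\<integral>\<^sup>+w. log_kernel R z w + ?p z + ?p w \<partial>\<nu>) \<partial>\<nu>)"
    unfolding field_energy_def mutual_energy_def by (simp add: nn_integral_add emeasure_space_1 mult_2 add_ac)
  also have "\<dots> = (\<integral>\<^sup>+z. (\<integral>\<^sup>+w. e2ennreal (energy_kernel P M z w) + ennreal (ln (2 * R)) \<partial>\<nu>) \<partial>\<nu>)"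
  proof (rule nn_integral_cong_AE)
    show "AE z in \<nu>. (\<integral>\<^sup>+w. log_kernel R z w + ?p z + ?p w \<partial>\<nu>) = (\<integral>\<^sup>+w. e2ennreal (energy_kernel P M z w) + ennreal (ln (2 * R)) \<partial>\<nu>)"
      using probs_onD(3)[OF \<nu>]
    proof eventually_elim
      case (elim z)
      show ?case
      proof (rule nn_integral_cong_AE)
        show "AE w in \<nu>. log_kernel R z w + ?p z + ?p w = e2ennreal (energy_kernel P M z w) + ennreal (ln (2 * R))"
          using probs_onD(3)[OF \<nu>]
        proof eventually_elim
          case (elim w)
          have nn: "0 \<le> energy_kernel P M z w" by (rule energy_kernel_nonneg[OF P])
          have nP: "0 \<le> P x + ereal M" for x
            using field_above_ge[OF P, of x] by (cases "P x") auto
          show ?case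
          proof (cases "P z = \<infinity> \<or> P w = \<infinity> \<or> z = w")
            case True
            then show ?thesis using nn field_above_not_MInf[OF P, of z] field_above_not_MInf[OF P, of w]
              by (cases "P z"; cases "P w"; cases "ln_recip (norm (w - z))") (auto simp: energy_kernel_def log_kernel_def ln_recip_def)
          next
            case False
            then obtain a b where ab: "P z = ereal a" "P w = ereal b"
              using field_above_not_MInf[OF P, of z] field_above_not_MInf[OF P, of w] by (cases "P z"; cases "P w") auto
            have "norm (z - w) \<le> 2 * R" using elim \<open>z \<in> cball 0 R\<close> norm_triangle_ineq4[of z w] by simp
            then have l: "ln (norm (z - w)) \<le> ln (2 * R)" using False by (intro ln_mono) auto
            have "log_kernel R z w + ?p z + ?p w = ennreal ((ln (2 * R) - ln (norm (z - w))) + (a + M) + (b + M))"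
            proof -
              have gen: "ennreal x + ennreal y + ennreal z = ennreal (x + y + z)" if "0 \<le> x" "0 \<le> y" "0 \<le> z" for x y z
                using that by simp
              show ?thesis
                using False l nP[of z] nP[of w] ab by (subst gen[symmetric]) (auto simp: log_kernel_def)
            qed
            also have "\<dots> = ennreal ((- ln (norm (z - w)) + a + b + 2 * M) + ln (2 * R))"
              by (simp add: algebra_simps)
            also have "\<dots> = ennreal (- ln (norm (z - w)) + a + b + 2 * M) + ennreal (ln (2 * R))"
              using nn False ab R by (intro ennreal_plus) (auto simp: energy_kernel_def ln_recip_def ln_div norm_minus_commute)
            also have "ennreal (- ln (norm (z - w)) + a + b + 2 * M) = e2ennreal (energy_kernel P M z w)"
              using False ab by (simp add: energy_kernel_def ln_recip_def ln_div norm_minus_commute)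
            finally show ?thesis .
          qed
        qed
      qed
    qed
  qed
  also have "\<dots> = kernel_energy P M \<nu> + ennreal (ln (2 * R))"
    unfolding kernel_energy_def by (simp add: nn_integral_add emeasure_space_1)
  finally show ?thesis .
qed

lemma probs_on_ln_finite:
  assumes "\<nu> \<in> probs_on R"
  shows "(\<integral>\<^sup>+z. ennreal (ln (1 + norm z)) \<partial>\<nu>) < \<infinity>"
proof -
  interpret prob_space \<nu> by (rule probs_onD(1)[OF assms])
  have "(\<integral>\<^sup>+z. ennreal (ln (1 + norm z)) \<partial>\<nu>) \<le> (\<integral>\<^sup>+z. ennreal (ln (1 + R)) \<partial>\<nu>)"
  proof (rule nn_integral_mono_AE)
    show "AE z in \<nu>. ennreal (ln (1 + norm z)) \<le> ennreal (ln (1 + R))"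
      using probs_onD(3)[OF assms]
    proof eventually_elim
      case (elim z)
      then have "0 < 1 + norm z" "1 + norm z \<le> 1 + R" by (auto intro: add_pos_nonneg)
      then show ?case by (intro ennreal_leI) (subst ln_le_cancel_iff; simp)
    qed
  qed
  also have "\<dots> < \<infinity>" by (simp add: emeasure_space_1)
  finally show ?thesis .
qed

lemma uniform_measure_probs_on:
  assumes \<nu>: "prob_space \<nu>" "sets \<nu> = sets borel" and A: "A \<in> sets borel" "A \<subseteq> cball 0 R" "emeasure \<nu> A \<noteq> 0"
  shows "uniform_measure \<nu> A \<in> probs_on R"
proof -
  interpret prob_space \<nu> by fact
  have "prob_space (uniform_measure \<nu> A)"
    using A(3) by (intro prob_space_uniform_measure) (auto simp: emeasure_eq_measure)
  moreover have "AE z in uniform_measure \<nu> A. z \<in> cball 0 R"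
    using A \<nu>(2) by (intro AE_uniform_measureI AE_I2) auto
  ultimately show ?thesis using \<nu>(2) by (simp add: probs_on_def)
qed

text \<open>Mass outside the disc only increases the energy, since the kernel is large there.\<close>

lemma kernel_energy_off_disc:
  assumes P: "field_above P M" and \<mu>: "\<mu> \<in> probs_on R"
    and min: "\<And>\<nu>. \<nu> \<in> probs_on R \<Longrightarrow> kernel_energy P M \<mu> \<le> kernel_energy P M \<nu>"
    and off: "\<And>z w. z \<notin> cball 0 R \<or> w \<notin> cball 0 R \<Longrightarrow> ereal T \<le> energy_kernel P M z w"
    and T: "kernel_energy P M \<mu> < ennreal T"
    and \<nu>: "\<nu> \<in> borel_probs" "\<nu> \<notin> probs_on R"
  shows "kernel_energy P M \<mu> < kernel_energy P M \<nu>"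
proof -
  interpret prob_space \<nu> by (rule borel_probsD(1)[OF \<nu>(1)])
  note sets_\<nu>[measurable_cong] = borel_probsD(2)[OF \<nu>(1)]
  have [measurable]: "P \<in> borel_measurable borel" using P by (simp add: field_above_def)
  have [measurable]: "(\<lambda>(z, w). energy_kernel P M z w) \<in> borel_measurable (borel \<Otimes>\<^sub>M borel)"
    unfolding energy_kernel_def split_beta by measurable
  define K where "K = cball (0::complex) R"
  have K[measurable]: "K \<in> sets borel" by (simp add: K_def)
  define L where "L z w = e2ennreal (energy_kernel P M z w)" for z w
  have [measurable]: "(\<lambda>(z, w). L z w) \<in> borel_measurable (borel \<Otimes>\<^sub>M borel)"
    unfolding L_def split_beta by measurable
  define a where "a = measure \<nu> K"
  have a: "emeasure \<nu> K = ennreal a" "0 \<le> a" "a \<le> 1"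
    by (auto simp: a_def emeasure_eq_measure)
  have sp: "space \<nu> = UNIV" using sets_eq_imp_space_eq[OF sets_\<nu>] by simp
  have "a \<noteq> 1"
  proof
    assume "a = 1"
    then have "AE z in \<nu>. z \<in> K" using prob_eq_1[of K] K sets_\<nu> by (simp add: a_def)
    then show False using \<nu> by (simp add: probs_on_def borel_probs_def K_def)
  qed
  then have a1: "a < 1" using a by simp
  have co: "emeasure \<nu> (- K) = ennreal (1 - a)"
    using prob_compl[of K] K sets_\<nu> sp by (simp add: emeasure_eq_measure a_def Compl_eq_Diff_UNIV)
  obtain x where x: "kernel_energy P M \<mu> = ennreal x" "0 \<le> x"
    using T by (cases "kernel_energy P M \<mu>") auto
  have xT: "x < T" "0 < T" using T x by (auto simp: ennreal_less_iff ennreal_neg not_less intro: le_less_trans)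
  \<comment> \<open>The measure \<open>\<nu>\<close> conditioned on the disc is a competitor there;
    undoing the normalization multiplies its energy by the square of the mass
    \<open>a\<close>.\<close>
  have inner: "ennreal (a\<^sup>2) * kernel_energy P M \<mu> \<le> (\<integral>\<^sup>+z. (\<integral>\<^sup>+w. L z w * indicator K w \<partial>\<nu>) * indicator K z \<partial>\<nu>)"
  proof (cases "a = 0")
    case False
    let ?u = "uniform_measure \<nu> K"
    have u: "?u \<in> probs_on R"
      using uniform_measure_probs_on[OF borel_probsD[OF \<nu>(1)] K] False a by (auto simp: K_def)
    have int: "(\<integral>\<^sup>+z. f z \<partial>?u) = (\<integral>\<^sup>+z. f z * indicator K z \<partial>\<nu>) / ennreal a"
      if [measurable]: "f \<in> borel_measurable borel" for f
      by (subst nn_integral_uniform_measure) (auto simp: a sets_\<nu>)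
    have "kernel_energy P M ?u = (\<integral>\<^sup>+z. (\<integral>\<^sup>+w. L z w * indicator K w \<partial>\<nu>) / ennreal a \<partial>?u)"
      unfolding kernel_energy_def L_def[symmetric] by (intro nn_integral_cong int) measurable
    also have "\<dots> = (\<integral>\<^sup>+z. ((\<integral>\<^sup>+w. L z w * indicator K w \<partial>\<nu>) / ennreal a) * indicator K z \<partial>\<nu>) / ennreal a"
      by (intro int) measurable
    also have "(\<integral>\<^sup>+z. ((\<integral>\<^sup>+w. L z w * indicator K w \<partial>\<nu>) / ennreal a) * indicator K z \<partial>\<nu>)
        = (\<integral>\<^sup>+z. ((\<integral>\<^sup>+w. L z w * indicator K w \<partial>\<nu>) * indicator K z) / ennreal a \<partial>\<nu>)"
      by (intro nn_integral_cong) (auto simp: indicator_def)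
    also have "\<dots> = (\<integral>\<^sup>+z. (\<integral>\<^sup>+w. L z w * indicator K w \<partial>\<nu>) * indicator K z \<partial>\<nu>) / ennreal a"
      by (rule nn_integral_divide) measurable
    finally have ku: "kernel_energy P M ?u = (\<integral>\<^sup>+z. (\<integral>\<^sup>+w. L z w * indicator K w \<partial>\<nu>) * indicator K z \<partial>\<nu>) / ennreal a / ennreal a" .
    have a0: "0 < a" using False a by simp
    have "ennreal (a\<^sup>2) * kernel_energy P M \<mu> \<le> ennreal (a\<^sup>2) * kernel_energy P M ?u"
      by (intro mult_left_mono min u) auto
    also have "\<dots> = (\<integral>\<^sup>+z. (\<integral>\<^sup>+w. L z w * indicator K w \<partial>\<nu>) * indicator K z \<partial>\<nu>)"
    proof -
      have "ennreal (a\<^sup>2) * (X / ennreal a / ennreal a) = X" for X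
      proof -
        have "ennreal (a\<^sup>2) = ennreal a * ennreal a" using a0 by (simp add: power2_eq_square ennreal_mult)
        moreover have "ennreal a * (Y / ennreal a) = Y" for Y
          using a0 by (simp add: ennreal_mult_divide_eq ennreal_times_divide mult.commute)
        ultimately show ?thesis by (simp add: mult.assoc)
      qed
      then show ?thesis unfolding ku .
    qed
    finally show ?thesis .
  qed simp
  \<comment> \<open>Off the square of \<open>K\<close> the kernel is at least \<open>T\<close>. That
    region has product mass \<open>1 - a^2\<close>, written as \<open>(1 - a) + (1 - a) * a\<close>
    to follow the two cases for the first point.\<close>
  have "ennreal (a\<^sup>2) * kernel_energy P M \<mu> + ennreal T * (ennreal (1 - a) + ennreal (1 - a) * ennreal a)
      \<le> (\<integral>\<^sup>+z. (\<integral>\<^sup>+w. L z w * indicator K w \<partial>\<nu>) * indicator K z \<partial>\<nu>)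
        + (\<integral>\<^sup>+z. ennreal T * (indicator (- K) z + ennreal (1 - a) * indicator K z) \<partial>\<nu>)"
  proof (intro add_mono inner eq_refl)
    have "(\<integral>\<^sup>+z. ennreal T * (indicator (- K) z + ennreal (1 - a) * indicator K z) \<partial>\<nu>)
        = ennreal T * (emeasure \<nu> (- K) + ennreal (1 - a) * emeasure \<nu> K)"
      by (subst nn_integral_cmult) (auto simp: nn_integral_add nn_integral_cmult sets_\<nu>)
    then show "ennreal T * (ennreal (1 - a) + ennreal (1 - a) * ennreal a)
        = (\<integral>\<^sup>+z. ennreal T * (indicator (- K) z + ennreal (1 - a) * indicator K z) \<partial>\<nu>)"
      by (simp add: co a)
  qed
  also have "\<dots> = (\<integral>\<^sup>+z. (\<integral>\<^sup>+w. L z w * indicator K w \<partial>\<nu>) * indicator K z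
        + ennreal T * (indicator (- K) z + ennreal (1 - a) * indicator K z) \<partial>\<nu>)"
    by (intro nn_integral_add[symmetric]) measurable
  also have "\<dots> \<le> (\<integral>\<^sup>+z. (\<integral>\<^sup>+w. L z w \<partial>\<nu>) \<partial>\<nu>)"
  proof (rule nn_integral_mono)
    fix z
    have TL: "ennreal T \<le> L z w" if "z \<notin> K \<or> w \<notin> K" for w
      unfolding L_def using e2ennreal_mono[OF off[of z w]] that by (simp add: K_def)
    show "(\<integral>\<^sup>+w. L z w * indicator K w \<partial>\<nu>) * indicator K z + ennreal T * (indicator (- K) z + ennreal (1 - a) * indicator K z)
        \<le> (\<integral>\<^sup>+w. L z w \<partial>\<nu>)"
    proof (cases "z \<in> K")
      case True
      have "(\<integral>\<^sup>+w. L z w * indicator K w \<partial>\<nu>) + ennreal T * ennreal (1 - a)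
          = (\<integral>\<^sup>+w. L z w * indicator K w + ennreal T * indicator (- K) w \<partial>\<nu>)"
        unfolding co[symmetric] by (subst nn_integral_add) (auto simp: nn_integral_cmult sets_\<nu>)
      also have "\<dots> \<le> (\<integral>\<^sup>+w. L z w \<partial>\<nu>)"
        by (intro nn_integral_mono) (auto simp: indicator_def intro: TL)
      finally show ?thesis using True by simp
    next
      case False
      have "ennreal T = (\<integral>\<^sup>+w. ennreal T \<partial>\<nu>)" by (simp add: emeasure_space_1)
      also have "\<dots> \<le> (\<integral>\<^sup>+w. L z w \<partial>\<nu>)"
        using False by (intro nn_integral_mono TL) auto
      finally show ?thesis using False by simp
    qed
  qed
  also have "\<dots> = kernel_energy P M \<nu>" by (simp add: kernel_energy_def L_def)
  finally have le: "ennreal (a\<^sup>2) * ennreal x + ennreal T * (ennreal (1 - a) + ennreal (1 - a) * ennreal a) \<le> kernel_energy P M \<nu>"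
    unfolding x(1) .
  have "x < a\<^sup>2 * x + T * ((1 - a) + (1 - a) * a)"
  proof -
    have "0 < (T - x) * ((1 - a) * (1 + a))" using xT a a1 by (intro mult_pos_pos) auto
    then show ?thesis by (simp add: power2_eq_square algebra_simps)
  qed
  then have "ennreal x < ennreal (a\<^sup>2 * x + T * ((1 - a) + (1 - a) * a))"
    using x by (intro ennreal_lessI) auto
  also have "\<dots> = ennreal (a\<^sup>2) * ennreal x + ennreal T * (ennreal (1 - a) + ennreal (1 - a) * ennreal a)"
  proof -
    have "ennreal (1 - a) + ennreal (1 - a) * ennreal a = ennreal ((1 - a) + (1 - a) * a)"
      using a a1 by (simp flip: ennreal_mult)
    moreover have "0 \<le> (1 - a) + (1 - a) * a" using a a1 by simp
    ultimately show ?thesis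
      using x xT by (simp del: ennreal_plus flip: ennreal_mult) (subst ennreal_plus[symmetric]; simp)
  qed
  also note le
  finally show ?thesis unfolding x(1) .
qed

text \<open>On the disc the field energy is the kernel energy up to a constant; mass off the disc
  costs more than \<open>\<mu>\<close> does in total; and every competitor has weighted energy at
  least its shifted kernel energy, with equality for \<open>\<mu>\<close>. So \<open>\<mu>\<close>
  beats all other probability measures strictly, as the definite description requires.\<close>

lemma equilibrium_measure_eqI:
  assumes P: "field_above P M" and M: "0 \<le> M" and R: "1 \<le> 2 * R" and \<mu>: "\<mu> \<in> probs_on R"
    and strict: "\<And>\<nu>. \<nu> \<in> probs_on R \<Longrightarrow> \<nu> \<noteq> \<mu> \<Longrightarrow>
      field_energy R (\<lambda>z. e2ennreal (P z + ereal M)) \<mu> < field_energy R (\<lambda>z. e2ennreal (P z + ereal M)) \<nu>"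
    and off: "\<And>z w. z \<notin> cball 0 R \<or> w \<notin> cball 0 R \<Longrightarrow> ereal T \<le> energy_kernel P M z w"
    and T: "kernel_energy P M \<mu> < ennreal T"
  shows "equilibrium_measure P = \<mu>"
proof -
  have strict': "kernel_energy P M \<mu> < kernel_energy P M \<nu>" if "\<nu> \<in> probs_on R" "\<nu> \<noteq> \<mu>" for \<nu>
    using strict[OF that] unfolding kernel_energy_eq_field_energy[OF P M R \<mu>] kernel_energy_eq_field_energy[OF P M R that(1)]
    by (meson add_right_mono not_le)
  then have min: "kernel_energy P M \<mu> \<le> kernel_energy P M \<nu>" if "\<nu> \<in> probs_on R" for \<nu>
    using that strict' by (cases "\<nu> = \<mu>") (auto intro: less_imp_le)
  have W\<mu>: "weighted_energy P \<mu> = enn2ereal (kernel_energy P M \<mu>) - ereal (2 * M)"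
    by (rule weighted_energy_eq_kernel_energy[OF P M probs_on_borel_probs[OF \<mu>] probs_on_ln_finite[OF \<mu>]])
  have less: "weighted_energy P \<mu> < weighted_energy P \<nu>" if \<nu>: "\<nu> \<in> borel_probs" "\<nu> \<noteq> \<mu>" for \<nu>
  proof -
    have "kernel_energy P M \<mu> < kernel_energy P M \<nu>"
      using strict' kernel_energy_off_disc[OF P \<mu> min off T \<nu>(1)] \<nu> by blast
    then have "enn2ereal (kernel_energy P M \<mu>) < enn2ereal (kernel_energy P M \<nu>)"
      by (simp add: less_ennreal.rep_eq)
    then have "weighted_energy P \<mu> < enn2ereal (kernel_energy P M \<nu>) - ereal (2 * M)"
      unfolding W\<mu> by (cases "enn2ereal (kernel_energy P M \<mu>)"; cases "enn2ereal (kernel_energy P M \<nu>)") auto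
    also have "\<dots> \<le> weighted_energy P \<nu>" by (rule weighted_energy_ge_kernel_energy[OF P M \<nu>(1)])
    finally show ?thesis .
  qed
  show ?thesis
    unfolding equilibrium_measure_def
  proof (rule the_equality)
    show "\<mu> \<in> borel_probs \<and> (\<forall>\<nu>\<in>borel_probs. weighted_energy P \<mu> \<le> weighted_energy P \<nu>)"
      using probs_on_borel_probs[OF \<mu>] less by (metis less_imp_le order_refl)
    show "\<mu>' = \<mu>" if "\<mu>' \<in> borel_probs \<and> (\<forall>\<nu>\<in>borel_probs. weighted_energy P \<mu>' \<le> weighted_energy P \<nu>)" for \<mu>'
      using that less[of \<mu>'] probs_on_borel_probs[OF \<mu>] by (metis not_le)
  qed
qed

section \<open>Admissible fields: growth, lower bounds and semicontinuity\<close>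

definition field_growth :: "(complex \<Rightarrow> ereal) \<Rightarrow> bool" where
  "field_growth P \<longleftrightarrow> (\<forall>B. \<exists>R. \<forall>z. R < norm z \<longrightarrow> ereal (ln (1 + norm z) + B) \<le> P z)"

text \<open>The lower bound of the kernel is a sum of two nonnegative terms, one for each point, so
  a single distant point already makes it large.\<close>

lemma energy_kernel_off_disc:
  assumes P: "field_above P M" and g: "field_growth P"
  shows "\<exists>R0. \<forall>R\<ge>R0. \<forall>z w. z \<notin> cball 0 R \<or> w \<notin> cball 0 R \<longrightarrow> ereal T \<le> energy_kernel P M z w"
proof -
  obtain R0 where R0: "\<And>z. R0 < norm z \<Longrightarrow> ereal (ln (1 + norm z) + (T - M)) \<le> P z"
    using g unfolding field_growth_def by blast
  have nn: "0 \<le> P z - ereal (ln (1 + norm z)) + ereal M" for z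
  proof -
    have "ereal (ln (1 + norm z) - M) \<le> P z" using P by (simp add: field_above_def)
    then show ?thesis by (cases "P z") auto
  qed
  have big: "ereal T \<le> P z - ereal (ln (1 + norm z)) + ereal M" if "R0 < norm z" for z :: complex
    using R0[OF that] by (cases "P z") auto
  show ?thesis
  proof (intro exI[of _ R0] allI impI)
    fix R :: real and z w :: complex assume R: "R0 \<le> R" and zw: "z \<notin> cball 0 R \<or> w \<notin> (cball 0 R :: complex set)"
    have "ereal T \<le> (P z - ereal (ln (1 + norm z)) + ereal M) + (P w - ereal (ln (1 + norm w)) + ereal M)"
      using zw
    proof
      assume "z \<notin> cball 0 R"
      then have "ereal T + 0 \<le> (P z - ereal (ln (1 + norm z)) + ereal M) + (P w - ereal (ln (1 + norm w)) + ereal M)"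
        using R by (intro add_mono big nn) auto
      then show ?thesis by simp
    next
      assume "w \<notin> cball 0 R"
      then have "0 + ereal T \<le> (P z - ereal (ln (1 + norm z)) + ereal M) + (P w - ereal (ln (1 + norm w)) + ereal M)"
        using R by (intro add_mono big nn) auto
      then show ?thesis by simp
    qed
    also note energy_kernel_lower[OF P]
    finally show "ereal T \<le> energy_kernel P M z w" .
  qed
qed

text \<open>Upper semicontinuity of \<open>exp (- Q)\<close> is lower semicontinuity of
  \<open>Q\<close>, since the exponential is monotone; infinite levels are treated
  separately.\<close>

lemma admissible_field_superlevel_open:
  assumes Q: "admissible_field Q"
  shows "open {z. y < Q z}"
proof (cases y)
  case (real r)
  have "exp_ereal (- Q z) < ennreal (exp (- r)) \<longleftrightarrow> ereal r < Q z" for z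
    by (cases "Q z") (auto simp: exp_ereal_def ennreal_less_iff)
  then have "{z. y < Q z} = {z. exp_ereal (- Q z) < ennreal (exp (- r))}" by (simp add: real)
  then show ?thesis using Q by (simp add: admissible_field_def)
next
  case MInf
  then have "{z. y < Q z} = UNIV" using Q by (auto simp: admissible_field_def less_le)
  then show ?thesis by simp
qed simp

lemma admissible_field_measurable:
  assumes "admissible_field Q"
  shows "Q \<in> borel_measurable borel"
  by (rule borel_measurableI_greater) (use admissible_field_superlevel_open[OF assms] in auto)

lemma admissible_field_growth:
  assumes Q: "admissible_field Q"
  shows "field_growth Q"
  unfolding field_growth_def
proof (intro allI)
  fix B
  have "((\<lambda>z. ennreal (norm z) * exp_ereal (- Q z)) \<longlongrightarrow> 0) at_infinity"
    using Q by (simp add: admissible_field_def)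
  \<comment> \<open>The factor \<open>exp (- ln 2)\<close> pays for the later estimate
    \<open>1 + |z| \<le> 2 |z|\<close>.\<close>
  then have "\<forall>\<^sub>F z in at_infinity. ennreal (norm z) * exp_ereal (- Q z) < ennreal (exp (- B - ln 2))"
    by (rule order_tendstoD(2)) simp
  then obtain b where b: "\<And>z. b \<le> norm z \<Longrightarrow> ennreal (norm z) * exp_ereal (- Q z) < ennreal (exp (- B - ln 2))"
    unfolding eventually_at_infinity by blast
  show "\<exists>R. \<forall>z. R < norm z \<longrightarrow> ereal (ln (1 + norm z) + B) \<le> Q z"
  proof (intro exI[of _ "max b 1"] allI impI)
    fix z :: complex assume z: "max b 1 < norm z"
    show "ereal (ln (1 + norm z) + B) \<le> Q z"
    proof (cases "Q z")
      case (real r)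
      have "ennreal (norm z * exp (- r)) < ennreal (exp (- B - ln 2))"
        using b[of z] z by (simp add: real exp_ereal_def ennreal_mult)
      then have "norm z * exp (- r) < exp (- B - ln 2)" by (simp add: ennreal_less_iff)
      moreover have "0 < norm z * exp (- r)" using z by (intro mult_pos_pos) auto
      ultimately have "ln (norm z * exp (- r)) < ln (exp (- B - ln 2))"
        by (subst ln_less_cancel_iff) auto
      moreover have "z \<noteq> 0" using z by auto
      ultimately have "ln (norm z) - r < - B - ln 2" by (simp add: ln_mult)
      moreover have "ln (1 + norm z) \<le> ln (2 * norm z)" using z by (subst ln_le_cancel_iff) auto
      moreover have "ln (2 * norm z) = ln 2 + ln (norm z)" using z by (intro ln_mult_pos) auto
      ultimately show ?thesis by (simp add: real)
    qed (use Q in \<open>auto simp: admissible_field_def\<close>)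
  qed
qed

text \<open>Far out the growth gives the bound. On the remaining disc \<open>Q\<close> is bounded
  below because its open superlevel sets cover a compact set; the value \<open>-\<infinity>\<close>
  is excluded by admissibility.\<close>

lemma admissible_field_above:
  assumes Q: "admissible_field Q"
  obtains M where "0 \<le> M" "field_above Q M"
proof -
  obtain R where R: "\<And>z. R < norm z \<Longrightarrow> ereal (ln (1 + norm z) + 0) \<le> Q z"
    using admissible_field_growth[OF Q] unfolding field_growth_def by blast
  have cov: "cball 0 R \<subseteq> (\<Union>n::nat. {z. ereal (- real n) < Q z})"
  proof
    fix z
    have "Q z \<noteq> -\<infinity>" using Q by (simp add: admissible_field_def)
    then show "z \<in> (\<Union>n::nat. {z. ereal (- real n) < Q z})"
    proof (cases "Q z")
      case (real r)
      obtain n :: nat where "- r < real n" using reals_Archimedean2 by blast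
      then show ?thesis by (auto simp: real intro!: exI[of _ n])
    qed auto
  qed
  obtain N where N: "finite N" "cball 0 R \<subseteq> (\<Union>n\<in>N. {z. ereal (- real n) < Q z})"
    using compactE_image[OF compact_cball, of UNIV "\<lambda>n::nat. {z. ereal (- real n) < Q z}"]
      admissible_field_superlevel_open[OF Q] cov by (metis)
  define k where "k = real (Max (insert 0 N))"
  define M where "M = max 0 (k + ln (1 + \<bar>R\<bar>))"
  have "ereal (ln (1 + norm z) - M) \<le> Q z" for z
  proof (cases "R < norm z")
    case True
    have "ln (1 + norm z) - M \<le> ln (1 + norm z) + 0" by (simp add: M_def)
    then have "ereal (ln (1 + norm z) - M) \<le> ereal (ln (1 + norm z) + 0)" by (simp only: ereal_less_eq)
    also note R[OF True]
    finally show ?thesis .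
  next
    case False
    then have "z \<in> cball 0 R" by simp
    then obtain n where n: "n \<in> N" "ereal (- real n) < Q z" using N(2) by blast
    have "real n \<le> k" using n(1) N(1) by (simp add: k_def)
    moreover have "ln (1 + norm z) \<le> ln (1 + \<bar>R\<bar>)"
      using False by (subst ln_le_cancel_iff) (auto intro: add_pos_nonneg)
    ultimately have "ln (1 + norm z) - M \<le> - real n" by (simp add: M_def)
    then have "ereal (ln (1 + norm z) - M) \<le> ereal (- real n)" by (simp only: ereal_less_eq)
    also have "\<dots> \<le> Q z" using n(2) by simp
    finally show ?thesis .
  qed
  then show ?thesis
    using that[of M] admissible_field_measurable[OF Q] by (auto simp: field_above_def M_def)
qed

lemma admissible_field_lsc:
  assumes Q: "admissible_field Q" and M: "field_above Q M"
  shows "lsc_seq (\<lambda>z. e2ennreal (Q z + ereal M))"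
  unfolding lsc_seq_def le_Liminf_iff
proof (intro allI impI)
  fix f z y assume f: "f \<longlonglongrightarrow> z" and y: "y < e2ennreal (Q z + ereal M)"
  then obtain r where r: "y = ennreal r" "0 \<le> r" by (cases y) auto
  have iff: "y < e2ennreal (Q x + ereal M) \<longleftrightarrow> ereal (r - M) < Q x" for x
    using field_above_ge[OF M, of x] r by (cases "Q x") (auto simp: ennreal_less_iff)
  have "\<forall>\<^sub>F n in sequentially. f n \<in> {x. ereal (r - M) < Q x}"
    by (rule topological_tendstoD[OF f admissible_field_superlevel_open[OF Q]]) (use y iff in simp)
  then show "\<forall>\<^sub>F n in sequentially. y < e2ennreal (Q (f n) + ereal M)"
    by (simp add: iff)
qed

section \<open>Frostman's conditions\<close>

text \<open>Supplies test measures: area on a subset of a disc, normalized and transported by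
  \<open>\<psi>\<close>. Their energy is finite because discarding the nonnegative defect bounds the
  inner potential by the kernel with pole \<open>\<psi> a\<close>, which is integrable over the
  disc.\<close>

lemma disc_image_probs_on:
  fixes \<psi> :: "complex \<Rightarrow> complex"
  assumes \<psi>: "\<psi> holomorphic_on ball a s" and s: "s > 0" and inj: "inj_on \<psi> (ball a s)"
    and sub: "\<psi> ` ball a s \<subseteq> cball 0 R"
    and A[measurable]: "A \<in> sets borel" and A_sub: "A \<subseteq> ball a s" and A0: "emeasure lborel A \<noteq> 0"
  shows "\<exists>\<eta>\<in>probs_on R. (\<forall>f\<in>borel_measurable borel. (\<integral>\<^sup>+z. f z \<partial>\<eta>) = (\<integral>\<^sup>+\<zeta>. f (\<psi> \<zeta>) * indicator A \<zeta> \<partial>lborel) / emeasure lborel A)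
      \<and> mutual_energy R \<eta> \<eta> < \<infinity>"
proof -
  define \<psi>' where "\<psi>' \<zeta> = indicator (ball a s) \<zeta> *\<^sub>R \<psi> \<zeta>" for \<zeta>
  have [measurable]: "\<psi>' \<in> borel_measurable borel"
    unfolding \<psi>'_def using holomorphic_on_imp_continuous_on[OF \<psi>]
    by (intro borel_measurable_continuous_on_indicator) auto
  have \<psi>': "\<psi>' \<zeta> = \<psi> \<zeta>" if "\<zeta> \<in> ball a s" for \<zeta> using that by (simp add: \<psi>'_def)
  have fin: "emeasure lborel A < \<infinity>"
  proof -
    have "emeasure lborel A \<le> emeasure lborel (ball a s)" using A_sub by (intro emeasure_mono) auto
    then show ?thesis using s by (simp add: emeasure_lborel_ball_complex le_less_trans)
  qed
  define u where "u = uniform_measure lborel A"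
  interpret u: prob_space u unfolding u_def using A0 fin by (intro prob_space_uniform_measure) auto
  have sets_u[measurable_cong]: "sets u = sets borel" by (simp add: u_def)
  define \<eta> where "\<eta> = distr u borel \<psi>'"
  have int: "(\<integral>\<^sup>+z. f z \<partial>\<eta>) = (\<integral>\<^sup>+\<zeta>. f (\<psi> \<zeta>) * indicator A \<zeta> \<partial>lborel) / emeasure lborel A"
    if [measurable]: "f \<in> borel_measurable borel" for f
  proof -
    have "(\<integral>\<^sup>+z. f z \<partial>\<eta>) = (\<integral>\<^sup>+\<zeta>. f (\<psi>' \<zeta>) \<partial>u)" unfolding \<eta>_def by (rule nn_integral_distr) measurable
    also have "\<dots> = (\<integral>\<^sup>+\<zeta>. f (\<psi>' \<zeta>) * indicator A \<zeta> \<partial>lborel) / emeasure lborel A"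
      unfolding u_def by (rule nn_integral_uniform_measure) measurable
    also have "(\<integral>\<^sup>+\<zeta>. f (\<psi>' \<zeta>) * indicator A \<zeta> \<partial>lborel) = (\<integral>\<^sup>+\<zeta>. f (\<psi> \<zeta>) * indicator A \<zeta> \<partial>lborel)"
      using A_sub by (intro nn_integral_cong) (auto simp: indicator_def \<psi>')
    finally show ?thesis .
  qed
  have "AE \<zeta> in u. \<psi>' \<zeta> \<in> cball 0 R"
    unfolding u_def using A_sub sub by (intro AE_uniform_measureI AE_I2) (auto simp: \<psi>' image_subset_iff)
  then have \<eta>: "\<eta> \<in> probs_on R"
    by (auto simp: probs_on_def \<eta>_def AE_distr_iff intro!: u.prob_space_distr)
  interpret \<eta>: sigma_finite_measure \<eta> by (rule probs_onD(5)[OF \<eta>])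
  have le: "(\<integral>\<^sup>+\<zeta>. log_kernel R (\<psi> \<omega>) (\<psi> \<zeta>) * indicator A \<zeta> \<partial>lborel) \<le> ennreal (pi * s\<^sup>2) * log_kernel R (\<psi> a) (\<psi> \<omega>)"
    if \<omega>: "\<omega> \<in> ball a s" for \<omega>
  proof -
    have "(\<integral>\<^sup>+\<zeta>. log_kernel R (\<psi> \<omega>) (\<psi> \<zeta>) * indicator A \<zeta> \<partial>lborel)
        \<le> (\<integral>\<^sup>+\<zeta>. log_kernel R (\<psi> \<omega>) (\<psi> \<zeta>) * indicator (ball a s) \<zeta> \<partial>lborel)"
      using A_sub by (intro nn_integral_mono) (auto simp: indicator_def)
    also have "\<dots> \<le> \<dots> + ennreal (pi * s\<^sup>2) * disc_defect ((\<omega> - a) /\<^sub>R s)" by simp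
    also note nn_integral_log_kernel_inside[OF \<psi> s inj sub \<omega>]
    finally show ?thesis by (simp add: log_kernel_commute)
  qed
  have [measurable]: "(\<lambda>\<omega>. log_kernel R (\<psi> a) (\<psi> \<omega>) * indicator (ball a s) \<omega>) \<in> borel_measurable borel"
    by (rule borel_measurable_on_indicator[OF holomorphic_on_imp_continuous_on[OF \<psi>]]) auto
  have "mutual_energy R \<eta> \<eta> = (\<integral>\<^sup>+z. (\<integral>\<^sup>+\<zeta>. log_kernel R z (\<psi> \<zeta>) * indicator A \<zeta> \<partial>lborel) / emeasure lborel A \<partial>\<eta>)"
    unfolding mutual_energy_def by (intro nn_integral_cong int) measurable
  also have "\<dots> = (\<integral>\<^sup>+\<omega>. ((\<integral>\<^sup>+\<zeta>. log_kernel R (\<psi> \<omega>) (\<psi> \<zeta>) * indicator A \<zeta> \<partial>lborel) / emeasure lborel A) * indicator A \<omega> \<partial>lborel) / emeasure lborel A"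
  proof (rule int)
    have "(\<lambda>z. \<integral>\<^sup>+w. log_kernel R z w \<partial>\<eta>) \<in> borel_measurable borel" by (rule log_kernel_measurable_integral[OF \<eta>])
    also have "(\<lambda>z. \<integral>\<^sup>+w. log_kernel R z w \<partial>\<eta>) = (\<lambda>z. (\<integral>\<^sup>+\<zeta>. log_kernel R z (\<psi> \<zeta>) * indicator A \<zeta> \<partial>lborel) / emeasure lborel A)"
      by (intro ext int) measurable
    finally show "(\<lambda>z. (\<integral>\<^sup>+\<zeta>. log_kernel R z (\<psi> \<zeta>) * indicator A \<zeta> \<partial>lborel) / emeasure lborel A) \<in> borel_measurable borel" .
  qed
  also have "\<dots> \<le> (\<integral>\<^sup>+\<omega>. (ennreal (pi * s\<^sup>2) / emeasure lborel A) * (log_kernel R (\<psi> a) (\<psi> \<omega>) * indicator (ball a s) \<omega>) \<partial>lborel) / emeasure lborel A"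
  proof (intro divide_right_mono_ennreal nn_integral_mono)
    fix \<omega>
    show "((\<integral>\<^sup>+\<zeta>. log_kernel R (\<psi> \<omega>) (\<psi> \<zeta>) * indicator A \<zeta> \<partial>lborel) / emeasure lborel A) * indicator A \<omega>
        \<le> (ennreal (pi * s\<^sup>2) / emeasure lborel A) * (log_kernel R (\<psi> a) (\<psi> \<omega>) * indicator (ball a s) \<omega>)"
    proof (cases "\<omega> \<in> A")
      case True
      then have \<omega>: "\<omega> \<in> ball a s" using A_sub by auto
      show ?thesis using divide_right_mono_ennreal[OF le[OF \<omega>], of "emeasure lborel A"] True \<omega>
        by (simp add: ennreal_times_divide mult.commute)
    qed simp
  qed
  also have "\<dots> = (ennreal (pi * s\<^sup>2) / emeasure lborel A) * (\<integral>\<^sup>+\<omega>. log_kernel R (\<psi> a) (\<psi> \<omega>) * indicator (ball a s) \<omega> \<partial>lborel) / emeasure lborel A"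
    by (subst nn_integral_cmult) auto
  also have "\<dots> < \<infinity>"
  proof -
    have "(\<integral>\<^sup>+\<omega>. log_kernel R (\<psi> a) (\<psi> \<omega>) * indicator (ball a s) \<omega> \<partial>lborel) < \<infinity>"
      using nn_integral_log_kernel_inside_finite[OF \<psi> s inj sub, of a] s by simp
    then show ?thesis using A0 fin
      by (auto simp: ennreal_divide_eq_top_iff ennreal_mult_eq_top_iff less_top[symmetric])
  qed
  finally show ?thesis using \<eta> int by blast
qed

text \<open>A strict inequality almost everywhere survives integration because \<open>F - g\<close>
  has positive integral; finiteness of \<open>F\<close> allows the cancellation.\<close>

lemma nn_integral_less_const:
  assumes "prob_space \<nu>" and [measurable]: "g \<in> borel_measurable \<nu>" and less: "AE z in \<nu>. g z < F" and F: "F < (\<infinity>::ennreal)"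
  shows "(\<integral>\<^sup>+z. g z \<partial>\<nu>) < F"
proof -
  interpret prob_space \<nu> by fact
  have "(\<integral>\<^sup>+z. g z \<partial>\<nu>) + (\<integral>\<^sup>+z. (F - g z) \<partial>\<nu>) = (\<integral>\<^sup>+z. g z + (F - g z) \<partial>\<nu>)"
    by (rule nn_integral_add[symmetric]) auto
  also have "\<dots> = (\<integral>\<^sup>+z. F \<partial>\<nu>)"
    using less by (intro nn_integral_cong_AE) (auto elim!: eventually_mono simp: add_diff_eq_ennreal intro!: add_diff_inverse_ennreal less_imp_le)
  also have "\<dots> = F" by (simp add: emeasure_space_1)
  finally have sum: "(\<integral>\<^sup>+z. g z \<partial>\<nu>) + (\<integral>\<^sup>+z. (F - g z) \<partial>\<nu>) = F" .
  have "(\<integral>\<^sup>+z. (F - g z) \<partial>\<nu>) \<noteq> 0"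
  proof
    assume "(\<integral>\<^sup>+z. (F - g z) \<partial>\<nu>) = 0"
    then have "AE z in \<nu>. F - g z = 0" by (subst (asm) nn_integral_0_iff_AE) auto
    with less have "AE z in \<nu>. False"
    proof eventually_elim
      case (elim z)
      have "F \<le> g z" using elim(2) F less_trans[OF elim(1) F] by (simp add: diff_eq_0_iff_ennreal)
      with elim(1) show ?case by simp
    qed
    then show False by simp
  qed
  moreover have "(\<integral>\<^sup>+z. g z \<partial>\<nu>) < \<infinity>" using sum F by (auto simp: less_top[symmetric])
  ultimately have "(\<integral>\<^sup>+z. g z \<partial>\<nu>) + 0 < (\<integral>\<^sup>+z. g z \<partial>\<nu>) + (\<integral>\<^sup>+z. (F - g z) \<partial>\<nu>)"
    unfolding ennreal_add_left_cancel_less by (auto simp: zero_less_iff_neq_zero)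
  then show ?thesis unfolding sum by simp
qed

lemma nn_integral_potential:
  assumes \<mu>: "\<mu> \<in> probs_on R" and \<nu>: "\<nu> \<in> probs_on R" and [measurable]: "p \<in> borel_measurable borel"
  shows "(\<integral>\<^sup>+z. (\<integral>\<^sup>+w. log_kernel R z w \<partial>\<mu>) + p z \<partial>\<nu>) = mutual_energy R \<mu> \<nu> + (\<integral>\<^sup>+z. p z \<partial>\<nu>)"
proof -
  note [measurable_cong] = probs_onD(2)[OF \<nu>]
  note [measurable] = log_kernel_measurable_integral[OF \<mu>, of R]
  have "(\<integral>\<^sup>+z. (\<integral>\<^sup>+w. log_kernel R z w \<partial>\<mu>) + p z \<partial>\<nu>) = mutual_energy R \<nu> \<mu> + (\<integral>\<^sup>+z. p z \<partial>\<nu>)"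
    unfolding mutual_energy_def by (rule nn_integral_add) measurable
  also have "mutual_energy R \<nu> \<mu> = mutual_energy R \<mu> \<nu>"
    by (rule mutual_energy_commute[OF probs_onD(5)[OF \<nu>] probs_onD(5)[OF \<mu>] probs_onD(2)[OF \<nu>] probs_onD(2)[OF \<mu>]])
  finally show ?thesis .
qed

section \<open>Frostman's conditions for a minimizer\<close>

locale minimizing_measure =
  fixes R :: real and p :: "complex \<Rightarrow> ennreal" and \<mu> :: "complex measure"
  assumes R: "R > 0" and p[measurable]: "p \<in> borel_measurable borel" and \<mu>: "\<mu> \<in> probs_on R"
    and fin: "field_energy R p \<mu> < \<infinity>"
    and min: "\<And>m. m \<in> probs_on R \<Longrightarrow> field_energy R p \<mu> \<le> field_energy R p m"
begin

definition Pot :: "complex \<Rightarrow> ennreal" where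
  "Pot z = (\<integral>\<^sup>+w. log_kernel R z w \<partial>\<mu>) + p z"

text \<open>The modified Robin constant, in the normalization given by the truncated kernel and the
  shifted field.\<close>

definition F :: ennreal where
  "F = mutual_energy R \<mu> \<mu> + (\<integral>\<^sup>+z. p z \<partial>\<mu>)"

lemma Pot_measurable[measurable]: "Pot \<in> borel_measurable borel"
  using log_kernel_measurable_integral[OF \<mu>, of R] unfolding Pot_def by measurable

lemma F_finite: "F < \<infinity>"
  using fin unfolding F_def field_energy_def
  by (auto simp: ennreal_add_eq_top ennreal_mult_eq_top_iff less_top[symmetric])

lemma nn_integral_Pot:
  assumes \<nu>: "\<nu> \<in> probs_on R"
  shows "(\<integral>\<^sup>+z. Pot z \<partial>\<nu>) = mutual_energy R \<mu> \<nu> + (\<integral>\<^sup>+z. p z \<partial>\<nu>)"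
  unfolding Pot_def by (rule nn_integral_potential[OF \<mu> \<nu> p])

lemma F_le:
  assumes "\<nu> \<in> probs_on R" "field_energy R p \<nu> < \<infinity>"
  shows "F \<le> (\<integral>\<^sup>+z. Pot z \<partial>\<nu>)"
  unfolding F_def nn_integral_Pot[OF assms(1)] by (rule first_variation[OF R p \<mu> assms(1) min assms(2)])

lemma field_energy_finiteI:
  assumes "mutual_energy R \<nu> \<nu> < \<infinity>" "(\<integral>\<^sup>+z. p z \<partial>\<nu>) < \<infinity>"
  shows "field_energy R p \<nu> < \<infinity>"
  using assms unfolding field_energy_def by (auto simp: ennreal_add_eq_top ennreal_mult_eq_top_iff less_top[symmetric])

lemma fin_parts: "mutual_energy R \<mu> \<mu> < \<infinity>" "(\<integral>\<^sup>+z. p z \<partial>\<mu>) < \<infinity>"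
  using fin unfolding field_energy_def by (auto simp: ennreal_add_eq_top ennreal_mult_eq_top_iff less_top[symmetric])

text \<open>If \<open>Pot < F\<close> on a set of positive mass, \<open>\<mu>\<close> conditioned on
  it has finite energy and contradicts the first variation. So \<open>F \<le> Pot\<close> almost
  everywhere, and as \<open>Pot\<close> has integral \<open>F\<close>, equality holds.\<close>

lemma AE_Pot_eq: "AE z in \<mu>. Pot z = F"
proof -
  interpret prob_space \<mu> by (rule probs_onD(1)[OF \<mu>])
  note sets_\<mu>[measurable_cong] = probs_onD(2)[OF \<mu>]
  note [measurable] = log_kernel_measurable_integral[OF \<mu>, of R]
  have ge: "AE z in \<mu>. F \<le> Pot z"
  proof (rule ccontr)
    assume not: "\<not> ?thesis"
    define A where "A = {z \<in> cball 0 R. Pot z < F}"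
    have A[measurable]: "A \<in> sets borel" unfolding A_def by measurable
    have "emeasure \<mu> A \<noteq> 0"
    proof
      assume "emeasure \<mu> A = 0"
      then have "AE z in \<mu>. z \<notin> A" using A by (intro AE_not_in) (auto simp: null_sets_def sets_\<mu>)
      with probs_onD(3)[OF \<mu>] have "AE z in \<mu>. F \<le> Pot z" by eventually_elim (auto simp: A_def not_less)
      with not show False by simp
    qed
    let ?u = "uniform_measure \<mu> A"
    have u: "?u \<in> probs_on R"
      using \<open>emeasure \<mu> A \<noteq> 0\<close> by (intro uniform_measure_probs_on probs_onD(1,2)[OF \<mu>] A) (auto simp: A_def)
    have div_fin: "X / emeasure \<mu> A < \<infinity>" if "X < \<infinity>" for X
      using that \<open>emeasure \<mu> A \<noteq> 0\<close> by (auto simp: ennreal_divide_eq_top_iff less_top[symmetric])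
    have int: "(\<integral>\<^sup>+z. f z \<partial>?u) \<le> (\<integral>\<^sup>+z. f z \<partial>\<mu>) / emeasure \<mu> A" if [measurable]: "f \<in> borel_measurable borel" for f
    proof -
      have "(\<integral>\<^sup>+z. f z \<partial>?u) = (\<integral>\<^sup>+z. f z * indicator A z \<partial>\<mu>) / emeasure \<mu> A"
        by (rule nn_integral_uniform_measure) measurable
      also have "\<dots> \<le> (\<integral>\<^sup>+z. f z \<partial>\<mu>) / emeasure \<mu> A"
        by (intro divide_right_mono_ennreal nn_integral_mono) (auto simp: indicator_def)
      finally show ?thesis .
    qed
    have "mutual_energy R ?u ?u \<le> (\<integral>\<^sup>+z. (\<integral>\<^sup>+w. log_kernel R z w \<partial>\<mu>) / emeasure \<mu> A \<partial>?u)"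
      unfolding mutual_energy_def by (intro nn_integral_mono int) measurable
    also have "\<dots> \<le> (\<integral>\<^sup>+z. (\<integral>\<^sup>+w. log_kernel R z w \<partial>\<mu>) / emeasure \<mu> A \<partial>\<mu>) / emeasure \<mu> A"
      by (intro int) measurable
    also have "\<dots> = mutual_energy R \<mu> \<mu> / emeasure \<mu> A / emeasure \<mu> A"
      unfolding mutual_energy_def by (subst nn_integral_divide) auto
    also have "\<dots> < \<infinity>" by (intro div_fin fin_parts)
    finally have "field_energy R p ?u < \<infinity>"
      using le_less_trans[OF int[OF p] div_fin[OF fin_parts(2)]] by (rule field_energy_finiteI)
    then have "F \<le> (\<integral>\<^sup>+z. Pot z \<partial>?u)" by (rule F_le[OF u])
    moreover have "(\<integral>\<^sup>+z. Pot z \<partial>?u) < F"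
    proof (rule nn_integral_less_const[OF probs_onD(1)[OF u] _ _ F_finite])
      have "A \<in> sets \<mu>" using A sets_\<mu> by simp
      then show "AE z in ?u. Pot z < F"
        by (rule AE_uniform_measureI) (simp add: A_def)
    qed measurable
    ultimately show False by simp
  qed
  have tot: "(\<integral>\<^sup>+z. Pot z \<partial>\<mu>) = F" unfolding nn_integral_Pot[OF \<mu>] F_def ..
  have "(\<integral>\<^sup>+z. (Pot z - F) \<partial>\<mu>) = (\<integral>\<^sup>+z. Pot z \<partial>\<mu>) - (\<integral>\<^sup>+z. F \<partial>\<mu>)"
    using F_finite ge by (intro nn_integral_diff) (auto simp: emeasure_space_1)
  also have "\<dots> = 0" using F_finite by (simp add: tot emeasure_space_1)
  finally have "AE z in \<mu>. Pot z - F = 0" by (subst (asm) nn_integral_0_iff_AE) auto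
  with ge show ?thesis
  proof eventually_elim
    case (elim z)
    then show ?case using F_finite by (auto simp: diff_eq_0_iff_ennreal)
  qed
qed

text \<open>The same contradiction, with conditioned area in place of \<open>\<mu>\<close>: the
  lower Frostman bound is obtained for almost every point in the sense of area, which is the sense
  in which discs are averaged later.\<close>

lemma AE_disc_Pot_ge:
  fixes \<psi> :: "complex \<Rightarrow> complex"
  assumes \<psi>: "\<psi> holomorphic_on ball a s" and s: "s > 0" and inj: "inj_on \<psi> (ball a s)"
    and sub: "\<psi> ` ball a s \<subseteq> cball 0 R" and pb: "\<And>\<zeta>. \<zeta> \<in> ball a s \<Longrightarrow> p (\<psi> \<zeta>) \<le> ennreal B"
  shows "AE \<zeta> in lborel. \<zeta> \<in> ball a s \<longrightarrow> F \<le> Pot (\<psi> \<zeta>)"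
proof (rule ccontr)
  assume not: "\<not> ?thesis"
  define \<psi>' where "\<psi>' \<zeta> = indicator (ball a s) \<zeta> *\<^sub>R \<psi> \<zeta>" for \<zeta>
  have [measurable]: "\<psi>' \<in> borel_measurable borel"
    unfolding \<psi>'_def using holomorphic_on_imp_continuous_on[OF \<psi>]
    by (intro borel_measurable_continuous_on_indicator) auto
  have \<psi>': "\<psi>' \<zeta> = \<psi> \<zeta>" if "\<zeta> \<in> ball a s" for \<zeta> using that by (simp add: \<psi>'_def)
  define A where "A = {\<zeta> \<in> ball a s. Pot (\<psi>' \<zeta>) < F}"
  have A[measurable]: "A \<in> sets borel" unfolding A_def by measurable
  have A0: "emeasure lborel A \<noteq> 0"
  proof
    assume "emeasure lborel A = 0"
    then have "AE \<zeta> in lborel. \<zeta> \<notin> A" using A by (intro AE_not_in) (auto simp: null_sets_def)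
    then have "AE \<zeta> in lborel. \<zeta> \<in> ball a s \<longrightarrow> F \<le> Pot (\<psi> \<zeta>)" by eventually_elim (auto simp: A_def \<psi>' not_less)
    with not show False by simp
  qed
  have A_sub: "A \<subseteq> ball a s" by (auto simp: A_def)
  have fin_A: "emeasure lborel A < \<infinity>"
  proof -
    have "emeasure lborel A \<le> emeasure lborel (ball a s)" using A_sub by (intro emeasure_mono) auto
    then show ?thesis using s by (simp add: emeasure_lborel_ball_complex le_less_trans)
  qed
  obtain \<eta> where \<eta>: "\<eta> \<in> probs_on R" and
    int: "\<And>f. f \<in> borel_measurable borel \<Longrightarrow> (\<integral>\<^sup>+z. f z \<partial>\<eta>) = (\<integral>\<^sup>+\<zeta>. f (\<psi> \<zeta>) * indicator A \<zeta> \<partial>lborel) / emeasure lborel A"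
    and J: "mutual_energy R \<eta> \<eta> < \<infinity>"
    using disc_image_probs_on[OF \<psi> s inj sub A A_sub A0] by blast
  have "(\<integral>\<^sup>+z. p z \<partial>\<eta>) \<le> (\<integral>\<^sup>+\<zeta>. ennreal B * indicator A \<zeta> \<partial>lborel) / emeasure lborel A"
    unfolding int[OF p] using pb A_sub by (intro divide_right_mono_ennreal nn_integral_mono) (auto simp: indicator_def)
  also have "\<dots> < \<infinity>"
    using A0 fin_A by (auto simp: nn_integral_cmult_indicator ennreal_divide_eq_top_iff ennreal_mult_eq_top_iff less_top[symmetric])
  finally have "F \<le> (\<integral>\<^sup>+z. Pot z \<partial>\<eta>)" by (intro F_le \<eta> field_energy_finiteI J)
  also have "(\<integral>\<^sup>+z. Pot z \<partial>\<eta>) = (\<integral>\<^sup>+\<zeta>. Pot (\<psi>' \<zeta>) \<partial>uniform_measure lborel A)"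
    unfolding int[OF Pot_measurable] using A_sub
    by (subst nn_integral_uniform_measure) (auto intro!: arg_cong2[where f="(/)"] nn_integral_cong simp: indicator_def \<psi>')
  also have "\<dots> < F"
  proof (rule nn_integral_less_const[OF prob_space_uniform_measure _ _ F_finite])
    have "A \<in> sets lborel" using A by simp
    then show "AE \<zeta> in uniform_measure lborel A. Pot (\<psi>' \<zeta>) < F"
      by (rule AE_uniform_measureI) (simp add: A_def)
  qed (use A0 fin_A in auto)
  finally show False by simp
qed

text \<open>By Fatou's lemma and continuity of \<open>p\<close> at \<open>z\<close>,
  \<open>Pot\<close> is lower semicontinuous there. Hence \<open>Pot z > F\<close> would persist on
  a neighbourhood, which has positive mass, against the equality almost everywhere.\<close>

lemma Pot_le_on_support:
  assumes z: "z \<in> measure_support \<mu>" and cont: "isCont p z"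
  shows "Pot z \<le> F"
proof (rule ccontr)
  note sets_\<mu>[measurable_cong] = probs_onD(2)[OF \<mu>]
  assume "\<not> Pot z \<le> F"
  then have less: "F < Pot z" by simp
  have "\<forall>\<^sub>F x in nhds z. F < Pot x"
    unfolding eventually_nhds_iff_sequentially
  proof (intro allI impI)
    fix f assume f: "f \<longlonglongrightarrow> z"
    have "(\<integral>\<^sup>+w. log_kernel R z w \<partial>\<mu>) = (\<integral>\<^sup>+w. liminf (\<lambda>n. log_kernel R (f n) w) \<partial>\<mu>)"
      by (intro nn_integral_cong lim_imp_Liminf[symmetric] tendsto_log_kernel f R tendsto_const) auto
    also have "\<dots> \<le> liminf (\<lambda>n. \<integral>\<^sup>+w. log_kernel R (f n) w \<partial>\<mu>)"
      by (rule nn_integral_liminf) simp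
    finally have 1: "(\<integral>\<^sup>+w. log_kernel R z w \<partial>\<mu>) \<le> liminf (\<lambda>n. \<integral>\<^sup>+w. log_kernel R (f n) w \<partial>\<mu>)" .
    have "(\<lambda>n. p (f n)) \<longlonglongrightarrow> p z" using cont f by (rule isCont_tendsto_compose)
    then have 2: "p z \<le> liminf (\<lambda>n. p (f n))" using lim_imp_Liminf[of sequentially "\<lambda>n. p (f n)" "p z"] by simp
    have "Pot z \<le> liminf (\<lambda>n. Pot (f n))"
      unfolding Pot_def by (rule order_trans[OF add_mono[OF 1 2] liminf_add_le_ennreal])
    then show "\<forall>\<^sub>F n in sequentially. F < Pot (f n)"
      using less unfolding le_Liminf_iff by blast
  qed
  then obtain N where N: "open N" "z \<in> N" "\<And>x. x \<in> N \<Longrightarrow> F < Pot x"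
    unfolding eventually_nhds by blast
  have "AE x in \<mu>. x \<notin> N"
    using AE_Pot_eq by eventually_elim (use N(3) in force)
  then have "emeasure \<mu> N = 0"
    using N(1) sets_\<mu> probs_onD(4)[OF \<mu>] by (subst (asm) AE_iff_measurable[of N]) auto
  then show False using z N by (auto simp: measure_support_def)
qed

end

text \<open>The energy \<open>k\<close> of one fixed competitor does not depend on \<open>R\<close>,
  hence neither does the radius beyond which the kernel exceeds it. For every larger
  \<open>R\<close> the minimizer on the disc is global and therefore the same measure. The freedom
  in \<open>R\<close> is needed when the disc must also confine the competitors for
  \<open>V\<close>.\<close>

lemma admissible_equilibrium:
  assumes Q: "admissible_field Q" and M: "0 \<le> M" "field_above Q M"
    and U: "open U" "z0 \<in> U" and h: "continuous_on U h" "\<And>z. z \<in> U \<Longrightarrow> Q z = ereal (h z)"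
  shows "\<exists>R0\<ge>1. \<forall>R\<ge>R0. minimizing_measure R (\<lambda>z. e2ennreal (Q z + ereal M)) (equilibrium_measure Q)"
proof -
  let ?p = "\<lambda>z. e2ennreal (Q z + ereal M)"
  have [measurable]: "Q \<in> borel_measurable borel" by (rule admissible_field_measurable[OF Q])
  have p: "?p \<in> borel_measurable borel" by measurable
  obtain d where d: "d > 0" "cball z0 d \<subseteq> U" using U open_contains_cball by blast
  define R1 where "R1 = 1 + norm z0 + d"
  have R1: "1 \<le> R1" using d by (simp add: R1_def)
  have "compact (h ` cball z0 d)"
    using h(1) d(2) by (intro compact_continuous_image) (auto intro: continuous_on_subset)
  then obtain B where B: "\<And>z. z \<in> cball z0 d \<Longrightarrow> \<bar>h z\<bar> \<le> B"
    by (fastforce dest!: compact_imp_bounded simp: bounded_iff)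
  have pb: "?p z \<le> ennreal (B + M)" if "z \<in> cball z0 d" for z
  proof -
    have "z \<in> U" using that d(2) by blast
    then show ?thesis using h(2)[of z] B[OF that] by (auto intro!: ennreal_leI)
  qed
  have sub: "(\<lambda>z. z) ` ball z0 d \<subseteq> cball 0 R1"
  proof -
    have "norm z \<le> R1" if "z \<in> ball z0 d" for z
      using that norm_triangle_ineq2[of z z0] by (simp add: R1_def dist_norm norm_minus_commute)
    then show ?thesis by auto
  qed
  have ball0: "emeasure lborel (ball z0 d) \<noteq> 0" "emeasure lborel (ball z0 d) < \<infinity>"
    using d(1) by (auto simp: emeasure_lborel_ball_complex)
  obtain \<eta> where \<eta>: "\<eta> \<in> probs_on R1" and
    int: "\<And>f. f \<in> borel_measurable borel \<Longrightarrow> (\<integral>\<^sup>+z. f z \<partial>\<eta>) = (\<integral>\<^sup>+\<zeta>. f \<zeta> * indicator (ball z0 d) \<zeta> \<partial>lborel) / emeasure lborel (ball z0 d)"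
    and J: "mutual_energy R1 \<eta> \<eta> < \<infinity>"
    using disc_image_probs_on[OF holomorphic_on_ident d(1) inj_on_id2 sub sets_borel_ball(1) subset_refl ball0(1)] by blast
  have "(\<integral>\<^sup>+z. ?p z \<partial>\<eta>) \<le> (\<integral>\<^sup>+\<zeta>. ennreal (B + M) * indicator (ball z0 d) \<zeta> \<partial>lborel) / emeasure lborel (ball z0 d)"
    unfolding int[OF p] using pb by (intro divide_right_mono_ennreal nn_integral_mono) (auto simp: indicator_def)
  also have "\<dots> < \<infinity>"
    using ball0 by (auto simp: nn_integral_cmult_indicator ennreal_divide_eq_top_iff ennreal_mult_eq_top_iff less_top[symmetric])
  finally have "field_energy R1 ?p \<eta> < \<infinity>"
    using J unfolding field_energy_def by (auto simp: ennreal_add_eq_top ennreal_mult_eq_top_iff less_top[symmetric])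
  then have "kernel_energy Q M \<eta> < \<infinity>"
    using kernel_energy_eq_field_energy[OF M(2,1) _ \<eta>] R1 by (simp add: ennreal_add_eq_top less_top[symmetric])
  then obtain k where k: "kernel_energy Q M \<eta> = ennreal k" "0 \<le> k" by (cases "kernel_energy Q M \<eta>") auto
  \<comment> \<open>The level \<open>k + 1\<close> provides the strict inequality by which mass off
    the disc is excluded.\<close>
  obtain R2 where R2: "\<forall>R\<ge>R2. \<forall>z w. z \<notin> cball 0 R \<or> w \<notin> cball 0 R \<longrightarrow> ereal (k + 1) \<le> energy_kernel Q M z w"
    using energy_kernel_off_disc[OF M(2) admissible_field_growth[OF Q], of "k + 1"] by (elim exE)
  show ?thesis
  proof (intro exI[of _ "max R1 R2"] conjI allI impI)
    show "1 \<le> max R1 R2" using R1 by simp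
    fix R assume R: "max R1 R2 \<le> R"
    then have R0: "R > 0" "1 \<le> 2 * R" "R1 \<le> R" "R2 \<le> R" using R1 by auto
    have \<eta>R: "\<eta> \<in> probs_on R" using \<eta> R0(3) by (auto simp: probs_on_def elim!: eventually_mono)
    obtain \<mu> where \<mu>: "\<mu> \<in> probs_on R" "\<And>\<nu>. \<nu> \<in> probs_on R \<Longrightarrow> field_energy R ?p \<mu> \<le> field_energy R ?p \<nu>"
      using field_energy_minimizer_exists[OF R0(1) p admissible_field_lsc[OF Q M(2)]] by blast
    note FE = kernel_energy_eq_field_energy[OF M(2,1) R0(2)]
    have fin: "field_energy R ?p \<mu> < \<infinity>"
      using \<mu>(2)[OF \<eta>R] unfolding FE[OF \<eta>R] k by (simp add: le_less_trans)
    have "kernel_energy Q M \<mu> \<le> kernel_energy Q M \<eta>"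
      using \<mu>(2)[OF \<eta>R] unfolding FE[OF \<eta>R] FE[OF \<mu>(1)] by (simp add: add.commute[of _ "ennreal (ln (2 * R))"] ennreal_add_left_cancel_le)
    also have "\<dots> < ennreal (k + 1)" unfolding k using k(2) by (simp add: ennreal_lessI del: ennreal_plus)
    finally have T: "kernel_energy Q M \<mu> < ennreal (k + 1)" .
    have "equilibrium_measure Q = \<mu>"
    proof (rule equilibrium_measure_eqI[OF M(2,1) R0(2) \<mu>(1) _ R2[rule_format, OF R0(4)] T])
      fix \<nu> assume \<nu>: "\<nu> \<in> probs_on R" "\<nu> \<noteq> \<mu>"
      show "field_energy R ?p \<mu> < field_energy R ?p \<nu>"
        by (rule strict_minimizer[OF R0(1) \<mu>(1) fin _ \<nu>]) (rule first_variation[OF R0(1) p \<mu>(1) _ \<mu>(2)])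
    qed auto
    then show "minimizing_measure R ?p (equilibrium_measure Q)"
      using R0 p \<mu> fin by (simp add: minimizing_measure_def)
  qed
qed

section \<open>The equilibrium measure on a conformal disc\<close>

lemma disc_defect_outside:
  assumes "s > 0" "z \<notin> ball a s"
  shows "disc_defect ((z - a) /\<^sub>R s) = 0"
proof -
  have "s \<le> norm (z - a)" using assms by (simp add: dist_norm norm_minus_commute)
  then have "1 \<le> norm ((z - a) /\<^sub>R s)" unfolding norm_scaleR using assms by (simp add: field_simps)
  then show ?thesis using norm_eq_zero[of "(z - a) /\<^sub>R s"] by (auto simp only: disc_defect_def split: if_splits)
qed

text \<open>The mean of \<open>|x|^2\<close> over a centred disc of radius \<open>s\<close> is
  \<open>s^2 / 2\<close>. The cross term from moving the centre to \<open>a\<close> is removed by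
  pairing \<open>x\<close> with \<open>- x\<close> in the parallelogram law.\<close>

lemma nn_integral_norm_square_ball:
  fixes a :: complex
  assumes s: "s > 0" and m: "0 \<le> m" and C: "0 \<le> C"
  shows "(\<integral>\<^sup>+\<zeta>. ennreal (m + C * (norm \<zeta>)\<^sup>2) * indicator (ball a s) \<zeta> \<partial>lborel)
    = ennreal (pi * s\<^sup>2 * (m + C * ((norm a)\<^sup>2 + s\<^sup>2 / 2)))"
proof -
  let ?B = "\<lambda>x. indicator (ball (0::complex) s) x :: ennreal"
  have area: "(\<integral>\<^sup>+x. ennreal k * ?B x \<partial>lborel) = ennreal (pi * s\<^sup>2 * k)" if "0 \<le> k" for k
    using s that by (subst nn_integral_cmult_indicator) (auto simp: emeasure_lborel_ball_complex mult.commute simp flip: ennreal_mult)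
  have sq: "(\<integral>\<^sup>+x. ennreal ((norm x)\<^sup>2) * ?B x \<partial>lborel) = ennreal (pi * s ^ 4 / 2)"
  proof -
    have "ennreal ((norm x)\<^sup>2) * ?B x = ennreal ((norm x)\<^sup>2) * indicator {..<s\<^sup>2} ((norm x)\<^sup>2)" for x
      using s by (auto simp: indicator_def power_mono_iff not_less intro: power_strict_mono)
        (metis norm_ge_zero not_less power2_less_imp_less power_mono less_imp_le)
    then have "(\<integral>\<^sup>+x. ennreal ((norm x)\<^sup>2) * ?B x \<partial>lborel) = ennreal pi * (\<integral>\<^sup>+u. ennreal u * indicator {..<s\<^sup>2} u * indicator {0..} u \<partial>lborel)"
      using nn_integral_radial[of "\<lambda>u. ennreal u * indicator {..<s\<^sup>2} u"] by simp
    also have "(\<integral>\<^sup>+u. ennreal u * indicator {..<s\<^sup>2} u * indicator {0..} u \<partial>lborel) = (\<integral>\<^sup>+u. ennreal u * indicator {0..s\<^sup>2} u \<partial>lborel)"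
    proof (rule nn_integral_cong_AE)
      have "AE u in lborel. u \<noteq> s\<^sup>2" by (rule AE_lborel_singleton)
      then show "AE u in lborel. ennreal u * indicator {..<s\<^sup>2} u * indicator {0..} u = ennreal u * indicator {0..s\<^sup>2} u"
        by eventually_elim (auto simp: indicator_def)
    qed
    also have "\<dots> = ennreal ((s\<^sup>2)\<^sup>2 / 2 - 0\<^sup>2 / 2)"
      by (rule nn_integral_FTC_Icc[where F="\<lambda>u. u\<^sup>2 / 2"]) (auto intro!: derivative_eq_intros)
    also have "ennreal pi * \<dots> = ennreal (pi * s ^ 4 / 2)"
      by (subst ennreal_mult[symmetric]) (auto simp flip: power_mult)
    finally show ?thesis .
  qed
  define I where "I b = (\<integral>\<^sup>+x. ennreal ((norm (b + x))\<^sup>2) * ?B x \<partial>lborel)" for b :: complex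
  \<comment> \<open>Invariance under the rotation by -1.\<close>
  have neg: "I (- a) = I a"
  proof -
    have "I (- a) = (\<integral>\<^sup>+x. ennreal ((norm (- a + x))\<^sup>2) * ?B x \<partial>distr lborel borel (\<lambda>z. (-1) * z))"
      unfolding I_def by (subst lborel_rotation) auto
    also have "\<dots> = (\<integral>\<^sup>+x. ennreal ((norm (- a + (-1) * x))\<^sup>2) * ?B ((-1) * x) \<partial>lborel)"
      by (rule nn_integral_distr) auto
    also have "\<dots> = I a"
    proof -
      have "norm (- a + (-1) * x) = norm (a + x)" for x by (metis minus_add_distrib mult_minus1 norm_minus_cancel)
      then show ?thesis unfolding I_def by (intro nn_integral_cong) (auto simp: indicator_def)
    qed
    finally show ?thesis .
  qed
  have "I a + I (- a) = (\<integral>\<^sup>+x. ennreal (2 * (norm a)\<^sup>2) * ?B x + ennreal 2 * (ennreal ((norm x)\<^sup>2) * ?B x) \<partial>lborel)"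
    unfolding I_def
  proof (subst nn_integral_add[symmetric], simp, simp, intro nn_integral_cong)
    fix x
    have "(norm (a + x))\<^sup>2 + (norm (- a + x))\<^sup>2 = 2 * (norm a)\<^sup>2 + 2 * (norm x)\<^sup>2"
      unfolding cmod_power2 by (simp add: power2_eq_square algebra_simps)
    then have "ennreal ((norm (a + x))\<^sup>2) + ennreal ((norm (- a + x))\<^sup>2) = ennreal (2 * (norm a)\<^sup>2) + ennreal 2 * ennreal ((norm x)\<^sup>2)"
      by (simp add: ennreal_two_mult flip: ennreal_plus)
    then show "ennreal ((norm (a + x))\<^sup>2) * ?B x + ennreal ((norm (- a + x))\<^sup>2) * ?B x
        = ennreal (2 * (norm a)\<^sup>2) * ?B x + ennreal 2 * (ennreal ((norm x)\<^sup>2) * ?B x)"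
      by (auto simp: indicator_def)
  qed
  also have "\<dots> = ennreal (pi * s\<^sup>2 * (2 * (norm a)\<^sup>2)) + ennreal 2 * ennreal (pi * s ^ 4 / 2)"
    unfolding sq[symmetric] area[symmetric, of "2 * (norm a)\<^sup>2", simplified]
    by (subst nn_integral_add) (auto simp: nn_integral_cmult)
  finally have "2 * I a = 2 * ennreal (pi * s\<^sup>2 * (norm a)\<^sup>2 + pi * s ^ 4 / 2)"
    unfolding neg using s by (simp add: mult_2[symmetric] ennreal_two_mult algebra_simps flip: ennreal_plus ennreal_mult)
  then have I: "I a = ennreal (pi * s\<^sup>2 * (norm a)\<^sup>2 + pi * s ^ 4 / 2)"
    by (subst (asm) ennreal_mult_cancel_left) auto
  have "(\<integral>\<^sup>+\<zeta>. ennreal (m + C * (norm \<zeta>)\<^sup>2) * indicator (ball a s) \<zeta> \<partial>lborel)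
      = (\<integral>\<^sup>+x. ennreal (m + C * (norm (a + x))\<^sup>2) * ?B x \<partial>lborel)"
    by (subst nn_integral_lborel_affine[of _ 1 a]) (auto intro!: nn_integral_cong simp: indicator_def dist_norm)
  also have "\<dots> = (\<integral>\<^sup>+x. ennreal m * ?B x + ennreal C * (ennreal ((norm (a + x))\<^sup>2) * ?B x) \<partial>lborel)"
    using m C by (intro nn_integral_cong) (auto simp: indicator_def ennreal_mult)
  also have "\<dots> = ennreal (pi * s\<^sup>2 * m) + ennreal C * I a"
    unfolding I_def area[OF m, symmetric] by (subst nn_integral_add) (auto simp: nn_integral_cmult)
  also have "\<dots> = ennreal (pi * s\<^sup>2 * m + C * (pi * s\<^sup>2 * (norm a)\<^sup>2 + pi * s ^ 4 / 2))"
    unfolding I using m C s by (simp del: ennreal_plus flip: ennreal_mult) (subst ennreal_plus; simp)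
  also have "pi * s\<^sup>2 * m + C * (pi * s\<^sup>2 * (norm a)\<^sup>2 + pi * s ^ 4 / 2) = pi * s\<^sup>2 * (m + C * ((norm a)\<^sup>2 + s\<^sup>2 / 2))"
    by (simp add: algebra_simps power2_eq_square power4_eq_xxxx)
  finally show ?thesis .
qed

text \<open>In the coordinate \<open>\<zeta> = f z\<close> the field on the image of the disc is
  \<open>C |\<zeta>|^2\<close>; \<open>m\<close> accounts for the shift that makes \<open>p\<close>
  nonnegative.\<close>

locale quadratic_disc = minimizing_measure R p \<mu> for R p \<mu> +
  fixes \<psi> f :: "complex \<Rightarrow> complex" and c :: complex and r C m :: real
  assumes \<psi>: "\<psi> holomorphic_on ball c r" and r: "r > 0"
    and f_\<psi>: "\<And>\<zeta>. \<zeta> \<in> ball c r \<Longrightarrow> f (\<psi> \<zeta>) = \<zeta>"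
    and f_cont: "continuous_on (\<psi> ` ball c r) f"
    and sub: "\<psi> ` ball c r \<subseteq> cball 0 R" and supp: "\<psi> ` ball c r \<subseteq> measure_support \<mu>"
    and C: "C > 0" and m: "0 \<le> m"
    and p_\<psi>: "\<And>\<zeta>. \<zeta> \<in> ball c r \<Longrightarrow> p (\<psi> \<zeta>) = ennreal (m + C * (norm \<zeta>)\<^sup>2)"
    and p_cont: "\<And>z. z \<in> \<psi> ` ball c r \<Longrightarrow> isCont p z"
begin

definition \<Omega> :: "complex set" where "\<Omega> = \<psi> ` ball c r"

text \<open>Extension by zero makes the coordinate maps Borel on the whole plane, while
  \<open>\<psi>\<close> and \<open>f\<close> are controlled only on the disc and on
  \<open>\<Omega>\<close>.\<close>

definition \<psi>' :: "complex \<Rightarrow> complex" where "\<psi>' \<zeta> = indicator (ball c r) \<zeta> *\<^sub>R \<psi> \<zeta>"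

definition f' :: "complex \<Rightarrow> complex" where "f' z = indicator \<Omega> z *\<^sub>R f z"

lemma inj: "inj_on \<psi> (ball c r)"
  using f_\<psi> by (rule inj_on_inverseI)

lemma open_\<Omega>: "open \<Omega>"
  unfolding \<Omega>_def by (rule open_mapping_thm3[OF \<psi> open_ball inj])

lemma \<Omega>_sets[measurable]: "\<Omega> \<in> sets borel"
  using open_\<Omega> by auto

lemma \<psi>'_meas[measurable]: "\<psi>' \<in> borel_measurable borel"
  unfolding \<psi>'_def using holomorphic_on_imp_continuous_on[OF \<psi>]
  by (intro borel_measurable_continuous_on_indicator) auto

lemma f'_meas[measurable]: "f' \<in> borel_measurable borel"
  unfolding f'_def using f_cont by (intro borel_measurable_continuous_on_indicator) (auto simp: \<Omega>_def[symmetric])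

lemma \<psi>'_eq: "\<zeta> \<in> ball c r \<Longrightarrow> \<psi>' \<zeta> = \<psi> \<zeta>"
  by (simp add: \<psi>'_def)

lemma f'_eq: "z \<in> \<Omega> \<Longrightarrow> f' z = f z"
  by (simp add: f'_def)

lemma f_in: "z \<in> \<Omega> \<Longrightarrow> f z \<in> ball c r \<and> \<psi> (f z) = z"
  unfolding \<Omega>_def by (auto simp del: mem_ball simp: f_\<psi>)

text \<open>The defect of the mean value property on a disc, transplanted by \<open>\<psi>\<close>.\<close>

definition \<rho> :: "complex \<Rightarrow> real \<Rightarrow> complex \<Rightarrow> ennreal" where
  "\<rho> a s z = disc_defect ((f' z - a) /\<^sub>R s) * indicator \<Omega> z"

lemma \<rho>_meas[measurable]: "\<rho> a s \<in> borel_measurable borel"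
  unfolding \<rho>_def by measurable

text \<open>Unites the inner and the outer mean value: the transplanted defect vanishes off the
  image of the small disc, because \<open>f\<close> maps the rest of \<open>\<Omega>\<close> outside
  that disc.\<close>

lemma mean_value_defect:
  assumes s: "s > 0" and D: "ball a s \<subseteq> ball c r" and z: "z \<in> cball 0 R"
  shows "(\<integral>\<^sup>+\<zeta>. log_kernel R z (\<psi> \<zeta>) * indicator (ball a s) \<zeta> \<partial>lborel) + ennreal (pi * s\<^sup>2) * \<rho> a s z
    = ennreal (pi * s\<^sup>2) * log_kernel R z (\<psi> a)"
proof -
  have \<psi>s: "\<psi> holomorphic_on ball a s" "inj_on \<psi> (ball a s)" "\<psi> ` ball a s \<subseteq> cball 0 R"
    using \<psi> inj sub D by (auto intro: holomorphic_on_subset inj_on_subset)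
  show ?thesis
  proof (cases "z \<in> \<psi> ` ball a s")
    case True
    then obtain \<omega> where \<omega>: "\<omega> \<in> ball a s" "z = \<psi> \<omega>" by blast
    then have "z \<in> \<Omega>" "f z = \<omega>" using D f_\<psi> by (auto simp: \<Omega>_def simp del: mem_ball)
    then show ?thesis
      using nn_integral_log_kernel_inside[OF \<psi>s(1) s \<psi>s(2,3) \<omega>(1)] by (simp add: \<rho>_def f'_eq \<omega>(2))
  next
    case False
    have "\<rho> a s z = 0"
    proof (cases "z \<in> \<Omega>")
      case True
      have "f z \<notin> ball a s" using f_in[OF True] False by (metis image_eqI)
      then show ?thesis using True disc_defect_outside[OF s] by (simp add: \<rho>_def f'_eq)
    qed (simp add: \<rho>_def)
    then show ?thesis
      using nn_integral_log_kernel_outside[OF \<psi>s(1) s \<psi>s(3) z False] by simp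
  qed
qed

text \<open>The upper bound holds at every point of the support, the lower one almost everywhere in
  area; together they give a constant potential in the coordinate \<open>\<zeta>\<close>.\<close>

lemma AE_Pot: "AE \<zeta> in lborel. \<zeta> \<in> ball c r \<longrightarrow> Pot (\<psi> \<zeta>) = F"
proof -
  have pb: "p (\<psi> \<zeta>) \<le> ennreal (m + C * (norm c + r)\<^sup>2)" if "\<zeta> \<in> ball c r" for \<zeta>
  proof -
    have "norm \<zeta> \<le> norm c + r" using that norm_triangle_ineq2[of \<zeta> c] by (simp add: dist_norm norm_minus_commute)
    then have "(norm \<zeta>)\<^sup>2 \<le> (norm c + r)\<^sup>2" by (intro power_mono) auto
    then show ?thesis unfolding p_\<psi>[OF that] using C by (intro ennreal_leI) auto
  qed
  have "Pot (\<psi> \<zeta>) \<le> F" if "\<zeta> \<in> ball c r" for \<zeta>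
    using Pot_le_on_support supp p_cont that by blast
  with AE_disc_Pot_ge[OF \<psi> r inj sub pb] show ?thesis
    by (auto elim!: eventually_mono intro: antisym)
qed

lemma Pot_parts:
  "Pot (\<psi> \<zeta>) = (\<integral>\<^sup>+w. log_kernel R (\<psi> \<zeta>) w \<partial>\<mu>) + ennreal (m + C * (norm \<zeta>)\<^sup>2)" if "\<zeta> \<in> ball c r"
  using that by (simp add: Pot_def p_\<psi>)

text \<open>The total potential equals \<open>F\<close> at the centre and on average. The mean of
  the logarithmic part lies below its central value by the integral of the defect, the mean of the
  quadratic field above its own by \<open>C s^2 / 2\<close>, so the two deviations agree.\<close>

lemma AE_integral_\<rho>:
  assumes s: "s > 0"
  shows "AE a in lborel. ball a s \<subseteq> ball c r \<longrightarrow> (\<integral>\<^sup>+z. \<rho> a s z \<partial>\<mu>) = ennreal (C * s\<^sup>2 / 2)"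
  using AE_Pot
proof eventually_elim
  case (elim a)
  note sets_\<mu>[measurable_cong] = probs_onD(2)[OF \<mu>]
  interpret prob_space \<mu> by (rule probs_onD(1)[OF \<mu>])
  interpret pair_sigma_finite lborel \<mu> ..
  show ?case
  proof
    assume D: "ball a s \<subseteq> ball c r"
    then have a: "a \<in> ball c r" using s by (metis centre_in_ball subsetD)
    define u where "u z = (\<integral>\<^sup>+w. log_kernel R z w \<partial>\<mu>)" for z
    have u[measurable]: "u \<in> borel_measurable borel" unfolding u_def by (rule log_kernel_measurable_integral[OF \<mu>])
    let ?k = "ennreal (pi * s\<^sup>2)"
    have swap: "(\<integral>\<^sup>+z. (\<integral>\<^sup>+\<zeta>. log_kernel R z (\<psi> \<zeta>) * indicator (ball a s) \<zeta> \<partial>lborel) \<partial>\<mu>)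
        = (\<integral>\<^sup>+\<zeta>. u (\<psi>' \<zeta>) * indicator (ball a s) \<zeta> \<partial>lborel)"
    proof -
      have "(\<integral>\<^sup>+z. (\<integral>\<^sup>+\<zeta>. log_kernel R z (\<psi> \<zeta>) * indicator (ball a s) \<zeta> \<partial>lborel) \<partial>\<mu>)
          = (\<integral>\<^sup>+z. (\<integral>\<^sup>+\<zeta>. log_kernel R (\<psi>' \<zeta>) z * indicator (ball a s) \<zeta> \<partial>lborel) \<partial>\<mu>)"
        using D by (intro nn_integral_cong) (auto simp: indicator_def \<psi>'_def log_kernel_commute)
      also have "\<dots> = (\<integral>\<^sup>+\<zeta>. (\<integral>\<^sup>+z. log_kernel R (\<psi>' \<zeta>) z * indicator (ball a s) \<zeta> \<partial>\<mu>) \<partial>lborel)"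
        by (rule Fubini') measurable
      also have "\<dots> = (\<integral>\<^sup>+\<zeta>. u (\<psi>' \<zeta>) * indicator (ball a s) \<zeta> \<partial>lborel)"
        unfolding u_def by (intro nn_integral_cong nn_integral_multc) measurable
      finally show ?thesis .
    qed
    have mfun: "(\<lambda>z. \<integral>\<^sup>+\<zeta>. log_kernel R z (\<psi> \<zeta>) * indicator (ball a s) \<zeta> \<partial>lborel) \<in> borel_measurable borel"
    proof -
      have "(\<lambda>z. \<integral>\<^sup>+\<zeta>. log_kernel R z (\<psi> \<zeta>) * indicator (ball a s) \<zeta> \<partial>lborel)
          = (\<lambda>z. \<integral>\<^sup>+\<zeta>. log_kernel R z (\<psi>' \<zeta>) * indicator (ball a s) \<zeta> \<partial>lborel)"
        using D by (intro ext nn_integral_cong) (auto simp: indicator_def \<psi>'_def)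
      then show ?thesis by simp
    qed
    have "(\<integral>\<^sup>+z. (\<integral>\<^sup>+\<zeta>. log_kernel R z (\<psi> \<zeta>) * indicator (ball a s) \<zeta> \<partial>lborel) + ?k * \<rho> a s z \<partial>\<mu>)
        = (\<integral>\<^sup>+z. ?k * log_kernel R (\<psi> a) z \<partial>\<mu>)"
      using probs_onD(3)[OF \<mu>]
      by (intro nn_integral_cong_AE) (auto elim!: eventually_mono simp: mean_value_defect[OF s D] log_kernel_commute)
    then have eq1: "(\<integral>\<^sup>+\<zeta>. u (\<psi>' \<zeta>) * indicator (ball a s) \<zeta> \<partial>lborel) + ?k * (\<integral>\<^sup>+z. \<rho> a s z \<partial>\<mu>) = ?k * u (\<psi> a)"
      using mfun by (simp add: nn_integral_add nn_integral_cmult swap u_def)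
    have quad: "(\<integral>\<^sup>+\<zeta>. ennreal (m + C * (norm \<zeta>)\<^sup>2) * indicator (ball a s) \<zeta> \<partial>lborel) = ennreal (pi * s\<^sup>2 * (m + C * ((norm a)\<^sup>2 + s\<^sup>2 / 2)))"
      using s m C by (intro nn_integral_norm_square_ball) auto
    have "(\<integral>\<^sup>+\<zeta>. u (\<psi>' \<zeta>) * indicator (ball a s) \<zeta> \<partial>lborel) + (\<integral>\<^sup>+\<zeta>. ennreal (m + C * (norm \<zeta>)\<^sup>2) * indicator (ball a s) \<zeta> \<partial>lborel)
        = (\<integral>\<^sup>+\<zeta>. u (\<psi>' \<zeta>) * indicator (ball a s) \<zeta> + ennreal (m + C * (norm \<zeta>)\<^sup>2) * indicator (ball a s) \<zeta> \<partial>lborel)"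
      by (intro nn_integral_add[symmetric]) auto
    also have "\<dots> = (\<integral>\<^sup>+\<zeta>. F * indicator (ball a s) \<zeta> \<partial>lborel)"
    proof (rule nn_integral_cong_AE)
      show "AE \<zeta> in lborel. u (\<psi>' \<zeta>) * indicator (ball a s) \<zeta> + ennreal (m + C * (norm \<zeta>)\<^sup>2) * indicator (ball a s) \<zeta> = F * indicator (ball a s) \<zeta>"
        using AE_Pot
      proof eventually_elim
        case (elim \<zeta>)
        show ?case
        proof (cases "\<zeta> \<in> ball a s")
          case True
          then have "\<zeta> \<in> ball c r" using D by blast
          then show ?thesis using elim True Pot_parts[of \<zeta>] by (simp add: \<psi>'_def u_def)
        qed simp
      qed
    qed
    also have "\<dots> = ?k * F"
      using s by (simp add: nn_integral_cmult_indicator emeasure_lborel_ball_complex mult.commute)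
    finally have eq2: "(\<integral>\<^sup>+\<zeta>. u (\<psi>' \<zeta>) * indicator (ball a s) \<zeta> \<partial>lborel) + ennreal (pi * s\<^sup>2 * (m + C * ((norm a)\<^sup>2 + s\<^sup>2 / 2))) = ?k * F"
      unfolding quad .
    \<comment> \<open>The potential is evaluated at the centre itself, which is why the result holds
      only for almost every \<open>a\<close>.\<close>
    have eq3: "u (\<psi> a) + ennreal (m + C * (norm a)\<^sup>2) = F"
      using elim a Pot_parts[OF a] by (simp add: u_def)
    have split: "ennreal (pi * s\<^sup>2 * (m + C * ((norm a)\<^sup>2 + s\<^sup>2 / 2))) = ?k * ennreal (m + C * (norm a)\<^sup>2) + ?k * ennreal (C * s\<^sup>2 / 2)"
    proof -
      have "pi * s\<^sup>2 * (m + C * ((norm a)\<^sup>2 + s\<^sup>2 / 2)) = pi * s\<^sup>2 * (m + C * (norm a)\<^sup>2) + pi * s\<^sup>2 * (C * s\<^sup>2 / 2)"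
        by (simp add: algebra_simps)
      moreover have "0 \<le> m + C * (norm a)\<^sup>2" "0 \<le> C * s\<^sup>2 / 2" using m C by auto
      moreover have "?k * ennreal x + ?k * ennreal y = ennreal (pi * s\<^sup>2 * x + pi * s\<^sup>2 * y)" if "0 \<le> x" "0 \<le> y" for x y
        using that by (simp flip: ennreal_mult ennreal_plus)
      ultimately show ?thesis by simp
    qed
    let ?X = "\<integral>\<^sup>+\<zeta>. u (\<psi>' \<zeta>) * indicator (ball a s) \<zeta> \<partial>lborel" and ?Y = "\<integral>\<^sup>+z. \<rho> a s z \<partial>\<mu>"
    have "?k * F + ?k * ?Y = (?X + (?k * ennreal (m + C * (norm a)\<^sup>2) + ?k * ennreal (C * s\<^sup>2 / 2))) + ?k * ?Y"
      using eq2 split by simp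
    also have "\<dots> = (?X + ?k * ?Y) + ?k * ennreal (m + C * (norm a)\<^sup>2) + ?k * ennreal (C * s\<^sup>2 / 2)"
      by (simp only: add_ac)
    also have "\<dots> = ?k * (u (\<psi> a) + ennreal (m + C * (norm a)\<^sup>2)) + ?k * ennreal (C * s\<^sup>2 / 2)"
      unfolding eq1 by (simp only: distrib_left)
    also have "\<dots> = ?k * F + ?k * ennreal (C * s\<^sup>2 / 2)" unfolding eq3 ..
    finally have "?k * ?Y = ?k * ennreal (C * s\<^sup>2 / 2)"
      using F_finite by (subst (asm) ennreal_add_left_cancel) (auto simp: ennreal_mult_eq_top_iff)
    then show "?Y = ennreal (C * s\<^sup>2 / 2)"
      using s by (subst (asm) ennreal_mult_cancel_left) auto
  qed
qed

text \<open>Both \<open>\<mu>\<close> on \<open>\<Omega>\<close>, transported by \<open>f\<close>,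
  and constant density on the disc have defect integral \<open>C s^2 / 2\<close> over each small
  disc, so they agree by uniqueness from smoothings with profile \<open>disc_defect\<close>.\<close>

lemma nn_integral_\<Omega>:
  assumes g[measurable]: "g \<in> borel_measurable borel"
  shows "(\<integral>\<^sup>+z. g z * indicator \<Omega> z \<partial>\<mu>) = ennreal (2 * C / pi) * (\<integral>\<^sup>+\<zeta>. g (\<psi> \<zeta>) * indicator (ball c r) \<zeta> \<partial>lborel)"
proof -
  note sets_\<mu>[measurable_cong] = probs_onD(2)[OF \<mu>]
  interpret prob_space \<mu> by (rule probs_onD(1)[OF \<mu>])
  define M1 where "M1 = distr (density \<mu> (indicator \<Omega>)) borel f'"
  \<comment> \<open>The density \<open>2 C / pi\<close> is \<open>C s^2 / 2\<close> divided by
    \<open>pi s^2 / 4\<close>, the area integral of the scaled defect.\<close>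
  define M2 where "M2 = density lborel (\<lambda>\<zeta>. ennreal (2 * C / pi) * indicator (ball c r) \<zeta>)"
  have ind[measurable]: "(indicator \<Omega> :: complex \<Rightarrow> ennreal) \<in> borel_measurable \<mu>" by measurable
  have int1: "(\<integral>\<^sup>+x. h x \<partial>M1) = (\<integral>\<^sup>+z. h (f' z) * indicator \<Omega> z \<partial>\<mu>)" if [measurable]: "h \<in> borel_measurable borel" for h
    unfolding M1_def by (simp add: nn_integral_distr nn_integral_density mult.commute)
  have dm: "(\<lambda>\<zeta>. ennreal (2 * C / pi) * indicator (ball c r) \<zeta>) \<in> borel_measurable lborel" by measurable
  have int2: "(\<integral>\<^sup>+x. h x \<partial>M2) = ennreal (2 * C / pi) * (\<integral>\<^sup>+\<zeta>. h \<zeta> * indicator (ball c r) \<zeta> \<partial>lborel)" if [measurable]: "h \<in> borel_measurable borel" for h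
  proof -
    have "(\<integral>\<^sup>+x. h x \<partial>M2) = (\<integral>\<^sup>+\<zeta>. ennreal (2 * C / pi) * (h \<zeta> * indicator (ball c r) \<zeta>) \<partial>lborel)"
      unfolding M2_def using nn_integral_density[OF dm, of h] by (simp add: mult_ac)
    also have "\<dots> = ennreal (2 * C / pi) * (\<integral>\<^sup>+\<zeta>. h \<zeta> * indicator (ball c r) \<zeta> \<partial>lborel)"
      by (rule nn_integral_cmult) measurable
    finally show ?thesis .
  qed
  have sets12: "sets M1 = sets borel" "sets M2 = sets borel" by (auto simp: M1_def M2_def)
  have fin1: "finite_measure M1"
  proof
    have "emeasure M1 (space M1) = (\<integral>\<^sup>+z. indicator \<Omega> z \<partial>\<mu>)"
      using int1[of "\<lambda>_. 1"] by simp
    also have "\<dots> \<le> 1" using measure_le_1 by (subst nn_integral_indicator) (auto simp: sets_\<mu> emeasure_eq_measure)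
    finally show "emeasure M1 (space M1) \<noteq> \<infinity>" by (auto simp: top_unique)
  qed
  have fin2: "finite_measure M2"
  proof
    have "emeasure M2 (space M2) = ennreal (2 * C / pi) * emeasure lborel (ball c r)"
      using int2[of "\<lambda>_. 1"] by simp
    then show "emeasure M2 (space M2) \<noteq> \<infinity>"
      using r by (simp add: emeasure_lborel_ball_complex ennreal_mult_eq_top_iff)
  qed
  have in_ball: "emeasure M1 B = emeasure M2 B" if B: "B \<in> sets borel" "B \<subseteq> ball c r" for B
  proof (rule emeasure_eq_if_smoothings_eq[OF fin1 sets12(1) fin2 sets12(2), where \<rho>=disc_defect and s="\<lambda>n. 1 / real (Suc n)" and G="ball c r"])
    show "(\<lambda>n. 1 / real (Suc n)) \<longlonglongrightarrow> 0" by real_asymp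
  next
    fix A assume A: "compact A" "A \<subseteq> ball c r"
    obtain e where e: "e > 0" "(\<Union>x\<in>A. cball x e) \<subseteq> ball c r"
      using compact_subset_open_imp_cball_epsilon_subset[OF A(1) _ A(2)] by auto
    have "\<forall>\<^sub>F n in sequentially. 1 / real (Suc n) < e"
      using e(1) by real_asymp
    then show "\<forall>\<^sub>F n in sequentially. AE a in lborel. a \<in> A \<longrightarrow>
        (\<integral>\<^sup>+z. disc_defect ((z - a) /\<^sub>R (1 / real (Suc n))) \<partial>M1) = (\<integral>\<^sup>+z. disc_defect ((z - a) /\<^sub>R (1 / real (Suc n))) \<partial>M2)"
    proof eventually_elim
      case (elim n)
      define s where "s = 1 / real (Suc n)"
      have s: "s > 0" "s < e" using elim by (auto simp: s_def)
      have "AE a in lborel. a \<in> A \<longrightarrow> (\<integral>\<^sup>+z. disc_defect ((z - a) /\<^sub>R s) \<partial>M1) = (\<integral>\<^sup>+z. disc_defect ((z - a) /\<^sub>R s) \<partial>M2)"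
        using AE_integral_\<rho>[OF s(1)]
      proof eventually_elim
        case (elim a)
        show ?case
        proof
          assume "a \<in> A"
          have sub_e: "ball a s \<subseteq> cball a e" using s(2) by (auto simp: less_imp_le)
          also have "\<dots> \<subseteq> ball c r" using \<open>a \<in> A\<close> e(2) by blast
          finally have D: "ball a s \<subseteq> ball c r" .
          have "(\<integral>\<^sup>+z. disc_defect ((z - a) /\<^sub>R s) \<partial>M1) = ennreal (C * s\<^sup>2 / 2)"
            using elim D by (simp add: int1 \<rho>_def)
          moreover have "(\<integral>\<^sup>+z. disc_defect ((z - a) /\<^sub>R s) \<partial>M2) = ennreal (C * s\<^sup>2 / 2)"
          proof -
            have "disc_defect ((z - a) /\<^sub>R s) * indicator (ball c r) z = disc_defect ((z - a) /\<^sub>R s)" for z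
            proof (cases "z \<in> ball c r")
              case False
              then have "z \<notin> ball a s" using D by blast
              then show ?thesis using disc_defect_outside[OF s(1)] by simp
            qed simp
            then have "(\<integral>\<^sup>+z. disc_defect ((z - a) /\<^sub>R s) \<partial>M2) = ennreal (2 * C / pi) * (\<integral>\<^sup>+z. disc_defect ((z - a) /\<^sub>R s) \<partial>lborel)"
              by (simp add: int2)
            also have "(\<integral>\<^sup>+z. disc_defect ((z - a) /\<^sub>R s) \<partial>lborel) = ennreal (s\<^sup>2) * (\<integral>\<^sup>+x. disc_defect x \<partial>lborel)"
              using s(1) by (subst nn_integral_lborel_affine[of _ s a]) simp_all
            also have "ennreal (2 * C / pi) * (ennreal (s\<^sup>2) * (\<integral>\<^sup>+x. disc_defect x \<partial>lborel)) = ennreal (C * s\<^sup>2 / 2)"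
              unfolding nn_integral_disc_defect using C by (simp flip: ennreal_mult)
            finally show ?thesis .
          qed
          ultimately show "(\<integral>\<^sup>+z. disc_defect ((z - a) /\<^sub>R s) \<partial>M1) = (\<integral>\<^sup>+z. disc_defect ((z - a) /\<^sub>R s) \<partial>M2)" by simp
        qed
      qed
      then show ?case by (simp add: s_def)
    qed
  qed (simp_all only: B open_ball borel_measurable_disc_defect nn_integral_disc_defect, simp_all)
  have "M1 = M2"
  proof (rule measure_eqI)
    fix B assume "B \<in> sets M1"
    then have B[measurable]: "B \<in> sets borel" by (simp add: sets12)
    have "emeasure M1 B = (\<integral>\<^sup>+x. indicator B x \<partial>M1)" using B sets12 by simp
    also have "\<dots> = (\<integral>\<^sup>+x. indicator (B \<inter> ball c r) x \<partial>M1)"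
      unfolding int1[of "indicator B", OF borel_measurable_indicator[OF B]]
      by (subst int1) (auto intro!: nn_integral_cong simp: indicator_def f'_eq f_in simp del: mem_ball)
    also have "\<dots> = emeasure M1 (B \<inter> ball c r)" using sets12 by simp
    also have "\<dots> = emeasure M2 (B \<inter> ball c r)" by (rule in_ball) auto
    also have "\<dots> = (\<integral>\<^sup>+x. indicator (B \<inter> ball c r) x \<partial>M2)" using sets12 by simp
    also have "\<dots> = (\<integral>\<^sup>+x. indicator B x \<partial>M2)"
    proof -
      have BI: "B \<inter> ball c r \<in> sets borel" by measurable
      have ind: "indicator (B \<inter> ball c r) x * indicator (ball c r) x = (indicator B x * indicator (ball c r) x :: ennreal)" for x
        by (cases "x \<in> ball c r"; cases "x \<in> B") simp_all
      show ?thesis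
        using int2[of "indicator B"] int2[of "indicator (B \<inter> ball c r)"] B BI
        by (simp only: ind borel_measurable_indicator)
    qed
    also have "\<dots> = emeasure M2 B" using B sets12 by simp
    finally show "emeasure M1 B = emeasure M2 B" .
  qed (simp add: sets12)
  have "(\<integral>\<^sup>+z. g z * indicator \<Omega> z \<partial>\<mu>) = (\<integral>\<^sup>+z. g (\<psi>' (f' z)) * indicator \<Omega> z \<partial>\<mu>)"
    by (intro nn_integral_cong) (auto simp: indicator_def f'_eq \<psi>'_eq f_in simp del: mem_ball)
  also have "\<dots> = (\<integral>\<^sup>+x. g (\<psi>' x) \<partial>M1)" by (subst int1) measurable
  also have "\<dots> = (\<integral>\<^sup>+x. g (\<psi>' x) \<partial>M2)" by (simp add: \<open>M1 = M2\<close>)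
  also have "\<dots> = ennreal (2 * C / pi) * (\<integral>\<^sup>+\<zeta>. g (\<psi>' \<zeta>) * indicator (ball c r) \<zeta> \<partial>lborel)" by (subst int2) measurable
  also have "(\<integral>\<^sup>+\<zeta>. g (\<psi>' \<zeta>) * indicator (ball c r) \<zeta> \<partial>lborel) = (\<integral>\<^sup>+\<zeta>. g (\<psi> \<zeta>) * indicator (ball c r) \<zeta> \<partial>lborel)"
    by (intro nn_integral_cong) (auto simp: indicator_def \<psi>'_eq)
  finally show ?thesis .
qed

lemma emeasure_\<Omega>: "emeasure \<mu> \<Omega> = ennreal (2 * C * r\<^sup>2)"
proof -
  have "emeasure \<mu> \<Omega> = (\<integral>\<^sup>+z. 1 * indicator \<Omega> z \<partial>\<mu>)" using probs_onD(2)[OF \<mu>] by simp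
  also have "\<dots> = ennreal (2 * C / pi) * emeasure lborel (ball c r)" by (subst nn_integral_\<Omega>) auto
  also have "\<dots> = ennreal (2 * C * r\<^sup>2)" using C r by (simp add: emeasure_lborel_ball_complex flip: ennreal_mult)
  finally show ?thesis .
qed

text \<open>The mean value identity for the whole disc, multiplied by the density: to the outside,
  \<open>\<Omega>\<close> acts as a point charge at \<open>\<psi> c\<close>.\<close>

lemma potential_\<Omega>:
  assumes z: "z \<in> cball 0 R"
  shows "(\<integral>\<^sup>+w. log_kernel R z w * indicator \<Omega> w \<partial>\<mu>) + ennreal (2 * C * r\<^sup>2) * \<rho> c r z
    = ennreal (2 * C * r\<^sup>2) * log_kernel R z (\<psi> c)"
proof -
  have k: "ennreal (2 * C * r\<^sup>2) = ennreal (2 * C / pi) * ennreal (pi * r\<^sup>2)"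
    using C by (simp flip: ennreal_mult)
  have "(\<integral>\<^sup>+w. log_kernel R z w * indicator \<Omega> w \<partial>\<mu>) = ennreal (2 * C / pi) * (\<integral>\<^sup>+\<zeta>. log_kernel R z (\<psi> \<zeta>) * indicator (ball c r) \<zeta> \<partial>lborel)"
    by (rule nn_integral_\<Omega>) measurable
  then have "(\<integral>\<^sup>+w. log_kernel R z w * indicator \<Omega> w \<partial>\<mu>) + ennreal (2 * C * r\<^sup>2) * \<rho> c r z
      = ennreal (2 * C / pi) * ((\<integral>\<^sup>+\<zeta>. log_kernel R z (\<psi> \<zeta>) * indicator (ball c r) \<zeta> \<partial>lborel) + ennreal (pi * r\<^sup>2) * \<rho> c r z)"
    by (simp only: k distrib_left mult.assoc[where 'a=ennreal])
  also have "\<dots> = ennreal (2 * C * r\<^sup>2) * log_kernel R z (\<psi> c)"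
    by (simp only: mean_value_defect[OF r subset_refl z] k mult.assoc[where 'a=ennreal])
  finally show ?thesis .
qed

end

section \<open>The swept measure and its optimality for the charged field\<close>

context quadratic_disc
begin

definition \<mu>V :: "real \<Rightarrow> complex measure" where
  "\<mu>V q = density \<mu> (\<lambda>z. ennreal (1 + q) * indicator (- \<Omega>) z)"

text \<open>On the disc of radius \<open>R\<close> this is \<open>V\<close> up to an additive
  constant, composed of two nonnegative terms.\<close>

definition pV :: "real \<Rightarrow> complex \<Rightarrow> ennreal" where
  "pV q z = ennreal (1 + q) * p z + ennreal q * log_kernel R z (\<psi> c)"

lemma pV_meas: "pV q \<in> borel_measurable borel"
  unfolding pV_def by measurable

lemma nn_integral_\<mu>V:
  assumes h[measurable]: "h \<in> borel_measurable borel"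
  shows "(\<integral>\<^sup>+z. h z \<partial>\<mu>V q) = ennreal (1 + q) * (\<integral>\<^sup>+z. h z * indicator (- \<Omega>) z \<partial>\<mu>)"
proof -
  note [measurable_cong] = probs_onD(2)[OF \<mu>]
  have dm: "(\<lambda>z. ennreal (1 + q) * indicator (- \<Omega>) z) \<in> borel_measurable \<mu>" by measurable
  have hm: "h \<in> borel_measurable \<mu>" by measurable
  have "(\<integral>\<^sup>+z. h z \<partial>\<mu>V q) = (\<integral>\<^sup>+z. ennreal (1 + q) * (h z * indicator (- \<Omega>) z) \<partial>\<mu>)"
    unfolding \<mu>V_def using nn_integral_density[OF dm hm] by (simp add: mult_ac)
  also have "\<dots> = ennreal (1 + q) * (\<integral>\<^sup>+z. h z * indicator (- \<Omega>) z \<partial>\<mu>)"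
    by (rule nn_integral_cmult) measurable
  finally show ?thesis .
qed

lemma sets_\<mu>V: "sets (\<mu>V q) = sets borel"
  using probs_onD(2)[OF \<mu>] by (simp add: \<mu>V_def)

lemma emeasure_\<mu>V:
  assumes A[measurable]: "A \<in> sets borel"
  shows "emeasure (\<mu>V q) A = ennreal (1 + q) * emeasure \<mu> (A - \<Omega>)"
proof -
  have "emeasure (\<mu>V q) A = (\<integral>\<^sup>+z. indicator A z \<partial>\<mu>V q)" using A sets_\<mu>V by simp
  also have "\<dots> = ennreal (1 + q) * (\<integral>\<^sup>+z. indicator (A - \<Omega>) z \<partial>\<mu>)"
    by (subst nn_integral_\<mu>V) (auto intro!: arg_cong2[where f="(*)"] nn_integral_cong simp: indicator_def)
  also have "(\<integral>\<^sup>+z. indicator (A - \<Omega>) z \<partial>\<mu>) = emeasure \<mu> (A - \<Omega>)"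
    using probs_onD(2)[OF \<mu>] by (intro nn_integral_indicator) simp
  finally show ?thesis .
qed

context
  fixes q :: real
  assumes q: "q > 0" and qC: "2 * C * r\<^sup>2 = q / (1 + q)"
begin

text \<open>By the choice of \<open>r\<close> the mass of \<open>\<Omega>\<close> is
  \<open>q / (1 + q)\<close>, so its complement has mass \<open>1 / (1 + q)\<close>, which the
  factor \<open>1 + q\<close> restores to 1.\<close>

lemma \<mu>V_probs_on: "\<mu>V q \<in> probs_on R"
proof -
  interpret prob_space \<mu> by (rule probs_onD(1)[OF \<mu>])
  have "measure \<mu> \<Omega> = q / (1 + q)"
    using emeasure_\<Omega> q unfolding qC by (simp add: measure_def)
  then have "measure \<mu> (UNIV - \<Omega>) = 1 - q / (1 + q)"
    using prob_compl[of \<Omega>] probs_onD(2,4)[OF \<mu>] by simp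
  also have "\<dots> = 1 / (1 + q)" using q by (simp add: field_simps)
  finally have "measure \<mu> (UNIV - \<Omega>) = 1 / (1 + q)" .
  then have "emeasure (\<mu>V q) UNIV = ennreal (1 + q) * ennreal (1 / (1 + q))"
    by (simp add: emeasure_\<mu>V emeasure_eq_measure)
  also have "\<dots> = 1" using q by (subst ennreal_mult[symmetric]) auto
  finally have "prob_space (\<mu>V q)"
    using sets_eq_imp_space_eq[OF sets_\<mu>V] by (intro prob_spaceI) simp
  moreover have "AE z in \<mu>V q. z \<in> cball 0 R"
  proof -
    note [measurable_cong] = probs_onD(2)[OF \<mu>]
    have dm: "(\<lambda>z. ennreal (1 + q) * indicator (- \<Omega>) z) \<in> borel_measurable \<mu>"
      by measurable
    show ?thesis unfolding \<mu>V_def AE_density[OF dm] using probs_onD(3)[OF \<mu>] by eventually_elim simp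
  qed
  ultimately show ?thesis using sets_\<mu>V by (simp add: probs_on_def)
qed

text \<open>Removing the mass on \<open>\<Omega>\<close> and adding the charge at \<open>\<psi> c\<close> leaves the total potential unchanged
  off \<open>\<Omega>\<close>, and raises it on \<open>\<Omega>\<close>.\<close>

lemma potential_\<mu>V:
  assumes z: "z \<in> cball 0 R"
  shows "(\<integral>\<^sup>+w. log_kernel R z w \<partial>\<mu>V q) + pV q z = ennreal (1 + q) * Pot z + ennreal q * \<rho> c r z"
proof -
  note [measurable_cong] = probs_onD(2)[OF \<mu>]
  let ?i = "\<integral>\<^sup>+w. log_kernel R z w * indicator \<Omega> w \<partial>\<mu>" and ?o = "\<integral>\<^sup>+w. log_kernel R z w * indicator (- \<Omega>) w \<partial>\<mu>"
  have split: "(\<integral>\<^sup>+w. log_kernel R z w \<partial>\<mu>) = ?o + ?i"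
  proof -
    have "(\<integral>\<^sup>+w. log_kernel R z w \<partial>\<mu>) = (\<integral>\<^sup>+w. log_kernel R z w * indicator (- \<Omega>) w + log_kernel R z w * indicator \<Omega> w \<partial>\<mu>)"
      by (intro nn_integral_cong) (auto simp: indicator_def)
    also have "\<dots> = ?o + ?i" by (rule nn_integral_add) measurable
    finally show ?thesis .
  qed
  \<comment> \<open>The rescaled mass taken from \<open>\<Omega>\<close> equals the added charge
    \<open>q\<close>, so the two potentials can be exchanged.\<close>
  have k: "ennreal (1 + q) * ennreal (2 * C * r\<^sup>2) = ennreal q"
    unfolding qC using q by (subst ennreal_mult[symmetric]) auto
  have "ennreal (1 + q) * (?i + ennreal (2 * C * r\<^sup>2) * \<rho> c r z) = ennreal (1 + q) * (ennreal (2 * C * r\<^sup>2) * log_kernel R z (\<psi> c))"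
    by (simp only: potential_\<Omega>[OF z])
  then have swap: "ennreal (1 + q) * ?i + ennreal q * \<rho> c r z = ennreal q * log_kernel R z (\<psi> c)"
    by (simp only: distrib_left mult.assoc[where 'a=ennreal, symmetric] k)
  have "(\<integral>\<^sup>+w. log_kernel R z w \<partial>\<mu>V q) + pV q z = ennreal (1 + q) * ?o + (ennreal (1 + q) * p z + ennreal q * log_kernel R z (\<psi> c))"
    by (simp add: nn_integral_\<mu>V pV_def)
  also have "\<dots> = ennreal (1 + q) * ?o + (ennreal (1 + q) * p z + (ennreal (1 + q) * ?i + ennreal q * \<rho> c r z))"
    by (simp only: swap)
  also have "\<dots> = ennreal (1 + q) * Pot z + ennreal q * \<rho> c r z"
    unfolding Pot_def split by (simp only: distrib_left add_ac)
  finally show ?thesis .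
qed

lemma nn_integral_potential_\<mu>V:
  assumes \<nu>: "\<nu> \<in> probs_on R"
  shows "mutual_energy R (\<mu>V q) \<nu> + (\<integral>\<^sup>+z. pV q z \<partial>\<nu>) = (\<integral>\<^sup>+z. ennreal (1 + q) * Pot z + ennreal q * \<rho> c r z \<partial>\<nu>)"
  unfolding nn_integral_potential[OF \<mu>V_probs_on \<nu> pV_meas, symmetric]
  using probs_onD(3)[OF \<nu>] by (intro nn_integral_cong_AE) (auto elim!: eventually_mono simp: potential_\<mu>V)

lemma nn_integral_potential_\<mu>V_self:
  "mutual_energy R (\<mu>V q) (\<mu>V q) + (\<integral>\<^sup>+z. pV q z \<partial>\<mu>V q) = ennreal (1 + q) * F"
proof -
  note sets_\<mu>[measurable_cong] = probs_onD(2)[OF \<mu>]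
  interpret V: prob_space "\<mu>V q" by (rule probs_onD(1)[OF \<mu>V_probs_on])
  have "mutual_energy R (\<mu>V q) (\<mu>V q) + (\<integral>\<^sup>+z. pV q z \<partial>\<mu>V q) = (\<integral>\<^sup>+z. ennreal (1 + q) * Pot z + ennreal q * \<rho> c r z \<partial>\<mu>V q)"
    by (rule nn_integral_potential_\<mu>V[OF \<mu>V_probs_on])
  also have "\<dots> = ennreal (1 + q) * (\<integral>\<^sup>+z. (ennreal (1 + q) * Pot z + ennreal q * \<rho> c r z) * indicator (- \<Omega>) z \<partial>\<mu>)"
    by (rule nn_integral_\<mu>V) measurable
  also have "(\<integral>\<^sup>+z. (ennreal (1 + q) * Pot z + ennreal q * \<rho> c r z) * indicator (- \<Omega>) z \<partial>\<mu>)
      = (\<integral>\<^sup>+z. ennreal (1 + q) * F * indicator (- \<Omega>) z \<partial>\<mu>)"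
    using AE_Pot_eq by (intro nn_integral_cong_AE) (auto elim!: eventually_mono simp: indicator_def \<rho>_def)
  also have "ennreal (1 + q) * \<dots> = (\<integral>\<^sup>+z. ennreal (1 + q) * F \<partial>\<mu>V q)"
    by (rule nn_integral_\<mu>V[symmetric]) measurable
  also have "\<dots> = ennreal (1 + q) * F" by (simp add: V.emeasure_space_1)
  finally show ?thesis .
qed

lemma field_energy_\<mu>V_finite: "field_energy R (pV q) (\<mu>V q) < \<infinity>"
proof -
  have "mutual_energy R (\<mu>V q) (\<mu>V q) + (\<integral>\<^sup>+z. pV q z \<partial>\<mu>V q) < \<infinity>"
    unfolding nn_integral_potential_\<mu>V_self using F_finite by (simp add: ennreal_mult_less_top)
  then show ?thesis
    unfolding field_energy_def by (auto simp: ennreal_add_eq_top ennreal_mult_eq_top_iff less_top[symmetric])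
qed

text \<open>The total potential of \<open>\<mu>V q\<close> is \<open>(1 + q) Pot\<close> plus a
  nonnegative defect carried by \<open>\<Omega>\<close>, which \<open>\<mu>V q\<close> does not
  charge. Its integral against \<open>\<nu>\<close> is thus at least \<open>(1 + q) F\<close>. The
  first variation for \<open>\<mu>\<close> applies to \<open>\<nu>\<close> because
  \<open>p \<le> pV q\<close> makes its energy for \<open>p\<close> finite as well.\<close>

lemma \<mu>V_strict:
  assumes \<nu>: "\<nu> \<in> probs_on R" "\<nu> \<noteq> \<mu>V q"
  shows "field_energy R (pV q) (\<mu>V q) < field_energy R (pV q) \<nu>"
proof (rule strict_minimizer[OF R \<mu>V_probs_on field_energy_\<mu>V_finite _ \<nu>])
  fix \<nu> assume \<nu>: "\<nu> \<in> probs_on R" and fin_\<nu>: "field_energy R (pV q) \<nu> < \<infinity>"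
  note sets_\<nu>[measurable_cong] = probs_onD(2)[OF \<nu>]
  have parts: "mutual_energy R \<nu> \<nu> < \<infinity>" "(\<integral>\<^sup>+z. pV q z \<partial>\<nu>) < \<infinity>"
    using fin_\<nu> unfolding field_energy_def by (auto simp: ennreal_add_eq_top ennreal_mult_eq_top_iff less_top[symmetric])
  have "(\<integral>\<^sup>+z. p z \<partial>\<nu>) \<le> (\<integral>\<^sup>+z. pV q z \<partial>\<nu>)"
  proof (rule nn_integral_mono)
    fix z
    have "p z = 1 * p z" by simp
    also have "\<dots> \<le> ennreal (1 + q) * p z" using q by (intro mult_right_mono) auto
    also have "\<dots> \<le> pV q z" by (simp add: pV_def)
    finally show "p z \<le> pV q z" .
  qed
  then have "field_energy R p \<nu> < \<infinity>" using parts by (intro field_energy_finiteI) auto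
  then have "ennreal (1 + q) * F \<le> ennreal (1 + q) * (\<integral>\<^sup>+z. Pot z \<partial>\<nu>)"
    by (intro mult_left_mono F_le \<nu>) auto
  also have "\<dots> = (\<integral>\<^sup>+z. ennreal (1 + q) * Pot z \<partial>\<nu>)" by (rule nn_integral_cmult[symmetric]) measurable
  also have "\<dots> \<le> (\<integral>\<^sup>+z. ennreal (1 + q) * Pot z + ennreal q * \<rho> c r z \<partial>\<nu>)"
    by (intro nn_integral_mono) simp
  finally show "mutual_energy R (\<mu>V q) (\<mu>V q) + (\<integral>\<^sup>+z. pV q z \<partial>\<mu>V q) \<le> mutual_energy R (\<mu>V q) \<nu> + (\<integral>\<^sup>+z. pV q z \<partial>\<nu>)"
    unfolding nn_integral_potential_\<mu>V[OF \<nu>] nn_integral_potential_\<mu>V_self .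
qed

end

end

section \<open>Dense conformal images of discs\<close>

text \<open>The slope is controlled only where \<open>h\<close> is positive. Beyond a last zero
  \<open>h\<close> would decrease from 0 and could not end positive; so \<open>h a > 0\<close>
  excludes zeros, and the mean value theorem applies on the whole interval.\<close>

lemma decrease_while_positive:
  fixes h :: "real \<Rightarrow> real"
  assumes a: "0 < a" and cont: "continuous_on {0..a} h" and nonneg: "\<And>t. t \<in> {0..a} \<Longrightarrow> 0 \<le> h t"
    and \<beta>: "0 \<le> \<beta>"
    and deriv: "\<And>t. 0 < t \<Longrightarrow> t < a \<Longrightarrow> 0 < h t \<Longrightarrow> \<exists>D. (h has_real_derivative D) (at t) \<and> D \<le> - \<beta>"
    and pos: "0 < h a"
  shows "h a \<le> h 0 - \<beta> * a"
proof -
  have step: "h a \<le> h t0 - \<beta> * (a - t0)" if t0: "0 \<le> t0" "t0 < a" and pos': "\<And>t. t0 < t \<Longrightarrow> t < a \<Longrightarrow> 0 < h t" for t0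
  proof -
    have "\<exists>l z. t0 < z \<and> z < a \<and> (h has_real_derivative l) (at z) \<and> h a - h t0 = (a - t0) * l"
    proof (rule MVT)
      show "continuous_on {t0..a} h" using t0 by (intro continuous_on_subset[OF cont]) auto
      show "h differentiable (at x)" if "t0 < x" "x < a" for x
        using deriv[of x] pos'[of x] that t0 by (auto simp: real_differentiable_def)
    qed (use t0 in auto)
    then obtain l z where z: "t0 < z" "z < a" "(h has_real_derivative l) (at z)" "h a - h t0 = (a - t0) * l" by blast
    obtain D where "(h has_real_derivative D) (at z)" "D \<le> - \<beta>" using deriv[of z] pos'[of z] z t0 by auto
    then have "l \<le> - \<beta>" using z(3) DERIV_unique by blast
    then have "(a - t0) * l \<le> (a - t0) * (- \<beta>)" using t0 by (intro mult_left_mono) auto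
    then show ?thesis using z(4) by (simp add: algebra_simps)
  qed
  show ?thesis
  proof (cases "\<exists>t\<in>{0..a}. h t = 0")
    case False
    then have "0 < h t" if "0 < t" "t < a" for t using nonneg[of t] that by (force simp: less_le)
    then show ?thesis using step[of 0] a by simp
  next
    case True
    define Z where "Z = {t \<in> {0..a}. h t = 0}"
    have "compact Z"
    proof -
      have "closed Z" unfolding Z_def using continuous_closed_preimage_constant[OF cont closed_atLeastAtMost] by simp
      then show ?thesis by (intro compact_eq_bounded_closed[THEN iffD2]) (auto simp: Z_def intro: bounded_subset[OF bounded_closed_interval[of 0 a]])
    qed
    moreover have "Z \<noteq> {}" using True by (auto simp: Z_def)
    ultimately have "\<exists>t0\<in>Z. \<forall>t\<in>Z. t \<le> t0" by (rule compact_attains_sup)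
    then obtain t0 where t0: "t0 \<in> Z" "\<And>t. t \<in> Z \<Longrightarrow> t \<le> t0" by blast
    have "t0 \<noteq> a" using t0(1) pos by (auto simp: Z_def)
    then have "0 \<le> t0" "t0 < a" using t0(1) by (auto simp: Z_def)
    moreover have "0 < h t" if "t0 < t" "t < a" for t
      using nonneg[of t] t0(2)[of t] that \<open>0 \<le> t0\<close> by (force simp: Z_def less_le)
    ultimately have "h a \<le> h t0 - \<beta> * (a - t0)" by (rule step)
    also have "\<dots> \<le> 0" using t0(1) \<beta> \<open>t0 < a\<close> by (simp add: Z_def)
    finally show ?thesis using pos by simp
  qed
qed

text \<open>The derivative of \<open>Re X\<close> in the direction conjugate to
  \<open>deriv X z\<close> is \<open>|deriv X z|^2\<close>.\<close>

lemma deriv_zero_if_Re_constant: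
  assumes X: "X holomorphic_on S" "open S" "z \<in> S" and Re: "\<And>w. w \<in> S \<Longrightarrow> Re (X w) = k"
  shows "deriv X z = 0"
proof -
  have "(X has_derivative (*) (deriv X z)) (at z)"
    using holomorphic_derivI[OF X] by (simp add: has_field_derivative_def)
  then have "((\<lambda>w. Re (X w)) has_derivative (\<lambda>h. Re (deriv X z * h))) (at z)"
    by (rule has_derivative_Re)
  moreover have "((\<lambda>w. Re (X w)) has_derivative (\<lambda>h. 0)) (at z)"
    by (rule has_derivative_transform_within_open[OF has_derivative_const[of k] X(2,3)]) (use Re in auto)
  ultimately have "(\<lambda>h. Re (deriv X z * h)) = (\<lambda>h. 0)" by (rule has_derivative_unique)
  from fun_cong[OF this, of "cnj (deriv X z)"] show ?thesis
    by (simp add: complex_mult_cnj complex_eq_iff power2_eq_square add_nonneg_eq_0_iff)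
qed

text \<open>The configuration excluded below: \<open>\<psi>\<close> maps a disc onto an open set that is dense in a ball \<open>N\<close>
  without filling it. With \<open>\<eta> = f - c\<close> and \<open>g = ln (r / norm \<eta>)\<close>, extended by zero, the identity for
  \<open>Re K\<close> makes \<open>g\<close> strictly monotone along the level lines of \<open>Im K\<close> wherever it is positive, so that its
  zero set has interior.\<close>

locale dense_disc_image =
  fixes \<psi> f K :: "complex \<Rightarrow> complex" and c :: complex and r :: real and z1 :: complex and \<rho> :: real
  assumes \<psi>: "\<psi> holomorphic_on ball c r" and r: "r > 0"
    and f_\<psi>: "\<And>\<zeta>. \<zeta> \<in> ball c r \<Longrightarrow> f (\<psi> \<zeta>) = \<zeta>"
    and \<rho>: "\<rho> > 0" and dense: "ball z1 \<rho> \<subseteq> closure (\<psi> ` ball c r)" and z1: "z1 \<notin> \<psi> ` ball c r"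
    and center: "\<psi> c \<notin> ball z1 \<rho>"
    and K: "K holomorphic_on ball z1 \<rho>"
    and K_eq: "\<And>z. z \<in> ball z1 \<rho> \<Longrightarrow> z \<in> \<psi> ` ball c r \<Longrightarrow>
      Re (cnj c * (f z - c)) + r\<^sup>2 * ln (norm (f z - c) / r) = Re (K z)"
begin

abbreviation "\<Omega> \<equiv> \<psi> ` ball c r"
abbreviation "N \<equiv> ball z1 \<rho>"

lemma inj: "inj_on \<psi> (ball c r)"
  using f_\<psi> by (rule inj_on_inverseI)

lemma open_\<Omega>: "open \<Omega>"
  by (rule open_mapping_thm3[OF \<psi> open_ball inj])

lemma f_in: "z \<in> \<Omega> \<Longrightarrow> f z \<in> ball c r" and \<psi>_f: "z \<in> \<Omega> \<Longrightarrow> \<psi> (f z) = z"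
  using f_\<psi> by (auto simp del: mem_ball)

lemma f_holo: "f holomorphic_on \<Omega>"
proof -
  obtain g where g: "g holomorphic_on \<Omega>" "\<And>\<zeta>. \<zeta> \<in> ball c r \<Longrightarrow> g (\<psi> \<zeta>) = \<zeta>"
    using holomorphic_has_inverse[OF \<psi> open_ball inj] by metis
  have "f z = g z" if "z \<in> \<Omega>" for z using that f_\<psi> g(2) by auto
  with g(1) show ?thesis by (simp cong: holomorphic_cong)
qed

lemma f_inj: "inj_on f \<Omega>"
  by (rule inj_on_inverseI[of _ \<psi>]) (rule \<psi>_f)

lemma deriv_f_nz: "z \<in> \<Omega> \<Longrightarrow> deriv f z \<noteq> 0"
  by (rule holomorphic_injective_imp_regular[OF f_holo open_\<Omega> f_inj])

lemma f_norm: "z \<in> \<Omega> \<Longrightarrow> norm (f z - c) < r"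
  using f_in[of z] by (simp add: dist_norm norm_minus_commute)

lemma f_ne: "z \<in> \<Omega> \<Longrightarrow> z \<in> N \<Longrightarrow> f z \<noteq> c"
  using \<psi>_f[of z] center by auto

text \<open>The Green function of \<open>\<Omega>\<close> with pole at \<open>\<psi> c\<close>,
  extended by zero.\<close>

definition g :: "complex \<Rightarrow> real" where
  "g z = (if z \<in> \<Omega> then ln (r / norm (f z - c)) else 0)"

lemma g_pos: "z \<in> \<Omega> \<Longrightarrow> z \<in> N \<Longrightarrow> 0 < g z"
  using f_norm[of z] f_ne[of z] by (simp add: g_def ln_gt_zero field_simps)

lemma g_nonneg: "z \<in> N \<Longrightarrow> 0 \<le> g z"
  using g_pos[of z] by (cases "z \<in> \<Omega>") (auto simp: g_def)

text \<open>The sublevel \<open>g \<ge> \<epsilon>\<close> corresponds to the closed disc of radius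
  \<open>r * exp (- \<epsilon>)\<close>, whose image is compact in \<open>\<Omega>\<close> and so
  misses a neighbourhood of \<open>e\<close>. No regularity of the boundary is involved.\<close>

lemma g_small:
  assumes e: "e \<notin> \<Omega>" and \<epsilon>: "\<epsilon> > 0"
  shows "\<forall>\<^sub>F z in nhds e. z \<in> N \<longrightarrow> g z < \<epsilon>"
proof -
  define t where "t = r * exp (- \<epsilon>)"
  have t: "0 < t" "t < r" using r \<epsilon> by (auto simp: t_def)
  have "cball c t \<subseteq> ball c r" using t by auto
  then have "compact (\<psi> ` cball c t)"
    using holomorphic_on_imp_continuous_on[OF \<psi>] by (intro compact_continuous_image) (auto intro: continuous_on_subset)
  then have "open (- \<psi> ` cball c t)" by (simp add: compact_imp_closed open_Compl)
  moreover have "e \<in> - \<psi> ` cball c t" using e \<open>cball c t \<subseteq> ball c r\<close> by blast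
  ultimately have "\<forall>\<^sub>F z in nhds e. z \<in> - \<psi> ` cball c t" by (rule eventually_nhds_in_open)
  then show ?thesis
  proof eventually_elim
    case (elim z)
    show ?case
    proof (intro impI)
      assume zN: "z \<in> N"
      show "g z < \<epsilon>"
      proof (cases "z \<in> \<Omega>")
        case True
        then have "f z \<notin> cball c t" using elim \<psi>_f[OF True] by (metis ComplD image_eqI)
        then have "t < norm (f z - c)" by (simp add: dist_norm norm_minus_commute)
        moreover from this have "0 < norm (f z - c)" using t by linarith
        ultimately have "r / norm (f z - c) < r / t" using t r by (intro divide_strict_left_mono mult_pos_pos)
        also have "r / t = exp \<epsilon>" using r by (simp add: t_def exp_minus field_simps)
        finally have "ln (r / norm (f z - c)) < ln (exp \<epsilon>)"
          using r f_ne[OF True zN] by (subst ln_less_cancel_iff) auto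
        then show ?thesis using True by (simp add: g_def)
      qed (use \<epsilon> in \<open>simp add: g_def\<close>)
    qed
  qed
qed

lemma g_cont: "continuous_on N g"
proof (rule continuous_at_imp_continuous_on, intro ballI)
  fix e assume eN: "e \<in> N"
  show "isCont g e"
  proof (cases "e \<in> \<Omega>")
    case True
    have "open (\<Omega> \<inter> N)" using open_\<Omega> by auto
    moreover have "continuous_on (\<Omega> \<inter> N) (\<lambda>z. ln (r / norm (f z - c)))"
    proof -
      have "continuous_on (\<Omega> \<inter> N) f" using holomorphic_on_imp_continuous_on[OF f_holo] by (rule continuous_on_subset) auto
      then show ?thesis using r f_ne by (intro continuous_intros) auto
    qed
    then have "continuous_on (\<Omega> \<inter> N) g" by (rule continuous_on_eq) (auto simp: g_def)
    ultimately show ?thesis using True eN by (auto simp: continuous_on_eq_continuous_at)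
  next
    case False
    show ?thesis
      unfolding isCont_def
    proof (rule tendstoI)
      fix \<epsilon> :: real assume \<epsilon>: "\<epsilon> > 0"
      have "\<forall>\<^sub>F z in nhds e. z \<in> N" using eN by (intro eventually_nhds_in_open) auto
      with g_small[OF False \<epsilon>] have "\<forall>\<^sub>F z in nhds e. dist (g z) (g e) < \<epsilon>"
      proof eventually_elim
        case (elim z)
        moreover have "g e = 0" using False by (simp add: g_def)
        ultimately show ?case using g_nonneg[of z] by (simp add: dist_real_def)
      qed
      then show "\<forall>\<^sub>F z in at e. dist (g z) (g e) < \<epsilon>" by (simp add: eventually_at_filter eventually_mono)
    qed
  qed
qed

text \<open>Locally the identity for \<open>Re K\<close> says that
  \<open>cnj c (f - c) + r^2 Ln (f - c) - K\<close> has constant real part, so its derivative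
  vanishes.\<close>

lemma deriv_identity:
  assumes z: "z \<in> \<Omega>" "z \<in> N"
  shows "deriv f z * (cnj c * (f z - c) + of_real (r\<^sup>2)) = deriv K z * (f z - c)"
proof -
  let ?h = "\<lambda>w. (f w - c) / (f z - c)"
  have nz: "f z - c \<noteq> 0" using f_ne[OF z] by simp
  have fd: "(f has_field_derivative deriv f z) (at z)" using holomorphic_derivI[OF f_holo open_\<Omega> z(1)] .
  have Kd: "(K has_field_derivative deriv K z) (at z)" using holomorphic_derivI[OF K open_ball z(2)] .
  have cont: "continuous_on (\<Omega> \<inter> N) ?h"
  proof -
    have "continuous_on (\<Omega> \<inter> N) f" using holomorphic_on_imp_continuous_on[OF f_holo] by (rule continuous_on_subset) auto
    then show ?thesis using nz by (intro continuous_intros) auto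
  qed
  \<comment> \<open>Dividing by the value at \<open>z\<close> and staying within distance 1 of 1
    keeps the argument of \<open>Ln\<close> off the slit.\<close>
  define S where "S = (\<Omega> \<inter> N) \<inter> ?h -` ball 1 1"
  have S: "open S" unfolding S_def using open_\<Omega> by (intro continuous_open_preimage cont) auto
  have zS: "z \<in> S" using z nz by (simp add: S_def)
  have SD: "w \<in> \<Omega>" "w \<in> N" "?h w \<in> ball 1 1" if "w \<in> S" for w using that by (auto simp: S_def)
  have slit: "?h w \<notin> \<real>\<^sub>\<le>\<^sub>0" if "w \<in> S" for w
  proof -
    have "norm (1 - ?h w) < 1" using SD(3)[OF that] by (simp add: dist_norm)
    then have "0 < Re (?h w)" using complex_Re_le_cmod[of "1 - ?h w"] by simp
    then show ?thesis by (auto simp: complex_nonpos_Reals_iff)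
  qed
  define X where "X w = cnj c * (f w - c) + of_real (r\<^sup>2) * Ln (?h w) - K w" for w
  have fS: "f holomorphic_on S" using f_holo by (rule holomorphic_on_subset) (use SD in auto)
  have KS: "K holomorphic_on S" using K by (rule holomorphic_on_subset) (use SD in auto)
  have X: "X holomorphic_on S" unfolding X_def using nz slit by (intro holomorphic_intros fS KS) auto
  have Re: "Re (X w) = r\<^sup>2 * ln r - r\<^sup>2 * ln (norm (f z - c))" if w: "w \<in> S" for w
  proof -
    have nw: "f w - c \<noteq> 0" using f_ne SD[OF w] by simp
    have Ln: "Re (Ln (?h w)) = ln (norm (f w - c)) - ln (norm (f z - c))"
      using nw nz by (simp add: Re_Ln norm_divide ln_div)
    have Kw: "Re (K w) = Re (cnj c * (f w - c)) + r\<^sup>2 * (ln (norm (f w - c)) - ln r)"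
      using K_eq[OF SD(2,1)[OF w]] nw r by (simp add: ln_div)
    have "Re (X w) = Re (cnj c * (f w - c)) + r\<^sup>2 * Re (Ln (?h w)) - Re (K w)"
      unfolding X_def minus_complex.sel plus_complex.sel times_complex.sel by (simp del: of_real_power)
    then show ?thesis unfolding Ln Kw right_diff_distrib by linarith
  qed
  have "deriv X z = 0" by (rule deriv_zero_if_Re_constant[OF X S zS Re])
  moreover have "(X has_field_derivative (cnj c * deriv f z + of_real (r\<^sup>2) * (deriv f z / (f z - c)) - deriv K z)) (at z)"
    unfolding X_def using nz slit[OF zS] by (auto intro!: derivative_eq_intros fd Kd)
  then have "deriv X z = cnj c * deriv f z + of_real (r\<^sup>2) * (deriv f z / (f z - c)) - deriv K z"
    by (rule DERIV_imp_deriv)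
  ultimately have "deriv K z = cnj c * deriv f z + of_real (r\<^sup>2) * (deriv f z / (f z - c))" by simp
  then show ?thesis using nz by (simp add: field_simps)
qed

text \<open>Otherwise \<open>cnj c (f - c) = - r^2\<close> throughout
  \<open>\<Omega> \<inter> N\<close>, which is nonempty by density, so \<open>f\<close> would be
  constant there, against injectivity.\<close>

lemma deriv_K_not_identically_zero: "\<exists>z\<in>N. deriv K z \<noteq> 0"
proof (rule ccontr)
  assume "\<not> ?thesis"
  then have K0: "deriv K z = 0" if "z \<in> N" for z using that by blast
  have eq: "cnj c * (f z - c) = - of_real (r\<^sup>2)" if "z \<in> \<Omega>" "z \<in> N" for z
    using deriv_identity[OF that] K0[OF that(2)] deriv_f_nz[OF that(1)] by (simp add: add_eq_0_iff2)
  have "z1 \<in> N \<inter> closure \<Omega>" using dense \<rho> by auto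
  then have "N \<inter> closure \<Omega> \<noteq> {}" by blast
  then have "N \<inter> \<Omega> \<noteq> {}" unfolding open_Int_closure_eq_empty[OF open_ball] .
  then obtain z where z: "z \<in> N" "z \<in> \<Omega>" by blast
  have "c \<noteq> 0" using eq[OF z(2,1)] r by auto
  have "open (\<Omega> \<inter> N)" "z \<in> \<Omega> \<inter> N" using open_\<Omega> z by auto
  from openE[OF this] obtain e where e: "e > 0" "ball z e \<subseteq> \<Omega> \<inter> N" .
  define w where "w = z + of_real (e / 2)"
  have "w \<in> ball z e" "w \<noteq> z" using e(1) by (auto simp: w_def dist_norm)
  then have "w \<in> \<Omega>" "w \<in> N" "w \<noteq> z" using e(2) by auto
  moreover have "f w = f z"
  proof -
    have "cnj c * (f w - c) = cnj c * (f z - c)" using eq[OF z(2,1)] eq[OF \<open>w \<in> \<Omega>\<close> \<open>w \<in> N\<close>] by simp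
    then show ?thesis using \<open>c \<noteq> 0\<close> by simp
  qed
  ultimately show False using inj_onD[OF f_inj, of w z] z by blast
qed

text \<open>If \<open>deriv K\<close> vanished at all points of \<open>N\<close> outside
  \<open>\<Omega>\<close>, isolation of its zeros would put a punctured disc around
  \<open>z1\<close> into \<open>\<Omega>\<close>. There \<open>f\<close> is bounded, hence extends
  to \<open>z1\<close>; by the boundary behaviour of \<open>g\<close> the extension has distance at
  least \<open>r\<close> from \<open>c\<close> at \<open>z1\<close>, and less elsewhere. The maximum
  principle makes it constant, against injectivity.\<close>

lemma exists_regular_point: "\<exists>z2\<in>N. z2 \<notin> \<Omega> \<and> deriv K z2 \<noteq> 0"
proof (rule ccontr)
  assume not: "\<not> ?thesis"
  have z1N: "z1 \<in> N" using \<rho> by simp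
  then have "deriv K z1 = 0" using not z1 by blast
  obtain b where b: "b \<in> N" "deriv K b \<noteq> 0" using deriv_K_not_identically_zero by blast
  have "\<exists>e>0. ball z1 e \<subseteq> N \<and> (\<forall>z\<in>ball z1 e - {z1}. deriv K z \<noteq> 0)"
    by (rule isolated_zeros[OF holomorphic_deriv[OF K open_ball] open_ball connected_ball z1N \<open>deriv K z1 = 0\<close> b]) blast
  then obtain e where e: "0 < e" "ball z1 e \<subseteq> N" "\<And>z. z \<in> ball z1 e - {z1} \<Longrightarrow> deriv K z \<noteq> 0" by blast
  have sub: "ball z1 e - {z1} \<subseteq> \<Omega>" using e(2,3) not by blast
  have fh: "f holomorphic_on ball z1 e - {z1}" using f_holo sub by (rule holomorphic_on_subset)
  have bd: "norm (f z - c) < r" if "z \<in> ball z1 e - {z1}" for z using f_norm sub that by blast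
  have near: "\<forall>\<^sub>F z in at z1. z \<in> ball z1 e - {z1}"
    by (rule eventually_at_in_open) (use e(1) in auto)
  then have bdd: "\<forall>\<^sub>F z in at z1. norm (f z) \<le> norm c + r"
  proof eventually_elim
    case (elim z)
    have "norm (f z) \<le> norm (f z - c) + norm c" by (metis diff_add_cancel norm_triangle_ineq)
    then show ?case using bd[OF elim] by simp
  qed
  have "z1 \<in> interior (ball z1 e)" using e(1) by simp
  have "\<exists>h. h holomorphic_on ball z1 e \<and> (\<forall>z\<in>ball z1 e - {z1}. h z = f z)"
    using holomorphic_on_extend_bounded[OF fh \<open>z1 \<in> interior _\<close>] bdd by blast
  then obtain h where h: "h holomorphic_on ball z1 e" "\<And>z. z \<in> ball z1 e - {z1} \<Longrightarrow> h z = f z" by blast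
  have hc: "(h \<longlongrightarrow> h z1) (at z1)"
    using holomorphic_on_imp_continuous_on[OF h(1)] e(1) by (simp add: continuous_on_eq_continuous_at isCont_def)
  have ge: "r \<le> norm (h z1 - c)"
  proof (rule ccontr)
    assume "\<not> ?thesis"
    then obtain s where s: "norm (h z1 - c) < s" "s < r" using dense_order_class.dense[of "norm (h z1 - c)" r] by auto
    have s0: "0 < s" using s(1) norm_ge_zero by (rule le_less_trans[rotated])
    have "\<forall>\<^sub>F z in at z1. norm (h z - c) < s"
      by (rule order_tendstoD(2)[OF _ s(1)]) (intro tendsto_intros hc)
    moreover have "\<forall>\<^sub>F z in at z1. z \<in> N \<longrightarrow> g z < ln (r / s)"
      using g_small[OF z1, of "ln (r / s)"] s s0 by (simp add: eventually_at_filter eventually_mono)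
    ultimately have "\<forall>\<^sub>F z in at z1. False"
      using near
    proof eventually_elim
      case (elim z)
      have zO: "z \<in> \<Omega>" "z \<in> N" using elim(3) sub e(2) by auto
      have "norm (f z - c) < s" using elim(1) h(2)[OF elim(3)] by simp
      then have "r / s < r / norm (f z - c)" using r s0 f_ne[OF zO] by (intro divide_strict_left_mono) auto
      then have "ln (r / s) < ln (r / norm (f z - c))" using r s0 f_ne[OF zO] by (subst ln_less_cancel_iff) auto
      then have "ln (r / s) < g z" using zO by (simp add: g_def)
      then show ?case using elim(2) zO by simp
    qed
    then show False by simp
  qed
  have "(\<lambda>z. h z - c) constant_on ball z1 e"
  proof (rule maximum_modulus_principle[of _ _ "ball z1 e" z1])
    show "norm (h z - c) \<le> norm (h z1 - c)" if "z \<in> ball z1 e" for z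
      using bd[of z] h(2)[of z] ge that by (cases "z = z1") auto
  qed (use e(1) in \<open>auto intro!: holomorphic_intros h(1)\<close>)
  then obtain k where k: "\<And>z. z \<in> ball z1 e \<Longrightarrow> h z - c = k" unfolding constant_on_def by blast
  let ?u = "z1 + of_real (e / 2)" and ?v = "z1 + of_real (e / 3)"
  have uv: "?u \<in> ball z1 e - {z1}" "?v \<in> ball z1 e - {z1}" "?u \<noteq> ?v" using e(1) by (auto simp: dist_norm)
  have "h ?u - c = k" "h ?v - c = k" by (rule k[OF DiffD1[OF uv(1)]], rule k[OF DiffD1[OF uv(2)]])
  then have "f ?u = f ?v" unfolding h(2)[OF uv(1)] h(2)[OF uv(2)] by (simp only: diff_eq_eq)
  then show False using f_inj uv sub unfolding inj_on_def by blast
qed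

lemma local_inverse:
  assumes z2: "z2 \<in> N" "deriv K z2 \<noteq> 0"
  shows "\<exists>\<kappa> d. d > 0 \<and> \<kappa> holomorphic_on ball (K z2) d \<and> \<kappa> (K z2) = z2 \<and>
    (\<forall>p\<in>ball (K z2) d. \<kappa> p \<in> N \<and> K (\<kappa> p) = p \<and> deriv K (\<kappa> p) * deriv \<kappa> p = 1)"
proof -
  obtain e where e: "e > 0" "ball z2 e \<subseteq> N" "open (K ` ball z2 e)" "inj_on K (ball z2 e)"
    using has_complex_derivative_locally_invertible[OF K z2(1) open_ball z2(2)] by blast
  have Ke: "K holomorphic_on ball z2 e" using K e(2) by (rule holomorphic_on_subset)
  obtain \<kappa> where \<kappa>: "\<kappa> holomorphic_on K ` ball z2 e" "\<And>z. z \<in> ball z2 e \<Longrightarrow> deriv K z * deriv \<kappa> (K z) = 1"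
    "\<And>z. z \<in> ball z2 e \<Longrightarrow> \<kappa> (K z) = z"
    using holomorphic_has_inverse[OF Ke open_ball e(4)] by blast
  obtain d where d: "d > 0" "ball (K z2) d \<subseteq> K ` ball z2 e"
    using e(1,3) openE[of "K ` ball z2 e" "K z2"] by (metis centre_in_ball image_eqI)
  have "\<kappa> p \<in> N \<and> K (\<kappa> p) = p \<and> deriv K (\<kappa> p) * deriv \<kappa> p = 1" if "p \<in> ball (K z2) d" for p
  proof -
    from that d(2) obtain z where "z \<in> ball z2 e" "p = K z" by blast
    then show ?thesis using \<kappa>(2,3) e(2) by auto
  qed
  moreover have "\<kappa> (K z2) = z2" using \<kappa>(3) e(1) by simp
  ultimately show ?thesis using d holomorphic_on_subset[OF \<kappa>(1) d(2)] by blast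
qed

section \<open>The Green function along the level lines of the conjugate potential\<close>

lemma DERIV_ln_norm:
  assumes F: "(F has_field_derivative D) (at p)" and nz: "F p \<noteq> 0"
  shows "((\<lambda>t. ln (norm (F (p + of_real t)))) has_real_derivative Re (D / F p)) (at 0)"
proof -
  have line: "((\<lambda>t. p + of_real t) has_vector_derivative 1) (at (0::real))"
    by (auto intro!: derivative_eq_intros)
  have "((F \<circ> (\<lambda>t. p + of_real t)) has_vector_derivative (1 * D)) (at (0::real))"
    by (rule field_vector_diff_chain_at[OF line]) (use F in simp)
  then have FV: "((\<lambda>t. F (p + of_real t)) has_vector_derivative D) (at (0::real))" by (simp add: o_def)
  have u: "((\<lambda>t. Re (F (p + of_real t))) has_real_derivative Re D) (at 0)"
    using bounded_linear.has_vector_derivative[OF bounded_linear_Re FV] by (simp add: has_real_derivative_iff_has_vector_derivative)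
  have v: "((\<lambda>t. Im (F (p + of_real t))) has_real_derivative Im D) (at 0)"
    using bounded_linear.has_vector_derivative[OF bounded_linear_Im FV] by (simp add: has_real_derivative_iff_has_vector_derivative)
  have pos: "(Re (F p))\<^sup>2 + (Im (F p))\<^sup>2 > 0" using nz by (simp add: complex_neq_0)
  have eq: "ln (norm (F w)) = ln ((Re (F w))\<^sup>2 + (Im (F w))\<^sup>2) / 2" for w
    by (cases "F w = 0") (simp_all add: cmod_def ln_sqrt)
  have sq: "((\<lambda>t. (Re (F (p + of_real t)))\<^sup>2 + (Im (F (p + of_real t)))\<^sup>2) has_real_derivative
      2 * (Re (F p) * Re D + Im (F p) * Im D)) (at 0)"
    by (rule DERIV_cong[OF DERIV_add[OF DERIV_power[OF u, of 2] DERIV_power[OF v, of 2]]]) (simp add: algebra_simps)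
  have ln_sq: "((\<lambda>t. ln ((Re (F (p + of_real t)))\<^sup>2 + (Im (F (p + of_real t)))\<^sup>2)) has_real_derivative
      inverse ((Re (F p))\<^sup>2 + (Im (F p))\<^sup>2) * (2 * (Re (F p) * Re D + Im (F p) * Im D))) (at 0)"
    by (rule DERIV_chain2[where f=ln, OF _ sq]) (use DERIV_ln[OF pos] in simp)
  have half: "inverse s * (2 * n) / 2 = n / s" for s n :: real by (simp add: field_simps)
  from DERIV_cdivide[OF ln_sq, of 2]
  have "((\<lambda>t. ln ((Re (F (p + of_real t)))\<^sup>2 + (Im (F (p + of_real t)))\<^sup>2) / 2) has_real_derivative
      (Re (F p) * Re D + Im (F p) * Im D) / ((Re (F p))\<^sup>2 + (Im (F p))\<^sup>2)) (at 0)"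
    unfolding half .
  moreover have "Re (D / F p) = (Re (F p) * Re D + Im (F p) * Im D) / ((Re (F p))\<^sup>2 + (Im (F p))\<^sup>2)"
    by (simp add: Re_divide algebra_simps)
  ultimately show ?thesis unfolding eq by simp
qed

end

text \<open>Near a point outside \<open>\<Omega>\<close> where \<open>deriv K\<close> does not
  vanish, \<open>K\<close> itself serves as coordinate, with inverse \<open>\<kappa>\<close>. Level
  lines of \<open>Im K\<close> become horizontal segments.\<close>

locale regular_chart = dense_disc_image +
  fixes z2 :: complex and \<kappa> :: "complex \<Rightarrow> complex" and d :: real
  assumes z2: "z2 \<in> N" "z2 \<notin> \<Omega>" and d: "d > 0" and \<kappa>: "\<kappa> holomorphic_on ball (K z2) d" and \<kappa>_z2: "\<kappa> (K z2) = z2"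
    and \<kappa>p: "\<And>p. p \<in> ball (K z2) d \<Longrightarrow> \<kappa> p \<in> N \<and> K (\<kappa> p) = p \<and> deriv K (\<kappa> p) * deriv \<kappa> p = 1"
begin

definition G where "G p = g (\<kappa> p)"
text \<open>Over \<open>\<Omega>\<close> this is the real part of
  \<open>cnj c (f - c) + r^2\<close>, rewritten through the identity for \<open>Re K\<close>. In
  this form it is defined and continuous off \<open>\<Omega>\<close> too, and its sign decides
  whether \<open>G\<close> falls or rises along a horizontal line.\<close>

definition A where "A p = Re p + r\<^sup>2 + r\<^sup>2 * G p"

lemma G_cont: "continuous_on (ball (K z2) d) G"
  unfolding G_def
  by (rule continuous_on_compose2[OF g_cont holomorphic_on_imp_continuous_on[OF \<kappa>]]) (use \<kappa>p in auto)

lemma G_nonneg: "p \<in> ball (K z2) d \<Longrightarrow> 0 \<le> G p"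
  using \<kappa>p g_nonneg by (simp add: G_def)

lemma G_pos_iff: "p \<in> ball (K z2) d \<Longrightarrow> 0 < G p \<longleftrightarrow> \<kappa> p \<in> \<Omega>"
  using \<kappa>p[of p] g_pos[of "\<kappa> p"] by (auto simp: G_def g_def split: if_splits)

lemma G_center: "G (K z2) = 0"
  using z2 by (simp add: G_def \<kappa>_z2 g_def)

text \<open>The derivative identity and the chain rule give logarithmic derivative
  \<open>1 / den\<close> for \<open>f - c\<close> in this chart, with
  \<open>den = cnj c (f - c) + r^2\<close>. So \<open>G\<close> has slope
  \<open>- Re (1 / den) = - A / |den|^2\<close>, and \<open>|f - c| < r\<close> bounds
  \<open>|den|\<close>.\<close>

lemma DERIV_G:
  assumes p: "p \<in> ball (K z2) d" "\<kappa> p \<in> \<Omega>"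
  shows "\<exists>D. ((\<lambda>t. G (p + of_real t)) has_real_derivative (- A p / D)) (at 0) \<and> 0 < D \<and> D \<le> (norm c * r + r\<^sup>2)\<^sup>2"
proof -
  let ?F = "\<lambda>q. f (\<kappa> q) - c"
  define S where "S = ball (K z2) d \<inter> \<kappa> -` \<Omega>"
  have S: "open S" unfolding S_def by (rule continuous_open_preimage[OF holomorphic_on_imp_continuous_on[OF \<kappa>] open_ball open_\<Omega>])
  have pS: "p \<in> S" using p by (simp add: S_def)
  have kN: "\<kappa> p \<in> N" and Kk: "K (\<kappa> p) = p" and dk: "deriv K (\<kappa> p) * deriv \<kappa> p = 1" using \<kappa>p[OF p(1)] by auto
  have nz: "?F p \<noteq> 0" using f_ne[OF p(2) kN] by simp
  define den where "den = cnj c * ?F p + of_real (r\<^sup>2)"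
  have id: "deriv f (\<kappa> p) * den = deriv K (\<kappa> p) * ?F p" unfolding den_def by (rule deriv_identity[OF p(2) kN])
  have K0: "deriv K (\<kappa> p) \<noteq> 0" using dk by auto
  then have den0: "den \<noteq> 0" using id nz by auto
  have "(\<kappa> has_field_derivative deriv \<kappa> p) (at p)" by (rule holomorphic_derivI[OF \<kappa> open_ball p(1)])
  moreover have "(f has_field_derivative deriv f (\<kappa> p)) (at (\<kappa> p))" by (rule holomorphic_derivI[OF f_holo open_\<Omega> p(2)])
  ultimately have "((\<lambda>q. f (\<kappa> q)) has_field_derivative (deriv f (\<kappa> p) * deriv \<kappa> p)) (at p)"
    by (intro DERIV_chain2)
  from DERIV_diff[OF this DERIV_const[of c]]
  have FD: "(?F has_field_derivative (deriv f (\<kappa> p) * deriv \<kappa> p)) (at p)" by simp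
  have quot: "deriv f (\<kappa> p) * deriv \<kappa> p / ?F p = 1 / den"
  proof -
    have "deriv f (\<kappa> p) * deriv \<kappa> p * den = (deriv K (\<kappa> p) * deriv \<kappa> p) * ?F p" using id by (simp add: mult_ac)
    then show ?thesis using dk nz den0 by (simp add: field_simps)
  qed
  have Re_den: "Re den = A p"
  proof -
    have "Re (cnj c * ?F p) + r\<^sup>2 * ln (norm (?F p) / r) = Re p" using K_eq[OF kN p(2)] Kk by simp
    moreover have "G p = - ln (norm (?F p) / r)" using p(2) nz r by (simp add: G_def g_def ln_div)
    ultimately show ?thesis by (simp add: den_def A_def)
  qed
  have "norm den \<le> norm (cnj c * ?F p) + norm (complex_of_real (r\<^sup>2))" unfolding den_def by (rule norm_triangle_ineq)
  also have "\<dots> \<le> norm c * r + r\<^sup>2"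
    using f_norm[OF p(2)] by (auto simp: norm_mult norm_power intro!: mult_left_mono)
  finally have "(norm den)\<^sup>2 \<le> (norm c * r + r\<^sup>2)\<^sup>2" by (intro power_mono) auto
  moreover have "((\<lambda>t. G (p + of_real t)) has_real_derivative (- A p / (norm den)\<^sup>2)) (at 0)"
  proof (rule has_field_derivative_transform_within_open)
    have "((\<lambda>t. ln r - ln (norm (?F (p + of_real t)))) has_real_derivative 0 - Re (deriv f (\<kappa> p) * deriv \<kappa> p / ?F p)) (at 0)"
      by (intro DERIV_diff DERIV_const DERIV_ln_norm[OF FD nz])
    moreover have "Re (1 / den) = A p / (norm den)\<^sup>2" unfolding Re_den[symmetric] by (simp add: Re_divide cmod_power2)
    ultimately show "((\<lambda>t. ln r - ln (norm (?F (p + of_real t)))) has_real_derivative (- A p / (norm den)\<^sup>2)) (at 0)"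
      unfolding quot by simp
    show "open ((\<lambda>t. p + of_real t) -` S :: real set)"
      by (rule open_vimage[OF S]) (intro continuous_intros)
    show "(0::real) \<in> (\<lambda>t. p + of_real t) -` S" using pS by simp
    fix t :: real assume "t \<in> (\<lambda>t. p + of_real t) -` S"
    then have q: "p + of_real t \<in> ball (K z2) d" "\<kappa> (p + of_real t) \<in> \<Omega>" by (auto simp: S_def)
    then have "?F (p + of_real t) \<noteq> 0" using f_ne \<kappa>p[OF q(1)] by auto
    then show "ln r - ln (norm (?F (p + of_real t))) = G (p + of_real t)"
      using q(2) r by (simp add: G_def g_def ln_div)
  qed
  ultimately show ?thesis using den0 by (intro exI[of _ "(norm den)\<^sup>2"]) auto
qed

text \<open>The sign \<open>\<sigma>\<close> is the direction of travel. As long as \<open>G\<close>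
  is positive the point lies over \<open>\<Omega>\<close>, so the slope formula applies and
  \<open>G\<close> falls at least at rate \<open>\<beta>\<close>.\<close>

lemma flow:
  fixes \<sigma> :: real
  assumes \<sigma>: "\<sigma> = 1 \<or> \<sigma> = -1" and p: "p \<in> ball (K z2) d" and a: "0 < a" and pa: "p + of_real (\<sigma> * a) \<in> ball (K z2) d"
    and \<beta>: "0 \<le> \<beta>"
    and lower: "\<And>t. 0 < t \<Longrightarrow> t < a \<Longrightarrow> \<kappa> (p + of_real (\<sigma> * t)) \<in> \<Omega> \<Longrightarrow> \<beta> * (norm c * r + r\<^sup>2)\<^sup>2 \<le> \<sigma> * A (p + of_real (\<sigma> * t))"
    and pos: "0 < G (p + of_real (\<sigma> * a))"
  shows "G (p + of_real (\<sigma> * a)) \<le> G p - \<beta> * a"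
proof -
  have seg: "p + of_real (\<sigma> * t) \<in> ball (K z2) d" if "t \<in> {0..a}" for t
  proof -
    have "p + of_real (\<sigma> * t) = (1 - t / a) *\<^sub>R p + (t / a) *\<^sub>R (p + of_real (\<sigma> * a))"
      using a by (simp add: scaleR_conv_of_real field_simps)
    also have "\<dots> \<in> ball (K z2) d" using that a by (intro convexD[OF convex_ball p pa]) auto
    finally show ?thesis .
  qed
  have "G (p + of_real (\<sigma> * a)) \<le> G (p + of_real (\<sigma> * 0)) - \<beta> * a"
  proof (rule decrease_while_positive[of a "\<lambda>t. G (p + of_real (\<sigma> * t))", OF a _ _ \<beta> _ pos])
    show "continuous_on {0..a} (\<lambda>t. G (p + of_real (\<sigma> * t)))"
      by (rule continuous_on_compose2[OF G_cont]) (use seg in \<open>auto intro!: continuous_intros\<close>)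
    show "0 \<le> G (p + of_real (\<sigma> * t))" if "t \<in> {0..a}" for t using G_nonneg[OF seg[OF that]] .
    fix t assume t: "0 < t" "t < a" and Gt: "0 < G (p + of_real (\<sigma> * t))"
    have q: "p + of_real (\<sigma> * t) \<in> ball (K z2) d" using seg[of t] t by simp
    have qO: "\<kappa> (p + of_real (\<sigma> * t)) \<in> \<Omega>" using Gt G_pos_iff[OF q] by simp
    obtain D where D: "((\<lambda>s. G (p + of_real (\<sigma> * t) + of_real s)) has_real_derivative (- A (p + of_real (\<sigma> * t)) / D)) (at 0)"
      "0 < D" "D \<le> (norm c * r + r\<^sup>2)\<^sup>2" using DERIV_G[OF q qO] by blast
    have "((\<lambda>s. G (p + of_real (\<sigma> * t) + of_real (\<sigma> * (s - t)))) has_real_derivative (- A (p + of_real (\<sigma> * t)) / D) * \<sigma>) (at t)"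
      by (rule DERIV_chain2[where g="\<lambda>s. \<sigma> * (s - t)" and f="\<lambda>s. G (p + of_real (\<sigma> * t) + of_real s)"])
         (use D(1) in \<open>auto intro!: derivative_eq_intros\<close>)
    moreover have shift: "p + of_real (\<sigma> * t) + of_real (\<sigma> * (s - t)) = p + of_real (\<sigma> * s)" for s
      by (simp add: algebra_simps)
    ultimately have "((\<lambda>s. G (p + of_real (\<sigma> * s))) has_real_derivative (- A (p + of_real (\<sigma> * t)) / D) * \<sigma>) (at t)" by (simp only: shift)
    moreover have "(- A (p + of_real (\<sigma> * t)) / D) * \<sigma> \<le> - \<beta>"
    proof -
      have "\<beta> * D \<le> \<beta> * (norm c * r + r\<^sup>2)\<^sup>2" using D(3) \<beta> by (intro mult_left_mono)
      also note lower[OF t qO]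
      finally show ?thesis using D(2) by (simp add: field_simps)
    qed
    ultimately show "\<exists>D. ((\<lambda>t. G (p + of_real (\<sigma> * t))) has_real_derivative D) (at t) \<and> D \<le> - \<beta>" by blast
  qed
  then show ?thesis by simp
qed

text \<open>At the base point \<open>G = 0\<close> and \<open>A = Re (K z2) + r^2\<close>. If this
  were nonzero, \<open>A\<close> would keep its sign nearby; travelling a fixed length in the
  direction of that sign, the small initial values of \<open>G\<close> would be used up. A whole
  disc of end points would then lie over the complement of \<open>\<Omega>\<close>, contradicting
  density.\<close>

lemma level_zero: "Re (K z2) + r\<^sup>2 = 0"
proof (rule ccontr)
  assume x0: "Re (K z2) + r\<^sup>2 \<noteq> 0"
  define x where "x = Re (K z2) + r\<^sup>2"
  define \<sigma> where "\<sigma> = sgn x"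
  have \<sigma>: "\<sigma> = 1 \<or> \<sigma> = -1" "\<sigma> * x = \<bar>x\<bar>" using x0 by (auto simp: \<sigma>_def x_def sgn_if)
  have "continuous_on (ball (K z2) d) (\<lambda>p. \<sigma> * A p)"
    unfolding A_def by (intro continuous_intros G_cont)
  then have "isCont (\<lambda>p. \<sigma> * A p) (K z2)" using d by (simp add: continuous_on_eq_continuous_at)
  then have "((\<lambda>p. \<sigma> * A p) \<longlongrightarrow> \<sigma> * A (K z2)) (nhds (K z2))"
    unfolding isCont_def by (rule tendsto_at_iff_tendsto_nhds[THEN iffD1])
  moreover have "\<sigma> * A (K z2) = \<bar>x\<bar>" using \<sigma>(2) by (simp add: A_def G_center x_def)
  ultimately have "((\<lambda>p. \<sigma> * A p) \<longlongrightarrow> \<bar>x\<bar>) (nhds (K z2))" by simp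
  then have "\<forall>\<^sub>F p in nhds (K z2). \<bar>x\<bar> / 2 < \<sigma> * A p" by (rule order_tendstoD(1)) (use x0 in \<open>simp add: x_def\<close>)
  then obtain d1 where d1: "d1 > 0" "\<And>p. p \<in> ball (K z2) d1 \<Longrightarrow> \<bar>x\<bar> / 2 < \<sigma> * A p"
    unfolding eventually_nhds_metric by (auto simp: dist_commute)
  define e where "e = min d d1"
  have e: "e > 0" "e \<le> d" "e \<le> d1" using d d1 by (auto simp: e_def)
  define L where "L = (norm c * r + r\<^sup>2)\<^sup>2"
  have L: "L > 0" unfolding L_def using r by (intro zero_less_power add_nonneg_pos) auto
  \<comment> \<open>Nearby \<open>\<sigma> A\<close> exceeds \<open>|x| / 2\<close>, and
    \<open>L\<close> bounds the denominator of the slope; their quotient is the guaranteed rate of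
    decrease.\<close>
  define \<beta> where "\<beta> = \<bar>x\<bar> / (2 * L)"
  have \<beta>: "\<beta> > 0" using x0 L by (simp add: \<beta>_def x_def)
  define a where "a = e / 2"
  have a: "a > 0" using e by (simp add: a_def)
  have "isCont G (K z2)" using G_cont d by (simp add: continuous_on_eq_continuous_at)
  then have "(G \<longlongrightarrow> G (K z2)) (nhds (K z2))"
    unfolding isCont_def by (rule tendsto_at_iff_tendsto_nhds[THEN iffD1])
  then have "(G \<longlongrightarrow> 0) (nhds (K z2))" by (simp only: G_center)
  then have "\<forall>\<^sub>F p in nhds (K z2). G p < \<beta> * a" by (rule order_tendstoD(2)) (use \<beta> a in simp)
  then obtain d2 where d2: "d2 > 0" "\<And>p. p \<in> ball (K z2) d2 \<Longrightarrow> G p < \<beta> * a"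
    unfolding eventually_nhds_metric by (auto simp: dist_commute)
  define e2 where "e2 = min d2 (e / 2)"
  have e2: "e2 > 0" "e2 \<le> d2" "e2 \<le> e / 2" using d2 e by (auto simp: e2_def)
  have near: "p + of_real (\<sigma> * t) \<in> ball (K z2) e" if "p \<in> ball (K z2) e2" "0 \<le> t" "t \<le> a" for p t
  proof -
    have "norm (p + of_real (\<sigma> * t) - K z2) \<le> norm (p - K z2) + norm (complex_of_real (\<sigma> * t))"
      using norm_triangle_ineq[of "p - K z2" "of_real (\<sigma> * t)"] by (simp add: algebra_simps)
    also have "\<dots> < e / 2 + e / 2"
    proof (rule add_less_le_mono)
      show "norm (p - K z2) < e / 2" using that(1) e2(3) by (simp add: dist_norm norm_minus_commute)
      show "norm (complex_of_real (\<sigma> * t)) \<le> e / 2" using \<sigma>(1) that(2,3) by (auto simp: a_def)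
    qed
    finally show ?thesis by (simp add: dist_norm norm_minus_commute)
  qed
  have zero: "\<kappa> (p + of_real (\<sigma> * a)) \<notin> \<Omega>" if p: "p \<in> ball (K z2) e2" for p
  proof
    assume "\<kappa> (p + of_real (\<sigma> * a)) \<in> \<Omega>"
    moreover have pa: "p + of_real (\<sigma> * a) \<in> ball (K z2) d" using near[OF p, of a] a e(2) by auto
    ultimately have pos: "0 < G (p + of_real (\<sigma> * a))" using G_pos_iff by simp
    have "G (p + of_real (\<sigma> * a)) \<le> G p - \<beta> * a"
    proof (rule flow[OF \<sigma>(1) _ a pa _ _ pos])
      show "p \<in> ball (K z2) d" using near[OF p, of 0] a e(2) by auto
      fix t assume t: "0 < t" "t < a"
      have "\<bar>x\<bar> / 2 < \<sigma> * A (p + of_real (\<sigma> * t))" using near[OF p, of t] t e(3) by (intro d1(2)) auto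
      then show "\<beta> * (norm c * r + r\<^sup>2)\<^sup>2 \<le> \<sigma> * A (p + of_real (\<sigma> * t))"
        using L unfolding L_def[symmetric] by (simp add: \<beta>_def)
    qed (use \<beta> in simp)
    also have "\<dots> < 0" using d2(2)[of p] p e2(2) by auto
    finally show False using pos by simp
  qed
  define W where "W = \<kappa> ` ball (K z2 + of_real (\<sigma> * a)) e2"
  have sub: "ball (K z2 + of_real (\<sigma> * a)) e2 \<subseteq> ball (K z2) d"
  proof
    fix w assume w: "w \<in> ball (K z2 + of_real (\<sigma> * a)) e2"
    have "w - of_real (\<sigma> * a) \<in> ball (K z2) e2" using w by (simp add: dist_norm algebra_simps)
    from near[OF this, of a] a e(2) show "w \<in> ball (K z2) d" by auto
  qed
  have "inj_on \<kappa> (ball (K z2) d)" by (rule inj_on_inverseI[of _ K]) (use \<kappa>p in blast)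
  then have "open W" unfolding W_def using sub \<kappa>
    by (intro open_mapping_thm3) (auto intro: holomorphic_on_subset inj_on_subset)
  have WN: "W \<subseteq> N" using sub \<kappa>p by (auto simp: W_def simp del: mem_ball)
  have WO: "W \<inter> \<Omega> = {}"
  proof -
    have "\<kappa> w \<notin> \<Omega>" if w: "w \<in> ball (K z2 + of_real (\<sigma> * a)) e2" for w
    proof -
      have "w - of_real (\<sigma> * a) \<in> ball (K z2) e2" using w by (simp add: dist_norm algebra_simps)
      from zero[OF this] show ?thesis by simp
    qed
    then show ?thesis by (auto simp: W_def simp del: mem_ball)
  qed
  have "\<kappa> (K z2 + of_real (\<sigma> * a)) \<in> W" using e2(1) by (auto simp: W_def)
  moreover from this have "\<kappa> (K z2 + of_real (\<sigma> * a)) \<in> closure \<Omega>" using WN dense by blast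
  ultimately show False using WO \<open>open W\<close> open_Int_closure_eq_empty[of W \<Omega>] by blast
qed

end

text \<open>Every regular point outside \<open>\<Omega>\<close> lies on the line
  \<open>Re K = - r^2\<close>. To the right of it \<open>A\<close> is nonnegative, so
  \<open>G\<close>, starting at 0, cannot become positive, and a shift by \<open>d / 2\<close>
  reaches another regular point outside \<open>\<Omega>\<close>. That point lies off the
  line.\<close>

theorem (in dense_disc_image) impossible: False
proof -
  obtain z2 where z2: "z2 \<in> N" "z2 \<notin> \<Omega>" "deriv K z2 \<noteq> 0" using exists_regular_point by blast
  from local_inverse[OF z2(1,3)] obtain \<kappa> d where \<kappa>: "d > 0" "\<kappa> holomorphic_on ball (K z2) d" "\<kappa> (K z2) = z2"
    "\<forall>p\<in>ball (K z2) d. \<kappa> p \<in> N \<and> K (\<kappa> p) = p \<and> deriv K (\<kappa> p) * deriv \<kappa> p = 1" by (elim exE conjE)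
  interpret chart: regular_chart \<psi> f K c r z1 \<rho> z2 \<kappa> d
    by unfold_locales (use z2 \<kappa> in blast)+
  have inb: "K z2 + of_real (1 * t) \<in> ball (K z2) d" if "0 \<le> t" "t < d" for t
    using that by (simp add: dist_norm)
  let ?q = "K z2 + of_real (1 * (d / 2))"
  have q: "?q \<in> ball (K z2) d" by (rule inb) (use \<kappa>(1) in auto)
  have q\<Omega>: "\<kappa> ?q \<notin> \<Omega>"
  proof
    assume "\<kappa> ?q \<in> \<Omega>"
    then have pos: "0 < chart.G ?q" using chart.G_pos_iff[OF q] by simp
    have "chart.G ?q \<le> chart.G (K z2) - 0 * (d / 2)"
    proof (rule chart.flow[OF _ _ _ q _ _ pos])
      fix t assume t: "0 < t" "t < d / 2"
      have "0 \<le> r\<^sup>2 * chart.G (K z2 + of_real (1 * t))" using chart.G_nonneg[OF inb, of t] t by simp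
      moreover have "Re (K z2 + of_real (1 * t)) = Re (K z2) + t" by simp
      ultimately have "0 \<le> chart.A (K z2 + of_real (1 * t))"
        unfolding chart.A_def using chart.level_zero t by linarith
      then show "0 * (norm c * r + r\<^sup>2)\<^sup>2 \<le> 1 * chart.A (K z2 + of_real (1 * t))" by simp
    qed (use \<kappa>(1) in auto)
    also have "chart.G (K z2) = 0" by (rule chart.G_center)
    finally show False using pos by simp
  qed
  have "\<kappa> ?q \<in> N \<and> K (\<kappa> ?q) = ?q \<and> deriv K (\<kappa> ?q) * deriv \<kappa> ?q = 1" by (rule bspec[OF \<kappa>(4) q])
  then have \<kappa>q: "\<kappa> ?q \<in> N" "K (\<kappa> ?q) = ?q" "deriv K (\<kappa> ?q) \<noteq> 0" by (blast, blast, metis mult_zero_left zero_neq_one)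
  from local_inverse[OF \<kappa>q(1,3)] obtain \<kappa>' d' where \<kappa>': "d' > 0" "\<kappa>' holomorphic_on ball (K (\<kappa> ?q)) d'" "\<kappa>' (K (\<kappa> ?q)) = \<kappa> ?q"
    "\<forall>p\<in>ball (K (\<kappa> ?q)) d'. \<kappa>' p \<in> N \<and> K (\<kappa>' p) = p \<and> deriv K (\<kappa>' p) * deriv \<kappa>' p = 1" by (elim exE conjE)
  interpret chart': regular_chart \<psi> f K c r z1 \<rho> "\<kappa> ?q" \<kappa>' d'
    by unfold_locales (use \<kappa>q q\<Omega> \<kappa>' in blast)+
  show False using chart.level_zero chart'.level_zero \<kappa>(1) unfolding \<kappa>q(2) by simp
qed

section \<open>The support of the perturbed measure\<close>

text \<open>Normalized to vanish at \<open>z1\<close>, the potential integrates the real part of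
  \<open>Ln (1 - (z - z1) / (w - z1))\<close>. The distance \<open>\<rho>\<close> of the charges
  from \<open>z1\<close> bounds the quotient below 1 in modulus, so the power series may be
  integrated term by term.\<close>

lemma holomorphic_log_potential:
  assumes \<mu>: "finite_measure \<mu>" "sets \<mu> = sets borel" and W: "W \<in> sets borel" and \<rho>: "\<rho> > 0"
    and far: "\<forall>w\<in>W. \<rho> \<le> norm (w - z1)"
  shows "\<exists>H. H holomorphic_on ball z1 \<rho> \<and> (\<forall>z\<in>ball z1 \<rho>.
    integrable \<mu> (\<lambda>w. indicator W w * (ln (norm (z - w)) - ln (norm (z1 - w)))) \<and>
    Re (H z) = (\<integral>w. indicator W w * (ln (norm (z - w)) - ln (norm (z1 - w))) \<partial>\<mu>))"
proof -
  interpret finite_measure \<mu> by fact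
  note [measurable_cong] = \<mu>(2)
  note [measurable] = W
  define k where "k w = indicator W w *\<^sub>R inverse (w - z1)" for w
  have k_meas[measurable]: "k \<in> borel_measurable borel" unfolding k_def by measurable
  have k_bound: "norm (k w) \<le> 1 / \<rho>" for w
  proof (cases "w \<in> W")
    case True
    then have "inverse (norm (w - z1)) \<le> inverse \<rho>" using far \<rho> by (intro le_imp_inverse_le) auto
    moreover have "norm (k w) = inverse (norm (w - z1))" using True by (simp add: k_def norm_inverse)
    ultimately show ?thesis by (simp only: inverse_eq_divide)
  qed (use \<rho> in \<open>simp add: k_def\<close>)
  define a where "a n = (deriv ^^ n) (\<lambda>y. Ln (1 - y)) 0 / fact n" for n
  have Ln_holo: "(\<lambda>y. Ln (1 - y)) holomorphic_on ball 0 1"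
  proof (intro holomorphic_intros)
    fix y :: complex assume "y \<in> ball 0 1"
    then have "0 < Re (1 - y)" using complex_Re_le_cmod[of y] by simp
    then show "1 - y \<notin> \<real>\<^sub>\<le>\<^sub>0" by (auto simp: complex_nonpos_Reals_iff)
  qed
  have a_sums: "(\<lambda>n. a n * y ^ n) sums Ln (1 - y)" if "norm y < 1" for y
    using holomorphic_power_series[OF Ln_holo, of y] that by (simp add: a_def)
  have a_summable: "summable (\<lambda>n. norm (a n) * t ^ n)" if t: "0 \<le> t" "t < 1" for t :: real
  proof -
    obtain s where s: "t < s" "s < 1" using dense t(2) by blast
    have "summable (\<lambda>n. norm (a n * of_real t ^ n))"
    proof (rule powser_insidea)
      show "summable (\<lambda>n. a n * of_real s ^ n)" using a_sums[of "of_real s"] s t by (auto intro: sums_summable)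
    qed (use s t in simp)
    then show ?thesis using t by (simp add: norm_mult norm_power)
  qed
  define H where "H z = (\<integral>w. Ln (1 - k w * (z - z1)) \<partial>\<mu>)" for z
  have kz: "norm (k w * (z - z1)) \<le> norm (z - z1) / \<rho>" for w z
    using mult_right_mono[OF k_bound[of w] norm_ge_zero[of "z - z1"]] by (simp add: norm_mult)
  have H: "(\<lambda>n. (a n * (\<integral>w. k w ^ n \<partial>\<mu>)) * (z - z1) ^ n) sums H z \<and> integrable \<mu> (\<lambda>w. Ln (1 - k w * (z - z1)))"
    if z: "z \<in> ball z1 \<rho>" for z
  proof -
    define t where "t = norm (z - z1) / \<rho>"
    have t: "0 \<le> t" "t < 1" using z \<rho> by (auto simp: t_def dist_norm norm_minus_commute)
    have le: "norm (a n * (k w * (z - z1)) ^ n) \<le> norm (a n) * t ^ n" for n w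
      unfolding norm_mult[of "a n"] norm_power using kz[of w z, folded t_def] by (intro mult_left_mono power_mono) auto
    have int: "integrable \<mu> (\<lambda>w. a n * (k w * (z - z1)) ^ n)" for n
    proof (rule integrable_const_bound)
      show "AE w in \<mu>. norm (a n * (k w * (z - z1)) ^ n) \<le> norm (a n) * t ^ n" using le by (intro AE_I2)
    qed measurable
    have AEs: "AE w in \<mu>. summable (\<lambda>n. norm (a n * (k w * (z - z1)) ^ n))"
    proof (rule AE_I2)
      fix w
      show "summable (\<lambda>n. norm (a n * (k w * (z - z1)) ^ n))"
        by (rule summable_comparison_test'[OF a_summable[OF t], of 0]) (use le in simp)
    qed
    have sI: "summable (\<lambda>n. \<integral>w. norm (a n * (k w * (z - z1)) ^ n) \<partial>\<mu>)"
    proof (rule summable_comparison_test'[of "\<lambda>n. (norm (a n) * t ^ n) * measure \<mu> (space \<mu>)" 0])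
      show "summable (\<lambda>n. (norm (a n) * t ^ n) * measure \<mu> (space \<mu>))" by (intro summable_mult2 a_summable t)
      fix n :: nat
      have "(\<integral>w. norm (a n * (k w * (z - z1)) ^ n) \<partial>\<mu>) \<le> (\<integral>w. norm (a n) * t ^ n \<partial>\<mu>)"
        using le int by (intro integral_mono integrable_norm) auto
      moreover have "0 \<le> (\<integral>w. norm (a n * (k w * (z - z1)) ^ n) \<partial>\<mu>)" by (rule Bochner_Integration.integral_nonneg) simp
      ultimately show "norm (\<integral>w. norm (a n * (k w * (z - z1)) ^ n) \<partial>\<mu>) \<le> norm (a n) * t ^ n * measure \<mu> (space \<mu>)"
        by (simp add: mult_ac)
    qed
    have sum: "(\<Sum>n. a n * (k w * (z - z1)) ^ n) = Ln (1 - k w * (z - z1))" for w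
    proof (rule sums_unique[symmetric, OF a_sums])
      show "norm (k w * (z - z1)) < 1" using kz[of w z] t(2) unfolding t_def by (rule le_less_trans)
    qed
    have "(\<lambda>n. \<integral>w. a n * (k w * (z - z1)) ^ n \<partial>\<mu>) sums H z"
      using sums_integral[OF int AEs sI] unfolding sum H_def .
    moreover have term_eq: "(\<integral>w. a n * (k w * (z - z1)) ^ n \<partial>\<mu>) = (a n * (\<integral>w. k w ^ n \<partial>\<mu>)) * (z - z1) ^ n" for n
      by (simp add: power_mult_distrib mult.assoc)
    moreover have "integrable \<mu> (\<lambda>w. Ln (1 - k w * (z - z1)))"
      using integrable_suminf[OF int AEs sI] unfolding sum .
    ultimately show ?thesis unfolding term_eq by blast
  qed
  have "H holomorphic_on ball z1 \<rho>"
    by (rule power_series_holomorphic[where a="\<lambda>n. a n * (\<integral>w. k w ^ n \<partial>\<mu>)"]) (use H in blast)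
  moreover have "integrable \<mu> (\<lambda>w. indicator W w * (ln (norm (z - w)) - ln (norm (z1 - w)))) \<and>
    Re (H z) = (\<integral>w. indicator W w * (ln (norm (z - w)) - ln (norm (z1 - w))) \<partial>\<mu>)" if z: "z \<in> ball z1 \<rho>" for z
  proof -
    have Re: "Re (Ln (1 - k w * (z - z1))) = indicator W w * (ln (norm (z - w)) - ln (norm (z1 - w)))" for w
    proof (cases "w \<in> W")
      case True
      have ne: "w \<noteq> z1" "w \<noteq> z" using bspec[OF far True] z \<rho> by (auto simp: dist_norm norm_minus_commute)
      have eq: "1 - k w * (z - z1) = (w - z) / (w - z1)" using True ne by (simp add: k_def field_simps)
      show ?thesis unfolding eq using ne True by (simp add: Re_Ln norm_divide ln_div norm_minus_commute)
    qed (simp add: k_def)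
    have "integrable \<mu> (\<lambda>w. Re (Ln (1 - k w * (z - z1))))" using H[OF z] by (intro integrable_Re) blast
    moreover have "Re (H z) = (\<integral>w. Re (Ln (1 - k w * (z - z1))) \<partial>\<mu>)"
      unfolding H_def using H[OF z] by (subst integral_Re) auto
    ultimately show ?thesis unfolding Re by blast
  qed
  ultimately show ?thesis by blast
qed

lemma continuous_eq_if_AE_eq:
  fixes h1 h2 :: "complex \<Rightarrow> real"
  assumes V: "open V" "z \<in> V" and h: "continuous_on V h1" "continuous_on V h2"
    and AE: "AE z in lborel. z \<in> V \<longrightarrow> h1 z = h2 z"
  shows "h1 z = h2 z"
proof (rule ccontr)
  assume ne: "h1 z \<noteq> h2 z"
  define A where "A = V \<inter> (\<lambda>z. h1 z - h2 z) -` (- {0})"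
  have "open A" unfolding A_def using h V by (intro continuous_open_preimage continuous_intros) auto
  moreover have "z \<in> A" using ne V by (simp add: A_def)
  ultimately obtain e where e: "e > 0" "ball z e \<subseteq> A" using openE by blast
  have "AE x in lborel. x \<notin> ball z e"
    using AE by eventually_elim (use e(2) in \<open>auto simp: A_def\<close>)
  then have "emeasure lborel (ball z e) = 0"
    by (subst (asm) AE_iff_measurable[of "ball z e"]) auto
  then show False using e(1) by (simp add: emeasure_lborel_ball_complex)
qed

context quadratic_disc
begin

text \<open>The constant total potential is split into three parts. Mass outside
  \<open>\<Omega>\<close> keeps away from the ball and contributes the real part of a holomorphic
  function; mass on \<open>\<Omega>\<close> acts as the charge at \<open>\<psi> c\<close> minus the
  defect; the field is \<open>C |\<zeta>|^2\<close>. Solving for the defect and field terms yields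
  the function \<open>K\<close> of the excluded configuration.\<close>

lemma boundary_not_filled:
  assumes z1: "z1 \<notin> \<Omega>" and \<epsilon>: "\<epsilon> > 0" and dense: "ball z1 \<epsilon> \<subseteq> closure \<Omega>"
    and null: "emeasure \<mu> (ball z1 \<epsilon> - \<Omega>) = 0" and far: "\<epsilon> \<le> norm (\<psi> c - z1)"
  shows False
proof -
  interpret prob_space \<mu> by (rule probs_onD(1)[OF \<mu>])
  note [measurable_cong] = probs_onD(2)[OF \<mu>]
  define W where "W = cball 0 R - \<Omega> - ball z1 \<epsilon>"
  have W[measurable]: "W \<in> sets borel" unfolding W_def by measurable
  have Wfar: "\<forall>w\<in>W. \<epsilon> \<le> norm (w - z1)"
    by (auto simp: W_def dist_norm norm_minus_commute)
  from holomorphic_log_potential[OF finite_measure_axioms probs_onD(2)[OF \<mu>] W \<epsilon> Wfar]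
  obtain H where H: "H holomorphic_on ball z1 \<epsilon>"
    "\<forall>z\<in>ball z1 \<epsilon>. integrable \<mu> (\<lambda>w. indicator W w * (ln (norm (z - w)) - ln (norm (z1 - w)))) \<and>
      Re (H z) = (\<integral>w. indicator W w * (ln (norm (z - w)) - ln (norm (z1 - w))) \<partial>\<mu>)" by (elim exE conjE)
  \<comment> \<open>The charge at \<open>\<psi> c\<close> is treated like the outer mass, with a
    point measure in place of \<open>\<mu>\<close>; \<open>far\<close> keeps it out of the
    ball.\<close>
  have ret: "finite_measure (return borel (\<psi> c))" using prob_space_return[of "\<psi> c" borel] by (simp add: prob_space_def)
  have farc: "\<forall>w\<in>{\<psi> c}. \<epsilon> \<le> norm (w - z1)" using far by simp
  have "sets (return borel (\<psi> c)) = sets borel" "{\<psi> c} \<in> sets borel" by auto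
  from holomorphic_log_potential[OF ret this \<epsilon> farc]
  obtain L where L: "L holomorphic_on ball z1 \<epsilon>"
    "\<forall>z\<in>ball z1 \<epsilon>. integrable (return borel (\<psi> c)) (\<lambda>w. indicator {\<psi> c} w * (ln (norm (z - w)) - ln (norm (z1 - w)))) \<and>
      Re (L z) = (\<integral>w. indicator {\<psi> c} w * (ln (norm (z - w)) - ln (norm (z1 - w))) \<partial>return borel (\<psi> c))" by (elim exE conjE)
  have ReL: "Re (L z) = ln (norm (z - \<psi> c)) - ln (norm (z1 - \<psi> c))" if "z \<in> ball z1 \<epsilon>" for z
    using L(2) that by (simp add: integral_return)
  have \<Omega>R: "closure \<Omega> \<subseteq> cball 0 R" using sub by (intro closure_minimal) (auto simp: \<Omega>_def)
  have z1R: "z1 \<in> cball 0 R" using dense \<Omega>R \<epsilon> by (meson centre_in_ball subsetD)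
  have ln_diff: "ln (norm (z - w)) \<le> ln (2 * R)" if "z \<in> cball 0 R" "w \<in> cball 0 R" "z \<noteq> w" for z w
  proof -
    have "norm (z - w) \<le> 2 * R" using that norm_triangle_ineq4[of z w] by simp
    then show ?thesis using that R by (subst ln_le_cancel_iff) auto
  qed
  have int1: "integrable \<mu> (\<lambda>w. indicator W w * (ln (2 * R) - ln (norm (z1 - w))))"
  proof (rule integrable_const_bound)
    show "AE w in \<mu>. norm (indicator W w * (ln (2 * R) - ln (norm (z1 - w)))) \<le> \<bar>ln (2 * R)\<bar> + \<bar>ln \<epsilon>\<bar>"
    proof (rule AE_I2)
      fix w
      show "norm (indicator W w * (ln (2 * R) - ln (norm (z1 - w)))) \<le> \<bar>ln (2 * R)\<bar> + \<bar>ln \<epsilon>\<bar>"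
      proof (cases "w \<in> W")
        case True
        then have "z1 \<noteq> w" "w \<in> cball 0 R" using bspec[OF Wfar True] \<epsilon> by (auto simp: W_def)
        then have "ln (norm (z1 - w)) \<le> ln (2 * R)" using z1R by (intro ln_diff) auto
        moreover have "ln \<epsilon> \<le> ln (norm (z1 - w))"
          using bspec[OF Wfar True] \<epsilon> \<open>z1 \<noteq> w\<close> by (subst ln_le_cancel_iff) (auto simp: norm_minus_commute)
        ultimately show ?thesis using True by simp
      qed simp
    qed
  qed measurable
  define I1 where "I1 = (\<integral>w. indicator W w * (ln (2 * R) - ln (norm (z1 - w))) \<partial>\<mu>)"
  have outer: "(\<integral>\<^sup>+w. log_kernel R z w * indicator (- \<Omega>) w \<partial>\<mu>) = ennreal (I1 - Re (H z)) \<and> 0 \<le> I1 - Re (H z)"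
    if z: "z \<in> ball z1 \<epsilon>" "z \<in> \<Omega>" for z
  proof -
    have zR: "z \<in> cball 0 R" using z(2) \<Omega>R closure_subset by blast
    let ?j = "\<lambda>w. indicator W w * (ln (2 * R) - ln (norm (z - w)))"
    have j: "?j = (\<lambda>w. indicator W w * (ln (2 * R) - ln (norm (z1 - w))) - indicator W w * (ln (norm (z - w)) - ln (norm (z1 - w))))"
      by (auto simp: algebra_simps)
    have intj: "integrable \<mu> ?j" unfolding j using int1 H(2) z(1) by (intro Bochner_Integration.integrable_diff) auto
    have valj: "(\<integral>w. ?j w \<partial>\<mu>) = I1 - Re (H z)"
      unfolding j I1_def using int1 H(2) z(1) by (subst Bochner_Integration.integral_diff) auto
    have nnj: "0 \<le> ?j w" for w
    proof (cases "w \<in> W")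
      case True
      then have "z \<noteq> w" "w \<in> cball 0 R" using z by (auto simp: W_def)
      then have "ln (norm (z - w)) \<le> ln (2 * R)" using zR by (intro ln_diff) auto
      then show ?thesis using True by simp
    qed simp
    have notin: "AE w in \<mu>. w \<notin> ball z1 \<epsilon> - \<Omega>"
      using null by (intro AE_not_in) (auto simp: null_sets_def)
    have "(\<integral>\<^sup>+w. log_kernel R z w * indicator (- \<Omega>) w \<partial>\<mu>) = (\<integral>\<^sup>+w. ennreal (?j w) \<partial>\<mu>)"
    proof (rule nn_integral_cong_AE)
      show "AE w in \<mu>. log_kernel R z w * indicator (- \<Omega>) w = ennreal (?j w)"
        using notin probs_onD(3)[OF \<mu>]
      proof eventually_elim
        case (elim w)
        show ?case
        proof (cases "w \<in> \<Omega>")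
          case False
          then have "w \<in> W" using elim by (auto simp: W_def)
          moreover have "z \<noteq> w" using False z(2) by blast
          ultimately show ?thesis using False by (simp add: log_kernel_def)
        qed (simp add: W_def)
      qed
    qed
    also have "\<dots> = ennreal (I1 - Re (H z))"
      unfolding valj[symmetric] using intj nnj by (intro nn_integral_eq_integral) auto
    finally show ?thesis using Bochner_Integration.integral_nonneg[of \<mu> ?j, OF nnj] valj by simp
  qed
  define F0 where "F0 = enn2real F"
  have F0: "F = ennreal F0" "0 \<le> F0" using F_finite by (auto simp: F0_def less_top)
  \<comment> \<open>Collects the constants: \<open>F\<close>, the normalizations of the two
    potentials at \<open>z1\<close>, the shift \<open>m\<close>, and the constant terms of the
    defect and of the field expanded about \<open>c\<close>.\<close>
  define k0 where "k0 = (F0 - C * r\<^sup>2 - I1 - 2 * C * r\<^sup>2 * ln (2 * R) - m - C * (norm c)\<^sup>2) / (2 * C) + r\<^sup>2 * ln (norm (z1 - \<psi> c))"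
  define K where "K z = of_real (1 / (2 * C)) * H z + of_real (r\<^sup>2) * L z + of_real k0" for z
  have K: "K holomorphic_on ball z1 \<epsilon>" unfolding K_def by (intro holomorphic_intros H(1) L(1))
  define V where "V = ball c r \<inter> \<psi> -` ball z1 \<epsilon>"
  have V: "open V"
    unfolding V_def by (rule continuous_open_preimage[OF holomorphic_on_imp_continuous_on[OF \<psi>]]) auto
  have cV: "c \<notin> V" using far by (auto simp: V_def dist_norm norm_minus_commute)
  have AE: "AE \<zeta> in lborel. \<zeta> \<in> V \<longrightarrow> Re (cnj c * (\<zeta> - c)) + r\<^sup>2 * ln (norm (\<zeta> - c) / r) = Re (K (\<psi> \<zeta>))"
    using AE_Pot
  proof eventually_elim
    case (elim \<zeta>)
    show ?case
    proof
      assume \<zeta>V: "\<zeta> \<in> V"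
      have \<zeta>: "\<zeta> \<in> ball c r" "\<psi> \<zeta> \<in> ball z1 \<epsilon>" using \<zeta>V by (auto simp: V_def)
      have \<zeta>c: "\<zeta> \<noteq> c" using \<zeta>V cV by blast
      define z where "z = \<psi> \<zeta>"
      have z: "z \<in> \<Omega>" "z \<in> ball z1 \<epsilon>" "f z = \<zeta>" using \<zeta> f_\<psi> by (auto simp: z_def \<Omega>_def simp del: mem_ball)
      have zR: "z \<in> cball 0 R" using z(1) \<Omega>R closure_subset by blast
      have zc: "z \<noteq> \<psi> c" using \<zeta>(2) far by (auto simp: z_def dist_norm norm_minus_commute)
      have cR: "\<psi> c \<in> cball 0 R" using sub r by (meson centre_in_ball imageI subsetD)
      define t where "t = norm (\<zeta> - c) / r"
      have t: "0 < t" "t < 1" using \<zeta>(1) \<zeta>c r by (auto simp: t_def dist_norm norm_minus_commute)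
      have nt: "norm ((\<zeta> - c) /\<^sub>R r) = t" using r by (simp add: t_def divide_inverse mult.commute)
      define d0 where "d0 = - ln t - (1 - t\<^sup>2) / 2"
      have d0: "0 \<le> d0" using disc_defect_nonneg_aux[of t] t by (simp add: d0_def)
      have \<rho>: "\<rho> c r z = ennreal d0"
      proof -
        have "(\<zeta> - c) /\<^sub>R r \<noteq> 0" using \<zeta>c r by simp
        then show ?thesis unfolding \<rho>_def f'_eq[OF z(1)] z(3) disc_defect_def nt using t z(1) by (simp add: d0_def)
      qed
      define T0 where "T0 = ln (2 * R) - ln (norm (z - \<psi> c))"
      have T0: "log_kernel R z (\<psi> c) = ennreal T0" "0 \<le> T0"
        using zc ln_diff[OF zR cR zc] by (auto simp: T0_def log_kernel_def)
      let ?i = "\<integral>\<^sup>+w. log_kernel R z w * indicator \<Omega> w \<partial>\<mu>" and ?o = "\<integral>\<^sup>+w. log_kernel R z w * indicator (- \<Omega>) w \<partial>\<mu>"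
      have split: "(\<integral>\<^sup>+w. log_kernel R z w \<partial>\<mu>) = ?o + ?i"
      proof -
        have "(\<integral>\<^sup>+w. log_kernel R z w \<partial>\<mu>) = (\<integral>\<^sup>+w. log_kernel R z w * indicator (- \<Omega>) w + log_kernel R z w * indicator \<Omega> w \<partial>\<mu>)"
          by (intro nn_integral_cong) (auto simp: indicator_def)
        also have "\<dots> = ?o + ?i" by (rule nn_integral_add) measurable
        finally show ?thesis .
      qed
      define k where "k = 2 * C * r\<^sup>2"
      have k: "0 \<le> k" using C by (simp add: k_def)
      have i: "?i + ennreal k * ennreal d0 = ennreal k * ennreal T0"
        using potential_\<Omega>[OF zR] by (simp add: \<rho> T0 k_def)
      define E where "E = m + C * (norm \<zeta>)\<^sup>2"
      have E: "0 \<le> E" using m C by (simp add: E_def)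
      define O0 where "O0 = I1 - Re (H z)"
      have O0: "?o = ennreal O0" "0 \<le> O0" using outer[OF z(2,1)] by (auto simp: O0_def)
      have "F = ?o + ?i + ennreal E"
        using elim \<zeta>(1) Pot_parts[OF \<zeta>(1)] split by (simp add: E_def z_def)
      then have "F + ennreal k * ennreal d0 = ?o + (?i + ennreal k * ennreal d0) + ennreal E" by (simp only: ac_simps)
      then have "ennreal F0 + ennreal k * ennreal d0 = ennreal O0 + ennreal k * ennreal T0 + ennreal E" unfolding i F0(1) O0(1) .
      then have "ennreal (F0 + k * d0) = ennreal (O0 + k * T0 + E)"
        using F0 k d0 T0 E O0 by (simp flip: ennreal_plus ennreal_mult)
      then have real_eq: "F0 + k * d0 = O0 + k * T0 + E"
        using F0 k d0 T0 E O0 by (subst (asm) ennreal_inj) auto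
      \<comment> \<open>The term in \<open>|\<zeta> - c|^2\<close> from the defect cancels the one
        from expanding \<open>C |\<zeta>|^2\<close> about \<open>c\<close>; only a linear and a
        logarithmic term remain.\<close>
      have kt: "k * t\<^sup>2 = 2 * C * (norm (\<zeta> - c))\<^sup>2" using r by (simp add: k_def t_def power_divide)
      have sq: "(norm \<zeta>)\<^sup>2 = (norm c)\<^sup>2 + (norm (\<zeta> - c))\<^sup>2 + 2 * Re (cnj c * (\<zeta> - c))"
        unfolding cmod_power2 by (simp add: power2_eq_square algebra_simps)
      have Re_scale: "Re (of_real x * w) = x * Re w" for x w by simp
      have ReK: "Re (K z) = Re (H z) / (2 * C) + r\<^sup>2 * (ln (norm (z - \<psi> c)) - ln (norm (z1 - \<psi> c))) + k0"
        unfolding K_def plus_complex.sel Re_scale Re_complex_of_real ReL[OF z(2)] by simp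
      define X where "X = Re (cnj c * (\<zeta> - c))"
      define B where "B = F0 - C * r\<^sup>2 - I1 - 2 * C * r\<^sup>2 * ln (2 * R) - m - C * (norm c)\<^sup>2"
      have "k * d0 = - (k * ln t) - k / 2 + k * t\<^sup>2 / 2" by (simp add: d0_def field_simps)
      moreover have "k * T0 = k * ln (2 * R) - k * ln (norm (z - \<psi> c))" by (simp add: T0_def right_diff_distrib)
      moreover have "E = m + C * (norm c)\<^sup>2 + C * (norm (\<zeta> - c))\<^sup>2 + 2 * (C * X)" by (simp add: E_def sq X_def distrib_left)
      moreover have "B = F0 - k / 2 - I1 - k * ln (2 * R) - m - C * (norm c)\<^sup>2" by (simp add: B_def k_def)
      moreover have "2 * C * (X + r\<^sup>2 * ln t) = 2 * (C * X) + k * ln t" by (simp add: k_def distrib_left)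
      moreover note kt real_eq
      ultimately have "2 * C * (X + r\<^sup>2 * ln t) = Re (H z) + k * ln (norm (z - \<psi> c)) + B"
        unfolding O0_def by linarith
      then have "X + r\<^sup>2 * ln t = (Re (H z) + k * ln (norm (z - \<psi> c)) + B) / (2 * C)"
        using C by (simp add: eq_divide_eq mult.commute)
      then have "X + r\<^sup>2 * ln t = Re (H z) / (2 * C) + r\<^sup>2 * ln (norm (z - \<psi> c)) + B / (2 * C)"
        using C by (simp add: k_def add_divide_distrib)
      then show "Re (cnj c * (\<zeta> - c)) + r\<^sup>2 * ln (norm (\<zeta> - c) / r) = Re (K (\<psi> \<zeta>))"
        unfolding z_def[symmetric] ReK k0_def X_def[symmetric] t_def[symmetric] B_def by (simp add: right_diff_distrib)
    qed
  qed
  have h1: "continuous_on V (\<lambda>\<zeta>. Re (cnj c * (\<zeta> - c)) + r\<^sup>2 * ln (norm (\<zeta> - c) / r))"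
    using cV r by (intro continuous_intros) auto
  have h2: "continuous_on V (\<lambda>\<zeta>. Re (K (\<psi> \<zeta>)))"
  proof (intro continuous_intros continuous_on_compose2[OF holomorphic_on_imp_continuous_on[OF K]])
    show "continuous_on V \<psi>" using holomorphic_on_imp_continuous_on[OF \<psi>] by (rule continuous_on_subset) (auto simp: V_def)
  qed (auto simp: V_def)
  have K_eq: "Re (cnj c * (f z - c)) + r\<^sup>2 * ln (norm (f z - c) / r) = Re (K z)"
    if z: "z \<in> ball z1 \<epsilon>" "z \<in> \<psi> ` ball c r" for z
  proof -
    obtain \<zeta> where \<zeta>: "\<zeta> \<in> ball c r" "z = \<psi> \<zeta>" using z(2) by blast
    then have "\<zeta> \<in> V" using z(1) by (simp add: V_def)
    from continuous_eq_if_AE_eq[OF V this h1 h2 AE] show ?thesis unfolding \<zeta>(2) f_\<psi>[OF \<zeta>(1)] .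
  qed
  have nc: "\<psi> c \<notin> ball z1 \<epsilon>" using far by (simp add: dist_norm norm_minus_commute)
  interpret D: dense_disc_image \<psi> f K c r z1 \<epsilon>
    by unfold_locales (use \<psi> r f_\<psi> \<epsilon> dense z1 K K_eq nc in \<open>auto simp: \<Omega>_def simp del: mem_ball\<close>)
  show False by (rule D.impossible)
qed

text \<open>Only a boundary point \<open>z\<close> of \<open>\<Omega>\<close> could be lost. If
  \<open>\<mu>V q\<close> vanished near it, support points near \<open>z\<close> would lie in the
  closure of \<open>\<Omega>\<close>, and as \<open>z\<close> is interior to the support,
  \<open>\<Omega>\<close> would be dense in a ball that it does not fill.\<close>

lemma support_\<mu>V:
  assumes q: "q > 0" and inside: "closure \<Omega> \<subseteq> interior (measure_support \<mu>)"
  shows "measure_support (\<mu>V q) = measure_support \<mu> - \<Omega>"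
proof -
  note [measurable_cong] = probs_onD(2)[OF \<mu>]
  have pos: "0 < emeasure (\<mu>V q) N \<longleftrightarrow> 0 < emeasure \<mu> (N - \<Omega>)" if "open N" for N
  proof -
    have "N \<in> sets borel" using that by simp
    from emeasure_\<mu>V[OF this] have "emeasure (\<mu>V q) N = ennreal (1 + q) * emeasure \<mu> (N - \<Omega>)" .
    moreover have "0 < ennreal (1 + q)" using q by (subst ennreal_less_zero_iff) simp
    ultimately show ?thesis by (simp only: ennreal_zero_less_mult_iff simp_thms)
  qed
  have supp: "0 < emeasure \<mu> N" if "z \<in> measure_support \<mu>" "open N" "z \<in> N" for z N
    using that by (simp add: measure_support_def)
  have mono: "0 < emeasure \<mu> B" if "0 < emeasure \<mu> A" "A \<subseteq> B" "B \<in> sets borel" for A B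
    using that emeasure_mono[of A B \<mu>] probs_onD(2)[OF \<mu>] by (auto intro: less_le_trans)
  have "z \<in> measure_support \<mu> \<and> z \<notin> \<Omega>" if z: "z \<in> measure_support (\<mu>V q)" for z
  proof
    show "z \<notin> \<Omega>"
    proof
      assume "z \<in> \<Omega>"
      then have "0 < emeasure (\<mu>V q) \<Omega>" using z open_\<Omega> by (simp add: measure_support_def)
      then show False using pos[OF open_\<Omega>] by simp
    qed
    show "z \<in> measure_support \<mu>"
      unfolding measure_support_def
    proof (intro CollectI allI impI)
      fix N assume N: "open N \<and> z \<in> N"
      then have "0 < emeasure (\<mu>V q) N" using z by (simp add: measure_support_def)
      then have "0 < emeasure \<mu> (N - \<Omega>)" using pos N by simp
      then show "0 < emeasure \<mu> N" by (rule mono) (use N in auto)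
    qed
  qed
  moreover have "z \<in> measure_support (\<mu>V q)" if z: "z \<in> measure_support \<mu>" "z \<notin> \<Omega>" for z
    unfolding measure_support_def
  proof (intro CollectI allI impI)
    fix N assume N: "open N \<and> z \<in> N"
    show "0 < emeasure (\<mu>V q) N"
    proof (rule ccontr)
      assume "\<not> ?thesis"
      then have null: "\<not> 0 < emeasure \<mu> (N - \<Omega>)" using pos N by simp
      have borelN: "N - \<Omega> \<in> sets borel" using N by auto
      have in_closure: "w \<in> closure \<Omega>" if w: "w \<in> N" "w \<in> measure_support \<mu>" for w
      proof (rule ccontr)
        assume "w \<notin> closure \<Omega>"
        then have "0 < emeasure \<mu> (N \<inter> - closure \<Omega>)" using w N by (intro supp[of w]) auto
        then have "0 < emeasure \<mu> (N - \<Omega>)" by (rule mono) (use closure_subset borelN in auto)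
        then show False using null by simp
      qed
      have "z \<in> interior (measure_support \<mu>)" using in_closure[of z] z N inside by auto
      then have "open (N \<inter> interior (measure_support \<mu>))" "z \<in> N \<inter> interior (measure_support \<mu>)" using N by auto
      from openE[OF this] obtain e where e: "e > 0" "ball z e \<subseteq> N \<inter> interior (measure_support \<mu>)" .
      \<comment> \<open>The second bound keeps the charge at \<open>\<psi> c\<close> outside the
        ball.\<close>
      define \<epsilon> where "\<epsilon> = min e (norm (\<psi> c - z))"
      have "\<psi> c \<noteq> z" using z(2) r by (auto simp: \<Omega>_def)
      then have \<epsilon>: "\<epsilon> > 0" "ball z \<epsilon> \<subseteq> N" "ball z \<epsilon> \<subseteq> measure_support \<mu>" "\<epsilon> \<le> norm (\<psi> c - z)"
        using e interior_subset[of "measure_support \<mu>"] by (auto simp: \<epsilon>_def)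
      show False
      proof (rule boundary_not_filled[OF z(2) \<epsilon>(1) _ _ \<epsilon>(4)])
        show "ball z \<epsilon> \<subseteq> closure \<Omega>" using in_closure \<epsilon> by blast
        have "\<not> 0 < emeasure \<mu> (ball z \<epsilon> - \<Omega>)" using mono[of "ball z \<epsilon> - \<Omega>" "N - \<Omega>"] \<epsilon>(2) null borelN by blast
        then show "emeasure \<mu> (ball z \<epsilon> - \<Omega>) = 0" by simp
      qed
    qed
  qed
  ultimately show ?thesis by blast
qed

end

section \<open>The charged field, and assembly of the result\<close>

context
  fixes Q :: "complex \<Rightarrow> ereal" and z0 :: complex and M q :: real and V :: "complex \<Rightarrow> ereal"
  assumes Q: "field_above Q M" and q: "q > 0"
    and V: "V = (\<lambda>z. ereal (1 + q) * Q z + ereal q * ln_recip (norm (z - z0)))"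
begin

text \<open>The charge costs at most \<open>q ln (1 + |z|)\<close> at infinity, while the factor
  \<open>1 + q\<close> multiplies the growth of \<open>Q\<close>. A logarithmic lower bound for
  \<open>Q\<close> therefore leaves one with coefficient \<open>(1 + q) - q = 1\<close> for
  \<open>V\<close>.\<close>

lemma charged_field_ge:
  assumes x: "ereal x \<le> Q z"
  shows "ereal ((1 + q) * x - q * ln (1 + norm z0) - q * ln (1 + norm z)) \<le> V z"
proof -
  have "- ereal (ln (1 + norm z0)) - ereal (ln (1 + norm z)) \<le> ln_recip (norm (z - z0))" by (rule ln_recip_lower)
  then have "ereal (- ln (1 + norm z0) - ln (1 + norm z)) \<le> ln_recip (norm (z - z0))" by simp
  then have "ereal q * ereal (- ln (1 + norm z0) - ln (1 + norm z)) \<le> ereal q * ln_recip (norm (z - z0))"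
    using q by (intro ereal_mult_left_mono) auto
  moreover have "ereal (1 + q) * ereal x \<le> ereal (1 + q) * Q z"
    using x q by (intro ereal_mult_left_mono) auto
  ultimately have "ereal (1 + q) * ereal x + ereal q * ereal (- ln (1 + norm z0) - ln (1 + norm z)) \<le> V z"
    unfolding V by (intro add_mono)
  moreover have "(1 + q) * x + q * (- ln (1 + norm z0) - ln (1 + norm z)) = (1 + q) * x - q * ln (1 + norm z0) - q * ln (1 + norm z)"
    by (simp add: algebra_simps)
  ultimately show ?thesis by (simp only: times_ereal.simps plus_ereal.simps)
qed

lemma charged_field_measurable: "V \<in> borel_measurable borel"
proof -
  have [measurable]: "Q \<in> borel_measurable borel" using Q by (simp add: field_above_def)
  show ?thesis unfolding V by measurable
qed

lemma charged_field_above: "field_above V ((1 + q) * M + q * ln (1 + norm z0))"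
  unfolding field_above_def
proof (intro conjI allI charged_field_measurable)
  fix z
  have "ereal (ln (1 + norm z) - M) \<le> Q z" using Q by (simp add: field_above_def)
  from charged_field_ge[OF this]
  show "ereal (ln (1 + norm z) - ((1 + q) * M + q * ln (1 + norm z0))) \<le> V z" by (simp add: algebra_simps)
qed

lemma charged_field_growth:
  assumes g: "field_growth Q"
  shows "field_growth V"
  unfolding field_growth_def
proof (intro allI)
  fix B
  \<comment> \<open>The constant is chosen so that the lower bound for \<open>V\<close> becomes
    exactly \<open>ln (1 + |z|) + B\<close>.\<close>
  obtain R where R: "\<forall>z. R < norm z \<longrightarrow> ereal (ln (1 + norm z) + (B + q * ln (1 + norm z0)) / (1 + q)) \<le> Q z"
    using g unfolding field_growth_def by blast
  have "ereal (ln (1 + norm z) + B) \<le> V z" if "R < norm z" for z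
  proof -
    have "(1 + q) * (ln (1 + norm z) + (B + q * ln (1 + norm z0)) / (1 + q)) = (1 + q) * ln (1 + norm z) + (B + q * ln (1 + norm z0))"
      by (subst distrib_left) (use q in simp)
    then have "(1 + q) * (ln (1 + norm z) + (B + q * ln (1 + norm z0)) / (1 + q)) - q * ln (1 + norm z0) - q * ln (1 + norm z) = ln (1 + norm z) + B"
      by (simp add: distrib_right)
    then show ?thesis using charged_field_ge[of _ z] R that by metis
  qed
  then show "\<exists>R. \<forall>z. R < norm z \<longrightarrow> ereal (ln (1 + norm z) + B) \<le> V z" by blast
qed

text \<open>The field of the abstract argument and the shifted \<open>V\<close> differ on the disc
  by a constant, so they have the same minimizers. The condition
  \<open>1 + norm z0 \<le> 2 * R\<close> makes the constant nonnegative.\<close>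

lemma charged_field_kernel:
  assumes R: "1 + norm z0 \<le> 2 * R" and z: "z \<in> cball 0 R" "z0 \<in> cball 0 R"
  shows "ennreal (1 + q) * e2ennreal (Q z + ereal M) + ennreal q * log_kernel R z z0
    = e2ennreal (V z + ereal ((1 + q) * M + q * ln (1 + norm z0))) + ennreal (q * (ln (2 * R) - ln (1 + norm z0)))"
proof (cases "z = z0 \<or> Q z = \<infinity>")
  case True
  have Qn: "Q z \<noteq> -\<infinity>" by (rule field_above_not_MInf[OF Q])
  have "V z = \<infinity>" using True q Qn unfolding V by (cases "Q z") (auto simp: ln_recip_def)
  then show ?thesis using True q by (auto simp: log_kernel_def ennreal_mult_top)
next
  case False
  then obtain x where x: "Q z = ereal x" using field_above_not_MInf[OF Q, of z] by (cases "Q z") auto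
  define l where "l = ln (norm (z - z0))"
  have "norm (z - z0) \<le> 2 * R" using z norm_triangle_ineq4[of z z0] by simp
  moreover have "0 < 2 * R" using R norm_ge_zero[of z0] by linarith
  ultimately have l: "l \<le> ln (2 * R)" unfolding l_def using False by (subst ln_le_cancel_iff) auto
  have D: "0 \<le> ln (2 * R) - ln (1 + norm z0)"
  proof -
    have "0 < 1 + norm z0" by (intro add_pos_nonneg) auto
    then show ?thesis using R by simp
  qed
  have xM: "0 \<le> x + M" using field_above_ge[OF Q, of z] by (simp add: x)
  have Vz: "V z = ereal ((1 + q) * x - q * l)"
    using False unfolding V x l_def by (simp add: ln_recip_def ln_div)
  define y where "y = (1 + q) * x - q * l + ((1 + q) * M + q * ln (1 + norm z0))"
  have y: "0 \<le> y" using field_above_ge[OF charged_field_above, of z] by (simp add: Vz y_def)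
  have "ennreal (1 + q) * e2ennreal (Q z + ereal M) + ennreal q * log_kernel R z z0
      = ennreal (1 + q) * ennreal (x + M) + ennreal q * ennreal (ln (2 * R) - l)"
    using False by (simp add: x log_kernel_def l_def e2ennreal_ereal del: ennreal_plus)
  also have "\<dots> = ennreal ((1 + q) * (x + M) + q * (ln (2 * R) - l))"
    using q xM l by (simp del: ennreal_plus flip: ennreal_mult) (subst ennreal_plus; simp)
  also have "(1 + q) * (x + M) + q * (ln (2 * R) - l) = y + q * (ln (2 * R) - ln (1 + norm z0))"
    by (simp add: y_def algebra_simps)
  also have "ennreal \<dots> = ennreal y + ennreal (q * (ln (2 * R) - ln (1 + norm z0)))"
    using y q D by (intro ennreal_plus) auto
  also have "ennreal y = e2ennreal (V z + ereal ((1 + q) * M + q * ln (1 + norm z0)))"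
    by (simp add: Vz y_def e2ennreal_ereal del: ennreal_plus)
  finally show ?thesis .
qed

end

lemma field_energy_shift:
  assumes \<nu>: "\<nu> \<in> probs_on R" and p: "p \<in> borel_measurable borel"
    and shift: "\<And>z. z \<in> cball 0 R \<Longrightarrow> p' z = p z + ennreal D"
  shows "field_energy R p' \<nu> = field_energy R p \<nu> + 2 * ennreal D"
proof -
  interpret prob_space \<nu> by (rule probs_onD(1)[OF \<nu>])
  note [measurable_cong] = probs_onD(2)[OF \<nu>]
  note [measurable] = p
  have "(\<integral>\<^sup>+z. p' z \<partial>\<nu>) = (\<integral>\<^sup>+z. p z + ennreal D \<partial>\<nu>)"
    using probs_onD(3)[OF \<nu>] shift by (intro nn_integral_cong_AE) (auto elim!: eventually_mono)
  also have "\<dots> = (\<integral>\<^sup>+z. p z \<partial>\<nu>) + ennreal D"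
    by (subst nn_integral_add) (auto simp: emeasure_space_1)
  finally show ?thesis by (simp add: field_energy_def distrib_left add.assoc)
qed

text \<open>The candidate \<open>\<nu>\<close> does not involve \<open>R\<close>. Its kernel energy
  \<open>T\<close> for \<open>V\<close> is thus fixed first, and \<open>R\<close> is chosen
  afterwards so large that the kernel of \<open>V\<close> is at least \<open>T + 1\<close> off the
  disc; optimality among measures on a disc is available for every such \<open>R\<close>.\<close>

theorem charged_equilibrium_support:
  fixes Q :: "complex \<Rightarrow> ereal" and f \<psi> :: "complex \<Rightarrow> complex"
  assumes Q: "admissible_field Q" and U: "open U" "z0 \<in> U" and f: "continuous_on U f" and C: "C > 0"
    and QU: "\<And>z. z \<in> U \<Longrightarrow> Q z = ereal (C * (norm (f z))\<^sup>2)" and q: "q > 0"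
    and r: "r = sqrt (q / (2 * C * (1 + q)))" and \<psi>: "local_inverse_on_disc f U z0 r \<psi>"
    and inside: "compactly_contained (\<psi> ` ball (f z0) r) (equilibrium_support Q)"
  shows "equilibrium_support (\<lambda>z. ereal (1 + q) * Q z + ereal q * ln_recip (norm (z - z0)))
    = equilibrium_support Q - \<psi> ` ball (f z0) r"
proof -
  define V where "V = (\<lambda>z. ereal (1 + q) * Q z + ereal q * ln_recip (norm (z - z0)))"
  define \<mu> where "\<mu> = equilibrium_measure Q"
  define Om where "Om = \<psi> ` ball (f z0) r"
  have r0: "r > 0" using q C by (simp add: r)
  have rq: "2 * C * r\<^sup>2 = q / (1 + q)" 
  proof -
    have "r\<^sup>2 = q / (2 * C * (1 + q))" using q C by (simp add: r)
    moreover have "1 + q \<noteq> 0" using q by linarith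
    then have "2 * C * (q / (2 * C * (1 + q))) = q / (1 + q)" 
      by (subst times_divide_eq_right, subst mult_divide_mult_cancel_left) (use C in auto)
    ultimately show ?thesis by (simp only:)
  qed
  have \<psi>D: "\<psi> holomorphic_on ball (f z0) r" "Om \<subseteq> U" "\<psi> (f z0) = z0" "\<And>w. w \<in> ball (f z0) r \<Longrightarrow> f (\<psi> w) = w"
    using \<psi> unfolding local_inverse_on_disc_def Om_def by blast+
  have cc: "compact (closure Om)" "closure Om \<subseteq> interior (measure_support \<mu>)"
    using inside unfolding compactly_contained_def Om_def \<mu>_def equilibrium_support_def by blast+
  obtain M where M: "0 \<le> M" "field_above Q M" by (rule admissible_field_above[OF Q])
  define p where "p = (\<lambda>z. e2ennreal (Q z + ereal M))"
  have h: "continuous_on U (\<lambda>z. C * (norm (f z))\<^sup>2)" by (intro continuous_intros f)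
  from admissible_equilibrium[OF Q M U h QU]
  obtain R0 where R0: "R0 \<ge> 1" "\<forall>R\<ge>R0. minimizing_measure R p \<mu>" unfolding p_def \<mu>_def by blast
  obtain R1 where R1: "\<forall>z\<in>Om. norm z \<le> R1"
    using compact_imp_bounded[OF cc(1)] closure_subset[of Om] unfolding bounded_iff by blast
  define R2 where "R2 = Max {R0, R1, 1 + norm z0}"
  have R2: "R0 \<le> R2" "R1 \<le> R2" "1 + norm z0 \<le> R2" by (auto simp: R2_def)
  have p_U: "p z = ennreal (M + C * (norm (f z))\<^sup>2)" if "z \<in> U" for z
    using QU[OF that] by (simp add: p_def e2ennreal_ereal add.commute del: ennreal_plus)
  have p_cont: "isCont p z" if "z \<in> Om" for z
  proof -
    have "continuous_on U (\<lambda>z. ennreal (M + C * (norm (f z))\<^sup>2))" by (intro continuous_intros f continuous_on_ennreal)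
    then have "continuous_on U p" by (rule continuous_on_eq) (simp only: p_U)
    then show ?thesis using that \<psi>D(2) U(1) by (auto simp: continuous_on_eq_continuous_at)
  qed
  have quad: "quadratic_disc R p \<mu> \<psi> f (f z0) r C M" if large: "R2 \<le> R" for R
  proof -
    interpret minimizing_measure R p \<mu> using R0(2) large R2(1) by auto
    show ?thesis
    proof unfold_locales
      show "continuous_on (\<psi> ` ball (f z0) r) f" using f \<psi>D(2) unfolding Om_def by (rule continuous_on_subset)
      show "\<psi> ` ball (f z0) r \<subseteq> cball 0 R"
      proof
        fix z assume "z \<in> \<psi> ` ball (f z0) r"
        then have "norm z \<le> R1" using R1 unfolding Om_def by blast
        then show "z \<in> cball 0 R" using large R2(2) by simp
      qed
      show "\<psi> ` ball (f z0) r \<subseteq> measure_support \<mu>"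
        using cc(2) closure_subset[of Om] interior_subset[of "measure_support \<mu>"] unfolding Om_def by blast
      show "p (\<psi> \<zeta>) = ennreal (M + C * (norm \<zeta>)\<^sup>2)" if "\<zeta> \<in> ball (f z0) r" for \<zeta>
        using p_U[of "\<psi> \<zeta>"] \<psi>D(2,4) that unfolding Om_def by (metis imageI subsetD)
    qed (use \<psi>D r0 C M p_cont in \<open>auto simp: Om_def simp del: mem_ball\<close>)
  qed
  define \<nu> where "\<nu> = quadratic_disc.\<mu>V \<mu> \<psi> (f z0) r q"
  define M1 where "M1 = (1 + q) * M + q * ln (1 + norm z0)"
  define p1 where "p1 = (\<lambda>z. e2ennreal (V z + ereal M1))"
  note charged = M(2) q V_def
  have above: "field_above V M1" unfolding M1_def by (rule charged_field_above[OF charged])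
  have M1: "0 \<le> M1" using M q by (simp add: M1_def)
  have p1: "p1 \<in> borel_measurable borel"
  proof -
    have [measurable]: "V \<in> borel_measurable borel" by (rule charged_field_measurable[OF charged])
    show ?thesis unfolding p1_def by measurable
  qed
  have minim: "\<nu> \<in> probs_on R \<and> field_energy R p1 \<nu> < \<infinity> \<and>
      (\<forall>\<nu>'\<in>probs_on R. \<nu>' \<noteq> \<nu> \<longrightarrow> field_energy R p1 \<nu> < field_energy R p1 \<nu>')" if R: "R2 \<le> R" for R
  proof -
    interpret D: quadratic_disc R p \<mu> \<psi> f "f z0" r C M by (rule quad[OF R])
    have \<nu>: "\<nu> = D.\<mu>V q" by (simp add: \<nu>_def)
    have \<nu>R: "\<nu> \<in> probs_on R" unfolding \<nu> by (rule D.\<mu>V_probs_on[OF q rq])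
    define K where "K = 2 * ennreal (q * (ln (2 * R) - ln (1 + norm z0)))"
    have K: "K < \<infinity>" by (simp add: K_def ennreal_mult_less_top)
    have shift: "field_energy R (D.pV q) \<nu>' = field_energy R p1 \<nu>' + K" if "\<nu>' \<in> probs_on R" for \<nu>'
      unfolding K_def
    proof (rule field_energy_shift[OF that p1])
      fix z :: complex assume z: "z \<in> cball 0 R"
      have "1 + norm z0 \<le> R" using R R2(3) by linarith
      then have "1 + norm z0 \<le> 2 * R" "norm z0 \<le> R" using norm_ge_zero[of z0] by linarith+
      then have "1 + norm z0 \<le> 2 * R" "z0 \<in> cball 0 R" by auto
      from charged_field_kernel[OF charged this(1) z this(2)]
      show "D.pV q z = p1 z + ennreal (q * (ln (2 * R) - ln (1 + norm z0)))"
        unfolding D.pV_def unfolding p_def p1_def M1_def \<psi>D(3) .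
    qed
    have "field_energy R p1 \<nu> + K < \<infinity>"
      using D.field_energy_\<mu>V_finite[OF q rq] shift[OF \<nu>R] unfolding \<nu> by simp
    moreover have "field_energy R p1 \<nu> < field_energy R p1 \<nu>'" if "\<nu>' \<in> probs_on R" "\<nu>' \<noteq> \<nu>" for \<nu>'
    proof -
      have "field_energy R (D.pV q) \<nu> < field_energy R (D.pV q) \<nu>'"
        using D.\<mu>V_strict[OF q rq that(1)] that(2) unfolding \<nu> by blast
      then have "field_energy R p1 \<nu> + K < field_energy R p1 \<nu>' + K" by (simp only: shift[OF \<nu>R] shift[OF that(1)])
      then show ?thesis by (meson add_right_mono not_le)
    qed
    ultimately show ?thesis using \<nu>R by (auto simp: ennreal_add_eq_top less_top[symmetric])
  qed
  have eq_kernel: "field_energy R p1 \<nu>' = kernel_energy V M1 \<nu>' + ennreal (ln (2 * R))" if "R2 \<le> R" "\<nu>' \<in> probs_on R" for R \<nu>'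
    unfolding p1_def using that R2(1) R0(1) by (intro kernel_energy_eq_field_energy[OF above M1]) auto
  have "kernel_energy V M1 \<nu> < \<infinity>"
    using minim[of R2] eq_kernel[of R2 \<nu>] by (auto simp: ennreal_add_eq_top less_top[symmetric])
  then obtain T where T: "kernel_energy V M1 \<nu> = ennreal T" "0 \<le> T" by (cases "kernel_energy V M1 \<nu>") auto
  obtain R3 where R3: "\<forall>R\<ge>R3. \<forall>z w. z \<notin> cball 0 R \<or> w \<notin> cball 0 R \<longrightarrow> ereal (T + 1) \<le> energy_kernel V M1 z w"
    using energy_kernel_off_disc[OF above charged_field_growth[OF charged admissible_field_growth[OF Q]]] by blast
  define R where "R = max R2 R3"
  have R: "R2 \<le> R" "R3 \<le> R" by (auto simp: R_def)
  have "equilibrium_measure V = \<nu>"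
  proof (rule equilibrium_measure_eqI[OF above M1])
    show "1 \<le> 2 * R" using R R2 R0 by simp
    show "\<nu> \<in> probs_on R" using minim[OF R(1)] by blast
    show "field_energy R (\<lambda>z. e2ennreal (V z + ereal M1)) \<nu> < field_energy R (\<lambda>z. e2ennreal (V z + ereal M1)) \<nu>'"
      if "\<nu>' \<in> probs_on R" "\<nu>' \<noteq> \<nu>" for \<nu>'
      using minim[OF R(1)] that unfolding p1_def by blast
    show "ereal (T + 1) \<le> energy_kernel V M1 z w" if "z \<notin> cball 0 R \<or> w \<notin> cball 0 R" for z w
      using R3 R(2) that by blast
    show "kernel_energy V M1 \<nu> < ennreal (T + 1)" unfolding T(1) using T(2) by (subst ennreal_less_iff) auto
  qed
  moreover interpret D: quadratic_disc R p \<mu> \<psi> f "f z0" r C M by (rule quad[OF R(1)])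
  have "measure_support \<nu> = measure_support \<mu> - Om"
    using D.support_\<mu>V[OF q] cc(2) unfolding \<nu>_def D.\<Omega>_def Om_def by blast
  ultimately show ?thesis unfolding equilibrium_support_def V_def[symmetric] \<mu>_def Om_def by simp
qed

text \<open>A ball of half the radius of injectivity puts the closures of all images into a compact
  disc inside the interior of \<open>S\<close>. One inverse serves all small radii.\<close>

lemma local_inverse_small_discs:
  assumes f: "f holomorphic_on U" and U: "open U" "z0 \<in> U" and f': "deriv f z0 \<noteq> 0" and S: "z0 \<in> interior S"
  shows "\<exists>\<delta>>0. \<exists>\<psi>. \<forall>s\<le>\<delta>. 0 < s \<longrightarrow> local_inverse_on_disc f U z0 s \<psi> \<and> compactly_contained (\<psi> ` ball (f z0) s) S"
proof -
  have fS: "f holomorphic_on U \<inter> interior S" using f by (rule holomorphic_on_subset) auto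
  have zS: "z0 \<in> U \<inter> interior S" "open (U \<inter> interior S)" using U S by auto
  from has_complex_derivative_locally_invertible[OF fS zS f']
  obtain e where e: "e > 0" "ball z0 e \<subseteq> U \<inter> interior S" "inj_on f (ball z0 e)" by metis
  define B where "B = ball z0 (e / 2)"
  have Be: "B \<subseteq> ball z0 e" "cball z0 (e / 2) \<subseteq> ball z0 e" "z0 \<in> B" "open B" using e(1) by (auto simp: B_def)
  have fB: "f holomorphic_on B" using fS by (rule holomorphic_on_subset) (use Be e in blast)
  have inj: "inj_on f B" using e(3) Be(1) by (rule inj_on_subset)
  have fBo: "open (f ` B)" by (rule open_mapping_thm3[OF fB Be(4) inj])
  have "\<exists>g. g holomorphic_on f ` B \<and> (\<forall>z\<in>B. g (f z) = z)"
    by (rule holomorphic_has_inverse[OF fB Be(4) inj]) blast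
  then obtain g where g: "g holomorphic_on f ` B" "\<forall>z\<in>B. g (f z) = z" by blast
  have "f z0 \<in> f ` B" using Be(3) by blast
  from openE[OF fBo this] obtain \<delta> where \<delta>: "\<delta> > 0" "ball (f z0) \<delta> \<subseteq> f ` B" .
  have "local_inverse_on_disc f U z0 s g \<and> compactly_contained (g ` ball (f z0) s) S" if s: "s \<le> \<delta>" for s
  proof
    have sub: "ball (f z0) s \<subseteq> f ` B" using \<delta>(2) subset_ball[OF s] by blast
    then have gB: "g ` ball (f z0) s \<subseteq> B" using g(2) by (auto simp del: mem_ball)
    have "f (g w) = w" if "w \<in> ball (f z0) s" for w
    proof -
      obtain z where "z \<in> B" "w = f z" using sub \<open>w \<in> _\<close> by blast
      then show ?thesis using g(2) by simp
    qed
    then show "local_inverse_on_disc f U z0 s g"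
      unfolding local_inverse_on_disc_def using holomorphic_on_subset[OF g(1) sub] gB g(2) Be e(2) by blast
    have "closure (g ` ball (f z0) s) \<subseteq> cball z0 (e / 2)"
      using gB by (intro closure_minimal) (auto simp: B_def)
    then show "compactly_contained (g ` ball (f z0) s) S"
      unfolding compactly_contained_def using Be(2) e(2)
      by (auto simp: compact_eq_bounded_closed intro: bounded_subset[OF bounded_cball])
  qed
  then show ?thesis using \<delta>(1) by blast
qed

text \<open>Smallness of \<open>q\<close> is the condition on \<open>\<psi>\<close> and its image,
  not a numerical threshold. Since \<open>r q\<close> tends to 0 with \<open>q\<close>, it holds
  eventually, which the first conjunct records; the second covers each \<open>q\<close> and
  \<open>\<psi>\<close> that meet it.\<close>

theorem theorem11:
  fixes Q :: "complex \<Rightarrow> ereal" and \<phi> :: "complex \<Rightarrow> complex"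
    and U :: "complex set" and z0 :: complex and p :: nat and C :: real
  assumes "admissible_field Q"
    and "z0 \<in> interior (equilibrium_support Q)"
    and "open U" and "z0 \<in> U"
    and "\<phi> holomorphic_on U"
    and "\<phi> z0 \<noteq> 0" and "deriv \<phi> z0 \<noteq> 0"
    and "p \<ge> 1" and "C > 0"
    and "\<And>z. z \<in> U \<Longrightarrow> Q z = ereal (C * norm (\<phi> z) ^ (2 * p))"
  shows
    "let f = (\<lambda>z. \<phi> z ^ p);
         r = (\<lambda>q. sqrt (q / (2 * C * (1 + q))));
         V = (\<lambda>q z. ereal (1 + q) * Q z + ereal q * ln_recip (norm (z - z0)));
         small = (\<lambda>q \<psi>. local_inverse_on_disc f U z0 (r q) \<psi> \<and>
                         compactly_contained (\<psi> ` ball (f z0) (r q)) (equilibrium_support Q))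
     in (\<forall>\<^sub>F q in at_right 0. \<exists>\<psi>. small q \<psi>) \<and>
        (\<forall>q > 0. \<forall>\<psi>. small q \<psi> \<longrightarrow>
           equilibrium_support (V q) = equilibrium_support Q - \<psi> ` ball (f z0) (r q))"
proof -
  define f where "f = (\<lambda>z. \<phi> z ^ p)"
  define r where "r = (\<lambda>q. sqrt (q / (2 * C * (1 + q))))"
  have f: "f holomorphic_on U" unfolding f_def by (intro holomorphic_intros assms(5))
  have "(f has_field_derivative of_nat p * (deriv \<phi> z0 * \<phi> z0 ^ (p - Suc 0))) (at z0)"
    unfolding f_def by (rule DERIV_power[OF holomorphic_derivI[OF assms(5,3,4)]])
  then have f': "deriv f z0 \<noteq> 0" using assms(6-8) by (auto dest!: DERIV_imp_deriv)
  have Qf: "Q z = ereal (C * (norm (f z))\<^sup>2)" if "z \<in> U" for z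
    using assms(10)[OF that] by (simp add: f_def norm_power mult.commute flip: power_mult)
  have small: "\<forall>\<^sub>F q in at_right 0. \<exists>\<psi>. local_inverse_on_disc f U z0 (r q) \<psi> \<and>
      compactly_contained (\<psi> ` ball (f z0) (r q)) (equilibrium_support Q)"
  proof -
    obtain \<delta> \<psi> where \<delta>: "\<delta> > 0" "\<forall>s\<le>\<delta>. 0 < s \<longrightarrow> local_inverse_on_disc f U z0 s \<psi> \<and>
        compactly_contained (\<psi> ` ball (f z0) s) (equilibrium_support Q)"
      using local_inverse_small_discs[OF f assms(3,4) f' assms(2)] by blast
    have "(r \<longlongrightarrow> sqrt (0 / (2 * C * (1 + 0)))) (at_right 0)"
      unfolding r_def using assms(9) by (intro tendsto_intros) auto
    then have "\<forall>\<^sub>F q in at_right 0. r q < \<delta>" by (rule order_tendstoD(2)) (use \<delta>(1) in simp)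
    then show ?thesis
      using eventually_at_right_less[of "0::real"]
    proof eventually_elim
      case (elim q)
      then have "0 < r q" using assms(9) by (simp add: r_def)
      then show ?case using \<delta>(2) elim(1) less_imp_le by blast
    qed
  qed
  have "equilibrium_support (\<lambda>z. ereal (1 + q) * Q z + ereal q * ln_recip (norm (z - z0)))
      = equilibrium_support Q - \<psi> ` ball (f z0) (r q)"
    if "q > 0" "local_inverse_on_disc f U z0 (r q) \<psi>"
      "compactly_contained (\<psi> ` ball (f z0) (r q)) (equilibrium_support Q)" for q \<psi>
    by (rule charged_equilibrium_support[OF assms(1,3,4) holomorphic_on_imp_continuous_on[OF f] assms(9) Qf that(1) _ that(2,3)])
       (simp_all add: r_def)
  with small show ?thesis unfolding Let_def f_def r_def by blast
qed

end
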